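(* For every word $w\in\mathcal{B}^0$, the function $$F_w(z)=\sum_{w=u_1u_2u_3}L_{\widetilde{u}_1}(\overline z)\,\mathcal{S}_{u_2}\,L_{u_3}(z)$$ is single-valued and satisfies $F_w(z)=F_{\widetilde w}(\overline z)$. Moreover, for $i,j\in\{0,1\}$, if $\mathsf{x}_iw\mathsf{x}_j\in\mathcal{B}^0$, then $$\frac{\partial^2}{\partial z\,\partial\overline z}F_{\mathsf{x}_iw\mathsf{x}_j}(z)=\frac{F_w(z)}{(\overline z-i)(z-j)}.$$
   Context: Words: $\{\mathsf{x}_0,\mathsf{x}_1\}^\times$ is the set of all words (including the empty word $1$) in two non-commuting letters; $\widetilde w$ is the word $w$ written in reverse order, and for a formal power series $S\in\mathbb{R}\langle\langle\mathsf{x}_0,\mathsf{x}_1\rangle\rangle$, $\widetilde S$ is obtained by reversing every word in $S$. The sum defining $F_w$ is over all factorizations of $w$ as a concatenation $u_1u_2u_3$ of (possibly empty) words. $\mathcal{B}^0$ is the set of words containing no consecutive $\mathsf{x}_1\mathsf{x}_1$, no consecutive $\mathsf{x}_0\mathsf{x}_0\mathsf{x}_0$, and at most one occurrence of consecutive $\mathsf{x}_0\mathsf{x}_0$. Multiple polylogarithms: $L_1=1$, $\frac{d}{dz}L_{w\mathsf{x}_i}(z)=\frac{L_w(z)}{z-i}$ for $i=0,1$, $L_{\mathsf{x}_0^n}(z)=\frac1{n!}\log^n z$, and $L_w(z)\to0$ as $z\to0$ for all $w$ not of the form $\mathsf{x}_0^n$. They are multivalued on $\mathbb{P}^1\setminus\{0,1,\infty\}(\mathbb{C})=\mathbb{C}\setminus\{0,1\}$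 (take principal branches on $\mathbb{C}\setminus((-\infty,0]\cup[1,\infty))$). A combination of products $L_u(\overline z)L_v(z)$ is single-valued if its continuation along every closed path in $\mathbb{C}\setminus\{0,1\}$ ($\overline z$ following the conjugate path) returns to itself, i.e. it defines a real-analytic function on $\mathbb{C}\setminus\{0,1\}$. The series $\mathcal{S}=1+\mathcal{S}^0_{0,0}+\mathcal{S}^1_{0,1}+\mathcal{S}^1_{1,0}+\mathcal{S}^1_{0,0}\in\mathbb{R}\langle\langle\mathsf{x}_0,\mathsf{x}_1\rangle\rangle$ is defined by $$\mathcal{S}^0_{0,0}=-4\sum_{n\ge1}\zeta(2n+1)(\mathsf{x}_0\mathsf{x}_1)^n\mathsf{x}_0,$$ $$\mathcal{S}^1_{1,0}=-4\sum_{m\ge1,\,n\ge0}\binom{2m+2n}{2m}\zeta(2m+2n+1)(\mathsf{x}_1\mathsf{x}_0)^m\mathsf{x}_0(\mathsf{x}_1\mathsf{x}_0)^n,$$ $\mathcal{S}^1_{0,1}=\widetilde{\mathcal{S}^1_{1,0}}$, and $\mathcal{S}^1_{0,0}=\frac12\big(\mathcal{S}^0_{0,0}\mathcal{S}^0_{0,0}+\mathcal{S}^0_{0,0}\mathcal{S}^1_{1,0}+\mathcal{S}^1_{0,1}\mathcal{S}^0_{0,0}\big)$. $\mathcal{S}_u$ denotes the coefficient of the word $u$ in $\mathcal{S}$. *)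

theory Defs
  imports "HOL-Analysis.Analysis" "HOL-Complex_Analysis.Complex_Analysis" "HOL-Library.Sublist"
begin

subsection \<open>Words and noncommutative formal power series\<close>

datatype letter = X0 | X1

type_synonym word = "letter list"

primrec pt :: "letter \<Rightarrow> complex" where
  "pt X0 = 0"
| "pt X1 = 1"

text \<open>\<^const>\<open>sublist\<close> is the relation of being a factor, i.e. a contiguous subword.\<close>

definition B0 :: "word set" where
  "B0 = {w. \<not> sublist [X1, X1] w \<and> \<not> sublist [X0, X0, X0] w \<and>
            card {(p, s). w = p @ [X0, X0] @ s} \<le> 1}"

text \<open>A formal power series is the function that sends a word to its coefficient.\<close>

type_synonym nc_series = "word \<Rightarrow> real"

definition nc_times :: "nc_series \<Rightarrow> nc_series \<Rightarrow> nc_series" where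
  "nc_times S T = (\<lambda>w. \<Sum>(u, v) \<in> {(u, v). w = u @ v}. S u * T v)"

definition nc_rev :: "nc_series \<Rightarrow> nc_series" where
  "nc_rev S = (\<lambda>w. S (rev w))"

definition wpow :: "word \<Rightarrow> nat \<Rightarrow> word" where
  "wpow u n = concat (replicate n u)"

definition zeta :: "nat \<Rightarrow> real" where
  "zeta k = (\<Sum>n. 1 / real (Suc n) ^ k)"

text \<open>
  The coefficient of \<open>w\<close> in an infinite sum of multiples of words is the sum over the
  (finitely many) indices whose word is \<open>w\<close>.
\<close>

definition S0_00 :: nc_series where
  "S0_00 w = - 4 * (\<Sum>n \<in> {n. n \<ge> 1 \<and> w = wpow [X0, X1] n @ [X0]}. zeta (2 * n + 1))"

definition S1_10 :: nc_series where
  "S1_10 w = - 4 * (\<Sum>(m, n) \<in> {(m, n). m \<ge> 1 \<and> w = wpow [X1, X0] m @ [X0] @ wpow [X1, X0] n}.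
      real ((2 * m + 2 * n) choose (2 * m)) * zeta (2 * m + 2 * n + 1))"

definition S1_01 :: nc_series where
  "S1_01 = nc_rev S1_10"

definition S1_00 :: nc_series where
  "S1_00 w = 1 / 2 * (nc_times S0_00 S0_00 w + nc_times S0_00 S1_10 w + nc_times S1_01 S0_00 w)"

definition S_series :: nc_series where
  "S_series w = (if w = [] then 1 else 0) + S0_00 w + S1_01 w + S1_10 w + S1_00 w"


subsection \<open>Multiple polylogarithms\<close>

definition slit_domain :: "complex set" where
  "slit_domain = UNIV - complex_of_real ` ({..0} \<union> {1..})"

definition multiple_polylogs :: "(word \<Rightarrow> complex \<Rightarrow> complex) \<Rightarrow> bool" where
  "multiple_polylogs L \<longleftrightarrow>
     (\<forall>z \<in> slit_domain. L [] z = 1) \<and>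
     (\<forall>w i. \<forall>z \<in> slit_domain.
        (L (w @ [i]) has_field_derivative L w z / (z - pt i)) (at z)) \<and>
     (\<forall>n. \<forall>z \<in> slit_domain. L (replicate n X0) z = (Ln z) ^ n / fact n) \<and>
     (\<forall>w. (\<nexists>n. w = replicate n X0) \<longrightarrow> (L w \<longlongrightarrow> 0) (at 0 within slit_domain))"

text \<open>
  The principal branches. The conditions determine them on \<^const>\<open>slit_domain\<close>, and only
  their values (and germs) there are used below.
\<close>

definition L :: "word \<Rightarrow> complex \<Rightarrow> complex" where
  "L = (SOME L. multiple_polylogs L)"


subsection \<open>Continuation along paths and single-valuedness\<close>

text \<open>
  The germ of \<open>f\<close> at the start of \<open>\<gamma>\<close> continues analytically along \<open>\<gamma>\<close> to the germ of \<open>g\<close> at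
  its end; \<open>h t\<close> represents the germ at \<open>\<gamma> t\<close>. The final germ is unique by the identity theorem.
\<close>

definition continues_to ::
    "(real \<Rightarrow> complex) \<Rightarrow> (complex \<Rightarrow> complex) \<Rightarrow> (complex \<Rightarrow> complex) \<Rightarrow> bool" where
  "continues_to \<gamma> f g \<longleftrightarrow> (\<exists>h :: real \<Rightarrow> complex \<Rightarrow> complex.
     (\<forall>t \<in> {0..1}. h t analytic_on {\<gamma> t} \<and>
        (\<forall>\<^sub>F s in at t within {0..1}. \<forall>\<^sub>F z in nhds (\<gamma> s). h s z = h t z)) \<and>
     (\<forall>\<^sub>F z in nhds (pathstart \<gamma>). h 0 z = f z) \<and>
     (\<forall>\<^sub>F z in nhds (pathfinish \<gamma>). h 1 z = g z))"

text \<open>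
  A combination of products \<open>L\<^sub>u (cnj z) L\<^sub>v z\<close> is encoded as a functional \<open>C\<close>: the value
  \<open>C A B z\<close> is that of the combination at \<open>z\<close> when the functions of \<open>cnj z\<close> are taken from
  the branches \<open>A\<close> and those of \<open>z\<close> from the branches \<open>B\<close>.
\<close>

type_synonym combination =
  "(word \<Rightarrow> complex \<Rightarrow> complex) \<Rightarrow> (word \<Rightarrow> complex \<Rightarrow> complex) \<Rightarrow> complex \<Rightarrow> complex"

text \<open>
  \<open>A\<close> and \<open>B\<close> are the branches reached from the principal ones by following \<open>\<gamma>\<close>, the
  conjugate path being used for \<open>A\<close>.
\<close>

definition branches_along ::
    "(real \<Rightarrow> complex) \<Rightarrow> (word \<Rightarrow> complex \<Rightarrow> complex) \<Rightarrow> (word \<Rightarrow> complex \<Rightarrow> complex) \<Rightarrow> bool" where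
  "branches_along \<gamma> A B \<longleftrightarrow>
     (\<forall>u. continues_to (cnj \<circ> \<gamma>) (L u) (A u)) \<and> (\<forall>u. continues_to \<gamma> (L u) (B u))"

definition admissible_path :: "(real \<Rightarrow> complex) \<Rightarrow> bool" where
  "admissible_path \<gamma> \<longleftrightarrow>
     path \<gamma> \<and> path_image \<gamma> \<subseteq> - {0, 1} \<and> pathstart \<gamma> \<in> slit_domain"

definition single_valued :: "combination \<Rightarrow> bool" where
  "single_valued C \<longleftrightarrow>
     (\<forall>\<gamma>. admissible_path \<gamma> \<and> pathfinish \<gamma> = pathstart \<gamma> \<longrightarrow>
        (\<exists>A B. branches_along \<gamma> A B \<and>
           (\<forall>\<^sub>F z in nhds (pathstart \<gamma>). C A B z = C L L z)))"

text \<open>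
  The function on \<open>- {0, 1}\<close> defined by a single-valued combination: its value at \<open>z\<close> is
  obtained by continuation along any path ending at \<open>z\<close>.
\<close>

definition sv_fun :: "combination \<Rightarrow> complex \<Rightarrow> complex" where
  "sv_fun C z = (THE v. \<exists>\<gamma> A B. admissible_path \<gamma> \<and> pathfinish \<gamma> = z \<and>
                    branches_along \<gamma> A B \<and> v = C A B z)"

definition F_comb :: "word \<Rightarrow> combination" where
  "F_comb w A B z =
     (\<Sum>(u1, u2, u3) \<in> {(u1, u2, u3). w = u1 @ u2 @ u3}.
        A (rev u1) (cnj z) * of_real (S_series u2) * B u3 z)"

definition F :: "word \<Rightarrow> complex \<Rightarrow> complex" where
  "F w = sv_fun (F_comb w)"


subsection \<open>Real analyticity and Wirtinger derivatives\<close>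

definition real_analytic_on :: "(complex \<Rightarrow> complex) \<Rightarrow> complex set \<Rightarrow> bool" where
  "real_analytic_on f U \<longleftrightarrow>
     (\<forall>p \<in> U. \<exists>(a :: nat \<Rightarrow> nat \<Rightarrow> complex) r. r > 0 \<and> (\<forall>z \<in> ball p r.
        ((\<lambda>(m, n). a m n * of_real (Re (z - p)) ^ m * of_real (Im (z - p)) ^ n)
           has_sum f z) UNIV))"

definition wirtinger_dz :: "(complex \<Rightarrow> complex) \<Rightarrow> complex \<Rightarrow> complex" where
  "wirtinger_dz f z =
     (frechet_derivative f (at z) 1 - \<i> * frechet_derivative f (at z) \<i>) / 2"

definition wirtinger_dzbar :: "(complex \<Rightarrow> complex) \<Rightarrow> complex \<Rightarrow> complex" where
  "wirtinger_dzbar f z =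
     (frechet_derivative f (at z) 1 + \<i> * frechet_derivative f (at z) \<i>) / 2"

end

theory Submission imports Defs "HOL-Real_Asymp.Real_Asymp" begin

text \<open>
  Let \<open>\<Lambda>\<close> be a series of branches of the polylogarithms, and write \<open>c~\<close> for the series \<open>c\<close> with
  reversed words and conjugate coefficients. The generating series of the functions \<open>F w\<close> is
  \<open>\<Lambda>~ S \<Lambda>\<close>, and another choice of branches replaces \<open>\<Lambda>\<close> by \<open>c \<Lambda>\<close> with constant \<open>c\<close>, hence \<open>S\<close> by
  \<open>c~ S c\<close>. Crossing the cut at \<open>0\<close> gives \<open>c = exp (2 \<pi> \<i> X0)\<close>; crossing the cut at \<open>1\<close> gives the
  conjugate of \<open>exp (- 2 \<pi> \<i> X1)\<close> by the Drinfeld associator \<open>Z\<close>. Since \<open>B0\<close> is closed under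
  factors, it suffices that \<open>S\<close> commutes with \<open>X0\<close> and that \<open>Z~ S Z\<close> commutes with \<open>X1\<close> in all
  coefficients at words of \<open>B0\<close>. The first statement is visible from the coefficients.

  For the second one, the words of \<open>B0\<close> are arranged into families of alternating words, and \<open>Z\<close>
  is computed on them by generating functions in \<open>x\<^sup>2\<close> and \<open>y\<^sup>2\<close>: on \<open>(X1 X0)\<^sup>n\<close> it gives
  \<open>sin (\<pi> x) / (\<pi> x)\<close>, and on \<open>(X1 X0)\<^sup>m X0 (X1 X0)\<^sup>n\<close> a hypergeometric sum \<open>esum x y\<close>. The group-like
  property of \<open>Z\<close> then reduces the commutation to a symmetry in \<open>x\<close> and \<open>y\<close>. It follows from a closed
  form of \<open>esum x y\<close>, found by telescoping the difference \<open>esum x (y + 1) - esum x y\<close>.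
\<close>

subsection \<open>Products of series\<close>

text \<open>A word of \<open>B0\<close> contains \<open>X0 X0\<close> at most once, so on
  \<open>B0\<close> products of series become products of 4 by 4 block triangular transfer matrices,
  whose diagonal blocks are the 2 by 2 matrix of alternating words in two independent variables.
  Reversal with signs turns the block of \<open>Z\<close> into its adjugate, so the group-like
  property says that its determinant is 1. This eliminates the unknown coefficients of the reversed
  \<open>Z\<close> and leaves two facts to verify: \<open>2 genB Z = - S0 genD Z\<close> and one
  symmetry involving \<open>genBD Z\<close>. The difference equation in \<open>y\<close> needs a
  boundary condition: \<open>esum x (y + real j)\<close> tends to 0, although the limits of the
  products in its terms grow linearly in \<open>j\<close>. Since \<open>esum\<close> is even in
  \<open>y\<close>, averaging the solution over \<open>y\<close> and \<open>- y\<close> turns its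
  digamma part into odd zeta series and leaves a remainder with a visible symmetry. Arbitrary paths
  are reached by a local criterion: compatibility of a branch with one glued function is checked on
  three slit planes and carried through overlapping discs, where a single common point decides
  whether the connecting constant preserves \<open>S\<close> on \<open>B0\<close>.\<close>

definition conv :: "(word \<Rightarrow> 'a::comm_ring_1) \<Rightarrow> (word \<Rightarrow> 'a) \<Rightarrow> word \<Rightarrow> 'a" where
  "conv f g w = (\<Sum>k\<le>length w. f (take k w) * g (drop k w))"

definition unit_series :: "word \<Rightarrow> 'a::comm_ring_1" where
  "unit_series w = (if w = [] then 1 else 0)"

lemma conv_Nil [simp]: "conv f g [] = f [] * g []"
  by (simp add: conv_def)

lemma conv_Cons: "conv f g (x # w) = f [] * g (x # w) + conv (\<lambda>u. f (x # u)) g w"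
  by (simp add: conv_def sum.atMost_Suc_shift del: sum.atMost_Suc)

lemma conv_snoc: "conv f g (w @ [x]) = conv f (\<lambda>v. g (v @ [x])) w + f (w @ [x]) * g []"
proof -
  have "(\<Sum>k\<le>length w. f (take k (w @ [x])) * g (drop k (w @ [x])))
      = (\<Sum>k\<le>length w. f (take k w) * g (drop k w @ [x]))"
    by (intro sum.cong) auto
  thus ?thesis by (simp add: conv_def)
qed

lemma conv_add_left: "conv (\<lambda>u. f u + g u) h w = conv f h w + conv g h w"
  by (simp add: conv_def sum.distrib algebra_simps)

lemma conv_add_right: "conv h (\<lambda>u. f u + g u) w = conv h f w + conv h g w"
  by (simp add: conv_def sum.distrib algebra_simps)

lemma conv_diff_right: "conv h (\<lambda>u. f u - g u) w = conv h f w - conv h g w"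
  by (simp add: conv_def sum_subtractf algebra_simps)

lemma conv_scale_left: "conv (\<lambda>u. c * f u) h w = c * conv f h w"
  by (simp add: conv_def sum_distrib_left mult.assoc)

lemma conv_scale_right: "conv h (\<lambda>u. c * f u) w = c * conv h f w"
  by (simp add: conv_def sum_distrib_left algebra_simps)

lemma conv_cong:
  assumes "\<And>k. k \<le> length w \<Longrightarrow> f (take k w) = f' (take k w)"
      and "\<And>k. k \<le> length w \<Longrightarrow> g (drop k w) = g' (drop k w)"
  shows "conv f g w = conv f' g' w"
  unfolding conv_def using assms by (intro sum.cong) auto

lemma conv_assoc: "conv (conv f g) h w = conv f (conv g h) w"
proof (induction w arbitrary: f)
  case Nil
  then show ?case by (simp add: mult.assoc)
next
  case (Cons x w)
  have "conv (conv f g) h (x # w) = f [] * g [] * h (x # w)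
      + conv (\<lambda>u. f [] * g (x # u) + conv (\<lambda>u. f (x # u)) g u) h w"
    by (simp add: conv_Cons)
  also have "\<dots> = f [] * g [] * h (x # w) + (f [] * conv (\<lambda>u. g (x # u)) h w
      + conv (conv (\<lambda>u. f (x # u)) g) h w)"
    by (simp add: conv_add_left conv_scale_left)
  also have "\<dots> = conv f (conv g h) (x # w)"
    by (simp add: Cons.IH conv_Cons algebra_simps)
  finally show ?case .
qed

lemma conv_unit_left [simp]: "conv unit_series f w = f w"
proof (cases w)
  case (Cons x v)
  have "conv (\<lambda>u. unit_series (x # u)) f v = 0"
    by (simp add: conv_def unit_series_def)
  then show ?thesis by (simp add: Cons conv_Cons unit_series_def)
qed (simp add: unit_series_def)

lemma conv_unit_right [simp]: "conv f unit_series w = f w"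
proof (cases w rule: rev_exhaust)
  case (snoc v x)
  have "conv f (\<lambda>v. unit_series (v @ [x])) v = 0"
    by (simp add: conv_def unit_series_def)
  then show ?thesis by (simp add: snoc conv_snoc unit_series_def)
qed (simp add: unit_series_def)

lemma conv_rev: "conv f g (rev w) = conv (\<lambda>u. g (rev u)) (\<lambda>u. f (rev u)) w"
proof -
  have "conv f g (rev w) = (\<Sum>k\<le>length w. f (rev (drop (length w - k) w)) * g (rev (take (length w - k) w)))"
    by (simp add: conv_def take_rev drop_rev)
  also have "\<dots> = (\<Sum>k\<le>length w. f (rev (drop k w)) * g (rev (take k w)))"
    by (rule sum.reindex_bij_witness[of _ "\<lambda>k. length w - k" "\<lambda>k. length w - k"]) auto
  finally show ?thesis by (simp add: conv_def mult.commute)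
qed

lemma conv_map: "conv (\<lambda>u. f (map \<sigma> u)) (\<lambda>u. g (map \<sigma> u)) w = conv f g (map \<sigma> w)"
  by (simp add: conv_def take_map drop_map)

lemma conv_of_real:
  "of_real (conv f g w) = conv (\<lambda>u. of_real (f u) :: 'a::{real_algebra_1,comm_ring_1}) (\<lambda>u. of_real (g u)) w"
  by (simp add: conv_def)

lemma cnj_conv: "cnj (conv f g w) = conv (\<lambda>u. cnj (f u)) (\<lambda>u. cnj (g u)) w"
  by (simp add: conv_def)

lemma conv_sign:
  "conv (\<lambda>u. (- 1) ^ length u * f u) (\<lambda>u. (- 1) ^ length u * g u) w = (- 1) ^ length w * conv f g w"
proof -
  have "(- 1) ^ k * f (take k w) * ((- 1) ^ (length w - k) * g (drop k w))
      = (- 1) ^ length w * (f (take k w) * g (drop k w))" if "k \<le> length w" for k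
  proof -
    have "(- 1 :: 'a) ^ length w = (- 1) ^ k * (- 1) ^ (length w - k)"
      using that by (simp flip: power_add)
    then show ?thesis by simp
  qed
  then show ?thesis
    unfolding conv_def sum_distrib_left by (intro sum.cong) (auto simp: min_absorb2)
qed

lemma splits_eq_image: "{(u, v). w = u @ v} = (\<lambda>k. (take k w, drop k w)) ` {..length w}"
proof (intro subset_antisym subsetI)
  fix p assume "p \<in> {(u, v). w = u @ v}"
  then obtain u v where "p = (u, v)" "w = u @ v" by auto
  then show "p \<in> (\<lambda>k. (take k w, drop k w)) ` {..length w}"
    by (intro image_eqI[of _ _ "length u"]) auto
qed auto

lemma sum_splits: "(\<Sum>(u, v) \<in> {(u, v). w = u @ v}. f u * g v) = conv f g w"
proof -
  have "inj_on (\<lambda>k. (take k w, drop k w)) {..length w}"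
    by (intro inj_onI) (metis Pair_inject atMost_iff length_take min.absorb2)
  then show ?thesis by (simp add: conv_def sum.reindex splits_eq_image)
qed

lemma nc_times_eq_conv: "nc_times f g = conv f g"
  by (simp add: nc_times_def fun_eq_iff sum_splits)

lemma sum_triple_splits:
  "(\<Sum>(u1, u2, u3) \<in> {(u1, u2, u3). w = u1 @ u2 @ u3}. f u1 * g u2 * h u3) = conv (conv f g) h w"
proof -
  have fin: "finite {(u, v). w = u @ v}" for w :: word
    by (simp add: splits_eq_image)
  have "(\<Sum>(u1, u2, u3) \<in> {(u1, u2, u3). w = u1 @ u2 @ u3}. f u1 * g u2 * h u3)
     = (\<Sum>((u, u3), (u1, u2)) \<in> (SIGMA p : {(u, v). w = u @ v}. {(u1, u2). fst p = u1 @ u2}). f u1 * g u2 * h u3)"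
    by (rule sum.reindex_bij_witness[of _ "\<lambda>((u, u3), (u1, u2)). (u1, u2, u3)"
          "\<lambda>(u1, u2, u3). ((u1 @ u2, u3), (u1, u2))"]) auto
  also have "\<dots> = (\<Sum>p \<in> {(u, v). w = u @ v}. \<Sum>q \<in> {(u1, u2). fst p = u1 @ u2}. f (fst q) * g (snd q) * h (snd p))"
    by (subst sum.Sigma) (auto intro!: fin sum.cong)
  also have "\<dots> = (\<Sum>p \<in> {(u, v). w = u @ v}. conv f g (fst p) * h (snd p))"
  proof (intro sum.cong refl)
    fix p :: "word \<times> word"
    show "(\<Sum>q \<in> {(u1, u2). fst p = u1 @ u2}. f (fst q) * g (snd q) * h (snd p)) = conv f g (fst p) * h (snd p)"
      using sum_splits[where f = f and g = g and w = "fst p"]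
      by (simp add: sum_distrib_right[symmetric] case_prod_beta)
  qed
  also have "\<dots> = conv (conv f g) h w"
    using sum_splits[of "conv f g" h w] by (simp add: case_prod_beta)
  finally show ?thesis .
qed

text \<open>Solves \<open>q * g = f\<close> for \<open>q\<close> when \<open>g\<close> has constant
  term 1. The values on proper prefixes determine the value on \<open>w\<close>, hence the recursion
  on length.\<close>

function lquot :: "(word \<Rightarrow> 'a::comm_ring_1) \<Rightarrow> (word \<Rightarrow> 'a) \<Rightarrow> word \<Rightarrow> 'a" where
  "lquot f g w = f w - (\<Sum>k\<in>{..<length w}. lquot f g (take k w) * g (drop k w))"
  by pat_completeness auto
termination by (relation "Wellfounded.measure (\<lambda>(f, g, w). length w)") auto

declare lquot.simps [simp del]

lemma conv_last: "conv f g w = (\<Sum>k<length w. f (take k w) * g (drop k w)) + f w * g []"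
  by (simp add: conv_def flip: lessThan_Suc_atMost)

lemma conv_first: "conv f g w = f [] * g w + (\<Sum>k\<in>{1..length w}. f (take k w) * g (drop k w))"
proof -
  have "{..length w} = insert 0 {1..length w}" by auto
  then show ?thesis by (simp add: conv_def)
qed

lemma conv_lquot: "g [] = 1 \<Longrightarrow> conv (lquot f g) g w = f w"
  by (simp add: conv_last lquot.simps[of f g w])

text \<open>Stated for the prefixes of one word, so that identities known only on a factor-closed
  set such as \<open>B0\<close> can be cancelled.\<close>

lemma conv_right_cancel:
  assumes "g [] = 1" and "\<And>k. k \<le> length w \<Longrightarrow> conv f g (take k w) = conv f' g (take k w)"
  shows "f w = f' w"
  using assms(2)
proof (induction "length w" arbitrary: w rule: less_induct)
  case less
  have "f (take k w) = f' (take k w)" if "k < length w" for k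
  proof (rule less.hyps)
    fix j assume "j \<le> length (take k w)"
    then show "conv f g (take j (take k w)) = conv f' g (take j (take k w))"
      using less.prems[of j] that by (simp add: min_def split: if_splits)
  qed (use that in simp)
  moreover have "conv f g w = conv f' g w" using less.prems[of "length w"] by simp
  ultimately show ?case by (simp add: conv_last assms(1))
qed

lemma conv_left_cancel:
  assumes "f [] = 1" and "\<And>k. k \<le> length w \<Longrightarrow> conv f g (drop k w) = conv f g' (drop k w)"
  shows "g w = g' w"
  using assms(2)
proof (induction "length w" arbitrary: w rule: less_induct)
  case less
  have "g (drop k w) = g' (drop k w)" if "k \<in> {1..length w}" for k
  proof (rule less.hyps)
    fix j assume "j \<le> length (drop k w)"
    then show "conv f g (drop j (drop k w)) = conv f g' (drop j (drop k w))"
      using less.prems[of "j + k"] that by fastforce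
  qed (use that in auto)
  moreover have "conv f g w = conv f g' w" using less.prems[of 0] by simp
  ultimately show ?case by (simp add: conv_first assms(1))
qed

subsection \<open>Multiplication by a letter and the exponential of a letter\<close>

text \<open>Written on coefficients, because commutation of a series with a letter is tested word by
  word; the product form is \<open>lsh_conv_letter\<close>.\<close>

definition lsh :: "letter \<Rightarrow> (word \<Rightarrow> 'a::comm_ring_1) \<Rightarrow> word \<Rightarrow> 'a" where
  "lsh i f w = (if w \<noteq> [] \<and> hd w = i then f (tl w) else 0)"

definition rsh :: "(word \<Rightarrow> 'a::comm_ring_1) \<Rightarrow> letter \<Rightarrow> word \<Rightarrow> 'a" where
  "rsh f i w = (if w \<noteq> [] \<and> last w = i then f (butlast w) else 0)"

definition letter_series :: "letter \<Rightarrow> word \<Rightarrow> 'a::comm_ring_1" where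
  "letter_series i w = (if w = [i] then 1 else 0)"

lemma lsh_conv_letter: "lsh i f = conv (letter_series i) f"
proof
  fix w show "lsh i f w = conv (letter_series i) f w"
  proof (cases w)
    case (Cons x v)
    have "(\<lambda>u. letter_series i (x # u)) = (\<lambda>u. if x = i then unit_series u else (0::'a))"
      by (auto simp: letter_series_def unit_series_def)
    moreover have "conv (\<lambda>u. 0) f v = 0" by (simp add: conv_def)
    ultimately show ?thesis
      by (simp add: lsh_def Cons conv_Cons) (simp add: letter_series_def)
  qed (simp add: lsh_def letter_series_def)
qed

lemma rsh_conv_letter: "rsh f i = conv f (letter_series i)"
proof
  fix w show "rsh f i w = conv f (letter_series i) w"
  proof (cases w rule: rev_exhaust)
    case (snoc v x)
    have "(\<lambda>u. letter_series i (u @ [x])) = (\<lambda>u. if x = i then unit_series u else (0::'a))"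
      by (auto simp: letter_series_def unit_series_def)
    moreover have "conv f (\<lambda>u. 0) v = 0" by (simp add: conv_def)
    ultimately show ?thesis
      by (simp add: rsh_def snoc conv_snoc) (simp add: letter_series_def)
  qed (simp add: rsh_def letter_series_def)
qed

text \<open>A letter moves across the product. This is what makes the two letter terms cancel in the
  Leibniz computations below.\<close>

lemma conv_rsh: "conv (rsh f i) g w = conv f (lsh i g) w"
  by (simp add: lsh_conv_letter rsh_conv_letter conv_assoc)

definition expl :: "letter \<Rightarrow> complex \<Rightarrow> word \<Rightarrow> complex" where
  "expl i c w = (if w = replicate (length w) i then c ^ length w / fact (length w) else 0)"

lemma expl_Nil [simp]: "expl i c [] = 1"
  by (simp add: expl_def)

lemma expl_zero [simp]: "expl i 0 = unit_series"
  by (auto simp: expl_def unit_series_def fun_eq_iff)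

lemma replicate_snoc_iff: "w @ [x] = replicate (Suc (length w)) i \<longleftrightarrow> x = i \<and> w = replicate (length w) i"
  by (metis append_eq_append_conv last_snoc length_append_singleton length_replicate
      replicate_Suc replicate_append_same)

lemma expl_rev: "expl i c (rev w) = expl i c w"
proof -
  have "rev w = replicate (length w) i \<longleftrightarrow> w = replicate (length w) i"
    by (metis rev_replicate rev_rev_ident)
  then show ?thesis by (simp add: expl_def)
qed

lemma expl_deriv: "((\<lambda>c. expl i c w) has_field_derivative rsh (expl i c) i w) (at c)"
proof (cases w rule: rev_exhaust)
  case (snoc v x)
  show ?thesis
  proof (cases "w = replicate (length w) i")
    case True
    then have xv: "x = i" "v = replicate (length v) i"
      using snoc replicate_snoc_iff[of v x i] by auto
    have "((\<lambda>c. c ^ Suc (length v) / fact (Suc (length v))) has_field_derivative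
        of_nat (Suc (length v)) * c ^ length v / fact (Suc (length v))) (at c)"
      by (rule derivative_eq_intros refl | simp del: of_nat_Suc fact_Suc)+
    moreover have "of_nat (Suc (length v)) * c ^ length v / fact (Suc (length v)) = c ^ length v / (fact (length v) :: complex)"
      by (simp add: fact_Suc del: of_nat_Suc)
    ultimately have "((\<lambda>c. c ^ Suc (length v) / fact (Suc (length v))) has_field_derivative
        c ^ length v / (fact (length v) :: complex)) (at c)" by (simp only:)
    moreover have "(\<lambda>c. expl i c w) = (\<lambda>c. c ^ Suc (length v) / fact (Suc (length v)))"
      using True snoc by (simp add: expl_def fun_eq_iff del: fact_Suc)
    moreover have "rsh (expl i c) i w = c ^ length v / fact (length v)"
      using xv snoc by (simp add: expl_def rsh_def)
    ultimately show ?thesis by (simp only:)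
  next
    case False
    then show ?thesis using snoc replicate_snoc_iff[of v x i]
      by (auto simp: expl_def rsh_def)
  qed
qed (simp add: rsh_def)

lemma expl_commute: "lsh i (expl i c) = rsh (expl i c) i"
proof
  fix w show "lsh i (expl i c) w = rsh (expl i c) i w"
  proof (cases "w = replicate (length w) i")
    case True
    then obtain n where w: "w = replicate n i" by blast
    show ?thesis
    proof (cases n)
      case (Suc m)
      have "butlast w = replicate m i" "last w = i" using w Suc
        by (metis butlast_snoc replicate_Suc replicate_append_same, simp)
      then show ?thesis using w Suc by (simp add: lsh_def rsh_def)
    qed (simp add: w lsh_def rsh_def)
  next
    case False
    have 1: "expl i c (tl w) = 0" if "w \<noteq> []" "hd w = i"
    proof -
      have "tl w \<noteq> replicate (length (tl w)) i"
        using False that by (cases w) auto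
      then show ?thesis by (simp add: expl_def)
    qed
    have 2: "expl i c (butlast w) = 0" if "w \<noteq> []" "last w = i"
    proof (cases w rule: rev_exhaust)
      case (snoc v x)
      then show ?thesis using that False replicate_snoc_iff[of v x i] by (auto simp: expl_def)
    qed (use that in simp)
    show ?thesis using 1 2 by (auto simp: lsh_def rsh_def)
  qed
qed

lemma conv_has_field_derivative:
  fixes f g :: "complex \<Rightarrow> word \<Rightarrow> complex"
  assumes "\<And>k. k \<le> length w \<Longrightarrow> ((\<lambda>z. f z (take k w)) has_field_derivative f' (take k w)) (at z within A)"
      and "\<And>k. k \<le> length w \<Longrightarrow> ((\<lambda>z. g z (drop k w)) has_field_derivative g' (drop k w)) (at z within A)"
  shows "((\<lambda>z. conv (f z) (g z) w) has_field_derivative conv f' (g z) w + conv (f z) g' w) (at z within A)"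
proof -
  have "((\<lambda>z. \<Sum>k\<le>length w. f z (take k w) * g z (drop k w)) has_field_derivative
      (\<Sum>k\<le>length w. f' (take k w) * g z (drop k w) + g' (drop k w) * f z (take k w))) (at z within A)"
    by (intro DERIV_sum DERIV_mult) (use assms in auto)
  then show ?thesis by (simp add: conv_def sum.distrib mult.commute)
qed

text \<open>The product \<open>exp ((a + b - t) i) exp (t i)\<close> is independent of
  \<open>t\<close>, since its two derivative terms cancel; compare \<open>t = b\<close> with
  \<open>t = 0\<close>.\<close>

lemma expl_add: "conv (expl i a) (expl i b) w = expl i (a + b) w"
proof -
  define \<phi> where "\<phi> t = conv (expl i (a + b - t)) (expl i t) w" for t
  have "(\<phi> has_field_derivative 0) (at t)" for t
  proof -
    have "((\<lambda>t. expl i (a + b - t) u) has_field_derivative - rsh (expl i (a + b - t)) i u) (at t)" for u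
    proof -
      have "((\<lambda>t. a + b - t) has_field_derivative -1) (at t)"
        by (auto intro!: derivative_eq_intros)
      from DERIV_chain2[OF expl_deriv this] show ?thesis by simp
    qed
    moreover have "((\<lambda>t. expl i t u) has_field_derivative lsh i (expl i t) u) (at t)" for u
      using expl_deriv by (simp add: expl_commute)
    ultimately have "(\<phi> has_field_derivative conv (\<lambda>u. - rsh (expl i (a + b - t)) i u) (expl i t) w
        + conv (expl i (a + b - t)) (\<lambda>u. lsh i (expl i t) u) w) (at t)"
      unfolding \<phi>_def by (intro conv_has_field_derivative)
    moreover have "conv (\<lambda>u. - rsh (expl i (a + b - t)) i u) (expl i t) w = - conv (rsh (expl i (a + b - t)) i) (expl i t) w"
      using conv_scale_left[of "-1"] by simp
    ultimately show ?thesis by (simp add: conv_rsh)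
  qed
  then obtain c where c: "\<And>t. \<phi> t = c"
    using has_field_derivative_zero_constant[of UNIV \<phi>] by auto
  have "\<phi> b = \<phi> 0" by (simp add: c)
  then show ?thesis by (simp add: \<phi>_def)
qed

subsection \<open>Polylogarithms at the origin\<close>

text \<open>The plane cut along the ray from 1 to infinity. It contains 0, where the regularised
  series is holomorphic, and is starlike about 0, so primitives exist.\<close>

definition upper_slit :: "complex set" where
  "upper_slit = UNIV - complex_of_real ` {1..}"

lemma open_upper_slit: "open upper_slit"
proof -
  have "upper_slit = - ({z. Im z = 0} \<inter> {z. 1 \<le> Re z})"
    by (auto simp: upper_slit_def complex_eq_iff image_iff)
  moreover have "closed ({z. Im z = 0} \<inter> {z. 1 \<le> Re z})"
    by (intro closed_Int closed_Collect_eq closed_Collect_le continuous_intros)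
  ultimately show ?thesis using open_Compl by metis
qed

lemma zero_in_upper_slit [simp]: "0 \<in> upper_slit"
  by (auto simp: upper_slit_def)

lemma one_notin_upper_slit [simp]: "1 \<notin> upper_slit"
  by (auto simp: upper_slit_def image_iff intro!: bexI[of _ 1])

lemma starlike_upper_slit: "starlike upper_slit"
  unfolding starlike_def
proof (intro bexI[of _ 0] ballI subsetI)
  fix z w assume z: "z \<in> upper_slit" and "w \<in> closed_segment 0 z"
  then obtain u where u: "0 \<le> u" "u \<le> 1" "w = of_real u * z"
    by (auto simp: closed_segment_def scaleR_conv_of_real)
  show "w \<in> upper_slit"
  proof (rule ccontr)
    assume "w \<notin> upper_slit"
    then obtain r where r: "r \<ge> 1" "w = of_real r" by (auto simp: upper_slit_def)
    then have "u > 0" using u by (cases "u = 0") auto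
    then have "z = of_real (r / u)" using r u by (simp add: field_simps)
    moreover have "r / u \<ge> 1" using r u \<open>u > 0\<close> by simp
    ultimately show False using z unfolding upper_slit_def by blast
  qed
qed simp

text \<open>
  The series \<open>h\<close> with \<open>L = exp (X0 log z) h\<close> is holomorphic at \<open>0\<close>; the subtracted term comes
  from the factor \<open>X0 / z\<close> on the left.
\<close>

function hfun :: "word \<Rightarrow> complex \<Rightarrow> complex" where
  "hfun v = (if v = [] then (\<lambda>_. 1) else
     (SOME f. f 0 = 0 \<and> f holomorphic_on upper_slit \<and>
        (\<forall>z\<in>upper_slit - {0}. (f has_field_derivative
            (hfun (butlast v) z / (z - pt (last v)) - (if hd v = X0 then hfun (tl v) z / z else 0))) (at z))))"
  by pat_completeness auto
termination by (relation "Wellfounded.measure length") auto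

declare hfun.simps [simp del]

lemma hfun_Nil [simp]: "hfun [] z = 1"
  by (simp add: hfun.simps)

definition hrhs :: "word \<Rightarrow> complex \<Rightarrow> complex" where
  "hrhs v z = hfun (butlast v) z / (z - pt (last v)) - (if hd v = X0 then hfun (tl v) z / z else 0)"

lemma holomorphic_divide_z:
  assumes "\<phi> holomorphic_on U" "open U" "\<phi> 0 = 0"
  obtains g where "g holomorphic_on U" "\<And>z. z \<noteq> 0 \<Longrightarrow> g z = \<phi> z / z"
proof
  show "(\<lambda>z. if z = 0 then deriv \<phi> 0 else \<phi> z / z) holomorphic_on U"
    by (rule pole_theorem_open_0[OF assms(1,2), of 0]) (use assms in auto)
qed auto

text \<open>The poles of \<open>hrhs v\<close> at 0 cancel, so it has a primitive on the starlike
  domain. If \<open>v\<close> ends in \<open>X0\<close>, the two numerators vanish at 0 by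
  induction, except for \<open>v = [X0]\<close>, where they are 1 and cancel. If \<open>v\<close>
  ends in \<open>X1\<close>, only the term of \<open>tl v\<close> has a pole, and then
  \<open>tl v\<close> is nonempty.\<close>

lemma hfun_props:
  "hfun v holomorphic_on upper_slit \<and> (v \<noteq> [] \<longrightarrow> hfun v 0 = 0 \<and>
     (\<forall>z\<in>upper_slit - {0}. (hfun v has_field_derivative hrhs v z) (at z)))"
proof (induction "length v" arbitrary: v rule: less_induct)
  case less
  show ?case
  proof (cases "v = []")
    case True
    then have "hfun v = (\<lambda>_. 1)" by (simp add: hfun.simps)
    then show ?thesis using True by simp
  next
    case False
    have IH: "hfun u holomorphic_on upper_slit" "u \<noteq> [] \<Longrightarrow> hfun u 0 = 0" if "length u < length v" for u
      using less[OF that] by auto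
    have lb: "length (butlast v) < length v" "length (tl v) < length v" using False by auto
    have "\<exists>g. g holomorphic_on upper_slit \<and> (\<forall>z\<in>upper_slit - {0}. g z = hrhs v z)"
    proof (cases "last v")
      case X0
      define \<phi> where "\<phi> z = hfun (butlast v) z - (if hd v = X0 then hfun (tl v) z else 0)" for z
      have h: "\<phi> holomorphic_on upper_slit"
        unfolding \<phi>_def using IH(1)[OF lb(1)] IH(1)[OF lb(2)] by (cases "hd v = X0") (auto intro!: holomorphic_intros)
      have "\<phi> 0 = 0"
      proof (cases "length v = 1")
        case True
        then have "v = [X0]" using X0 by (cases v) auto
        then show ?thesis by (simp add: \<phi>_def)
      next
        case False
        then have "butlast v \<noteq> []" "tl v \<noteq> []" using \<open>v \<noteq> []\<close>
          by (metis One_nat_def Suc_pred length_0_conv length_butlast length_greater_0_conv)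
             (metis False \<open>v \<noteq> []\<close> One_nat_def list.collapse length_Cons list.size(3))
        then show ?thesis using IH(2)[OF lb(1)] IH(2)[OF lb(2)] by (simp add: \<phi>_def)
      qed
      then obtain g where g: "g holomorphic_on upper_slit" "\<And>z. z \<noteq> 0 \<Longrightarrow> g z = \<phi> z / z"
        using holomorphic_divide_z[OF h open_upper_slit] by metis
      moreover have "\<phi> z / z = hrhs v z" for z
        by (simp add: \<phi>_def hrhs_def X0 diff_divide_distrib)
      ultimately show ?thesis by auto
    next
      case X1
      have "\<exists>g. g holomorphic_on upper_slit \<and> (\<forall>z\<in>upper_slit - {0}. g z = (if hd v = X0 then hfun (tl v) z / z else 0))"
      proof (cases "hd v = X0")
        case True
        then have "tl v \<noteq> []" using X1 False by (cases v) auto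
        then obtain g where "g holomorphic_on upper_slit" "\<And>z. z \<noteq> 0 \<Longrightarrow> g z = hfun (tl v) z / z"
          using holomorphic_divide_z[OF IH(1)[OF lb(2)] open_upper_slit IH(2)[OF lb(2)]] by metis
        then show ?thesis using True by auto
      qed (auto intro: exI[of _ "\<lambda>_. 0"])
      then obtain g where g: "g holomorphic_on upper_slit" "\<And>z. z\<in>upper_slit - {0} \<Longrightarrow> g z = (if hd v = X0 then hfun (tl v) z / z else 0)"
        by blast
      have "(\<lambda>z. hfun (butlast v) z / (z - 1) - g z) holomorphic_on upper_slit"
        using IH(1)[OF lb(1)] g(1) one_notin_upper_slit by (intro holomorphic_intros) auto
      then show ?thesis using g(2) X1 by (intro exI[of _ "\<lambda>z. hfun (butlast v) z / (z - 1) - g z"]) (simp add: hrhs_def)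
    qed
    then obtain g where g: "g holomorphic_on upper_slit" "\<And>z. z \<in> upper_slit - {0} \<Longrightarrow> g z = hrhs v z" by blast
    obtain f where f: "\<And>z. z \<in> upper_slit \<Longrightarrow> (f has_field_derivative g z) (at z)"
      using holomorphic_starlike_primitive[of upper_slit g "{}"] g(1) starlike_upper_slit open_upper_slit
        holomorphic_on_imp_continuous_on holomorphic_on_imp_differentiable_at by (metis Diff_empty finite.emptyI)
    let ?P = "\<lambda>f. f 0 = 0 \<and> f holomorphic_on upper_slit \<and> (\<forall>z\<in>upper_slit - {0}. (f has_field_derivative hrhs v z) (at z))"
    have "?P (\<lambda>z. f z - f 0)"
    proof (intro conjI ballI)
      have d: "((\<lambda>z. f z - f 0) has_field_derivative g z) (at z)" if "z \<in> upper_slit" for z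
        using DERIV_diff[OF f[OF that] DERIV_const[of "f 0"]] by simp
      then show "(\<lambda>z. f z - f 0) holomorphic_on upper_slit"
        using holomorphic_on_open[OF open_upper_slit] by blast
      show "((\<lambda>z. f z - f 0) has_field_derivative hrhs v z) (at z)" if "z \<in> upper_slit - {0}" for z
        using d[of z] g(2)[OF that] that by simp
    qed simp
    then have "?P (SOME f. ?P f)" by (rule someI[where P = ?P])
    moreover have "hfun v = (SOME f. ?P f)" using False by (simp add: hfun.simps[of v] hrhs_def)
    ultimately show ?thesis by simp
  qed
qed

lemma hfun_holomorphic: "hfun v holomorphic_on upper_slit"
  and hfun_0: "v \<noteq> [] \<Longrightarrow> hfun v 0 = 0"
  and hfun_deriv: "v \<noteq> [] \<Longrightarrow> z \<in> upper_slit \<Longrightarrow> z \<noteq> 0 \<Longrightarrow> (hfun v has_field_derivative hrhs v z) (at z)"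
  using hfun_props[of v] by auto

lemma replicate_butlast_tl: "butlast (replicate n x) = replicate (n - 1) x" "tl (replicate n x) = replicate (n - 1) x"
proof -
  show "butlast (replicate n x) = replicate (n - 1) x"
    by (cases n) (simp_all add: replicate_append_same[symmetric] del: replicate_Suc, simp add: replicate_append_same[symmetric] butlast_append)
  show "tl (replicate n x) = replicate (n - 1) x" by (cases n) auto
qed

text \<open>The two terms of \<open>hrhs\<close> coincide on powers of \<open>X0\<close>: the
  logarithm sits entirely in the exponential factor.\<close>

lemma hfun_replicate_X0:
  assumes "n > 0" "z \<in> upper_slit" shows "hfun (replicate n X0) z = 0"
proof -
  let ?v = "replicate n X0"
  have "hrhs ?v z = 0" if "z \<noteq> 0" for z
    using assms(1) by (simp add: hrhs_def replicate_butlast_tl)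
  then have d: "(hfun ?v has_field_derivative 0) (at z)" if "z \<in> upper_slit - {0}" for z
    using hfun_deriv[of ?v z] that assms(1) by fastforce
  have "\<exists>c. \<forall>z\<in>upper_slit. hfun ?v z = c"
  proof (rule DERIV_zero_connected_constant[of _ "{0}"])
    show "connected upper_slit" by (rule starlike_imp_connected[OF starlike_upper_slit])
    show "continuous_on upper_slit (hfun ?v)" by (rule holomorphic_on_imp_continuous_on[OF hfun_holomorphic])
  qed (use d open_upper_slit in auto)
  then show ?thesis using assms hfun_0[of ?v] by (metis length_replicate list.size(3) not_gr0 zero_in_upper_slit)
qed

text \<open>Coefficient form of the Knizhnik-Zamolodchikov equation
  \<open>d\<Lambda> = \<Lambda> (X0 dz / z + X1 dz / (z - 1))\<close> with constant term 1. Its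
  solutions can be multiplied by constants on the left.\<close>

definition poly_sol :: "complex set \<Rightarrow> (word \<Rightarrow> complex \<Rightarrow> complex) \<Rightarrow> bool" where
  "poly_sol U \<Lambda> \<longleftrightarrow> (\<forall>z\<in>U. \<Lambda> [] z = 1) \<and>
     (\<forall>w i. \<forall>z\<in>U. (\<Lambda> (w @ [i]) has_field_derivative \<Lambda> w z / (z - pt i)) (at z))"

text \<open>The branch of the logarithm is a parameter, so that one construction serves the
  principal branch and the other slit planes.\<close>

definition log_sol :: "(complex \<Rightarrow> complex) \<Rightarrow> word \<Rightarrow> complex \<Rightarrow> complex" where
  "log_sol lg w z = conv (expl X0 (lg z)) (\<lambda>v. hfun v z) w"

text \<open>The derivative of the exponential inserts \<open>X0 / z\<close> between the two factors,
  and the equation of \<open>h\<close> subtracts the same term; only the multiplication by letters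
  on the right survives.\<close>

lemma poly_sol_log_sol:
  assumes U: "U \<subseteq> upper_slit - {0}"
    and lg: "\<And>z. z \<in> U \<Longrightarrow> (lg has_field_derivative 1 / z) (at z)"
  shows "poly_sol U (log_sol lg)"
  unfolding poly_sol_def
proof (intro conjI allI ballI)
  fix z assume z: "z \<in> U"
  show "log_sol lg [] z = 1" by (simp add: log_sol_def)
  fix w i
  define h where "h v = hfun v z" for v
  define d where "d v = (if v = [] then 0 else h (butlast v) / (z - pt (last v)))" for v
  have e': "((\<lambda>z. expl X0 (lg z) u) has_field_derivative (1 / z) * rsh (expl X0 (lg z)) X0 u) (at z)" for u
    using DERIV_chain2[OF expl_deriv lg[OF z]] by (simp add: mult.commute)
  have h': "((\<lambda>z. hfun v z) has_field_derivative d v - (1 / z) * lsh X0 h v) (at z)" for v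
  proof (cases "v = []")
    case False
    then have "hrhs v z = d v - (1 / z) * lsh X0 h v" by (simp add: hrhs_def d_def h_def lsh_def)
    then show ?thesis using hfun_deriv[OF False, of z] z U by auto
  qed (simp add: d_def lsh_def hfun.simps)
  have "((\<lambda>z. conv (expl X0 (lg z)) (\<lambda>v. hfun v z) (w @ [i])) has_field_derivative
      conv (\<lambda>u. (1 / z) * rsh (expl X0 (lg z)) X0 u) h (w @ [i])
      + conv (expl X0 (lg z)) (\<lambda>v. d v - (1 / z) * lsh X0 h v) (w @ [i])) (at z)"
    unfolding h_def
    by (rule conv_has_field_derivative[where g = "\<lambda>z v. hfun v z" and f = "\<lambda>z. expl X0 (lg z)"])
       (use e' h'[unfolded h_def] in blast)+
  also have "conv (\<lambda>u. (1 / z) * rsh (expl X0 (lg z)) X0 u) h (w @ [i])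
      + conv (expl X0 (lg z)) (\<lambda>v. d v - (1 / z) * lsh X0 h v) (w @ [i]) = conv (expl X0 (lg z)) d (w @ [i])"
    unfolding conv_scale_left conv_diff_right conv_scale_right conv_rsh by simp
  also have "\<dots> = conv (expl X0 (lg z)) (\<lambda>v. (1 / (z - pt i)) * h v) w"
    by (simp add: conv_snoc d_def)
  also have "\<dots> = log_sol lg w z / (z - pt i)"
    unfolding conv_scale_right log_sol_def h_def by simp
  finally show "(log_sol lg (w @ [i]) has_field_derivative log_sol lg w z / (z - pt i)) (at z)"
    by (simp add: log_sol_def[abs_def])
qed

lemma poly_sol_Nil: "poly_sol U \<Lambda> \<Longrightarrow> z \<in> U \<Longrightarrow> \<Lambda> [] z = 1"
  and poly_sol_deriv: "poly_sol U \<Lambda> \<Longrightarrow> z \<in> U \<Longrightarrow> (\<Lambda> (w @ [i]) has_field_derivative \<Lambda> w z / (z - pt i)) (at z)"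
  by (auto simp: poly_sol_def)

lemma poly_sol_subset: "poly_sol U \<Lambda> \<Longrightarrow> V \<subseteq> U \<Longrightarrow> poly_sol V \<Lambda>"
  unfolding poly_sol_def by blast

lemma poly_sol_deriv_ex:
  assumes "poly_sol U \<Lambda>" "z \<in> U" "open U"
  shows "\<exists>d. (\<Lambda> w has_field_derivative d) (at z)"
proof (cases w rule: rev_exhaust)
  case Nil
  have "((\<lambda>_. 1) has_field_derivative 0) (at z)" by simp
  then have "(\<Lambda> [] has_field_derivative 0) (at z)"
    by (rule has_field_derivative_transform_within_open[OF _ assms(3,2)]) (use poly_sol_Nil[OF assms(1)] in auto)
  then show ?thesis using Nil by blast
next
  case (snoc v x)
  then show ?thesis using poly_sol_deriv[OF assms(1,2)] by blast
qed

lemma poly_sol_holomorphic: "poly_sol U \<Lambda> \<Longrightarrow> open U \<Longrightarrow> \<Lambda> w holomorphic_on U"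
  by (simp add: holomorphic_on_open poly_sol_deriv_ex)

lemma poly_sol_conv:
  assumes "poly_sol U \<Lambda>" "open U" "c [] = 1"
  shows "poly_sol U (\<lambda>w z. conv c (\<lambda>v. \<Lambda> v z) w)"
  unfolding poly_sol_def
proof (intro conjI allI ballI)
  fix w i z assume z: "z \<in> U"
  have "((\<lambda>z. conv c (\<lambda>v. \<Lambda> (v @ [i]) z) w) has_field_derivative
      conv (\<lambda>_. 0) (\<lambda>v. \<Lambda> (v @ [i]) z) w + conv c (\<lambda>v. \<Lambda> v z / (z - pt i)) w) (at z)"
    by (rule conv_has_field_derivative[where f = "\<lambda>z. c" and g = "\<lambda>z v. \<Lambda> (v @ [i]) z"])
       (use poly_sol_deriv[OF assms(1) z] in auto)
  also have "conv (\<lambda>_. 0) (\<lambda>v. \<Lambda> (v @ [i]) z) w + conv c (\<lambda>v. \<Lambda> v z / (z - pt i)) w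
      = conv c (\<lambda>v. \<Lambda> v z) w / (z - pt i)"
    using conv_scale_right[of c "1 / (z - pt i)" "\<lambda>v. \<Lambda> v z" w] by (simp add: conv_def)
  finally have "((\<lambda>z. conv c (\<lambda>v. \<Lambda> (v @ [i]) z) w + c (w @ [i])) has_field_derivative
      conv c (\<lambda>v. \<Lambda> v z) w / (z - pt i)) (at z)"
    using DERIV_add[OF _ DERIV_const] by fastforce
  then show "((\<lambda>z. conv c (\<lambda>v. \<Lambda> v z) (w @ [i])) has_field_derivative conv c (\<lambda>v. \<Lambda> v z) w / (z - pt i)) (at z)"
    by (rule has_field_derivative_transform_within_open[OF _ assms(2) z])
       (use poly_sol_Nil[OF assms(1)] in \<open>auto simp: conv_snoc\<close>)
qed (use assms in \<open>auto simp: poly_sol_Nil\<close>)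

lemma poly_sol_unique_at:
  assumes "poly_sol U \<Lambda>" "poly_sol U \<Lambda>'" "open U" "connected U" "a \<in> U"
    and "\<And>w. \<Lambda> w a = \<Lambda>' w a" and "z \<in> U"
  shows "\<Lambda> w z = \<Lambda>' w z"
  using \<open>z \<in> U\<close>
proof (induction w arbitrary: z rule: rev_induct)
  case Nil
  then show ?case using assms(1,2) by (simp add: poly_sol_Nil)
next
  case (snoc i w)
  have "((\<lambda>z. \<Lambda> (w @ [i]) z - \<Lambda>' (w @ [i]) z) has_field_derivative 0) (at z)" if "z \<in> U" for z
    using DERIV_diff[OF poly_sol_deriv[OF assms(1) that] poly_sol_deriv[OF assms(2) that], of w i w i] snoc.IH[OF that] by simp
  then have "(\<lambda>z. \<Lambda> (w @ [i]) z - \<Lambda>' (w @ [i]) z) constant_on U"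
    by (rule has_field_derivative_0_imp_constant_on[OF _ assms(4,3)])
  then obtain c where c: "\<And>z. z \<in> U \<Longrightarrow> \<Lambda> (w @ [i]) z - \<Lambda>' (w @ [i]) z = c"
    unfolding constant_on_def by blast
  have "c = 0" using c[OF assms(5)] assms(6) by simp
  then show ?case using c[OF snoc.prems] by simp
qed

text \<open>The constant is the quotient of the two values at one point; equality there spreads over
  the connected set by integrating letter by letter.\<close>

lemma poly_sol_unique:
  assumes "poly_sol U \<Lambda>" "poly_sol U \<Lambda>'" "open U" "connected U" "U \<noteq> {}"
  obtains c where "c [] = 1" "\<And>w z. z \<in> U \<Longrightarrow> \<Lambda>' w z = conv c (\<lambda>v. \<Lambda> v z) w"
proof -
  obtain a where a: "a \<in> U" using assms(5) by blast
  define c where "c = lquot (\<lambda>v. \<Lambda>' v a) (\<lambda>v. \<Lambda> v a)"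
  have c1: "c [] = 1" unfolding c_def by (subst lquot.simps) (simp add: poly_sol_Nil[OF assms(2) a])
  have e: "conv c (\<lambda>v. \<Lambda> v a) w = \<Lambda>' w a" for w
    unfolding c_def by (rule conv_lquot) (rule poly_sol_Nil[OF assms(1) a])
  have "\<Lambda>' w z = conv c (\<lambda>v. \<Lambda> v z) w" if "z \<in> U" for w z
      using poly_sol_unique_at[OF assms(2) poly_sol_conv[of U \<Lambda> c, OF assms(1,3) c1] assms(3,4) a _ that] by (simp add: e)
  then show ?thesis using that[of c] c1 by blast
qed

subsection \<open>The principal branches\<close>

lemma slit_domain_iff: "z \<in> slit_domain \<longleftrightarrow> Im z \<noteq> 0 \<or> (0 < Re z \<and> Re z < 1)"
proof
  assume z: "z \<in> slit_domain"
  show "Im z \<noteq> 0 \<or> (0 < Re z \<and> Re z < 1)"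
  proof (rule ccontr)
    assume a: "\<not> ?thesis"
    then have "z = of_real (Re z)" "Re z \<in> {..0} \<union> {1..}" by (auto simp: complex_eq_iff)
    then show False using z unfolding slit_domain_def by blast
  qed
qed (auto simp: slit_domain_def)

lemma open_slit_domain: "open slit_domain"
proof -
  have "slit_domain = {z. Im z \<noteq> 0} \<union> ({z. 0 < Re z} \<inter> {z. Re z < 1})"
    by (auto simp: slit_domain_iff)
  moreover have "open \<dots>"
    by (intro open_Un open_Int open_Collect_neq open_Collect_less continuous_intros)
  ultimately show ?thesis by simp
qed

lemma slit_domain_subset: "slit_domain \<subseteq> upper_slit - {0}" "slit_domain \<subseteq> - {0, 1}"
  by (auto simp: upper_slit_def slit_domain_iff)

lemma starlike_slit_domain: "starlike slit_domain"
  unfolding starlike_def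
proof (intro bexI[of _ "1/2"] ballI subsetI)
  fix z w assume z: "z \<in> slit_domain" and "w \<in> closed_segment (1/2) z"
  then obtain u where u: "0 \<le> u" "u \<le> 1" "w = (1 - u) *\<^sub>R (1/2) + u *\<^sub>R z"
    by (auto simp: closed_segment_def)
  have im: "Im w = u * Im z" and re: "Re w = (1 - u) / 2 + u * Re z" using u(3) by simp_all
  show "w \<in> slit_domain"
  proof (cases "Im w = 0")
    case True
    show ?thesis
    proof (cases "u = 0")
      case True then show ?thesis using re by (simp add: slit_domain_iff)
    next
      case False
      then have r: "0 < Re z" "Re z < 1" using True im z by (auto simp: slit_domain_iff)
      have "u * Re z > 0" using False u r by simp
      moreover have "u * Re z < u * 1" using False u r by (intro mult_strict_left_mono) auto
      ultimately have "0 < Re w \<and> Re w < 1" using re u(2) by argo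
      then show ?thesis by (simp add: slit_domain_iff)
    qed
  qed (simp add: slit_domain_iff)
qed (simp add: slit_domain_iff)

lemma connected_slit_domain: "connected slit_domain"
  by (rule starlike_imp_connected[OF starlike_slit_domain])

lemma slit_nonpos: "z \<in> slit_domain \<Longrightarrow> z \<notin> \<real>\<^sub>\<le>\<^sub>0"
  by (auto simp: slit_domain_iff complex_nonpos_Reals_iff)

lemma Ln_deriv_slit: "z \<in> slit_domain \<Longrightarrow> (Ln has_field_derivative 1 / z) (at z)"
  using has_field_derivative_Ln[of z] slit_nonpos by (simp add: inverse_eq_divide)

lemma zero_islimpt_slit: "at 0 within slit_domain \<noteq> bot"
proof -
  have "0 islimpt slit_domain"
    unfolding islimpt_approachable
  proof (intro allI impI)
    fix e :: real assume "e > 0"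
    then show "\<exists>x'\<in>slit_domain. x' \<noteq> 0 \<and> dist x' 0 < e"
      by (intro bexI[of _ "of_real (min (e/2) (1/2))"]) (auto simp: slit_domain_iff min_def)
  qed
  then show ?thesis by (simp add: trivial_limit_within)
qed

lemma times_Ln_power_tendsto_0: "((\<lambda>z. z * Ln z ^ k) \<longlongrightarrow> 0) (at 0 within slit_domain)"
proof -
  have "((\<lambda>x::real. x * (\<bar>ln x\<bar> + pi) ^ k) \<longlongrightarrow> 0) (at_right 0)" by real_asymp
  then have "((\<lambda>z::complex. norm z * (\<bar>ln (norm z)\<bar> + pi) ^ k) \<longlongrightarrow> 0) (at 0 within slit_domain)"
  proof (rule filterlim_compose)
    show "filterlim (norm :: complex \<Rightarrow> real) (at_right 0) (at 0 within slit_domain)"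
      unfolding filterlim_at
      by (auto intro!: tendsto_eq_intros simp: eventually_at_filter)
  qed
  then show ?thesis
  proof (rule Lim_null_comparison[rotated])
    show "\<forall>\<^sub>F z in at 0 within slit_domain. norm (z * Ln z ^ k) \<le> norm z * (\<bar>ln (norm z)\<bar> + pi) ^ k"
      unfolding eventually_at_filter
    proof (intro always_eventually allI impI)
      fix z :: complex assume z: "z \<noteq> 0"
      have "norm (Ln z) \<le> \<bar>Re (Ln z)\<bar> + \<bar>Im (Ln z)\<bar>" by (rule cmod_le)
      also have "\<dots> \<le> \<bar>ln (norm z)\<bar> + pi"
        using mpi_less_Im_Ln[OF z] Im_Ln_le_pi[OF z] z by (simp add: Re_Ln)
      finally show "norm (z * Ln z ^ k) \<le> norm z * (\<bar>ln (norm z)\<bar> + pi) ^ k"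
        unfolding norm_mult norm_power by (intro mult_left_mono power_mono) auto
    qed
  qed
qed

lemma hfun_Ln_power_tendsto_0:
  assumes "v \<noteq> []"
  shows "((\<lambda>z. Ln z ^ k * hfun v z) \<longlongrightarrow> 0) (at 0 within slit_domain)"
proof -
  obtain g where g: "g holomorphic_on upper_slit" "\<And>z. z \<noteq> 0 \<Longrightarrow> g z = hfun v z / z"
    using holomorphic_divide_z[OF hfun_holomorphic open_upper_slit hfun_0[OF assms]] by metis
  have "(g \<longlongrightarrow> g 0) (at 0 within slit_domain)"
  proof -
    have "isCont g 0"
      using holomorphic_on_imp_continuous_on[OF g(1)] continuous_on_eq_continuous_at[OF open_upper_slit, of g] zero_in_upper_slit by blast
    then show ?thesis using tendsto_within_subset[OF _ subset_UNIV] by (simp add: isCont_def)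
  qed
  from tendsto_mult[OF times_Ln_power_tendsto_0[of k] this]
  have "((\<lambda>z. z * Ln z ^ k * g z) \<longlongrightarrow> 0) (at 0 within slit_domain)" by simp
  then show ?thesis
    by (rule Lim_transform_eventually) (auto simp: eventually_at_filter g(2))
qed

text \<open>In every nonzero term the prefix is a power of \<open>X0\<close>, so the rest is
  nonempty and its \<open>hfun\<close> vanishes at 0, which beats all powers of the logarithm. The
  factor \<open>Ln z ^ j\<close> prepares for products with the values on powers of
  \<open>X0\<close>.\<close>

lemma log_sol_tendsto_0:
  assumes "\<nexists>n. w = replicate n X0"
  shows "((\<lambda>z. Ln z ^ j * log_sol Ln w z) \<longlongrightarrow> 0) (at 0 within slit_domain)"
proof -
  have "((\<lambda>z. Ln z ^ j * (expl X0 (Ln z) (take k w) * hfun (drop k w) z)) \<longlongrightarrow> 0) (at 0 within slit_domain)" for k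
  proof (cases "take k w = replicate (length (take k w)) X0")
    case True
    then have ne: "drop k w \<noteq> []" using assms by (metis append_Nil2 append_take_drop_id)
    have "((\<lambda>z. Ln z ^ (j + length (take k w)) * hfun (drop k w) z / fact (length (take k w))) \<longlongrightarrow> 0 / fact (length (take k w))) (at 0 within slit_domain)"
      by (intro tendsto_divide tendsto_const hfun_Ln_power_tendsto_0 ne) simp
    moreover have "Ln z ^ j * (expl X0 (Ln z) (take k w) * hfun (drop k w) z)
      = Ln z ^ (j + length (take k w)) * hfun (drop k w) z / fact (length (take k w))" for z
      using True by (simp add: expl_def power_add)
    ultimately show ?thesis by simp
  qed (simp add: expl_def)
  then have "((\<lambda>z. \<Sum>k\<le>length w. Ln z ^ j * (expl X0 (Ln z) (take k w) * hfun (drop k w) z)) \<longlongrightarrow> (\<Sum>k\<le>length w. 0)) (at 0 within slit_domain)"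
    by (intro tendsto_sum)
  then show ?thesis by (simp add: log_sol_def conv_def sum_distrib_left)
qed

lemma log_sol_replicate:
  assumes "z \<in> upper_slit"
  shows "log_sol lg (replicate n X0) z = lg z ^ n / fact n"
proof -
  have "hfun (drop k (replicate n X0)) z = 0" if "k < n" for k
    using hfun_replicate_X0[of "n - k" z] that assms by simp
  then show ?thesis
    by (simp add: log_sol_def conv_last expl_def)
qed

lemma poly_sol_log_sol_Ln: "poly_sol slit_domain (log_sol Ln)"
  by (rule poly_sol_log_sol) (use slit_domain_subset Ln_deriv_slit in auto)

lemma multiple_polylogs_iff:
  "multiple_polylogs M \<longleftrightarrow> poly_sol slit_domain M \<and>
     (\<forall>n. \<forall>z \<in> slit_domain. M (replicate n X0) z = (Ln z) ^ n / fact n) \<and>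
     (\<forall>w. (\<nexists>n. w = replicate n X0) \<longrightarrow> (M w \<longlongrightarrow> 0) (at 0 within slit_domain))"
  by (auto simp: multiple_polylogs_def poly_sol_def)

lemma multiple_polylogs_log_sol: "multiple_polylogs (log_sol Ln)"
  unfolding multiple_polylogs_iff
  using poly_sol_log_sol_Ln log_sol_replicate slit_domain_subset log_sol_tendsto_0[where j = 0] by auto

text \<open>By induction the difference at \<open>w @ [i]\<close> is constant on the connected slit
  plane, and the prescribed limit at 0 fixes the constant; powers of \<open>X0\<close> are
  prescribed outright.\<close>

lemma multiple_polylogs_unique:
  assumes "multiple_polylogs M" "multiple_polylogs M'" "z \<in> slit_domain"
  shows "M w z = M' w z"
  using \<open>z \<in> slit_domain\<close>
proof (induction w arbitrary: z rule: rev_induct)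
  case Nil
  then show ?case using assms(1,2) by (auto simp: multiple_polylogs_def)
next
  case (snoc i w)
  have sol: "poly_sol slit_domain M" "poly_sol slit_domain M'" using assms by (auto simp: multiple_polylogs_iff)
  show ?case
  proof (cases "\<exists>n. w @ [i] = replicate n X0")
    case True
    then show ?thesis using assms(1,2) snoc.prems unfolding multiple_polylogs_iff by metis
  next
    case False
    have "((\<lambda>z. M (w @ [i]) z - M' (w @ [i]) z) has_field_derivative 0) (at z)" if "z \<in> slit_domain" for z
      using DERIV_diff[OF poly_sol_deriv[OF sol(1) that] poly_sol_deriv[OF sol(2) that], of w i w i] snoc.IH[OF that] by simp
    then have "(\<lambda>z. M (w @ [i]) z - M' (w @ [i]) z) constant_on slit_domain"
      by (rule has_field_derivative_0_imp_constant_on[OF _ connected_slit_domain open_slit_domain])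
    then obtain c where c: "\<And>z. z \<in> slit_domain \<Longrightarrow> M (w @ [i]) z - M' (w @ [i]) z = c"
      unfolding constant_on_def by blast
    have "((\<lambda>z. M (w @ [i]) z - M' (w @ [i]) z) \<longlongrightarrow> 0 - 0) (at 0 within slit_domain)"
      using assms(1,2) False unfolding multiple_polylogs_iff by (intro tendsto_diff) blast+
    moreover have "((\<lambda>z. M (w @ [i]) z - M' (w @ [i]) z) \<longlongrightarrow> c) (at 0 within slit_domain)"
      by (rule tendsto_eventually) (auto simp: eventually_at_filter c)
    ultimately have "c = 0" using tendsto_unique[OF zero_islimpt_slit] by fastforce
    then show ?thesis using c[OF snoc.prems] by simp
  qed
qed

lemma multiple_polylogs_L: "multiple_polylogs L"
  unfolding L_def by (rule someI[of multiple_polylogs, OF multiple_polylogs_log_sol])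

lemma L_eq: "z \<in> slit_domain \<Longrightarrow> L w z = log_sol Ln w z"
  by (rule multiple_polylogs_unique[OF multiple_polylogs_L multiple_polylogs_log_sol])

lemma poly_sol_L: "poly_sol slit_domain L"
  using multiple_polylogs_L by (simp add: multiple_polylogs_iff)

lemma cnj_slit_domain [simp]: "cnj z \<in> slit_domain \<longleftrightarrow> z \<in> slit_domain"
  by (simp add: slit_domain_iff)

text \<open>Both singular points are real, so the conjugated functions satisfy the same
  characterisation.\<close>

lemma L_cnj:
  assumes "z \<in> slit_domain"
  shows "L w (cnj z) = cnj (L w z)"
proof -
  define M where "M w z = cnj (L w (cnj z))" for w z
  have "multiple_polylogs M"
    unfolding multiple_polylogs_iff poly_sol_def
  proof (intro conjI allI ballI impI)
    fix z assume z: "z \<in> slit_domain"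
    show "M [] z = 1" using z by (simp add: M_def poly_sol_Nil[OF poly_sol_L])
    show "M (replicate n X0) z = Ln z ^ n / fact n" for n
      using z multiple_polylogs_L slit_nonpos[OF z] by (simp add: M_def multiple_polylogs_iff cnj_Ln[symmetric])
    fix w i
    have d: "(L (w @ [i]) has_field_derivative L w (cnj z) / (cnj z - pt i)) (at (cnj z))"
      using poly_sol_deriv[OF poly_sol_L] z by simp
    have "cnj (pt i) = pt i" by (cases i) auto
    then show "(M (w @ [i]) has_field_derivative M w z / (z - pt i)) (at z)"
      using has_field_derivative_cnj_cnj[OF d] by (simp add: M_def[abs_def] o_def)
  next
    fix w assume "\<nexists>n. w = replicate n X0"
    then have "(L w \<longlongrightarrow> 0) (at 0 within slit_domain)" using multiple_polylogs_L by (simp add: multiple_polylogs_iff)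
    moreover have "filterlim cnj (at 0 within slit_domain) (at 0 within slit_domain)"
      unfolding filterlim_at by (auto intro!: tendsto_eq_intros simp: eventually_at_filter)
    ultimately have "((\<lambda>z. L w (cnj z)) \<longlongrightarrow> 0) (at 0 within slit_domain)" by (rule filterlim_compose)
    from tendsto_cnj[OF this] show "(M w \<longlongrightarrow> 0) (at 0 within slit_domain)" by (simp add: M_def[abs_def])
  qed
  then have "M w z = L w z" using multiple_polylogs_unique multiple_polylogs_L assms by blast
  from arg_cong[of _ _ cnj, OF this] show ?thesis unfolding M_def complex_cnj_cnj .
qed

subsection \<open>Branches on the other two slit planes\<close>

definition left_plane :: "complex set" where "left_plane = {z. Im z \<noteq> 0 \<or> Re z < 0}"
definition right_plane :: "complex set" where "right_plane = {z. Im z \<noteq> 0 \<or> 1 < Re z}"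

lemma open_left_plane: "open left_plane"
proof -
  have "left_plane = {z. Im z \<noteq> 0} \<union> {z. Re z < 0}" by (auto simp: left_plane_def)
  moreover have "open \<dots>"
    by (intro open_Un open_Collect_neq open_Collect_less continuous_intros)
  ultimately show ?thesis by simp
qed

lemma open_right_plane: "open right_plane"
proof -
  have "right_plane = {z. Im z \<noteq> 0} \<union> {z. 1 < Re z}" by (auto simp: right_plane_def)
  moreover have "open \<dots>"
    by (intro open_Un open_Collect_neq open_Collect_less continuous_intros)
  ultimately show ?thesis by simp
qed

lemma planes_cover: "z \<noteq> 0 \<Longrightarrow> z \<noteq> 1 \<Longrightarrow> z \<in> slit_domain \<or> z \<in> left_plane \<or> z \<in> right_plane"
  by (auto simp: slit_domain_iff left_plane_def right_plane_def complex_eq_iff)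

lemma Ln_minus_deriv: "z \<in> left_plane \<Longrightarrow> ((\<lambda>z. Ln (- z) + c) has_field_derivative 1 / z) (at z)"
proof -
  assume z: "z \<in> left_plane"
  then have n: "- z \<notin> \<real>\<^sub>\<le>\<^sub>0" by (auto simp: left_plane_def complex_nonpos_Reals_iff)
  have "((\<lambda>z. Ln (- z)) has_field_derivative inverse (- z) * (- 1)) (at z)"
    by (rule DERIV_chain2[where f = Ln and g = uminus, OF has_field_derivative_Ln[OF n]]) (auto intro!: derivative_eq_intros)
  from DERIV_add[OF this DERIV_const[of c]] show ?thesis by (simp add: inverse_eq_divide)
qed

lemma Ln_minus_upper: "Im z > 0 \<Longrightarrow> Ln (- z) = Ln z - \<i> * of_real pi"
  by (subst Ln_minus) auto

lemma Ln_minus_lower: "Im z < 0 \<Longrightarrow> Ln (- z) = Ln z + \<i> * of_real pi"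
  by (subst Ln_minus) auto

lemma log_sol_shift:
  assumes "lg z = lg' z + c"
  shows "log_sol lg w z = conv (expl X0 c) (\<lambda>v. log_sol lg' v z) w"
proof -
  have "expl X0 (lg z) = conv (expl X0 c) (expl X0 (lg' z))"
    by (rule ext) (simp add: expl_add assms add.commute)
  then show ?thesis by (simp add: log_sol_def conv_assoc)
qed

lemma left_plane_subset: "left_plane \<subseteq> upper_slit - {0}"
  by (auto simp: left_plane_def upper_slit_def)

lemma poly_sol_log_sol_left: "poly_sol left_plane (log_sol (\<lambda>z. Ln (- z) + c))"
  by (rule poly_sol_log_sol[OF left_plane_subset Ln_minus_deriv])

text \<open>With the constant \<open>\<i> * of_real pi\<close> this branch agrees with
  \<open>L\<close> on the upper half-plane, and the whole jump appears on the lower one.\<close>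

definition Lleft :: "word \<Rightarrow> complex \<Rightarrow> complex" where
  "Lleft = log_sol (\<lambda>z. Ln (- z) + \<i> * of_real pi)"

lemma poly_sol_Lleft: "poly_sol left_plane Lleft"
  unfolding Lleft_def by (rule poly_sol_log_sol_left)

lemma Lleft_upper: "Im z > 0 \<Longrightarrow> Lleft w z = L w z"
  using log_sol_shift[of "\<lambda>z. Ln (- z) + \<i> * of_real pi" z Ln 0 w]
  by (simp add: Lleft_def Ln_minus_upper L_eq slit_domain_iff)

lemma Lleft_lower: "Im z < 0 \<Longrightarrow> Lleft w z = conv (expl X0 (2 * \<i> * of_real pi)) (\<lambda>v. L v z) w"
  using log_sol_shift[of "\<lambda>z. Ln (- z) + \<i> * of_real pi" z Ln "2 * \<i> * of_real pi" w]
  by (simp add: Lleft_def Ln_minus_lower L_eq slit_domain_iff)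

primrec swap :: "letter \<Rightarrow> letter" where
  "swap X0 = X1" | "swap X1 = X0"

lemma pt_swap: "pt (swap i) = 1 - pt i"
  by (cases i) auto

lemma swap_swap [simp]: "swap (swap i) = i"
  by (cases i) auto

lemma swap_o_swap [simp]: "swap \<circ> swap = id"
  by auto

text \<open>The reflection \<open>1 - z\<close> exchanges the forms \<open>dz / z\<close> and
  \<open>dz / (z - 1)\<close>, hence the letters.\<close>

lemma poly_sol_swap:
  assumes "poly_sol U \<Lambda>"
  shows "poly_sol {z. 1 - z \<in> U} (\<lambda>w z. \<Lambda> (map swap w) (1 - z))"
  unfolding poly_sol_def
proof (intro conjI allI ballI)
  fix w i z assume "z \<in> {z. 1 - z \<in> U}"
  then have z: "1 - z \<in> U" by simp
  have "((\<lambda>z. \<Lambda> (map swap w @ [swap i]) (1 - z)) has_field_derivative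
      \<Lambda> (map swap w) (1 - z) / (1 - z - pt (swap i)) * (- 1)) (at z)"
    by (rule DERIV_chain2[where f = "\<Lambda> (map swap w @ [swap i])" and g = "\<lambda>z. 1 - z", OF poly_sol_deriv[OF assms z, of "map swap w" "swap i"]]) (auto intro!: derivative_eq_intros)
  moreover have "\<Lambda> (map swap w) (1 - z) / (1 - z - pt (swap i)) * (- 1) = \<Lambda> (map swap w) (1 - z) / (z - pt i)"
    by (simp add: pt_swap) (metis minus_diff_eq minus_divide_right)
  ultimately show "((\<lambda>z. \<Lambda> (map swap (w @ [i])) (1 - z)) has_field_derivative
      \<Lambda> (map swap w) (1 - z) / (z - pt i)) (at z)" by simp
qed (use assms in \<open>auto simp: poly_sol_Nil\<close>)

lemma one_minus_slit [simp]: "1 - z \<in> slit_domain \<longleftrightarrow> z \<in> slit_domain"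
  by (auto simp: slit_domain_iff)

lemma poly_sol_L_swap: "poly_sol slit_domain (\<lambda>w z. L (map swap w) (1 - z))"
  using poly_sol_swap[OF poly_sol_L] by simp

text \<open>The Drinfeld associator: it compares the solutions normalised at \<open>0\<close> and at \<open>1\<close>.\<close>

definition Zser :: "word \<Rightarrow> real" where
  "Zser = lquot (\<lambda>v. Re (L v (1 / 2))) (\<lambda>v. Re (L (map swap v) (1 / 2)))"

lemma half_slit [simp]: "1 / 2 \<in> slit_domain"
  by (simp add: slit_domain_iff)

lemma L_half_real: "of_real (Re (L v (1 / 2))) = L v (1 / 2)"
  using L_cnj[OF half_slit, of v] by (simp add: complex_eq_iff)

lemma Zser_Nil [simp]: "Zser [] = 1"
  unfolding Zser_def by (subst lquot.simps) (simp add: poly_sol_Nil[OF poly_sol_L])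

text \<open>Both sides solve the equation and agree at \<open>1 / 2\<close>, the fixed point of the
  reflection. The values of \<open>L\<close> there are real, so the real parts in
  \<open>Zser\<close> lose nothing.\<close>

lemma L_Zser:
  assumes "z \<in> slit_domain"
  shows "L w z = conv (\<lambda>u. of_real (Zser u)) (\<lambda>v. L (map swap v) (1 - z)) w"
proof (rule poly_sol_unique_at[OF poly_sol_L poly_sol_conv[OF poly_sol_L_swap open_slit_domain, of "\<lambda>u. of_real (Zser u)"]
      open_slit_domain connected_slit_domain half_slit _ assms])
  fix w
  have "conv Zser (\<lambda>v. Re (L (map swap v) (1 / 2))) w = Re (L w (1 / 2))"
    unfolding Zser_def by (rule conv_lquot) (simp add: poly_sol_Nil[OF poly_sol_L])
  then have "of_real (conv Zser (\<lambda>v. Re (L (map swap v) (1 / 2))) w) = L w (1 / 2)"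
    by (simp add: L_half_real)
  then show "L w (1 / 2) = conv (\<lambda>u. of_real (Zser u)) (\<lambda>v. L (map swap v) (1 - 1 / 2)) w"
    unfolding conv_of_real L_half_real by simp
qed simp

text \<open>The reflection maps the upper half-plane to the lower one, hence the sign opposite to
  \<open>Lleft\<close>: this branch also continues \<open>L\<close> from above, now across the ray
  beyond 1.\<close>

definition Lright :: "word \<Rightarrow> complex \<Rightarrow> complex" where
  "Lright w z = conv (\<lambda>u. of_real (Zser u))
     (\<lambda>v. log_sol (\<lambda>z. Ln (- z) - \<i> * of_real pi) (map swap v) (1 - z)) w"

lemma poly_sol_Lright: "poly_sol right_plane Lright"
proof -
  have "{z. 1 - z \<in> left_plane} = right_plane" by (auto simp: left_plane_def right_plane_def)
  then have "poly_sol right_plane (\<lambda>w z. log_sol (\<lambda>z. Ln (- z) - \<i> * of_real pi) (map swap w) (1 - z))"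
    using poly_sol_swap[OF poly_sol_log_sol_left[of "- \<i> * of_real pi"]] by simp
  from poly_sol_conv[OF this open_right_plane, of "\<lambda>u. of_real (Zser u)"] show ?thesis
    by (simp add: Lright_def[abs_def])
qed

lemma Lright_upper: "Im z > 0 \<Longrightarrow> Lright w z = L w z"
proof -
  assume z: "Im z > 0"
  have "log_sol (\<lambda>z. Ln (- z) - \<i> * of_real pi) v (1 - z) = L v (1 - z)" for v
    using log_sol_shift[of "\<lambda>z. Ln (- z) - \<i> * of_real pi" "1 - z" Ln 0 v] z Ln_minus_lower[of "1 - z"]
    by (simp add: L_eq slit_domain_iff)
  then show ?thesis using L_Zser[of z w] z by (simp add: Lright_def slit_domain_iff)
qed

lemma expl_swap: "expl i c (map swap w) = expl (swap i) c w"
proof -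
  have "map swap w = replicate (length w) i \<longleftrightarrow> w = replicate (length w) (swap i)"
    by (metis length_map map_replicate map_map swap_o_swap list.map_id)
  then show ?thesis by (simp add: expl_def)
qed

lemma Lright_lower:
  "Im z < 0 \<Longrightarrow> Lright w z = conv (\<lambda>u. of_real (Zser u))
     (conv (expl X1 (- (2 * \<i> * of_real pi))) (\<lambda>v. L (map swap v) (1 - z))) w"
proof -
  assume z: "Im z < 0"
  have "log_sol (\<lambda>z. Ln (- z) - \<i> * of_real pi) (map swap v) (1 - z)
      = conv (expl X1 (- (2 * \<i> * of_real pi))) (\<lambda>v. L (map swap v) (1 - z)) v" for v
  proof -
    have "log_sol (\<lambda>z. Ln (- z) - \<i> * of_real pi) (map swap v) (1 - z)
      = conv (expl X0 (- (2 * \<i> * of_real pi))) (\<lambda>v. log_sol Ln v (1 - z)) (map swap v)"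
      by (rule log_sol_shift) (use z Ln_minus_upper[of "1 - z"] in simp)
    also have "\<dots> = conv (expl X1 (- (2 * \<i> * of_real pi))) (\<lambda>v. log_sol Ln (map swap v) (1 - z)) v"
      unfolding conv_map[symmetric] expl_swap by simp
    finally show ?thesis using z by (simp add: L_eq slit_domain_iff)
  qed
  then show ?thesis by (simp add: Lright_def)
qed

subsection \<open>Relations for the associator\<close>

lemma L_tendsto_0: "\<nexists>n. w = replicate n X0 \<Longrightarrow> ((\<lambda>z. Ln z ^ j * L w z) \<longlongrightarrow> 0) (at 0 within slit_domain)"
  by (rule Lim_transform_eventually[OF log_sol_tendsto_0[of w j]]) (auto simp: eventually_at_filter L_eq)

lemma L_replicate: "z \<in> slit_domain \<Longrightarrow> L (replicate n X0) z = Ln z ^ n / fact n"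
  using multiple_polylogs_L by (simp add: multiple_polylogs_iff)

lemma expl_replicate: "expl i c (replicate n i) = c ^ n / fact n"
  by (simp add: expl_def)

lemma L_X0: "z \<in> slit_domain \<Longrightarrow> L [X0] z = Ln z"
  using L_replicate[of z 1] by simp

text \<open>Common last step of the functional identities for \<open>L\<close> in this part:
  differentiate to 0, then evaluate the limit at 0.\<close>

lemma constant_slit_tendsto:
  assumes "\<And>z. z \<in> slit_domain \<Longrightarrow> (f has_field_derivative 0) (at z)"
    and "(f \<longlongrightarrow> l) (at 0 within slit_domain)" and "z \<in> slit_domain"
  shows "f z = l"
proof -
  have "f constant_on slit_domain"
    using assms(1) by (rule has_field_derivative_0_imp_constant_on[OF _ connected_slit_domain open_slit_domain])
  then obtain c where c: "\<And>z. z \<in> slit_domain \<Longrightarrow> f z = c" unfolding constant_on_def by blast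
  have "(f \<longlongrightarrow> c) (at 0 within slit_domain)"
    by (rule tendsto_eventually) (auto simp: eventually_at_filter c)
  then have "c = l" using tendsto_unique[OF zero_islimpt_slit _ assms(2)] by blast
  then show ?thesis using c assms(3) by simp
qed

text \<open>The antipode of the shuffle Hopf algebra, which inverts group-like series.\<close>

definition antipode :: "(word \<Rightarrow> 'a::comm_ring_1) \<Rightarrow> word \<Rightarrow> 'a" where
  "antipode f w = (- 1) ^ length w * f (rev w)"

lemma antipode_Nil [simp]: "antipode f [] = f []"
  by (simp add: antipode_def)

lemma antipode_conv: "antipode (conv f g) w = conv (antipode g) (antipode f) w"
  unfolding antipode_def[abs_def] conv_sign conv_rev ..

lemma sum_letters: "(\<Sum>i\<in>{X0, X1}. f i) = f X0 + f X1"
  by simp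

lemma L_deriv:
  assumes "z \<in> slit_domain"
  shows "(L u has_field_derivative (\<Sum>i\<in>{X0, X1}. 1 / (z - pt i) * rsh (\<lambda>v. L v z) i u)) (at z)"
proof (cases u rule: rev_exhaust)
  case Nil
  have "((\<lambda>_. 1) has_field_derivative 0) (at z)" by simp
  then have "(L [] has_field_derivative 0) (at z)"
    by (rule has_field_derivative_transform_within_open[OF _ open_slit_domain assms])
       (use poly_sol_Nil[OF poly_sol_L] in auto)
  then show ?thesis using Nil by (simp add: rsh_def)
next
  case (snoc v x)
  then show ?thesis using poly_sol_deriv[OF poly_sol_L assms, of v x] by (cases x) (auto simp: rsh_def)
qed

lemma antipode_lsh: "antipode (rsh f i) v = - lsh i (antipode f) v"
  by (cases v) (auto simp: antipode_def lsh_def rsh_def)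

text \<open>The letter terms of the two factors cancel in the derivative. At 0, a power of
  \<open>X0\<close> gives \<open>exp (X0 log z) exp (- X0 log z)\<close> exactly; for any other word
  one of the two parts contains \<open>X1\<close> and tends to 0 faster than the powers of the
  logarithm grow.\<close>

lemma L_antipode:
  assumes "z \<in> slit_domain"
  shows "conv (\<lambda>v. L v z) (antipode (\<lambda>v. L v z)) w = unit_series w"
proof (rule constant_slit_tendsto[OF _ _ assms])
  fix z assume z: "z \<in> slit_domain"
  have d: "((\<lambda>z. antipode (\<lambda>v. L v z) u) has_field_derivative
      (\<Sum>i\<in>{X0, X1}. - (1 / (z - pt i)) * lsh i (antipode (\<lambda>v. L v z)) u)) (at z)" for u
  proof -
    have "((\<lambda>z. antipode (\<lambda>v. L v z) u) has_field_derivative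
        (- 1) ^ length u * (\<Sum>i\<in>{X0, X1}. 1 / (z - pt i) * rsh (\<lambda>v. L v z) i (rev u))) (at z)"
      unfolding antipode_def by (rule DERIV_cmult[OF L_deriv[OF z]])
    moreover have "(- 1) ^ length u * rsh (\<lambda>v. L v z) i (rev u) = - lsh i (antipode (\<lambda>v. L v z)) u" for i
      using antipode_lsh[of "\<lambda>v. L v z" i u] by (simp add: antipode_def)
    then have "(- 1) ^ length u * (\<Sum>i\<in>{X0, X1}. 1 / (z - pt i) * rsh (\<lambda>v. L v z) i (rev u))
       = (\<Sum>i\<in>{X0, X1}. - (1 / (z - pt i)) * lsh i (antipode (\<lambda>v. L v z)) u)"
      unfolding sum_distrib_left by (intro sum.cong refl) (metis mult.left_commute mult_minus_left mult_minus_right)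
    ultimately show ?thesis by simp
  qed
  have "((\<lambda>z. conv (\<lambda>v. L v z) (antipode (\<lambda>v. L v z)) w) has_field_derivative
     conv (\<lambda>u. \<Sum>i\<in>{X0, X1}. 1 / (z - pt i) * rsh (\<lambda>v. L v z) i u) (antipode (\<lambda>v. L v z)) w
     + conv (\<lambda>v. L v z) (\<lambda>u. \<Sum>i\<in>{X0, X1}. - (1 / (z - pt i)) * lsh i (antipode (\<lambda>v. L v z)) u) w) (at z)"
    by (rule conv_has_field_derivative[OF L_deriv[OF z] d])
  moreover have "conv (\<lambda>u. \<Sum>i\<in>{X0, X1}. 1 / (z - pt i) * rsh (\<lambda>v. L v z) i u) (antipode (\<lambda>v. L v z)) w
     + conv (\<lambda>v. L v z) (\<lambda>u. \<Sum>i\<in>{X0, X1}. - (1 / (z - pt i)) * lsh i (antipode (\<lambda>v. L v z)) u) w = 0"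
    unfolding sum_letters conv_add_left conv_add_right conv_scale_left conv_scale_right conv_rsh by simp
  ultimately show "((\<lambda>z. conv (\<lambda>v. L v z) (antipode (\<lambda>v. L v z)) w) has_field_derivative 0) (at z)" by simp
next
  show "((\<lambda>z. conv (\<lambda>v. L v z) (antipode (\<lambda>v. L v z)) w) \<longlongrightarrow> unit_series w) (at 0 within slit_domain)"
  proof (cases "\<exists>n. w = replicate n X0")
    case True
    then obtain n where w: "w = replicate n X0" by blast
    have "conv (\<lambda>v. L v z) (antipode (\<lambda>v. L v z)) w = unit_series w" if z: "z \<in> slit_domain" for z
    proof -
      have "conv (\<lambda>v. L v z) (antipode (\<lambda>v. L v z)) w = conv (expl X0 (Ln z)) (expl X0 (- Ln z)) w"
      proof (rule conv_cong)
        fix k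
        show "L (take k w) z = expl X0 (Ln z) (take k w)"
          unfolding w take_replicate L_replicate[OF z] expl_replicate ..
        show "antipode (\<lambda>v. L v z) (drop k w) = expl X0 (- Ln z) (drop k w)"
          unfolding w drop_replicate antipode_def rev_replicate L_replicate[OF z] expl_replicate
            length_replicate power_minus[of "Ln z"] by simp
      qed
      then show ?thesis by (simp add: expl_add)
    qed
    then show ?thesis by (intro tendsto_eventually) (auto simp: eventually_at_filter)
  next
    case False
    have "((\<lambda>z. L (take k w) z * antipode (\<lambda>v. L v z) (drop k w)) \<longlongrightarrow> 0) (at 0 within slit_domain)" for k
    proof -
      have *: "((\<lambda>z. L u z * L v z) \<longlongrightarrow> 0) (at 0 within slit_domain)" if v: "\<nexists>n. v = replicate n X0" for u v
      proof (cases "\<exists>m. u = replicate m X0")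
        case True
        then obtain m where u: "u = replicate m X0" by blast
        have "((\<lambda>z. Ln z ^ m * L v z / fact m) \<longlongrightarrow> 0 / fact m) (at 0 within slit_domain)"
          by (intro tendsto_divide tendsto_const L_tendsto_0 v) simp
        then have "((\<lambda>z. Ln z ^ m * L v z / fact m) \<longlongrightarrow> 0) (at 0 within slit_domain)" by simp
        then show ?thesis
          by (rule Lim_transform_eventually) (auto simp: eventually_at_filter u L_replicate)
      next
        case False
        then show ?thesis using tendsto_mult[OF L_tendsto_0[of u 0] L_tendsto_0[OF v, of 0]] by simp
      qed
      have "(\<nexists>n. take k w = replicate n X0) \<or> (\<nexists>n. rev (drop k w) = replicate n X0)"
        using False by (metis append_take_drop_id rev_replicate rev_swap replicate_add)
      then have "((\<lambda>z. L (take k w) z * L (rev (drop k w)) z) \<longlongrightarrow> 0) (at 0 within slit_domain)"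
        using *[of "take k w" "rev (drop k w)"] *[of "rev (drop k w)" "take k w"] by (auto simp: mult.commute)
      from tendsto_mult[OF tendsto_const this, of "(- 1) ^ length (drop k w)"] show ?thesis
        by (simp add: antipode_def mult.left_commute)
    qed
    then have "((\<lambda>z. \<Sum>k\<le>length w. L (take k w) z * antipode (\<lambda>v. L v z) (drop k w)) \<longlongrightarrow> (\<Sum>k\<le>length w. 0)) (at 0 within slit_domain)"
      by (intro tendsto_sum)
    moreover have "w \<noteq> []" using False by auto
    ultimately show ?thesis by (simp add: conv_def unit_series_def)
  qed
qed

lemma conv_assoc_fun: "conv (conv f g) h = conv f (conv g h)"
  by (rule ext) (rule conv_assoc)

text \<open>At \<open>1 / 2\<close> both \<open>L\<close> and its letter-swapped version are
  inverted by the antipode, and \<open>L = Z L'\<close>; this gives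
  \<open>Z * antipode Z = 1\<close>. The order of the factors is then exchanged by cancelling
  \<open>antipode Z\<close> on the right.\<close>

lemma antipode_Zser: "conv (antipode Zser) Zser w = unit_series w"
proof -
  let ?Z = "\<lambda>u. of_real (Zser u) :: complex" and ?z = "1 / 2 :: complex"
  let ?L = "\<lambda>v. L v ?z" and ?L' = "\<lambda>v. L (map swap v) ?z"
  have half: "1 - 1 / 2 = (1 / 2 :: complex)" by simp
  have L: "?L = conv ?Z ?L'" by (rule ext) (rule L_Zser[OF half_slit, unfolded half])
  have L'a: "conv ?L' (antipode ?L') = unit_series"
  proof
    fix w
    have "antipode ?L' = (\<lambda>u. antipode ?L (map swap u))" by (simp add: fun_eq_iff antipode_def rev_map)
    then have "conv ?L' (antipode ?L') w = conv ?L (antipode ?L) (map swap w)"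
      by (simp add: conv_map[of ?L swap "antipode ?L", symmetric])
    then show "conv ?L' (antipode ?L') w = unit_series w"
      by (simp add: L_antipode[OF half_slit]) (simp add: unit_series_def)
  qed
  have "antipode (conv ?Z ?L') = conv (antipode ?L') (antipode ?Z)" using antipode_conv by (rule ext)
  moreover have "conv (conv ?Z ?L') (antipode (conv ?Z ?L')) = unit_series"
    by (rule ext) (simp only: L[symmetric] L_antipode[OF half_slit])
  ultimately have "unit_series = conv (conv ?Z ?L') (conv (antipode ?L') (antipode ?Z))" by simp
  also have "\<dots> = conv ?Z (conv (conv ?L' (antipode ?L')) (antipode ?Z))"
    by (simp only: conv_assoc_fun)
  also have "\<dots> = conv ?Z (antipode ?Z)"
  proof -
    have "conv unit_series (antipode ?Z) = antipode ?Z" by (rule ext) (rule conv_unit_left)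
    then show ?thesis by (simp only: L'a)
  qed
  finally have "conv ?Z (antipode ?Z) = unit_series" ..
  moreover have "antipode ?Z = (\<lambda>u. of_real (antipode Zser u))" by (simp add: fun_eq_iff antipode_def)
  ultimately have "of_real (conv Zser (antipode Zser) u) = (of_real (unit_series u) :: complex)" for u
    by (simp add: conv_of_real unit_series_def)
  then have R: "conv Zser (antipode Zser) = unit_series" by (simp only: of_real_eq_iff fun_eq_iff simp_thms)
  have "conv (conv (antipode Zser) Zser) (antipode Zser) u = conv unit_series (antipode Zser) u" for u
    by (simp only: conv_assoc_fun R conv_unit_right conv_unit_left)
  then show ?thesis
    using conv_right_cancel[where f = "conv (antipode Zser) Zser" and f' = unit_series and g = "antipode Zser" and w = w]
    by simp
qed

lemma one_minus_filterlim: "filterlim (\<lambda>z. 1 - z) (at 0 within slit_domain) (at 1 within slit_domain)"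
  unfolding filterlim_at by (auto intro!: tendsto_eq_intros simp: eventually_at_filter)

text \<open>In the expansion of \<open>L_Zser\<close>, a nonempty remainder ends in
  \<open>X0\<close>, so after the swap it ends in \<open>X1\<close> and its value tends to 0. On
  these words the regularised value is thus an honest limit.\<close>

lemma L_tendsto_Zser:
  assumes "last w = X0" "w \<noteq> []"
  shows "(L w \<longlongrightarrow> of_real (Zser w)) (at 1 within slit_domain)"
proof -
  have "((\<lambda>z. of_real (Zser (take k w)) * L (map swap (drop k w)) (1 - z)) \<longlongrightarrow> of_real (Zser (take k w)) * 0) (at 1 within slit_domain)"
    if "k < length w" for k
  proof (intro tendsto_mult tendsto_const)
    have "last (map swap (drop k w)) = X1" "drop k w \<noteq> []" using that assms by (auto simp: last_map last_drop)
    then have "\<nexists>n. map swap (drop k w) = replicate n X0"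
      by (metis last_replicate letter.distinct(1) replicate_0 map_is_Nil_conv)
    from L_tendsto_0[OF this, of 0] have "(L (map swap (drop k w)) \<longlongrightarrow> 0) (at 0 within slit_domain)" by simp
    from filterlim_compose[OF this one_minus_filterlim]
    show "((\<lambda>z. L (map swap (drop k w)) (1 - z)) \<longlongrightarrow> 0) (at 1 within slit_domain)" .
  qed
  then have "((\<lambda>z. (\<Sum>k<length w. of_real (Zser (take k w)) * L (map swap (drop k w)) (1 - z)) + of_real (Zser w))
      \<longlongrightarrow> (\<Sum>k<length w. of_real (Zser (take k w)) * 0) + of_real (Zser w)) (at 1 within slit_domain)"
    by (intro tendsto_add tendsto_sum tendsto_const) auto
  then have lim: "((\<lambda>z. (\<Sum>k<length w. of_real (Zser (take k w)) * L (map swap (drop k w)) (1 - z)) + of_real (Zser w))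
      \<longlongrightarrow> of_real (Zser w)) (at 1 within slit_domain)" by simp
  show ?thesis
    by (rule Lim_transform_eventually[OF lim])
       (auto simp: eventually_at_filter L_Zser[of _ w] conv_last poly_sol_Nil[OF poly_sol_L])
qed

subsection \<open>Shuffling with the letter \<open>X0\<close>\<close>

text \<open>\<open>insertions f w\<close> is the value of \<open>f\<close> on the shuffle product of \<open>X0\<close> and \<open>w\<close>.\<close>

definition insertions :: "(word \<Rightarrow> 'a::comm_ring_1) \<Rightarrow> word \<Rightarrow> 'a" where
  "insertions f w = (\<Sum>k\<le>length w. f (take k w @ X0 # drop k w))"

lemma insertions_snoc:
  "insertions f (w @ [i]) = insertions (\<lambda>v. f (v @ [i])) w + f (w @ [i, X0])"
proof -
  have "(\<Sum>k\<le>length w. f (take k (w @ [i]) @ X0 # drop k (w @ [i]))) = (\<Sum>k\<le>length w. f ((take k w @ X0 # drop k w) @ [i]))"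
    by (intro sum.cong) auto
  then show ?thesis by (simp add: insertions_def)
qed

text \<open>The shuffle relation with the word \<open>[X0]\<close>. Derivatives agree by induction
  on the last letter; a nonempty \<open>w\<close> begins with \<open>X1\<close>, so all words
  involved contain \<open>X1\<close> and both sides vanish at 0.\<close>

lemma L_insertions:
  assumes "w \<noteq> [] \<longrightarrow> hd w = X1" and "z \<in> slit_domain"
  shows "Ln z * L w z = insertions (\<lambda>v. L v z) w"
  using assms
proof (induction w arbitrary: z rule: rev_induct)
  case Nil
  then show ?case by (simp add: insertions_def L_X0 poly_sol_Nil[OF poly_sol_L])
next
  case (snoc i w)
  have hw: "w \<noteq> [] \<longrightarrow> hd w = X1" using snoc.prems(1) by (cases w) auto
  let ?f = "\<lambda>z. Ln z * L (w @ [i]) z - insertions (\<lambda>v. L v z) (w @ [i])"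
  have "?f z = 0"
  proof (rule constant_slit_tendsto[OF _ _ snoc.prems(2)])
    fix z assume z: "z \<in> slit_domain"
    have 1: "((\<lambda>z. Ln z * L (w @ [i]) z) has_field_derivative 1 / z * L (w @ [i]) z + L w z / (z - pt i) * Ln z) (at z)"
      by (rule DERIV_mult[OF Ln_deriv_slit[OF z] poly_sol_deriv[OF poly_sol_L z]])
    have 2: "((\<lambda>z. insertions (\<lambda>v. L (v @ [i]) z) w) has_field_derivative insertions (\<lambda>v. L v z / (z - pt i)) w) (at z)"
      unfolding insertions_def by (intro DERIV_sum poly_sol_deriv[OF poly_sol_L z])
    have 3: "(L (w @ [i, X0]) has_field_derivative L (w @ [i]) z / (z - pt X0)) (at z)"
      using poly_sol_deriv[OF poly_sol_L z, of "w @ [i]" X0] by simp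
    have "insertions (\<lambda>v. L v z / (z - pt i)) w = insertions (\<lambda>v. L v z) w / (z - pt i)"
      by (simp add: insertions_def sum_divide_distrib)
    also have "\<dots> = Ln z * L w z / (z - pt i)" using snoc.IH[OF hw z] by simp
    finally have e: "1 / z * L (w @ [i]) z + L w z / (z - pt i) * Ln z
        - (insertions (\<lambda>v. L v z / (z - pt i)) w + L (w @ [i]) z / (z - pt X0)) = 0"
      by simp
    show "(?f has_field_derivative 0) (at z)"
      using DERIV_diff[OF 1 DERIV_add[OF 2 3]] unfolding insertions_snoc e .
  next
    have X1: "X1 \<in> set (w @ [i])" using snoc.prems(1) by (metis hd_in_set snoc_eq_iff_butlast)
    then have np: "\<nexists>n. w @ [i] = replicate n X0" by (metis in_set_replicate letter.distinct(1))
    have "((\<lambda>z. Ln z ^ 1 * L (w @ [i]) z - (\<Sum>k\<le>length (w @ [i]). L (take k (w @ [i]) @ X0 # drop k (w @ [i])) z))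
      \<longlongrightarrow> 0 - (\<Sum>k\<le>length (w @ [i]). 0)) (at 0 within slit_domain)"
    proof (intro tendsto_diff tendsto_sum L_tendsto_0 np)
      fix k
      have "X1 \<in> set (take k (w @ [i]) @ X0 # drop k (w @ [i]))"
        using X1 by (metis Un_iff append_take_drop_id list.set_intros(2) set_append)
      then have "\<nexists>n. take k (w @ [i]) @ X0 # drop k (w @ [i]) = replicate n X0"
        by (metis in_set_replicate letter.distinct(1))
      from L_tendsto_0[OF this, of 0] show "(L (take k (w @ [i]) @ X0 # drop k (w @ [i])) \<longlongrightarrow> 0) (at 0 within slit_domain)"
        by simp
    qed
    then show "(?f \<longlongrightarrow> 0) (at 0 within slit_domain)" by (simp add: insertions_def)
  qed
  then show ?case by simp
qed

lemma one_islimpt_slit: "at 1 within slit_domain \<noteq> bot"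
proof -
  have "1 islimpt slit_domain"
    unfolding islimpt_approachable
  proof (intro allI impI)
    fix e :: real assume "e > 0"
    then show "\<exists>x'\<in>slit_domain. x' \<noteq> 1 \<and> dist x' 1 < e"
      by (intro bexI[of _ "of_real (1 - min (e/2) (1/2))"]) (auto simp: slit_domain_iff min_def dist_norm)
  qed
  then show ?thesis by (simp add: trivial_limit_within)
qed

text \<open>Let \<open>z\<close> tend to 1 in the shuffle relation: \<open>Ln z\<close> vanishes,
  \<open>L w\<close> stays finite, and every shuffled word ends in \<open>X0\<close>.\<close>

lemma Zser_insertions:
  assumes "w \<noteq> []" "hd w = X1" "last w = X0"
  shows "insertions Zser w = 0"
proof -
  have "(Ln \<longlongrightarrow> Ln 1) (at 1 within slit_domain)"
    by (rule tendsto_within_subset[OF _ subset_UNIV]) (use DERIV_isCont[OF has_field_derivative_Ln[of 1]] in \<open>simp add: isCont_def\<close>)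
  from tendsto_mult[OF this L_tendsto_Zser[OF assms(3,1)]]
  have 1: "((\<lambda>z. Ln z * L w z) \<longlongrightarrow> 0) (at 1 within slit_domain)" by simp
  have "((\<lambda>z. insertions (\<lambda>v. L v z) w) \<longlongrightarrow> insertions (\<lambda>v. of_real (Zser v)) w) (at 1 within slit_domain)"
    unfolding insertions_def
  proof (intro tendsto_sum L_tendsto_Zser)
    fix k
    show "last (take k w @ X0 # drop k w) = X0" using assms by (cases "drop k w = []") (auto simp: last_drop)
  qed simp
  then have "((\<lambda>z. Ln z * L w z) \<longlongrightarrow> insertions (\<lambda>v. of_real (Zser v)) w) (at 1 within slit_domain)"
    by (rule Lim_transform_eventually) (use assms in \<open>auto simp: eventually_at_filter L_insertions\<close>)
  then have "insertions (\<lambda>v. of_real (Zser v) :: complex) w = 0"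
    using tendsto_unique[OF one_islimpt_slit _ 1] by blast
  then have "complex_of_real (insertions Zser w) = 0" by (simp add: insertions_def)
  then show ?thesis by simp
qed

unbundle no vec_syntax
unbundle fps_syntax

subsection \<open>Alternating words\<close>

lemma wpow_0 [simp]: "wpow u 0 = []"
  and wpow_Suc: "wpow u (Suc n) = u @ wpow u n"
  by (simp_all add: wpow_def)

lemma wpow_Suc_right: "wpow u (Suc n) = wpow u n @ u"
  by (induction n) (simp_all add: wpow_Suc)

lemma wpow_shift: "a # wpow [b, a] n = wpow [a, b] n @ [a]"
  by (induction n) (simp_all add: wpow_Suc)

lemma length_wpow [simp]: "length (wpow [a, b] n) = 2 * n"
  by (induction n) (simp_all add: wpow_Suc)

lemma rev_wpow: "rev (wpow [a, b] n) = wpow [b, a] n"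
proof (induction n)
  case (Suc n)
  have "rev (wpow [a, b] (Suc n)) = wpow [b, a] n @ [b, a]" by (simp add: wpow_Suc Suc)
  then show ?case by (simp only: wpow_Suc_right)
qed simp

text \<open>
  In the names below the two letters are the states of an automaton that reads a word of \<open>B0\<close>:
  \<open>a\<close> and \<open>c\<close> expect \<open>X0\<close>, \<open>b\<close> and \<open>d\<close> expect \<open>X1\<close>, and the step from \<open>b\<close> to \<open>d\<close> reads the
  second letter of the factor \<open>X0 X0\<close>.
\<close>

definition wa :: "nat \<Rightarrow> word" where "wa n = wpow [X0, X1] n"
definition wb :: "nat \<Rightarrow> word" where "wb n = wpow [X0, X1] n @ [X0]"
definition wc :: "nat \<Rightarrow> word" where "wc n = wpow [X1, X0] n @ [X1]"
definition wd :: "nat \<Rightarrow> word" where "wd n = wpow [X1, X0] n"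
definition wad :: "nat \<Rightarrow> nat \<Rightarrow> word" where "wad m n = wpow [X0, X1] m @ [X0, X0] @ wpow [X1, X0] n"
definition wbd :: "nat \<Rightarrow> nat \<Rightarrow> word" where "wbd m n = wpow [X1, X0] m @ [X0] @ wpow [X1, X0] n"
definition wac :: "nat \<Rightarrow> nat \<Rightarrow> word" where "wac m n = wpow [X0, X1] m @ [X0, X0] @ wpow [X1, X0] n @ [X1]"
definition wbc :: "nat \<Rightarrow> nat \<Rightarrow> word" where "wbc m n = wpow [X1, X0] m @ [X0] @ wpow [X1, X0] n @ [X1]"

lemmas word_defs = wa_def wb_def wc_def wd_def wad_def wbd_def wac_def wbc_def

text \<open>A cut inside the power comes after whole pairs or in the middle of a pair. In the second
  case the remainder is rewritten as an alternating word that starts with \<open>b\<close>.\<close>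

lemma conv_wpow:
  "conv f g (wpow [a, b] m @ w) =
     (\<Sum>i<m. f (wpow [a, b] i) * g (wpow [a, b] (m - i) @ w)
          + f (wpow [a, b] i @ [a]) * g (wpow [b, a] (m - Suc i) @ b # w))
     + conv (\<lambda>u. f (wpow [a, b] m @ u)) g w"
proof (induction m arbitrary: f)
  case (Suc m)
  have e: "wpow [a, b] (Suc m) @ w = a # b # wpow [a, b] m @ w" by (simp add: wpow_Suc)
  have s: "b # wpow [a, b] m @ w = wpow [b, a] m @ b # w" using wpow_shift[of b a m] by simp
  show ?case
    unfolding e conv_Cons Suc.IH sum.lessThan_Suc_shift
    by (simp add: wpow_Suc s algebra_simps)
qed simp

text \<open>Multiplication of the generating function by its variable. A cut after
  \<open>wc i\<close> splits a pair, so the cofactor has index \<open>n - Suc i\<close>; the shift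
  restores the shape of a Cauchy product.\<close>

definition shift_seq :: "(nat \<Rightarrow> 'a::zero) \<Rightarrow> nat \<Rightarrow> 'a" where
  "shift_seq f n = (case n of 0 \<Rightarrow> 0 | Suc k \<Rightarrow> f k)"

lemma shift_seq_simps [simp]: "shift_seq f 0 = 0" "shift_seq f (Suc k) = f k"
  by (simp_all add: shift_seq_def)

lemma sum_shift_seq:
  fixes f :: "nat \<Rightarrow> 'a::comm_semiring_0"
  shows "(\<Sum>i\<le>n. shift_seq f i * g (n - i)) = (\<Sum>i<n. f i * g (n - Suc i))"
proof (cases n)
  case (Suc k)
  then show ?thesis by (simp add: sum.atMost_Suc_shift lessThan_Suc_atMost del: sum.atMost_Suc)
qed simp

lemma conv_wb: "conv f g (wb n) = (\<Sum>i\<le>n. f (wa i) * g (wb (n - i))) + (\<Sum>i\<le>n. f (wb i) * g (wd (n - i)))"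
proof -
  have 1: "wpow [X1, X0] (n - Suc i) @ [X1, X0] = wpow [X1, X0] (n - i)" if "i < n" for i
    using that by (simp add: wpow_Suc_right[symmetric] Suc_diff_Suc)
  show ?thesis
    using conv_wpow[of f g X0 X1 n "[X0]"]
    by (simp add: word_defs sum.distrib lessThan_Suc_atMost[symmetric] conv_Cons 1)
qed

lemma conv_wd: "conv f g (wd n) = (\<Sum>i\<le>n. shift_seq (\<lambda>i. f (wc i)) i * g (wb (n - i))) + (\<Sum>i\<le>n. f (wd i) * g (wd (n - i)))"
  unfolding sum_shift_seq[of "\<lambda>i. f (wc i)" "\<lambda>k. g (wb k)" n] using conv_wpow[of f g X1 X0 n "[]"]
  by (simp add: word_defs sum.distrib lessThan_Suc_atMost[symmetric])

lemma conv_wad: "conv f g (wad m n) = (\<Sum>i\<le>m. f (wa i) * g (wad (m - i) n)) + (\<Sum>i\<le>m. f (wb i) * g (wbd (m - i) n))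
    + (\<Sum>j\<le>n. shift_seq (\<lambda>j. f (wac m j)) j * g (wb (n - j))) + (\<Sum>j\<le>n. f (wad m j) * g (wd (n - j)))"
proof -
  have 1: "wpow [X1, X0] (m - Suc i) @ X1 # X0 # w = wpow [X1, X0] (m - i) @ w" if "i < m" for i w
    using that by (metis Suc_diff_Suc append.assoc append_Cons append_Nil wpow_Suc_right)
  show ?thesis
    unfolding sum_shift_seq[of "\<lambda>j. f (wac m j)" "\<lambda>k. g (wb k)" n]
    using conv_wpow[of f g X0 X1 m "X0 # X0 # wpow [X1, X0] n"]
      conv_wpow[of "\<lambda>u. f (wpow [X0, X1] m @ X0 # X0 # u)" g X1 X0 n "[]"]
    by (simp add: word_defs sum.distrib lessThan_Suc_atMost[symmetric] conv_Cons 1)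
qed

lemma conv_wbd: "conv f g (wbd m n) = (\<Sum>i\<le>m. shift_seq (\<lambda>i. f (wc i)) i * g (wad (m - i) n)) + (\<Sum>i\<le>m. f (wd i) * g (wbd (m - i) n))
    + (\<Sum>j\<le>n. shift_seq (\<lambda>j. f (wbc m j)) j * g (wb (n - j))) + (\<Sum>j\<le>n. f (wbd m j) * g (wd (n - j)))"
  unfolding sum_shift_seq[of "\<lambda>i. f (wc i)" "\<lambda>k. g (wad k n)" m] sum_shift_seq[of "\<lambda>j. f (wbc m j)" "\<lambda>k. g (wb k)" n]
    using conv_wpow[of f g X1 X0 m "X0 # wpow [X1, X0] n"]
      conv_wpow[of "\<lambda>u. f (wpow [X1, X0] m @ X0 # u)" g X1 X0 n "[]"]
    by (simp add: word_defs sum.distrib lessThan_Suc_atMost[symmetric] conv_Cons)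

subsection \<open>Generating functions\<close>

text \<open>Entries of the transfer matrix with rows \<open>A, B\<close> and \<open>C, D\<close>.
  Products of series become matrix products because \<open>genC\<close> carries one extra factor of
  the variable.\<close>

definition genA :: "(word \<Rightarrow> real) \<Rightarrow> real fps" where "genA f = Abs_fps (\<lambda>n. f (wa n))"
definition genB :: "(word \<Rightarrow> real) \<Rightarrow> real fps" where "genB f = Abs_fps (\<lambda>n. f (wb n))"
definition genC :: "(word \<Rightarrow> real) \<Rightarrow> real fps" where "genC f = Abs_fps (shift_seq (\<lambda>n. f (wc n)))"
definition genD :: "(word \<Rightarrow> real) \<Rightarrow> real fps" where "genD f = Abs_fps (\<lambda>n. f (wd n))"

text \<open>The outer variable counts the pairs of letters before the factor \<open>X0 X0\<close>, the inner one those after it.\<close>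

definition genAD :: "(word \<Rightarrow> real) \<Rightarrow> real fps fps" where "genAD f = Abs_fps (\<lambda>m. Abs_fps (\<lambda>n. f (wad m n)))"
definition genBD :: "(word \<Rightarrow> real) \<Rightarrow> real fps fps" where "genBD f = Abs_fps (\<lambda>m. Abs_fps (\<lambda>n. f (wbd m n)))"
definition genAC :: "(word \<Rightarrow> real) \<Rightarrow> real fps fps" where "genAC f = Abs_fps (\<lambda>m. Abs_fps (shift_seq (\<lambda>n. f (wac m n))))"
definition genBC :: "(word \<Rightarrow> real) \<Rightarrow> real fps fps" where "genBC f = Abs_fps (\<lambda>m. Abs_fps (shift_seq (\<lambda>n. f (wbc m n))))"

definition outer :: "real fps \<Rightarrow> real fps fps" where "outer u = Abs_fps (\<lambda>m. fps_const (u $ m))"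
abbreviation inner :: "real fps \<Rightarrow> real fps fps" where "inner \<equiv> fps_const"

lemma outer_mult_nth: "(outer u * v) $ m $ n = (\<Sum>i\<le>m. u $ i * v $ (m - i) $ n)"
  by (subst fps_mult_nth) (simp add: outer_def fps_sum_nth atLeast0AtMost)

lemma fps_fps_eqI: "(\<And>m n. u $ m $ n = v $ m $ n) \<Longrightarrow> u = (v :: real fps fps)"
  by (simp add: fps_eq_iff)

lemma outer_mult: "outer (u * v) = outer u * outer v"
proof (rule fps_fps_eqI)
  fix m n show "outer (u * v) $ m $ n = (outer u * outer v) $ m $ n"
    by (cases n) (simp_all add: outer_mult_nth, simp_all add: outer_def fps_mult_nth atLeast0AtMost)
qed

lemma outer_add: "outer (u + v) = outer u + outer v"
  and outer_minus: "outer (- u) = - outer u"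
  and outer_1: "outer 1 = 1"
  and outer_0: "outer 0 = 0"
  by (auto intro!: fps_fps_eqI simp: outer_def fps_one_def)

lemma genB_conv: "genB (conv f g) = genA f * genB g + genB f * genD g"
  by (simp add: fps_eq_iff genA_def genB_def genD_def fps_mult_nth atLeast0AtMost conv_wb)

lemma genD_conv: "genD (conv f g) = genC f * genB g + genD f * genD g"
  by (simp add: fps_eq_iff genC_def genB_def genD_def fps_mult_nth atLeast0AtMost conv_wd)

text \<open>An entry of the off-diagonal block of a product: the first two terms collect the cuts up
  to the middle of \<open>X0 X0\<close>, the last two the cuts after it.\<close>

lemma genAD_conv: "genAD (conv f g) = outer (genA f) * genAD g + outer (genB f) * genBD g
    + genAC f * inner (genB g) + genAD f * inner (genD g)"
  by (rule fps_fps_eqI)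
     (simp add: outer_mult_nth conv_wad genAD_def genBD_def genAC_def genA_def genB_def genD_def,
      simp add: fps_mult_nth atLeast0AtMost)

lemma genBD_conv: "genBD (conv f g) = outer (genC f) * genAD g + outer (genD f) * genBD g
    + genBC f * inner (genB g) + genBD f * inner (genD g)"
  by (rule fps_fps_eqI)
     (simp add: outer_mult_nth conv_wbd genAD_def genBD_def genBC_def genC_def genB_def genD_def,
      simp add: fps_mult_nth atLeast0AtMost)

definition flip_fps :: "real fps fps \<Rightarrow> real fps fps" where
  "flip_fps u = Abs_fps (\<lambda>m. Abs_fps (\<lambda>n. u $ n $ m))"

lemma flip_fps_nth: "flip_fps u $ m $ n = u $ n $ m"
  by (simp add: flip_fps_def)

lemma fps_fps_mult_nth: "(u * v) $ m $ n = (\<Sum>i\<le>m. \<Sum>j\<le>n. u $ i $ j * v $ (m - i) $ (n - j))"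
  for u v :: "real fps fps"
  by (simp add: fps_mult_nth fps_sum_nth atLeast0AtMost)

lemma flip_fps_mult: "flip_fps (u * v) = flip_fps u * flip_fps v"
proof (rule fps_fps_eqI)
  fix m n
  have "flip_fps (u * v) $ m $ n = (\<Sum>i\<le>n. \<Sum>j\<le>m. u $ i $ j * v $ (n - i) $ (m - j))"
    by (simp only: flip_fps_nth fps_fps_mult_nth)
  also have "\<dots> = (\<Sum>j\<le>m. \<Sum>i\<le>n. u $ i $ j * v $ (n - i) $ (m - j))"
    by (rule sum.swap)
  also have "\<dots> = (flip_fps u * flip_fps v) $ m $ n"
    by (simp only: flip_fps_nth fps_fps_mult_nth)
  finally show "flip_fps (u * v) $ m $ n = (flip_fps u * flip_fps v) $ m $ n" .
qed

lemma flip_fps_outer: "flip_fps (outer u) = inner u" "flip_fps (inner u) = outer u"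
  by (rule fps_fps_eqI, simp add: flip_fps_nth outer_def)+

lemma inner_mult: "inner (u * v) = inner u * inner v"
  by simp

lemma rev_words: "rev (wa n) = wd n" "rev (wd n) = wa n" "rev (wb n) = wb n" "rev (wc n) = wc n"
  by (simp_all add: word_defs rev_wpow wpow_shift)

lemma length_words: "length (wa n) = 2 * n" "length (wd n) = 2 * n" "length (wb n) = 2 * n + 1" "length (wc n) = 2 * n + 1"
    "length (wad m n) = 2 * m + 2 * n + 2" "length (wbd m n) = 2 * m + 2 * n + 1"
    "length (wac m n) = 2 * m + 2 * n + 3" "length (wbc m n) = 2 * m + 2 * n + 2"
  by (simp_all add: word_defs)

section \<open>The conjugated series \<open>M\<close>, from abstract properties of \<open>Z\<close>
  and \<open>S\<close>\<close>

context
  fixes Z S :: "word \<Rightarrow> real" and X C :: "real fps fps" and S0 :: "real fps"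
  assumes Z_inv: "\<And>w. conv (\<lambda>u. (- 1) ^ length u * Z (rev u)) Z w = unit_series w"
    and S_rev: "\<And>w. S (rev w) = S w"
    and S_gen: "genA S = 1" "genB S = S0" "genC S = 0" "genD S = 1"
      "genAC S = C - outer S0" "genAD S = X" "genBC S = 0" "genBD S = C"
    and X_eq: "2 * X = C * (outer S0 + inner S0) - outer S0 * inner S0"
    and Z_gen: "2 * genB Z = - (S0 * genD Z)"
    and Z_Nil: "Z [] = 1"
begin

abbreviation "Zr \<equiv> \<lambda>u. Z (rev u)"
abbreviation "Za \<equiv> \<lambda>u. (- 1) ^ length u * Z (rev u)"
abbreviation "M \<equiv> conv (conv Zr S) Z"

lemma M_rev: "M (rev w) = M w"
proof -
  have "M (rev w) = conv (\<lambda>u. Z (rev u)) (\<lambda>u. conv Zr S (rev u)) w" by (rule conv_rev)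
  also have "\<dots> = conv Zr (conv S Z) w"
    by (simp add: conv_rev[of Zr S] S_rev)
  finally show ?thesis by (simp add: conv_assoc)
qed

lemma gen_Za:
  "genA Za = genA Zr" "genB Za = - genB Zr" "genC Za = - genC Zr" "genD Za = genD Zr"
  "genAC Za = - genAC Zr" "genAD Za = genAD Zr" "genBC Za = genBC Zr" "genBD Za = - genBD Zr"
proof -
  show "genA Za = genA Zr" "genB Za = - genB Zr" "genD Za = genD Zr"
    by (simp_all add: genA_def genB_def genD_def fps_eq_iff length_words)
  show "genC Za = - genC Zr"
    by (auto simp: genC_def fps_eq_iff shift_seq_def length_words split: nat.split)
  show "genAC Za = - genAC Zr" "genBC Za = genBC Zr"
    by (auto intro!: fps_fps_eqI simp: genAC_def genBC_def shift_seq_def length_words split: nat.split)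
  show "genAD Za = genAD Zr" "genBD Za = - genBD Zr"
    by (auto intro!: fps_fps_eqI simp: genAD_def genBD_def length_words)
qed

lemma gen_Zr: "genA Zr = genD Z" "genB Zr = genB Z" "genC Zr = genC Z" "genD Zr = genA Z"
  by (simp_all add: genA_def genB_def genC_def genD_def rev_words)

text \<open>By reversal and the parity of lengths, the inverse of the alternating block of
  \<open>Z\<close> is its adjugate; the first relation is determinant 1. The other two serve to
  eliminate \<open>genAC Zr\<close> and \<open>genBC Zr\<close>.\<close>

lemma antipode_relations:
  "genA Z * genD Z = 1 + genC Z * genB Z"
  "outer (genD Z) * genAD Z - outer (genB Z) * genBD Z - genAC Zr * inner (genB Z) + genAD Zr * inner (genD Z) = 0"
  "- (outer (genC Z) * genAD Z) + outer (genA Z) * genBD Z + genBC Zr * inner (genB Z) - genBD Zr * inner (genD Z) = 0"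
proof -
  have e: "conv Za Z = unit_series" using Z_inv by (rule ext)
  have u: "genD unit_series = 1" "genAD unit_series = 0" "genBD unit_series = 0"
    by (auto intro!: fps_fps_eqI simp: genD_def fps_eq_iff unit_series_def genAD_def genBD_def word_defs wpow_def)
  show "genA Z * genD Z = 1 + genC Z * genB Z"
    using genD_conv[of Za Z] unfolding e u gen_Za gen_Zr by (simp add: algebra_simps)
  show "outer (genD Z) * genAD Z - outer (genB Z) * genBD Z - genAC Zr * inner (genB Z) + genAD Zr * inner (genD Z) = 0"
    using genAD_conv[of Za Z] unfolding e u gen_Za gen_Zr outer_minus by (simp add: algebra_simps)
  show "- (outer (genC Z) * genAD Z) + outer (genA Z) * genBD Z + genBC Zr * inner (genB Z) - genBD Zr * inner (genD Z) = 0"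
    using genBD_conv[of Za Z] unfolding e u gen_Za gen_Zr outer_minus by (simp add: algebra_simps)
qed

text \<open>Multiplication by \<open>S\<close> adds \<open>S0 * genD Z\<close>, which is
  \<open>- 2 * genB Z\<close> by \<open>Z_gen\<close>: the sign of \<open>genB Z\<close> is
  reversed.\<close>

lemma SZ_gen:
  "genB (conv S Z) = - genB Z" "genD (conv S Z) = genD Z"
  "genAD (conv S Z) = genAD Z + outer S0 * genBD Z + (C - outer S0) * inner (genB Z) + X * inner (genD Z)"
  "genBD (conv S Z) = genBD Z + C * inner (genD Z)"
proof -
  have "genB (conv S Z) = genB Z + S0 * genD Z" by (simp add: genB_conv S_gen)
  then show "genB (conv S Z) = - genB Z" using Z_gen by (simp add: algebra_simps eq_neg_iff_add_eq_0)
qed (simp_all add: genD_conv genAD_conv genBD_conv S_gen outer_1 outer_0)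

lemma M_assoc: "M = conv Zr (conv S Z)"
  by (rule ext) (rule conv_assoc)

lemma genB_M: "genB M = 0"
  unfolding M_assoc genB_conv[of Zr "conv S Z"] SZ_gen gen_Zr by (simp add: mult.commute)

lemma two_outer_inner: "2 * outer (genB Z) = - (outer S0 * outer (genD Z))" "2 * inner (genB Z) = - (inner S0 * inner (genD Z))"
proof -
  have "outer (2 * genB Z) = outer (- (S0 * genD Z))" by (simp only: Z_gen)
  moreover have "outer (2 * genB Z) = 2 * outer (genB Z)" by (simp only: mult_2 outer_add)
  ultimately show "2 * outer (genB Z) = - (outer S0 * outer (genD Z))" by (simp add: outer_minus outer_mult)
  have "inner (2 * genB Z) = inner (- (S0 * genD Z))" by (simp only: Z_gen)
  moreover have "inner (2 * genB Z) = 2 * inner (genB Z)" by (simp only: mult_2 fps_const_add[symmetric])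
  ultimately show "2 * inner (genB Z) = - (inner S0 * inner (genD Z))" by (simp add: fps_const_neg[symmetric] del: fps_const_neg)
qed

text \<open>After doubling, \<open>Z_gen\<close> and \<open>X_eq\<close> express everything through
  \<open>C\<close>, \<open>S0\<close> and \<open>genD Z\<close>, and the terms cancel. The shape of
  \<open>S1_00\<close>, including its factor 1/2, is made for this identity.\<close>

lemma key_relation:
  "outer (genD Z) * ((C - outer S0) * inner (genB Z) + X * inner (genD Z)) = - (outer (genB Z) * C * inner (genD Z))"
proof -
  define Ps Pt Qs Qt Ss St where "Ps = outer (genD Z)" and "Pt = inner (genD Z)" and "Qs = outer (genB Z)"
    and "Qt = inner (genB Z)" and "Ss = outer S0" and "St = inner S0"
  have a: "2 * Qs = - (Ss * Ps)" "2 * Qt = - (St * Pt)" "2 * X = C * (Ss + St) - Ss * St"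
    using two_outer_inner X_eq by (simp_all only: Ps_def Pt_def Qs_def Qt_def Ss_def St_def)
  define T where "T = Ps * ((C - Ss) * Qt + X * Pt) + Qs * C * Pt"
  have "2 * T
    = Ps * (C - Ss) * (2 * Qt) + Ps * Pt * (2 * X) + (2 * Qs) * C * Pt" by (simp add: T_def algebra_simps)
  also have "\<dots> = 0" unfolding a by (simp add: algebra_simps)
  finally have "T = 0" by simp
  then have "Ps * ((C - Ss) * Qt + X * Pt) + Qs * C * Pt = 0" by (simp only: T_def)
  then show ?thesis unfolding Ps_def Pt_def Qs_def Qt_def Ss_def by (simp add: eq_neg_iff_add_eq_0)
qed

lemma genAD_M: "genAD M = 0"
proof -
  define Ps Pt Qs Qt Ss where "Ps = outer (genD Z)" and "Pt = inner (genD Z)" and "Qs = outer (genB Z)"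
    and "Qt = inner (genB Z)" and "Ss = outer S0"
  have G: "genAD M = Ps * (genAD Z + Ss * genBD Z + (C - Ss) * Qt + X * Pt) + Qs * (genBD Z + C * Pt)
      + genAC Zr * (- Qt) + genAD Zr * Pt"
    unfolding M_assoc genAD_conv[of Zr] gen_Zr SZ_gen Ps_def Pt_def Qs_def Qt_def Ss_def by simp
  have "Ps * genAD Z - Qs * genBD Z - genAC Zr * Qt + genAD Zr * Pt = 0"
    using antipode_relations(2) unfolding Ps_def Pt_def Qs_def Qt_def .
  then have r: "genAC Zr * (- Qt) = - (Ps * genAD Z - Qs * genBD Z + genAD Zr * Pt)" by algebra
  have "genAD M = (Ss * Ps + 2 * Qs) * genBD Z + (Ps * ((C - Ss) * Qt + X * Pt) + Qs * C * Pt)"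
    unfolding G r by (simp add: algebra_simps)
  moreover have "Ss * Ps + 2 * Qs = 0" using two_outer_inner(1) unfolding Ss_def Ps_def Qs_def by simp
  moreover have "Ps * ((C - Ss) * Qt + X * Pt) + Qs * C * Pt = 0"
    using key_relation unfolding Ps_def Pt_def Qs_def Qt_def Ss_def by simp
  ultimately show ?thesis by simp
qed

text \<open>The factor \<open>outer (genD Z)\<close> makes \<open>key_relation\<close> applicable;
  determinant 1 then removes \<open>genA Z\<close> and \<open>genC Z\<close>.\<close>

lemma genBD_M: "outer (genD Z) * genBD M = 2 * genBD Z + C * inner (genD Z)"
proof -
  define Ps Pt Qs Qt Ss Os Ps' W where "Ps = outer (genD Z)" and "Pt = inner (genD Z)" and "Qs = outer (genB Z)"
    and "Qt = inner (genB Z)" and "Ss = outer S0" and "Os = outer (genC Z)" and "Ps' = outer (genA Z)" and "W = genBD Z"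
  have M: "genBD M = Os * (genAD Z + Ss * W + (C - Ss) * Qt + X * Pt) + Ps' * (W + C * Pt)
      + genBC Zr * (- Qt) + genBD Zr * Pt"
    unfolding M_assoc genBD_conv[of Zr] gen_Zr SZ_gen Ps_def Pt_def Qs_def Qt_def Ss_def Os_def Ps'_def W_def by simp
  have "- (Os * genAD Z) + Ps' * W + genBC Zr * Qt - genBD Zr * Pt = 0"
    using antipode_relations(3) unfolding Os_def Pt_def Ps'_def Qt_def W_def .
  then have r3: "genBC Zr * (- Qt) = - (Os * genAD Z - Ps' * W + genBD Zr * Pt)" by algebra
  have S2: "Ss * Ps = - 2 * Qs" using two_outer_inner(1) unfolding Ss_def Ps_def Qs_def by simp
  have k: "Ps * ((C - Ss) * Qt + X * Pt) = - (Qs * C * Pt)"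
    using key_relation unfolding Ps_def Pt_def Qs_def Qt_def Ss_def .
  have det: "Ps' * Ps = 1 + Os * Qs"
    using arg_cong[of _ _ outer, OF antipode_relations(1)] unfolding Ps'_def Ps_def Os_def Qs_def
    by (simp add: outer_mult outer_add outer_1)
  have "Ps * genBD M = Os * ((Ss * Ps) * W + Ps * ((C - Ss) * Qt + X * Pt)) + Ps' * Ps * (2 * W + C * Pt)"
    unfolding M r3 by (simp add: algebra_simps)
  also have "\<dots> = 2 * W + C * Pt" unfolding S2 k det by (simp add: algebra_simps)
  finally show ?thesis unfolding Ps_def W_def Pt_def .
qed

text \<open>The factor \<open>inner fps_X\<close> aligns the indices: coefficient
  \<open>(Suc m, Suc n)\<close> of \<open>Y\<close> is \<open>M (wbd (Suc m) n)\<close>.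
  Multiplication by the symmetric nonzero \<open>K\<close> turns the symmetry of \<open>Y\<close>
  into the hypothesis, and \<open>K\<close> cancels in the domain of power series.\<close>

lemma genBD_M_symmetric:
  assumes sym: "\<And>m n. (inner (fps_X * genD Z) * (2 * genBD Z + C * inner (genD Z))) $ m $ n
     = (inner (fps_X * genD Z) * (2 * genBD Z + C * inner (genD Z))) $ n $ m"
  shows "M (wbd (Suc m) n) = M (wbd (Suc n) m)"
proof -
  define K where "K = outer (genD Z) * inner (genD Z)"
  define Y where "Y = inner fps_X * genBD M"
  have e: "inner (fps_X * genD Z) * (2 * genBD Z + C * inner (genD Z)) = K * Y"
    unfolding K_def Y_def genBD_M[symmetric] inner_mult by (simp add: algebra_simps)
  have "flip_fps (K * Y) = K * Y"
    by (rule fps_fps_eqI) (simp add: flip_fps_nth sym[unfolded e, symmetric])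
  moreover have "flip_fps K = K" by (simp add: K_def flip_fps_mult flip_fps_outer mult.commute)
  ultimately have "K * (flip_fps Y - Y) = 0" by (simp add: flip_fps_mult algebra_simps)
  moreover have "K \<noteq> 0"
  proof
    assume "K = 0"
    then have "K $ 0 $ 0 = 0" by simp
    then show False by (simp add: K_def outer_def genD_def wd_def Z_Nil)
  qed
  ultimately have Y: "flip_fps Y = Y" by simp
  have nth: "Y $ i $ Suc j = M (wbd i j)" for i j
    by (simp add: Y_def genBD_def)
  have "Y $ Suc m $ Suc n = Y $ Suc n $ Suc m" using Y flip_fps_nth[of Y "Suc m" "Suc n"] by simp
  then show ?thesis by (simp add: nth)
qed

end

subsection \<open>The series \<open>S\<close> on the word families\<close>

lemma nth_wpow: "j < 2 * n \<Longrightarrow> wpow [a, b] n ! j = (if even j then a else b)"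
proof (induction n arbitrary: j)
  case (Suc n)
  show ?case
  proof (cases "j < 2")
    case True
    then have "j = 0 \<or> j = 1" by auto
    then show ?thesis by (auto simp: wpow_Suc)
  next
    case False
    then have "wpow [a, b] (Suc n) ! j = wpow [a, b] n ! (j - 2)"
      by (simp add: wpow_Suc nth_append numeral_2_eq_2)
    then show ?thesis using Suc False by auto
  qed
qed simp

text \<open>The inserted \<open>X0\<close> is visible: at position \<open>2 * i\<close> the word
  \<open>wbd i k\<close> has \<open>X0\<close>, while a word with a longer first block still has
  \<open>X1\<close>.\<close>

lemma wbd_inj: "wbd m n = wbd m' n' \<longleftrightarrow> m = m' \<and> n = n'"
proof
  assume e: "wbd m n = wbd m' n'"
  then have "length (wbd m n) = length (wbd m' n')" by (simp only:)
  then have l: "m + n = m' + n'" unfolding length_words by presburger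
  have *: False if "i < i'" "wbd i k = wbd i' k'" for i k i' k'
  proof -
    have "wbd i k ! (2 * i) = X0" by (simp add: wbd_def nth_append)
    moreover have "wbd i' k' ! (2 * i) = X1" using that(1) by (simp add: wbd_def nth_append nth_wpow)
    ultimately show False using that(2) by simp
  qed
  have "m = m'" using *[of m m' n n'] *[of m' m n' n] e by (metis linorder_neqE_nat)
  then show "m = m' \<and> n = n'" using l by simp
qed simp

lemma hd_wpow [simp]: "n > 0 \<Longrightarrow> hd (wpow [a, b] n) = a"
  by (cases n) (simp_all add: wpow_Suc)

lemma last_wpow [simp]: "n > 0 \<Longrightarrow> last (wpow [a, b] n) = b"
  by (cases n) (simp_all add: wpow_Suc_right)

lemma wpow_Nil_iff [simp]: "wpow [a, b] n = [] \<longleftrightarrow> n = 0"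
  by (cases n) (simp_all add: wpow_Suc)

definition S0c :: "nat \<Rightarrow> real" where "S0c n = (if n = 0 then 0 else - 4 * zeta (2 * n + 1))"
text \<open>Row \<open>m = 0\<close> is included and holds the coefficients of \<open>S0_00\<close>,
  because \<open>wbd 0 n = wb n\<close>. Only the divergent \<open>zeta 1\<close> at
  \<open>m = n = 0\<close> is replaced by 0.\<close>

definition Cc :: "nat \<Rightarrow> nat \<Rightarrow> real" where
  "Cc m n = (if m + n = 0 then 0 else - 4 * (real ((2 * m + 2 * n) choose (2 * m)) * zeta (2 * m + 2 * n + 1)))"

lemma S0_00_wb: "S0_00 (wb n) = S0c n"
proof -
  have "{k. k \<ge> 1 \<and> wb n = wpow [X0, X1] k @ [X0]} = (if n = 0 then {} else {n})"
    using arg_cong[where f = length and x = "wb n"] by (auto simp: wb_def dest: arg_cong[where f = length])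
  then show ?thesis by (simp add: S0_00_def S0c_def)
qed

lemma S0_00_other: "(\<And>n. w \<noteq> wb n) \<Longrightarrow> S0_00 w = 0"
  by (simp add: S0_00_def wb_def)

lemma S1_10_alt: "S1_10 w = - 4 * (\<Sum>(m, n) \<in> {(m, n). m \<ge> 1 \<and> w = wbd m n}.
      real ((2 * m + 2 * n) choose (2 * m)) * zeta (2 * m + 2 * n + 1))"
  by (simp only: S1_10_def wbd_def)

lemma S1_10_wbd: "S1_10 (wbd m n) = (if m = 0 then 0 else Cc m n)"
proof -
  have "{(k, l). k \<ge> 1 \<and> wbd m n = wbd k l} = (if m = 0 then {} else {(m, n)})"
    unfolding wbd_inj by auto
  then show ?thesis by (simp add: S1_10_alt Cc_def)
qed

lemma S1_10_other:
  assumes "\<And>m n. m \<ge> 1 \<Longrightarrow> w \<noteq> wbd m n"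
  shows "S1_10 w = 0"
proof -
  have e: "{(k, l). k \<ge> 1 \<and> w = wbd k l} = {}" using assms by blast
  show ?thesis unfolding S1_10_alt e by simp
qed

lemma S0_00_zero: "w = [] \<or> last w = X1 \<or> hd w = X1 \<or> even (length w) \<Longrightarrow> S0_00 w = 0"
proof (rule S0_00_other)
  fix n assume a: "w = [] \<or> last w = X1 \<or> hd w = X1 \<or> even (length w)"
  have "hd (wb n) = X0" by (cases n) (simp_all add: wb_def)
  then show "w \<noteq> wb n" using a by (auto simp: wb_def)
qed

lemma hd_wbd: "m \<ge> 1 \<Longrightarrow> hd (wbd m n) = X1"
  by (cases m) (simp_all add: wbd_def wpow_Suc)

lemma last_wbd: "last (wbd m n) = X0"
  by (cases n) (simp_all add: wbd_def wpow_Suc_right)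

lemma S1_10_zero: "w = [] \<or> last w = X1 \<or> hd w = X0 \<or> even (length w) \<Longrightarrow> S1_10 w = 0"
proof (rule S1_10_other)
  fix m n :: nat assume a: "w = [] \<or> last w = X1 \<or> hd w = X0 \<or> even (length w)" and "m \<ge> 1"
  then show "w \<noteq> wbd m n" using hd_wbd[of m n] last_wbd[of m n] by (auto simp: length_words) (auto simp: wbd_def)
qed

lemma S1_01_zero: "w = [] \<or> last w = X0 \<or> hd w = X1 \<or> even (length w) \<Longrightarrow> S1_01 w = 0"
  unfolding S1_01_def nc_rev_def by (rule S1_10_zero) (auto simp: hd_rev last_rev)

lemma S1_00_conv: "S1_00 w = 1 / 2 * (conv S0_00 S0_00 w + conv S0_00 S1_10 w + conv S1_01 S0_00 w)"
  by (simp add: S1_00_def nc_times_eq_conv)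

lemma conv_zero_last:
  assumes "\<And>u. u = [] \<or> last u = X1 \<Longrightarrow> g u = 0" "w = [] \<or> last w = X1"
  shows "conv f g w = 0"
proof (cases w rule: rev_exhaust)
  case (snoc v x)
  then show ?thesis using assms by (simp add: conv_snoc) (simp add: conv_def)
qed (use assms in simp)

lemma S1_00_zero: "w = [] \<or> last w = X1 \<Longrightarrow> S1_00 w = 0"
proof -
  assume w: "w = [] \<or> last w = X1"
  have "conv f S0_00 w = 0" "conv f S1_10 w = 0" for f
    by (rule conv_zero_last[OF _ w]; rule S0_00_zero S1_10_zero; blast)+
  then show ?thesis by (simp add: S1_00_conv)
qed

lemma hd_last_words [simp]:
  "hd (wb n) = X0" "hd (wc n) = X1" "last (wb n) = X0" "last (wc n) = X1"
  "hd (wad m n) = X0" "last (wad m n) = X0" "hd (wac m n) = X0" "last (wac m n) = X1" "last (wbc m n) = X1"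
  "n > 0 \<Longrightarrow> hd (wa n) = X0" "n > 0 \<Longrightarrow> last (wa n) = X1" "n > 0 \<Longrightarrow> hd (wd n) = X1" "n > 0 \<Longrightarrow> last (wd n) = X0"
  by (cases n; cases m; simp add: word_defs wpow_Suc)+

lemma gen_S0_00: "genA S0_00 = 0" "genB S0_00 = Abs_fps S0c" "genC S0_00 = 0" "genD S0_00 = 0"
    "genAC S0_00 = 0" "genAD S0_00 = 0" "genBC S0_00 = 0" "genBD S0_00 = inner (Abs_fps S0c)"
proof -
  show "genA S0_00 = 0" "genD S0_00 = 0" by (simp_all add: fps_eq_iff genA_def genD_def S0_00_zero length_words)
  show "genB S0_00 = Abs_fps S0c" by (simp add: genB_def S0_00_wb)
  show "genC S0_00 = 0" by (simp add: fps_eq_iff genC_def shift_seq_def S0_00_zero split: nat.split)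
  show "genAC S0_00 = 0" "genBC S0_00 = 0"
    by (auto intro!: fps_fps_eqI simp: genAC_def genBC_def shift_seq_def S0_00_zero split: nat.split)
  show "genAD S0_00 = 0" by (auto intro!: fps_fps_eqI simp: genAD_def S0_00_zero length_words)
  have "S0_00 (wbd m n) = (if m = 0 then S0c n else 0)" for m n
  proof (cases "m = 0")
    case True
    have "wbd 0 n = wb n" using wpow_shift[of X0 X1 n] by (simp add: wbd_def wb_def)
    then show ?thesis using True by (simp add: S0_00_wb)
  next
    case False
    then show ?thesis using S0_00_zero[of "wbd m n"] hd_wbd[of m n] by simp
  qed
  then show "genBD S0_00 = inner (Abs_fps S0c)" by (auto intro!: fps_fps_eqI simp: genBD_def)
qed

lemma gen_S1_10: "genA S1_10 = 0" "genB S1_10 = 0" "genC S1_10 = 0" "genD S1_10 = 0"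
    "genAC S1_10 = 0" "genAD S1_10 = 0" "genBC S1_10 = 0"
    "genBD S1_10 = Abs_fps (\<lambda>m. Abs_fps (Cc m)) - inner (Abs_fps S0c)"
proof -
  show "genA S1_10 = 0" "genD S1_10 = 0" "genB S1_10 = 0"
    by (simp_all add: fps_eq_iff genA_def genD_def genB_def S1_10_zero length_words)
  show "genC S1_10 = 0" by (simp add: fps_eq_iff genC_def shift_seq_def S1_10_zero split: nat.split)
  show "genAC S1_10 = 0" "genBC S1_10 = 0"
    by (auto intro!: fps_fps_eqI simp: genAC_def genBC_def shift_seq_def S1_10_zero split: nat.split)
  show "genAD S1_10 = 0" by (auto intro!: fps_fps_eqI simp: genAD_def S1_10_zero length_words)
  show "genBD S1_10 = Abs_fps (\<lambda>m. Abs_fps (Cc m)) - inner (Abs_fps S0c)"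
    by (auto intro!: fps_fps_eqI simp: genBD_def S1_10_wbd Cc_def S0c_def)
qed

lemma rev_wac: "rev (wac m n) = wbd (Suc n) m"
proof -
  have "rev (wac m n) = X1 # wpow [X0, X1] n @ [X0] @ [X0] @ wpow [X1, X0] m" by (simp add: wac_def rev_wpow)
  also have "\<dots> = wbd (Suc n) m"
    using wpow_shift[of X1 X0 n] by (simp add: wbd_def wpow_Suc_right)
  finally show ?thesis .
qed

lemma Cc_sym: "Cc m n = Cc n m"
proof -
  have "(2 * m + 2 * n) choose (2 * m) = (2 * n + 2 * m) choose (2 * n)"
    using binomial_symmetric[of "2 * m" "2 * m + 2 * n"] by (simp add: add.commute)
  then show ?thesis by (simp add: Cc_def add.commute)
qed

lemma Cc_0: "Cc m 0 = S0c m" "Cc 0 m = S0c m"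
  by (simp_all add: Cc_def S0c_def)

lemma gen_S1_01: "genA S1_01 = 0" "genB S1_01 = 0" "genC S1_01 = 0" "genD S1_01 = 0"
    "genAC S1_01 = Abs_fps (\<lambda>m. Abs_fps (Cc m)) - outer (Abs_fps S0c)"
    "genAD S1_01 = 0" "genBC S1_01 = 0" "genBD S1_01 = 0"
proof -
  show "genA S1_01 = 0" "genD S1_01 = 0" "genB S1_01 = 0"
    by (simp_all add: fps_eq_iff genA_def genD_def genB_def S1_01_zero length_words)
  show "genC S1_01 = 0" by (simp add: fps_eq_iff genC_def shift_seq_def S1_01_zero split: nat.split)
  have "S1_01 (wbc m n) = 0" for m n by (rule S1_01_zero) (simp add: length_words)
  then show "genBC S1_01 = 0"
    by (auto intro!: fps_fps_eqI simp: genBC_def shift_seq_def split: nat.split)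
  show "genAD S1_01 = 0" "genBD S1_01 = 0"
    by (auto intro!: fps_fps_eqI simp: genAD_def genBD_def S1_01_zero length_words last_wbd)
  have "S1_01 (wac m n) = Cc m (Suc n)" for m n
    by (simp add: S1_01_def nc_rev_def rev_wac S1_10_wbd Cc_sym)
  then show "genAC S1_01 = Abs_fps (\<lambda>m. Abs_fps (Cc m)) - outer (Abs_fps S0c)"
    by (auto intro!: fps_fps_eqI simp: genAC_def shift_seq_def outer_def Cc_0 split: nat.split)
qed

lemma Sser_split: "S_series = (\<lambda>w. unit_series w + (S0_00 w + S1_01 w + S1_10 w + S1_00 w))"
  by (auto simp: S_series_def unit_series_def)

abbreviation "S0fps \<equiv> Abs_fps S0c"
abbreviation "Cfps \<equiv> Abs_fps (\<lambda>m. Abs_fps (Cc m))"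
abbreviation "Xfps \<equiv> fps_const (fps_const (1 / 2)) * (Cfps * (outer S0fps + inner S0fps) - outer S0fps * inner S0fps)"

lemma gen_unit: "genA unit_series = 1" "genB unit_series = 0" "genC unit_series = 0" "genD unit_series = 1"
    "genAC unit_series = 0" "genAD unit_series = 0" "genBC unit_series = 0" "genBD unit_series = 0"
  by (auto intro!: fps_fps_eqI simp: genA_def genB_def genC_def genD_def genAC_def genAD_def genBC_def genBD_def
      fps_eq_iff unit_series_def word_defs shift_seq_def split: nat.split)

lemma gen_add:
  "genA (\<lambda>w. f w + g w) = genA f + genA g" "genB (\<lambda>w. f w + g w) = genB f + genB g"
  "genC (\<lambda>w. f w + g w) = genC f + genC g" "genD (\<lambda>w. f w + g w) = genD f + genD g"
  "genAC (\<lambda>w. f w + g w) = genAC f + genAC g" "genAD (\<lambda>w. f w + g w) = genAD f + genAD g"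
  "genBC (\<lambda>w. f w + g w) = genBC f + genBC g" "genBD (\<lambda>w. f w + g w) = genBD f + genBD g"
  by (auto intro!: fps_fps_eqI simp: genA_def genB_def genC_def genD_def genAC_def genAD_def genBC_def genBD_def
      fps_eq_iff shift_seq_def split: nat.split)

lemma gen_scale:
  "genB (\<lambda>w. c * f w) = fps_const c * genB f" "genD (\<lambda>w. c * f w) = fps_const c * genD f"
  "genAD (\<lambda>w. c * f w) = fps_const (fps_const c) * genAD f" "genBD (\<lambda>w. c * f w) = fps_const (fps_const c) * genBD f"
  by (auto intro!: fps_fps_eqI simp: genB_def genD_def genAD_def genBD_def fps_eq_iff)

lemma gen_S1_00: "genA S1_00 = 0" "genB S1_00 = 0" "genC S1_00 = 0" "genD S1_00 = 0"
    "genAC S1_00 = 0" "genAD S1_00 = Xfps" "genBC S1_00 = 0" "genBD S1_00 = 0"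
proof -
  have "wa n = [] \<or> last (wa n) = X1" for n by (cases n) (auto simp: wa_def)
  then show "genA S1_00 = 0" by (simp add: fps_eq_iff genA_def S1_00_zero)
  show "genC S1_00 = 0" by (simp add: fps_eq_iff genC_def shift_seq_def S1_00_zero split: nat.split)
  show "genAC S1_00 = 0" "genBC S1_00 = 0"
    by (auto intro!: fps_fps_eqI simp: genAC_def genBC_def shift_seq_def S1_00_zero split: nat.split)
  have e: "S1_00 = (\<lambda>w. 1 / 2 * (conv S0_00 S0_00 w + conv S0_00 S1_10 w + conv S1_01 S0_00 w))"
    by (simp add: fun_eq_iff S1_00_conv)
  note gens = gen_S0_00 gen_S1_10 gen_S1_01 outer_0
  show "genB S1_00 = 0" "genD S1_00 = 0" "genBD S1_00 = 0"
    unfolding e gen_scale gen_add genB_conv genD_conv genBD_conv gens by simp_all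
  show "genAD S1_00 = Xfps"
    unfolding e gen_scale gen_add genAD_conv gens by (simp add: algebra_simps)
qed

text \<open>On \<open>wbd m n\<close> row 0 comes from \<open>S0_00\<close> and the other rows from
  \<open>S1_10\<close>, which together give the full array \<open>Cfps\<close>. In
  \<open>genAC\<close> the shift leaves column 0 empty, hence the subtracted
  \<open>outer S0fps\<close>.\<close>

lemma gen_S_series: "genA S_series = 1" "genB S_series = S0fps" "genC S_series = 0" "genD S_series = 1"
    "genAC S_series = Cfps - outer S0fps" "genAD S_series = Xfps" "genBC S_series = 0" "genBD S_series = Cfps"
  unfolding Sser_split gen_add gen_unit gen_S0_00 gen_S1_01 gen_S1_10 gen_S1_00 by simp_all

lemma S_series_rev: "S_series (rev w) = S_series w"
proof -
  have "S0_00 (rev u) = S0_00 u" for u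
  proof (cases "\<exists>n. u = wb n")
    case True
    then show ?thesis using rev_words by auto
  next
    case False
    then have "S0_00 u = 0" by (intro S0_00_other) auto
    moreover have "S0_00 (rev u) = 0" using False by (intro S0_00_other) (metis rev_rev_ident rev_words(3))
    ultimately show ?thesis by simp
  qed
  moreover have "S1_01 (rev u) = S1_10 u" "S1_10 (rev u) = S1_01 u" for u
    by (simp_all add: S1_01_def nc_rev_def)
  ultimately show ?thesis
    by (simp add: S_series_def S1_00_conv conv_rev)
qed

subsection \<open>The set \<open>B0\<close>\<close>

lemma sublist_occ: "sublist v w \<longleftrightarrow> (\<exists>p s. w = p @ v @ s)"
  by (auto simp: sublist_def)

definition occ00 :: "word \<Rightarrow> (word \<times> word) set" where "occ00 w = {(p, s). w = p @ [X0, X0] @ s}"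

lemma finite_occ00: "finite (occ00 w)"
proof (rule finite_subset)
  show "occ00 w \<subseteq> (\<lambda>(i, j). (take i w, drop j w)) ` ({..length w} \<times> {..length w})"
  proof
    fix q assume "q \<in> occ00 w"
    then obtain p s where q: "q = (p, s)" "w = p @ [X0, X0] @ s" by (auto simp: occ00_def)
    then show "q \<in> (\<lambda>(i, j). (take i w, drop j w)) ` ({..length w} \<times> {..length w})"
      by (intro image_eqI[of _ _ "(length p, length p + 2)"]) auto
  qed
qed simp

text \<open>The cardinality bound becomes uniqueness of the prefix before \<open>X0 X0\<close>, a
  form that passes directly to factors and reversals.\<close>

lemma B0_iff: "w \<in> B0 \<longleftrightarrow> (\<forall>p s. w \<noteq> p @ [X1, X1] @ s) \<and> (\<forall>p s. w \<noteq> p @ [X0, X0, X0] @ s) \<and>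
    (\<forall>p s p' s'. w = p @ [X0, X0] @ s \<longrightarrow> w = p' @ [X0, X0] @ s' \<longrightarrow> p = p')"
proof -
  have c: "card (occ00 w) \<le> 1 \<longleftrightarrow> (\<forall>p s p' s'. w = p @ [X0, X0] @ s \<longrightarrow> w = p' @ [X0, X0] @ s' \<longrightarrow> p = p')"
  proof
    assume "card (occ00 w) \<le> 1"
    then have "\<forall>x\<in>occ00 w. \<forall>y\<in>occ00 w. x = y" using card_le_Suc0_iff_eq[OF finite_occ00] by simp
    then show "\<forall>p s p' s'. w = p @ [X0, X0] @ s \<longrightarrow> w = p' @ [X0, X0] @ s' \<longrightarrow> p = p'"
      unfolding occ00_def by blast
  next
    assume a: "\<forall>p s p' s'. w = p @ [X0, X0] @ s \<longrightarrow> w = p' @ [X0, X0] @ s' \<longrightarrow> p = p'"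
    have "\<forall>x\<in>occ00 w. \<forall>y\<in>occ00 w. x = y"
    proof (intro ballI)
      fix x y assume "x \<in> occ00 w" "y \<in> occ00 w"
      then obtain p s p' s' where xy: "x = (p, s)" "y = (p', s')" and w: "w = p @ [X0, X0] @ s" "w = p' @ [X0, X0] @ s'"
        unfolding occ00_def by blast
      have "p = p'" using a w by blast
      then show "x = y" using w xy by simp
    qed
    then show "card (occ00 w) \<le> 1" using card_le_Suc0_iff_eq[OF finite_occ00] by simp
  qed
  have "w \<in> B0 \<longleftrightarrow> \<not> sublist [X1, X1] w \<and> \<not> sublist [X0, X0, X0] w \<and> card (occ00 w) \<le> 1"
    by (simp only: B0_def mem_Collect_eq occ00_def)
  then show ?thesis by (simp only: c sublist_occ not_ex)
qed

lemma B0_factor: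
  assumes "x @ v @ y \<in> B0" shows "v \<in> B0"
proof -
  have a: "v = p @ u @ s \<Longrightarrow> x @ v @ y = (x @ p) @ u @ (s @ y)" for p u s by simp
  show ?thesis
    unfolding B0_iff
  proof (intro conjI allI notI impI)
    fix p s assume "v = p @ [X1, X1] @ s"
    from a[OF this] show False using assms unfolding B0_iff by blast
  next
    fix p s assume "v = p @ [X0, X0, X0] @ s"
    from a[OF this] show False using assms unfolding B0_iff by blast
  next
    fix p s p' s' assume "v = p @ [X0, X0] @ s" "v = p' @ [X0, X0] @ s'"
    from a[OF this(1)] a[OF this(2)] have "x @ p = x @ p'" using assms unfolding B0_iff by blast
    then show "p = p'" by simp
  qed
qed

lemma B0_take: "w \<in> B0 \<Longrightarrow> take k w \<in> B0"
  using B0_factor[of "[]" "take k w" "drop k w"] by simp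

lemma B0_drop: "w \<in> B0 \<Longrightarrow> drop k w \<in> B0"
  using B0_factor[of "take k w" "drop k w" "[]"] by simp

lemma B0_rev: "w \<in> B0 \<Longrightarrow> rev w \<in> B0"
proof -
  assume w: "w \<in> B0"
  have a: "rev w = p @ u @ s \<Longrightarrow> w = rev s @ rev u @ rev p" for p u s
    by (metis append.assoc rev_append rev_rev_ident)
  show ?thesis
    unfolding B0_iff
  proof (intro conjI allI notI impI)
    fix p s assume "rev w = p @ [X1, X1] @ s"
    from a[OF this] have "w = rev s @ [X1, X1] @ rev p" by simp
    then show False using w unfolding B0_iff by blast
  next
    fix p s assume "rev w = p @ [X0, X0, X0] @ s"
    from a[OF this] have "w = rev s @ [X0, X0, X0] @ rev p" by simp
    then show False using w unfolding B0_iff by blast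
  next
    fix p s p' s' assume e: "rev w = p @ [X0, X0] @ s" "rev w = p' @ [X0, X0] @ s'"
    have "w = rev s @ [X0, X0] @ rev p" "w = rev s' @ [X0, X0] @ rev p'" using a[OF e(1)] a[OF e(2)] by simp_all
    then have "rev s = rev s'" using w unfolding B0_iff by blast
    then have "s = s'" by simp
    then show "p = p'" using e by simp
  qed
qed

lemma alternating_word:
  assumes "\<And>p s. w \<noteq> p @ [X1, X1] @ s" "\<And>p s. w \<noteq> p @ [X0, X0] @ s" "w \<noteq> []" "hd w = X0" "last w = X0"
  shows "\<exists>n. w = wb n"
  using assms
proof (induction "length w" arbitrary: w rule: less_induct)
  case less
  from less.prems(3,4) obtain v where w: "w = X0 # v" by (cases w) auto
  show ?case
  proof (cases v)
    case Nil
    then show ?thesis using w by (intro exI[of _ 0]) (simp add: wb_def)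
  next
    case (Cons x u)
    have x: "x = X1" using less.prems(2)[of "[]" u] w Cons by (cases x) auto
    have u: "u \<noteq> []" using less.prems(5) w Cons x by auto
    have "hd u = X0"
    proof (rule ccontr)
      assume "hd u \<noteq> X0"
      then have "hd u = X1" by (cases "hd u") auto
      then have "u = X1 # tl u" using u by (metis list.collapse)
      then show False using less.prems(1)[of "[X0]" "tl u"] w Cons x by simp
    qed
    moreover have "last u = X0" using less.prems(5) w Cons u by simp
    moreover have "u \<noteq> p @ [X1, X1] @ s" "u \<noteq> p @ [X0, X0] @ s" for p s
      using less.prems(1)[of "X0 # X1 # p" s] less.prems(2)[of "X0 # X1 # p" s] w Cons x by auto
    ultimately obtain n where "u = wb n" using less.hyps[of u] u w Cons by auto
    then have "w = wb (Suc n)" using w Cons x by (simp add: wb_def wpow_Suc)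
    then show ?thesis ..
  qed
qed

text \<open>If \<open>w = p @ [X0, X0] @ s\<close>, uniqueness of this factor makes
  \<open>p @ [X0]\<close> and \<open>X0 # s\<close> alternating with \<open>X0\<close> at both ends,
  and \<open>wad m n = wb m @ wb n\<close>.\<close>

lemma B0_classify:
  assumes w: "w \<in> B0" "w \<noteq> []" "hd w = X0" "last w = X0"
  shows "(\<exists>n. w = wb n) \<or> (\<exists>m n. w = wad m n)"
proof (cases "\<exists>p s. w = p @ [X0, X0] @ s")
  case False
  then show ?thesis using alternating_word[of w] w unfolding B0_iff by blast
next
  case True
  then obtain p s where ps: "w = p @ [X0, X0] @ s" by blast
  have B: "\<And>p s. w \<noteq> p @ [X1, X1] @ s" "\<And>p s. w \<noteq> p @ [X0, X0, X0] @ s"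
      "\<And>p s p' s'. w = p @ [X0, X0] @ s \<Longrightarrow> w = p' @ [X0, X0] @ s' \<Longrightarrow> p = p'"
    using w(1) unfolding B0_iff by blast+
  have "\<exists>m. p @ [X0] = wb m"
  proof (rule alternating_word)
    show "p @ [X0] \<noteq> p' @ [X1, X1] @ s'" for p' s'
    proof
      assume "p @ [X0] = p' @ [X1, X1] @ s'"
      then have "w = p' @ [X1, X1] @ (s' @ X0 # s)" using ps by (metis append.assoc append_Cons append_Nil)
      then show False using B(1) by blast
    qed
    show "p @ [X0] \<noteq> p' @ [X0, X0] @ s'" for p' s'
    proof
      assume a: "p @ [X0] = p' @ [X0, X0] @ s'"
      then have "w = p' @ [X0, X0] @ (s' @ X0 # s)" using ps by (metis append.assoc append_Cons append_Nil)
      then have "p' = p" using B(3) ps by blast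
      then show False using a by simp
    qed
    show "hd (p @ [X0]) = X0" using w(3) ps by (cases p) auto
  qed auto
  then obtain m where m: "p @ [X0] = wb m" by blast
  have "\<exists>n. X0 # s = wb n"
  proof (rule alternating_word)
    show "X0 # s \<noteq> p' @ [X1, X1] @ s'" for p' s'
    proof
      assume "X0 # s = p' @ [X1, X1] @ s'"
      then have "w = ((p @ [X0]) @ p') @ [X1, X1] @ s'" using ps by simp
      then show False using B(1) by blast
    qed
    show "X0 # s \<noteq> p' @ [X0, X0] @ s'" for p' s'
    proof
      assume a: "X0 # s = p' @ [X0, X0] @ s'"
      then have "w = (p @ [X0] @ p') @ [X0, X0] @ s'" using ps by simp
      then have "p @ [X0] @ p' = p" using B(3) ps by blast
      then show False by simp
    qed
    show "last (X0 # s) = X0" using w(4) ps by (cases s rule: rev_cases) auto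
  qed auto
  then obtain n where n: "X0 # s = wb n" by blast
  have "w = wb m @ wb n" using ps m n by (metis append.assoc append_Cons append_Nil)
  also have "\<dots> = wad m n" using wpow_shift[of X0 X1 n] by (simp add: wad_def wb_def)
  finally show ?thesis by blast
qed

text \<open>A word in the support of \<open>S1_01\<close> already contains \<open>X0 X0\<close>. A
  further \<open>X0\<close> in front creates a second such factor, or \<open>X0 X0 X0\<close> if the
  word starts with \<open>X0 X0\<close>.\<close>

lemma B0_X0_S1_01:
  assumes "X0 # u \<in> B0" shows "S1_01 u = 0"
proof (rule ccontr)
  assume "S1_01 u \<noteq> 0"
  then have "S1_10 (rev u) \<noteq> 0" by (simp add: S1_01_def nc_rev_def)
  then obtain m n where m: "m \<ge> 1" and u: "rev u = wbd m n" using S1_10_other by blast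
  obtain k where k: "m = Suc k" using m by (cases m) auto
  have "u = rev (wbd m n)" using u by (metis rev_rev_ident)
  also have "\<dots> = wpow [X0, X1] n @ [X0] @ wpow [X0, X1] m" by (simp add: wbd_def rev_wpow)
  finally have u: "u = wpow [X0, X1] n @ [X0, X0] @ (X1 # wpow [X0, X1] k)" by (simp add: k wpow_Suc)
  have B: "\<And>p s. X0 # u \<noteq> p @ [X0, X0, X0] @ s"
      "\<And>p s p' s'. X0 # u = p @ [X0, X0] @ s \<Longrightarrow> X0 # u = p' @ [X0, X0] @ s' \<Longrightarrow> p = p'"
    using assms unfolding B0_iff by blast+
  have 1: "X0 # u = (X0 # wpow [X0, X1] n) @ [X0, X0] @ (X1 # wpow [X0, X1] k)" using u by simp
  show False
  proof (cases n)
    case 0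
    then show False using B(1)[of "[]" "X1 # wpow [X0, X1] k"] u by simp
  next
    case (Suc j)
    then have "X0 # u = [] @ [X0, X0] @ (X1 # wpow [X0, X1] j @ [X0, X0] @ (X1 # wpow [X0, X1] k))"
      using u by (simp add: wpow_Suc)
    from B(2)[OF this 1] show False by simp
  qed
qed

lemma letter_not: "i \<noteq> X0 \<longleftrightarrow> i = X1" "i \<noteq> X1 \<longleftrightarrow> i = X0"
  by (cases i; simp)+

lemma S_series_last_X1:
  assumes "X0 # u \<in> B0" "u \<noteq> []" "last u = X1"
  shows "S_series u = 0"
  using assms B0_X0_S1_01[OF assms(1)] by (simp add: S_series_def S0_00_zero S1_10_zero S1_00_zero)

text \<open>With \<open>X0\<close> at both ends the two coefficients agree by reversal symmetry and,
  on \<open>wad m n\<close>, by \<open>Cc_sym\<close>. With mixed ends one side is 0 by definition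
  and the other because the coefficient of \<open>S\<close> itself vanishes, up to reversal.\<close>

lemma S_series_commutes:
  assumes w: "w \<in> B0"
  shows "lsh X0 S_series w = rsh S_series X0 w"
proof (cases "w = [] \<or> hd w = X1 \<and> last w = X1")
  case True then show ?thesis by (auto simp: lsh_def rsh_def)
next
  case False
  then have ne: "w \<noteq> []" by simp
  have half: "lsh X0 S_series v = rsh S_series X0 v" if v: "v \<in> B0" "v \<noteq> []" "hd v = X0" "last v = X1" for v
  proof -
    obtain u where u: "v = X0 # u" using v by (cases v) auto
    then have "u \<noteq> []" "last u = X1" using v by (auto split: if_splits)
    then have "S_series u = 0" using S_series_last_X1 v(1) u by blast
    then show ?thesis using u v(4) by (simp add: lsh_def rsh_def)
  qed
  consider "hd w = X0" "last w = X0" | "hd w = X0" "last w = X1" | "hd w = X1" "last w = X0"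
    using False letter_not by metis
  then show ?thesis
  proof cases
    case 1
    consider n where "w = wb n" | m n where "w = wad m n" using B0_classify[OF w ne 1] by blast
    then show ?thesis
    proof cases
      case 1
      have wb: "wb n = X0 # wd n" using wpow_shift[of X0 X1 n] by (simp add: wb_def wd_def)
      have "S_series (wd n) = S_series (wa n)" using S_series_rev[of "wa n"] by (simp add: rev_words)
      moreover have "lsh X0 S_series w = S_series (wd n)" by (simp only: 1 wb lsh_def) simp
      moreover have "rsh S_series X0 w = S_series (wa n)" by (simp add: 1 rsh_def wb_def wa_def)
      ultimately show ?thesis by simp
    next
      case 2
      have l: "wad m n = X0 # wbd m n" using wpow_shift[of X0 X1 m] by (simp add: wad_def wbd_def)
      have "wad m n = rev (wad n m)" by (simp add: wad_def rev_wpow)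
      also have "wad n m = X0 # wbd n m" using wpow_shift[of X0 X1 n] by (simp add: wad_def wbd_def)
      finally have r: "wad m n = rev (wbd n m) @ [X0]" by simp
      have C: "S_series (wbd m n) = Cc m n" for m n
      proof -
        have "genBD S_series $ m $ n = Cfps $ m $ n" by (simp only: gen_S_series)
        then show ?thesis by (simp add: genBD_def)
      qed
      have "lsh X0 S_series w = Cc m n" using 2 l by (simp add: lsh_def C)
      moreover have "rsh S_series X0 w = Cc n m" using 2 r by (simp add: rsh_def S_series_rev C)
      ultimately show ?thesis using Cc_sym by simp
    qed
  next
    case 2
    then show ?thesis using half w ne by blast
  next
    case 3
    have "lsh X0 S_series (rev w) = rsh S_series X0 (rev w)"
      by (rule half) (use 3 w ne B0_rev in \<open>auto simp: hd_rev last_rev\<close>)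
    moreover have "lsh X0 S_series (rev w) = rsh S_series X0 w"
    proof (cases w rule: rev_exhaust)
      case (snoc v x) then show ?thesis using S_series_rev[of v] by (simp add: lsh_def rsh_def)
    qed (use ne in simp)
    moreover have "rsh S_series X0 (rev w) = lsh X0 S_series w"
    proof (cases w)
      case (Cons x v) then show ?thesis using S_series_rev[of v] by (simp add: lsh_def rsh_def)
    qed (use ne in simp)
    ultimately show ?thesis by simp
  qed
qed

lemma B0_X1_neighbour: "X1 # u \<in> B0 \<Longrightarrow> u \<noteq> [] \<Longrightarrow> hd u = X0" "u @ [X1] \<in> B0 \<Longrightarrow> u \<noteq> [] \<Longrightarrow> last u = X0"
proof -
  assume a: "X1 # u \<in> B0" "u \<noteq> []"
  show "hd u = X0"
  proof (rule ccontr)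
    assume "hd u \<noteq> X0"
    then have "X1 # u = [] @ [X1, X1] @ tl u" using a(2) letter_not by (cases u) auto
    then show False using a(1) unfolding B0_iff by blast
  qed
next
  assume a: "u @ [X1] \<in> B0" "u \<noteq> []"
  show "last u = X0"
  proof (rule ccontr)
    assume "last u \<noteq> X0"
    then have "u @ [X1] = butlast u @ [X1, X1] @ []" using a(2) letter_not by (cases u rule: rev_cases) auto
    then show False using a(1) unfolding B0_iff by blast
  qed
qed

text \<open>If just one end of the word is \<open>X1\<close>, removing it leaves a word with
  \<open>X0\<close> at both ends, where \<open>T\<close> is 0. If both ends are \<open>X1\<close>,
  the inside is \<open>wb n\<close> or \<open>wad m n\<close>; reversal settles the first case, and
  turns the second into the symmetry \<open>bd\<close>.\<close>

lemma palindromic_commutes: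
  assumes rv: "\<And>w. T (rev w) = T w"
    and b: "\<And>n. T (wb n) = 0" and ad: "\<And>m n. T (wad m n) = 0"
    and bd: "\<And>m n. T (wbd (Suc m) n) = T (wbd (Suc n) m)" and w: "w \<in> B0"
  shows "lsh X1 T w = rsh T X1 w"
proof -
  have z: "T u = 0" if "u \<in> B0" "u \<noteq> []" "hd u = X0" "last u = X0" for u
    using B0_classify[OF that] b ad by auto
  have left: "lsh X1 T v = 0" if v: "v \<in> B0" "last v = X0" for v
  proof (cases "v \<noteq> [] \<and> hd v = X1")
    case True
    then obtain u where u: "v = X1 # u" by (cases v) auto
    have "u \<noteq> []" using v(2) u by auto
    moreover have "u \<in> B0" using v(1) u B0_factor[of "[X1]" u "[]"] by simp
    ultimately have "T u = 0" using z[of u] B0_X1_neighbour(1)[of u] v u by simp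
    then show ?thesis using u by (simp add: lsh_def)
  qed (auto simp: lsh_def)
  have lr: "rsh T X1 v = lsh X1 T (rev v)" for v
  proof (cases v rule: rev_exhaust)
    case (snoc u x) then show ?thesis using rv[of u] by (simp add: lsh_def rsh_def)
  qed (simp add: lsh_def rsh_def)
  show ?thesis
  proof (cases "w \<noteq> [] \<and> hd w = X1 \<and> last w = X1")
    case False
    show ?thesis
    proof (cases "w = []")
      case True then show ?thesis by (simp add: lsh_def rsh_def)
    next
      case ne: False
      have "lsh X1 T w = 0" 
      proof (cases "last w = X0")
        case True then show ?thesis using left w by blast
      next
        case f: False
        then have "hd w \<noteq> X1" using False ne letter_not by metis
        then show ?thesis by (simp add: lsh_def)
      qed
      moreover have "lsh X1 T (rev w) = 0"
      proof (cases "hd w = X0")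
        case True then show ?thesis using left[of "rev w"] w B0_rev ne by (simp add: last_rev)
      next
        case f: False
        then have "last w \<noteq> X1" using False ne letter_not by metis
        then show ?thesis using ne by (simp add: lsh_def hd_rev)
      qed
      ultimately show ?thesis by (simp add: lr)
    qed
  next
    case True
    then obtain v where v: "w = X1 # v" by (cases w) auto
    show ?thesis
    proof (cases "v = []")
      case True then show ?thesis using v by (simp add: lsh_def rsh_def)
    next
      case False
      then obtain u where u: "v = u @ [X1]" using True v by (metis append_butlast_last_id last_ConsR)
      have vB: "v \<in> B0" using w v B0_factor[of "[X1]" v "[]"] by simp
      have "u \<noteq> []" using B0_X1_neighbour(1)[of v] w v False u by auto
      moreover have "u \<in> B0" using vB u B0_factor[of "[]" u "[X1]"] by simp
      moreover have "hd u = X0" using B0_X1_neighbour(1)[of v] w v False u \<open>u \<noteq> []\<close> by simp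
      moreover have "last u = X0" using B0_X1_neighbour(2)[of u] vB u \<open>u \<noteq> []\<close> by simp
      ultimately consider n where "u = wb n" | m n where "u = wad m n" using B0_classify by blast
      then have "T (u @ [X1]) = T (X1 # u)"
      proof cases
        case 1
        then show ?thesis using rv[of "u @ [X1]"] by (simp add: rev_words)
      next
        case 2
        have e: "X1 # wad m n = wbd (Suc m) n" for m n using wpow_shift[of X1 X0 m] by (simp add: wad_def wbd_def wpow_Suc_right)
        have "rev (u @ [X1]) = X1 # wad n m" using 2 by (simp add: wad_def rev_wpow)
        then have "T (u @ [X1]) = T (wbd (Suc n) m)" using rv[of "u @ [X1]"] e by simp
        then show ?thesis using bd 2 e by simp
      qed
      then show ?thesis using v u by (simp add: lsh_def rsh_def)
    qed
  qed
qed

subsection \<open>A symmetric hypergeometric sum\<close>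

text \<open>Partial product of Euler's product for the sine; \<open>s\<close> stands for the square
  of the argument.\<close>

definition sine_partial :: "nat \<Rightarrow> real \<Rightarrow> real" where
  "sine_partial n s = (\<Prod>k\<in>{1..n}. 1 - s / real k ^ 2)"

definition uprod :: "real \<Rightarrow> real \<Rightarrow> nat \<Rightarrow> real" where
  "uprod x y n = (\<Prod>k\<in>{1..n}. (real k ^ 2 - x ^ 2) / (real k ^ 2 - y ^ 2))"

definition eterm :: "real \<Rightarrow> real \<Rightarrow> nat \<Rightarrow> real" where
  "eterm x y n = uprod x y n / (real (Suc n) * (real (Suc n) ^ 2 - y ^ 2))"

lemma uprod_0 [simp]: "uprod x y 0 = 1"
  by (simp add: uprod_def)

lemma uprod_Suc: "uprod x y (Suc n) = uprod x y n * ((real (Suc n) ^ 2 - x ^ 2) / (real (Suc n) ^ 2 - y ^ 2))"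
  by (simp add: uprod_def)

text \<open>Shows the summand, up to the factor \<open>real (Suc n)\<close>, as a difference of
  consecutive products; this is the input to the Abel summation in
  \<open>esum_bound\<close>.\<close>

lemma uprod_diff:
  assumes "real (Suc n) ^ 2 \<noteq> y ^ 2"
  shows "uprod x y (Suc n) - uprod x y n = (y ^ 2 - x ^ 2) * real (Suc n) * eterm x y n"
proof -
  have d: "real (Suc n) ^ 2 - y ^ 2 \<noteq> 0" using assms by simp
  have "uprod x y (Suc n) - uprod x y n = uprod x y n * ((real (Suc n) ^ 2 - x ^ 2) / (real (Suc n) ^ 2 - y ^ 2) - 1)"
    by (simp add: uprod_Suc algebra_simps)
  also have "(real (Suc n) ^ 2 - x ^ 2) / (real (Suc n) ^ 2 - y ^ 2) - 1 = (y ^ 2 - x ^ 2) / (real (Suc n) ^ 2 - y ^ 2)"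
    using d by (simp add: field_simps del: of_nat_Suc)
  finally show ?thesis
    by (simp add: eterm_def del: of_nat_Suc)
qed

definition nonint :: "real \<Rightarrow> bool" where "nonint y \<longleftrightarrow> (\<forall>k::int. y \<noteq> of_int k)"

lemma nonint_add_nat: "nonint y \<Longrightarrow> nonint (y + real n)"
  unfolding nonint_def by (metis add_diff_cancel_right' of_int_diff of_int_of_nat_eq)

lemma nonint_minus: "nonint y \<Longrightarrow> nonint (- y)"
  unfolding nonint_def by (metis minus_minus of_int_minus)

lemma nonint_nz: assumes "nonint y" shows "y + real n \<noteq> 0" "real n - y \<noteq> 0" "real n ^ 2 \<noteq> y ^ 2"
proof -
  have "y \<noteq> of_int (- int n)" "y \<noteq> of_int (int n)" using assms unfolding nonint_def by blast+
  then show "y + real n \<noteq> 0" "real n - y \<noteq> 0" "real n ^ 2 \<noteq> y ^ 2" by (auto simp: power2_eq_iff)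
qed

lemma nonint_nz':
  assumes "nonint y"
  shows "y \<noteq> 0" "1 + y \<noteq> 0" "real n + 1 - y \<noteq> 0" "real n + 1 + y \<noteq> 0" "real n + 2 + y \<noteq> 0"
    "real n - y \<noteq> 0" "real n + 1 \<noteq> 0"
proof -
  show "y \<noteq> 0" using nonint_nz(1)[OF assms, of 0] by simp
  show "1 + y \<noteq> 0" using nonint_nz(1)[OF assms, of 1] by (simp add: add.commute)
  show "real n + 1 - y \<noteq> 0" using nonint_nz(2)[OF assms, of "n + 1"] by simp
  show "real n + 1 + y \<noteq> 0" using nonint_nz(1)[OF assms, of "n + 1"] by (simp add: add_ac)
  show "real n + 2 + y \<noteq> 0" using nonint_nz(1)[OF assms, of "n + 2"] by (simp add: add_ac)
  show "real n - y \<noteq> 0" using nonint_nz(2)[OF assms, of n] by simp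
qed simp

text \<open>Since \<open>k^2 - (y + 1)^2 = (k - 1 - y) (k + 1 + y)\<close>, the shift moves each
  linear factor by one place, and the quotient of the products telescopes to boundary
  factors.\<close>

lemma uprod_shift:
  assumes y: "nonint y"
  shows "uprod x (y + 1) n = uprod x y n * (- ((real n - y) * (1 + y)) / (y * (real n + 1 + y)))"
proof (induction n)
  case 0
  have "y \<noteq> 0" "1 + y \<noteq> 0" using nonint_nz'(1,2)[OF y] by auto
  then show ?case by simp
next
  case (Suc n)
  define m where "m = real n"
  have rS: "real (Suc n) = m + 1" and rSS: "real (Suc (Suc n)) = m + 2" by (simp_all add: m_def)
  note nz = nonint_nz'(1,2)[OF y] nonint_nz'(3-)[OF y, of n, folded m_def]
  have f1: "(m + 1)\<^sup>2 - (y + 1)\<^sup>2 = (m - y) * (m + 2 + y)" by (simp add: power2_eq_square algebra_simps)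
  have f2: "(m + 1)\<^sup>2 - y\<^sup>2 = (m + 1 - y) * (m + 1 + y)" by (simp add: power2_eq_square algebra_simps)
  have "uprod x (y + 1) (Suc n) = uprod x y n * (- ((m - y) * (1 + y)) / (y * (m + 1 + y)))
      * (((m + 1)\<^sup>2 - x\<^sup>2) / ((m - y) * (m + 2 + y)))"
    by (simp only: uprod_Suc Suc.IH rS f1 m_def[symmetric])
  also have "\<dots> = uprod x y n * (((m + 1)\<^sup>2 - x\<^sup>2) / ((m + 1 - y) * (m + 1 + y)))
      * (- ((m + 1 - y) * (1 + y)) / (y * (m + 1 + 1 + y)))"
    using nz by (simp add: divide_simps)
  also have "\<dots> = uprod x y (Suc n) * (- ((real (Suc n) - y) * (1 + y)) / (y * (real (Suc n) + 1 + y)))"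
    by (simp only: uprod_Suc rS f2 m_def[symmetric])
  finally show ?case .
qed

text \<open>Gosper's algorithm applied to the difference of the summands at \<open>y + 1\<close> and \<open>y\<close>.\<close>

lemma eterm_shift:
  assumes y: "nonint y" and x: "x ^ 2 \<noteq> y ^ 2" "x ^ 2 \<noteq> (y + 1) ^ 2"
  defines "G \<equiv> \<lambda>n. (real (Suc n) + (y ^ 2 + y - x ^ 2)) / (real (Suc n) + y) * uprod x y n"
  defines "c \<equiv> (y ^ 2 - x ^ 2) * ((y + 1) ^ 2 - x ^ 2)"
  shows "eterm x (y + 1) n - eterm x y n = - ((1 + 2 * y) / (y * c)) * (G (Suc n) - G n)"
proof -
  define m where "m = real n"
  have rS: "real (Suc n) = m + 1" and rSS: "real (Suc (Suc n)) = m + 2" by (simp_all add: m_def)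
  define U where "U = uprod x y n"
  note nz = nonint_nz'(1,2)[OF y] nonint_nz'(3-)[OF y, of n, folded m_def]
  have cnz: "c \<noteq> 0" using x by (simp add: c_def)
  have f1: "(m + 1)\<^sup>2 - (y + 1)\<^sup>2 = (m - y) * (m + 2 + y)" by (simp add: power2_eq_square algebra_simps)
  have f2: "(m + 1)\<^sup>2 - y\<^sup>2 = (m + 1 - y) * (m + 1 + y)" by (simp add: power2_eq_square algebra_simps)
  have e1: "eterm x (y + 1) n = U * (- ((m - y) * (1 + y)) / (y * (m + 1 + y))) / ((m + 1) * ((m - y) * (m + 2 + y)))"
    unfolding eterm_def uprod_shift[OF y] rS f1 U_def m_def[symmetric] ..
  have e2: "eterm x y n = U / ((m + 1) * ((m + 1 - y) * (m + 1 + y)))"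
    unfolding eterm_def rS f2 U_def m_def[symmetric] ..
  have L: "eterm x (y + 1) n - eterm x y n
      = - (1 + 2 * y) * U / (y * ((m + 2 + y) * ((m + 1 - y) * (m + 1 + y))))"
    unfolding e1 e2 using nz by (simp add: divide_simps) (simp add: algebra_simps)
  have "G (Suc n) - G n = (m + 2 + (y ^ 2 + y - x ^ 2)) / (m + 2 + y) * (U * (((m + 1)\<^sup>2 - x\<^sup>2) / ((m + 1 - y) * (m + 1 + y))))
      - (m + 1 + (y ^ 2 + y - x ^ 2)) / (m + 1 + y) * U"
    by (simp only: G_def uprod_Suc rSS rS f2 U_def m_def[symmetric])
  also have "\<dots> = U * (((m + 2 + (y ^ 2 + y - x ^ 2)) * ((m + 1)\<^sup>2 - x\<^sup>2) - (m + 1 + (y ^ 2 + y - x ^ 2)) * ((m + 2 + y) * (m + 1 - y)))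
      / ((m + 2 + y) * ((m + 1 - y) * (m + 1 + y))))"
    using nz by (simp add: divide_simps) (simp add: algebra_simps)
  also have "(m + 2 + (y ^ 2 + y - x ^ 2)) * ((m + 1)\<^sup>2 - x\<^sup>2) - (m + 1 + (y ^ 2 + y - x ^ 2)) * ((m + 2 + y) * (m + 1 - y)) = c"
    unfolding c_def by (simp add: power2_eq_square algebra_simps)
  finally have R: "G (Suc n) - G n = U * (c / ((m + 2 + y) * ((m + 1 - y) * (m + 1 + y))))" .
  show ?thesis unfolding L R using nz cnz by (simp add: divide_simps) (simp add: algebra_simps)
qed

definition sinc :: "real \<Rightarrow> real" where "sinc x = sin (pi * x) / (pi * x)"

lemma sine_partial_tendsto:
  assumes "x \<noteq> 0"
  shows "(\<lambda>n. sine_partial n (x ^ 2)) \<longlonglongrightarrow> sinc x"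
proof -
  have "(\<lambda>n. pi * x * (\<Prod>k=1..n. 1 - x ^ 2 / real k ^ 2)) \<longlonglongrightarrow> sin (pi * x)"
    by (rule sin_product_formula_real)
  then have "(\<lambda>n. pi * x * sine_partial n (x ^ 2) / (pi * x)) \<longlonglongrightarrow> sin (pi * x) / (pi * x)"
    unfolding sine_partial_def by (intro tendsto_divide tendsto_const) (use assms in auto)
  then show ?thesis using assms by (simp add: sinc_def)
qed

lemma sin_pi_nonint: "nonint y \<Longrightarrow> sin (pi * y) \<noteq> 0"
  unfolding nonint_def by (metis mult_cancel_left mult.commute pi_neq_zero sin_zero_iff_int2)

lemma sinc_nz: "nonint y \<Longrightarrow> sinc y \<noteq> 0"
  using sin_pi_nonint[of y] nonint_nz'(1)[of y] by (simp add: sinc_def)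

lemma uprod_eq: "uprod x y n = sine_partial n (x ^ 2) / sine_partial n (y ^ 2)"
proof -
  have "(real k ^ 2 - x ^ 2) / (real k ^ 2 - y ^ 2) = (1 - x ^ 2 / real k ^ 2) / (1 - y ^ 2 / real k ^ 2)"
    if "k \<in> {1..n}" for k
  proof -
    have "real k ^ 2 \<noteq> 0" using that by simp
    then have "1 - x ^ 2 / real k ^ 2 = (real k ^ 2 - x ^ 2) / real k ^ 2"
        "1 - y ^ 2 / real k ^ 2 = (real k ^ 2 - y ^ 2) / real k ^ 2"
      by (simp_all add: diff_divide_distrib)
    then show ?thesis using \<open>real k ^ 2 \<noteq> 0\<close> by simp
  qed
  then show ?thesis
    unfolding uprod_def sine_partial_def prod_dividef[symmetric] by (intro prod.cong) auto
qed

definition ulim :: "real \<Rightarrow> real \<Rightarrow> real" where "ulim x y = sinc x / sinc y"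

lemma uprod_tendsto:
  assumes "x \<noteq> 0" "nonint y"
  shows "uprod x y \<longlonglongrightarrow> ulim x y"
  using assms sine_partial_tendsto[of x] sine_partial_tendsto[of y] sinc_nz[of y] nonint_nz'(1)[of y]
  unfolding uprod_eq ulim_def by (intro tendsto_divide) auto

text \<open>The sine only changes sign, so the limit grows linearly in \<open>j\<close>; this is the
  growth that \<open>esum_tendsto_0\<close> has to overcome.\<close>

lemma ulim_add_nat:
  assumes "nonint y"
  shows "ulim x (y + real j) = (- 1) ^ j * (y + real j) / y * ulim x y"
proof -
  have "sin (pi * (y + real j)) = (- 1) ^ j * sin (pi * y)"
    by (induction j) (simp_all add: algebra_simps sin_add)
  then have "sinc x / sinc (y + real j) = sinc x * (pi * (y + real j)) / ((- 1) ^ j * sin (pi * y))"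
    by (simp add: sinc_def)
  also have "\<dots> = (- 1) ^ j * (sinc x * (pi * (y + real j)) / sin (pi * y))"
    by (cases "even j") simp_all
  finally show ?thesis
    using nonint_nz'(1)[OF assms] by (simp add: ulim_def) (simp add: sinc_def)
qed

lemma eterm_summable:
  assumes "x \<noteq> 0" "nonint y"
  shows "summable (eterm x y)"
proof -
  have "Bseq (uprod x y)"
    using uprod_tendsto[OF assms] convergentI convergent_imp_Bseq by blast
  then obtain B where B: "B > 0" "\<And>n. \<bar>uprod x y n\<bar> \<le> B" by (auto simp: Bseq_def)
  have "eventually (\<lambda>n. real (Suc n) ^ 2 - y ^ 2 \<ge> real (Suc n)) at_top"
  proof -
    obtain K :: nat where K: "y ^ 2 \<le> real K" using real_arch_simple by blast
    show ?thesis
    proof (rule eventually_mono[OF eventually_ge_at_top[of K]])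
      fix n assume "K \<le> n"
      then have "y ^ 2 \<le> 1 * real n" using K by linarith
      also have "\<dots> \<le> real (Suc n) * real n" by (intro mult_right_mono) auto
      finally show "real (Suc n) ^ 2 - y ^ 2 \<ge> real (Suc n)" by (simp add: power2_eq_square algebra_simps)
    qed
  qed
  then have ev: "eventually (\<lambda>n. norm (eterm x y n) \<le> B * inverse (real (Suc n) ^ 2)) at_top"
  proof eventually_elim
    case (elim n)
    then have "real (Suc n) * real (Suc n) \<le> real (Suc n) * (real (Suc n) ^ 2 - y ^ 2)"
      by (intro mult_left_mono) auto
    then have "\<bar>uprod x y n\<bar> / (real (Suc n) * (real (Suc n) ^ 2 - y ^ 2)) \<le> B / real (Suc n) ^ 2"
      using B unfolding power2_eq_square[of "real (Suc n)"] by (intro frac_le) auto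
    moreover have "\<bar>real (Suc n) * (real (Suc n) ^ 2 - y ^ 2)\<bar> = real (Suc n) * (real (Suc n) ^ 2 - y ^ 2)"
      using elim by (intro abs_of_nonneg mult_nonneg_nonneg) auto
    ultimately show ?case by (simp add: eterm_def divide_inverse abs_mult)
  qed
  have "summable (\<lambda>n. inverse (real n ^ 2))" by (rule inverse_power_summable) simp
  then have "summable (\<lambda>n. inverse (real (Suc n) ^ 2))" by (subst summable_Suc_iff)
  then have "summable (\<lambda>n. B * inverse (real (Suc n) ^ 2))" by (rule summable_mult)
  then show ?thesis by (rule summable_comparison_test_ev[OF ev])
qed

section \<open>Size of the sum and its decay along \<open>y + j\<close>\<close>

definition esum :: "real \<Rightarrow> real \<Rightarrow> real" where "esum x y = (\<Sum>n. eterm x y n)"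

text \<open>Abel summation against \<open>1 / real (Suc n)\<close>: the boundary terms contribute at
  most \<open>B + 1\<close>, and the differences of reciprocals telescope to at most 1, contributing
  \<open>B\<close>. The factor \<open>y ^ 2 - x ^ 2\<close> provides the quadratic decay.\<close>

lemma esum_bound:
  assumes x: "x \<noteq> 0" and y: "nonint y" and B: "\<And>n. \<bar>uprod x y n\<bar> \<le> B"
  shows "\<bar>(y ^ 2 - x ^ 2) * esum x y\<bar> \<le> 2 * B + 1"
proof -
  have parts: "(y ^ 2 - x ^ 2) * (\<Sum>n<N. eterm x y n)
     = uprod x y N / real (Suc N) - 1 + (\<Sum>n<N. uprod x y (Suc n) * (1 / real (Suc n) - 1 / real (Suc (Suc n))))" for N
  proof (induction N)
    case (Suc N)
    have "(y ^ 2 - x ^ 2) * eterm x y N = (uprod x y (Suc N) - uprod x y N) / real (Suc N)"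
      using uprod_diff[of N y x] nonint_nz(3)[OF y, of "Suc N"] by (simp del: of_nat_Suc)
    then show ?case using Suc by (simp add: algebra_simps diff_divide_distrib del: of_nat_Suc)
  qed simp
  have tele: "(\<Sum>n<N. 1 / real (Suc n) - 1 / real (Suc (Suc n))) \<le> 1" for N
  proof -
    have "(\<Sum>n<N. 1 / real (Suc n) - 1 / real (Suc (Suc n))) = 1 - 1 / real (Suc N)"
      by (induction N) simp_all
    then show ?thesis by simp
  qed
  have B0: "B \<ge> 0" using B[of 0] by simp
  have "\<bar>(y ^ 2 - x ^ 2) * (\<Sum>n<N. eterm x y n)\<bar> \<le> 2 * B + 1" for N
  proof -
    have "\<bar>uprod x y N / real (Suc N)\<bar> \<le> \<bar>uprod x y N\<bar> / 1"
      unfolding abs_divide by (intro divide_left_mono) auto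
    then have 1: "\<bar>uprod x y N / real (Suc N)\<bar> \<le> B" using B[of N] by simp
    have "\<bar>\<Sum>n<N. uprod x y (Suc n) * (1 / real (Suc n) - 1 / real (Suc (Suc n)))\<bar>
       \<le> (\<Sum>n<N. B * (1 / real (Suc n) - 1 / real (Suc (Suc n))))"
    proof (rule order_trans[OF sum_abs], rule sum_mono)
      fix n
      have "1 / real (Suc n) - 1 / real (Suc (Suc n)) \<ge> 0" by (simp add: field_simps)
      then show "\<bar>uprod x y (Suc n) * (1 / real (Suc n) - 1 / real (Suc (Suc n)))\<bar> \<le> B * (1 / real (Suc n) - 1 / real (Suc (Suc n)))"
        unfolding abs_mult using B[of "Suc n"] by (intro mult_mono) auto
    qed
    also have "\<dots> \<le> B * 1"
      unfolding sum_distrib_left[symmetric] by (intro mult_left_mono tele B0)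
    finally show ?thesis unfolding parts using 1 by linarith
  qed
  moreover have "(\<lambda>N. \<bar>(y ^ 2 - x ^ 2) * (\<Sum>n<N. eterm x y n)\<bar>) \<longlonglongrightarrow> \<bar>(y ^ 2 - x ^ 2) * esum x y\<bar>"
    unfolding esum_def by (intro tendsto_rabs tendsto_mult tendsto_const summable_LIMSEQ eterm_summable x y)
  ultimately show ?thesis by (intro LIMSEQ_le_const2) auto
qed

text \<open>For \<open>y\<close> close to a large integer, \<open>max 1 \<bar>uprod x y n\<bar>\<close> increases with \<open>n\<close>.\<close>

lemma uprod_bound:
  assumes x: "x \<noteq> 0" "\<bar>x\<bar> < 1 / 2" and y: "nonint y" and N: "N \<ge> 2" "\<bar>y - real N\<bar> < 1 / 2"
  shows "\<bar>uprod x y n\<bar> \<le> max 1 \<bar>ulim x y\<bar>"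
proof -
  define f where "f k = \<bar>(real k ^ 2 - x ^ 2) / (real k ^ 2 - y ^ 2)\<bar>" for k
  have x2: "x ^ 2 \<le> 1 / 4" using x(2) power_mono[of "\<bar>x\<bar>" "1/2" 2] by (simp add: power2_eq_square)
  have ybd: "real N - 1 / 2 < y" "y < real N + 1 / 2" using N by linarith+
  have f_iff: "f k \<ge> 1 \<longleftrightarrow> real k ^ 2 - x ^ 2 \<ge> \<bar>real k ^ 2 - y ^ 2\<bar>" if "k \<ge> 1" for k
  proof -
    have "(1::real) \<le> real k ^ 2" using that by simp
    then have "\<bar>real k ^ 2 - x ^ 2\<bar> = real k ^ 2 - x ^ 2" using x2 by simp
    moreover have "\<bar>real k ^ 2 - y ^ 2\<bar> > 0" using nonint_nz(3)[OF y, of k] by simp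
    ultimately show ?thesis by (simp add: f_def field_simps)
  qed
  have big: "f k \<ge> 1" if "k \<ge> N" for k
  proof -
    have k1: "k \<ge> 1" using that N by simp
    have y0: "0 \<le> y" using ybd N by simp
    show ?thesis
    proof (cases "k = N")
      case True
      have N2: "real N * 2 \<le> real N ^ 2" using N unfolding power2_eq_square by (intro mult_left_mono) auto
      have "y ^ 2 \<le> (real N + 1 / 2) ^ 2" using ybd y0 by (intro power_mono) auto
      moreover have "(real N - 1 / 2) ^ 2 \<le> y ^ 2" using ybd N by (intro power_mono) auto
      ultimately have "y ^ 2 \<le> real N ^ 2 + real N + 1 / 4" "real N ^ 2 - real N + 1 / 4 \<le> y ^ 2"
        by (simp_all add: power2_eq_square algebra_simps)
      then show ?thesis unfolding f_iff[OF k1] using True x2 N2 N by (simp add: abs_le_iff)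
    next
      case False
      then have "real k \<ge> real N + 1" using that by simp
      then have "y ^ 2 \<le> real k ^ 2" using ybd y0 by (intro power_mono) auto
      moreover have "x ^ 2 \<le> y ^ 2" 
      proof -
        have "\<bar>x\<bar> \<le> y" using x ybd N by simp
        then show ?thesis using power_mono[of "\<bar>x\<bar>" y 2] by simp
      qed
      ultimately show ?thesis unfolding f_iff[OF k1] by simp
    qed
  qed
  have step: "f (Suc k) \<ge> 1" if "f k \<ge> 1" "k \<ge> 1" for k
  proof (cases "Suc k \<ge> N")
    case True then show ?thesis by (rule big)
  next
    case False
    then have "real k + 2 \<le> real N" by linarith
    then have "real (Suc k) < y" using ybd by simp
    then have *: "real (Suc k) ^ 2 \<le> y ^ 2" by (intro power_mono) auto
    have **: "real k ^ 2 \<le> real (Suc k) ^ 2" by (intro power_mono) auto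
    have "\<bar>real k ^ 2 - y ^ 2\<bar> \<le> real k ^ 2 - x ^ 2" using that f_iff by blast
    moreover have "1 \<le> Suc k" by simp
    ultimately show ?thesis unfolding f_iff[OF \<open>1 \<le> Suc k\<close>] using * ** by linarith
  qed
  have uS: "\<bar>uprod x y (Suc n)\<bar> = \<bar>uprod x y n\<bar> * f (Suc n)" for n
    by (simp add: uprod_Suc f_def abs_mult)
  \<comment> \<open>Invariant: the product is still at most 1 in absolute value, or the next factor
    is at least 1; by \<open>step\<close> the second alternative persists.\<close>
  have Q: "\<bar>uprod x y n\<bar> \<le> 1 \<or> f (Suc n) \<ge> 1" for n
  proof (induction n)
    case (Suc n)
    show ?case
    proof (cases "f (Suc n) \<ge> 1")
      case True
      then show ?thesis using step by simp
    next
      case False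
      then have "\<bar>uprod x y n\<bar> \<le> 1" "f (Suc n) \<le> 1" using Suc by auto
      then have "\<bar>uprod x y (Suc n)\<bar> \<le> 1" unfolding uS by (intro mult_le_one) (auto simp: f_def)
      then show ?thesis ..
    qed
  qed simp
  have "incseq (\<lambda>n. max 1 \<bar>uprod x y n\<bar>)"
  proof (rule incseq_SucI)
    fix n
    from Q[of n] show "max 1 \<bar>uprod x y n\<bar> \<le> max 1 \<bar>uprod x y (Suc n)\<bar>"
    proof
      assume "f (Suc n) \<ge> 1"
      then have "\<bar>uprod x y n\<bar> * 1 \<le> \<bar>uprod x y (Suc n)\<bar>" unfolding uS by (intro mult_left_mono) auto
      then show ?thesis by simp
    qed simp
  qed
  moreover have "(\<lambda>n. max 1 \<bar>uprod x y n\<bar>) \<longlonglongrightarrow> max 1 \<bar>ulim x y\<bar>"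
    by (intro tendsto_max tendsto_const tendsto_rabs uprod_tendsto x y)
  ultimately have "max 1 \<bar>uprod x y n\<bar> \<le> max 1 \<bar>ulim x y\<bar>" by (rule incseq_le)
  then show ?thesis by simp
qed

text \<open>The products are bounded linearly in \<open>j\<close> by \<open>uprod_bound\<close> and
  \<open>ulim_add_nat\<close>, and \<open>esum_bound\<close> divides by a quadratic. For
  \<open>j \<ge> 3\<close> the denominator \<open>(j - 1)^2 - 1\<close> is at least
  \<open>j^2 / 3\<close>.\<close>

lemma esum_tendsto_0:
  assumes x: "x \<noteq> 0" "\<bar>x\<bar> < 1 / 2" and y: "nonint y" "\<bar>y\<bar> < 1 / 2"
  shows "(\<lambda>j. esum x (y + real j)) \<longlonglongrightarrow> 0"
proof -
  define C where "C = \<bar>ulim x y / y\<bar>"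
  have bd: "norm (esum x (y + real j)) \<le> (2 * (1 + C * (real j + 1)) + 1) / ((real j - 1) ^ 2 - 1)" if "j \<ge> 3" for j
  proof -
    have ny: "nonint (y + real j)" using y nonint_add_nat by blast
    have "\<bar>ulim x (y + real j)\<bar> = C * \<bar>y + real j\<bar>"
      by (simp add: ulim_add_nat[OF y(1)] C_def abs_mult)
    also have "\<dots> \<le> C * (real j + 1)" using y by (intro mult_left_mono) (auto simp: C_def)
    finally have ul: "\<bar>ulim x (y + real j)\<bar> \<le> C * (real j + 1)" .
    have C0: "C \<ge> 0" by (simp add: C_def)
    have "\<bar>uprod x (y + real j) n\<bar> \<le> 1 + C * (real j + 1)" for n
    proof -
      have "\<bar>uprod x (y + real j) n\<bar> \<le> max 1 \<bar>ulim x (y + real j)\<bar>"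
        by (rule uprod_bound[OF x ny, of j]) (use that y in auto)
      also have "\<dots> \<le> 1 + C * (real j + 1)" using ul C0 by (simp add: max_def)
      finally show ?thesis .
    qed
    then have e: "\<bar>((y + real j) ^ 2 - x ^ 2) * esum x (y + real j)\<bar> \<le> 2 * (1 + C * (real j + 1)) + 1"
      by (rule esum_bound[OF x(1) ny])
    have "(real j - 1) ^ 2 \<le> (y + real j) ^ 2" using y that by (intro power_mono) auto
    moreover have "x ^ 2 \<le> 1" using x power_mono[of "\<bar>x\<bar>" 1 2] by simp
    ultimately have d: "(real j - 1) ^ 2 - 1 \<le> (y + real j) ^ 2 - x ^ 2" by simp
    have "(2::real) ^ 2 \<le> (real j - 1) ^ 2" using that by (intro power_mono) auto
    then have pos: "(real j - 1) ^ 2 - 1 > 0" by simp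
    have "((real j - 1) ^ 2 - 1) * \<bar>esum x (y + real j)\<bar> \<le> \<bar>((y + real j) ^ 2 - x ^ 2)\<bar> * \<bar>esum x (y + real j)\<bar>"
      using d by (intro mult_right_mono) auto
    then have "\<bar>esum x (y + real j)\<bar> * ((real j - 1) ^ 2 - 1) \<le> 2 * (1 + C * (real j + 1)) + 1"
      using e by (simp add: abs_mult mult.commute)
    then show ?thesis using pos by (simp add: pos_le_divide_eq)
  qed
  show ?thesis
  proof (rule Lim_null_comparison)
    show "eventually (\<lambda>j. norm (esum x (y + real j)) \<le> 3 * (3 + 4 * C) / real j) sequentially"
    proof (rule eventually_mono[OF eventually_ge_at_top[of 3]])
      fix j :: nat assume j: "3 \<le> j"
      have C0: "0 \<le> C" by (simp add: C_def)
      have j3: "3 \<le> real j" using j by simp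
      have "C * (real j + 1) \<le> C * (2 * real j)" using C0 j3 by (intro mult_left_mono) auto
      then have num: "2 * (1 + C * (real j + 1)) + 1 \<le> (3 + 4 * C) * real j" using j3 by (simp add: algebra_simps)
      have "real j * (real j / 3) \<le> real j * (real j - 2)" using j3 by (intro mult_left_mono) auto
      then have den: "real j * real j / 3 \<le> (real j - 1) ^ 2 - 1" by (simp add: power2_eq_square algebra_simps)
      have "(2 * (1 + C * (real j + 1)) + 1) / ((real j - 1) ^ 2 - 1) \<le> (3 + 4 * C) * real j / (real j * real j / 3)"
        using num den j3 C0 by (intro frac_le) auto
      also have "\<dots> = 3 * (3 + 4 * C) / real j" using j3 by simp
      finally show "norm (esum x (y + real j)) \<le> 3 * (3 + 4 * C) / real j" using bd[OF j] by linarith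
    qed
    show "(\<lambda>j. 3 * (3 + 4 * C) / real j) \<longlonglongrightarrow> 0" by (rule lim_const_over_n)
  qed
qed

text \<open>Equals \<open>(1 / (y - x) + 1 / (y + x)) / 2 - 1 / y\<close>, so its sum over the
  shifts \<open>y + k\<close> is a combination of digamma values.\<close>

definition psi_term :: "real \<Rightarrow> real \<Rightarrow> real" where "psi_term x y = x ^ 2 / (y * (y ^ 2 - x ^ 2))"
definition a_term :: "real \<Rightarrow> real \<Rightarrow> real" where "a_term x y = 1 / (y ^ 2 - x ^ 2)"

section \<open>The difference equation in \<open>y\<close> and its solution\<close>

lemma eventually_shifted_square:
  "eventually (\<lambda>n. (y + real n) ^ 2 - a \<ge> real n ^ 2 / 2 \<and>
     (y + real n) * ((y + real n) ^ 2 - a) \<ge> real n ^ 2 / 2) at_top"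
proof -
  obtain K :: nat where K: "16 * (\<bar>y\<bar> + \<bar>a\<bar> + 1) \<le> real K" using real_arch_simple by blast
  show ?thesis
  proof (rule eventually_mono[OF eventually_ge_at_top[of K]])
    fix n assume "K \<le> n"
    then have n: "16 * (\<bar>y\<bar> + \<bar>a\<bar> + 1) \<le> real n" using K by linarith
    have n1: "16 \<le> real n" using n by argo
    have ny: "3 / 4 * real n \<le> y + real n" using n by argo
    have sq: "(3 / 4 * real n) ^ 2 \<le> (y + real n) ^ 2" using n1 ny by (intro power_mono) auto
    have "real n * 1 \<le> real n * real n" using n1 by (intro mult_left_mono) auto
    moreover have "16 * a \<le> real n * 1" using n by argo
    ultimately have "16 * a \<le> real n * real n" by (rule order_trans[rotated])
    then have "16 * a \<le> real n ^ 2" by (simp only: power2_eq_square)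
    moreover have "(3 / 4 * real n) ^ 2 = 9 / 16 * real n ^ 2" by (simp add: power2_eq_square)
    moreover have n0: "real n ^ 2 \<ge> 0" by simp
    ultimately have 1: "(y + real n) ^ 2 - a \<ge> real n ^ 2 / 2" using sq by argo
    have yn: "1 \<le> y + real n" using n1 ny by argo
    have "1 * (real n ^ 2 / 2) \<le> (y + real n) * ((y + real n) ^ 2 - a)"
      by (rule mult_mono[OF yn 1]) (use yn n0 in argo)+
    with 1 show "(y + real n) ^ 2 - a \<ge> real n ^ 2 / 2 \<and> (y + real n) * ((y + real n) ^ 2 - a) \<ge> real n ^ 2 / 2"
      by simp
  qed
qed

text \<open>Summing \<open>eterm_shift\<close> leaves the limit of \<open>G\<close>, which is
  \<open>ulim x y\<close>, minus \<open>G 0\<close>. Partial fractions attach the differences of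
  \<open>a_term\<close> to \<open>ulim\<close> and collect the contribution of \<open>G 0\<close> in
  the two \<open>psi_term\<close>s.\<close>

lemma esum_shift:
  assumes x: "x \<noteq> 0" and y: "nonint y" and xy: "x ^ 2 \<noteq> y ^ 2" "x ^ 2 \<noteq> (y + 1) ^ 2"
  shows "x ^ 2 * (esum x (y + 1) - esum x y)
       = - (ulim x y / y) * x ^ 2 * (a_term x y - a_term x (y + 1)) + (psi_term x y + psi_term x (y + 1))"
proof -
  define G where "G n = (real (Suc n) + (y ^ 2 + y - x ^ 2)) / (real (Suc n) + y) * uprod x y n" for n
  define c where "c = (y ^ 2 - x ^ 2) * ((y + 1) ^ 2 - x ^ 2)"
  have y1: "nonint (y + 1)" using nonint_add_nat[OF y, of 1] by simp
  have nz: "y \<noteq> 0" "1 + y \<noteq> 0" using nonint_nz'(1,2)[OF y] .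
  have lim: "(\<lambda>n. (real (Suc n) + (y ^ 2 + y - x ^ 2)) / (real (Suc n) + y)) \<longlonglongrightarrow> 1"
  proof -
    have "filterlim (\<lambda>n. y + real (Suc n)) at_top sequentially"
      by (intro filterlim_tendsto_add_at_top[OF tendsto_const]
            filterlim_compose[OF filterlim_real_sequentially filterlim_Suc])
    then have "(\<lambda>n. (y ^ 2 - x ^ 2) / (y + real (Suc n))) \<longlonglongrightarrow> 0"
      by (intro tendsto_divide_0[OF tendsto_const] filterlim_at_top_imp_at_infinity)
    then have "(\<lambda>n. 1 + (y ^ 2 - x ^ 2) / (y + real (Suc n))) \<longlonglongrightarrow> 1 + 0"
      by (intro tendsto_add tendsto_const)
    moreover have "1 + (y ^ 2 - x ^ 2) / (y + real (Suc n)) = (real (Suc n) + (y ^ 2 + y - x ^ 2)) / (real (Suc n) + y)" for n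
      using nonint_nz(1)[OF y, of "Suc n"] by (simp add: field_simps)
    ultimately show ?thesis by (simp only: add_0_right)
  qed
  have "G \<longlonglongrightarrow> ulim x y"
    using tendsto_mult[OF lim uprod_tendsto[OF x y]] by (simp only: G_def[abs_def] mult_1)
  then have "(\<lambda>n. G (Suc n) - G n) sums (ulim x y - G 0)" by (rule telescope_sums)
  then have "(\<lambda>n. - ((1 + 2 * y) / (y * c)) * (G (Suc n) - G n)) sums (- ((1 + 2 * y) / (y * c)) * (ulim x y - G 0))"
    by (rule sums_mult)
  moreover have "- ((1 + 2 * y) / (y * c)) * (G (Suc n) - G n) = eterm x (y + 1) n - eterm x y n" for n
    using eterm_shift[OF y xy, of n] by (simp only: G_def c_def)
  moreover have "(\<lambda>n. eterm x (y + 1) n - eterm x y n) sums (esum x (y + 1) - esum x y)"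
    unfolding esum_def by (intro sums_diff summable_sums eterm_summable x y y1)
  ultimately have "esum x (y + 1) - esum x y = - ((1 + 2 * y) / (y * c)) * (ulim x y - G 0)"
    by (simp add: sums_iff)
  also have "G 0 = (1 + (y ^ 2 + y - x ^ 2)) / (1 + y)" by (simp add: G_def)
  finally have E: "esum x (y + 1) - esum x y = - ((1 + 2 * y) / (y * c)) * (ulim x y - (1 + (y ^ 2 + y - x ^ 2)) / (1 + y))" .
  define p q where "p = y ^ 2 - x ^ 2" and "q = (y + 1) ^ 2 - x ^ 2"
  have pq: "p \<noteq> 0" "q \<noteq> 0" using xy by (auto simp: p_def q_def)
  have qp: "q - p = 1 + 2 * y" by (simp add: p_def q_def power2_eq_square algebra_simps)
  have "1 + (y ^ 2 + y - x ^ 2) = (1 + y) + p" by (simp add: p_def)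
  then have "esum x (y + 1) - esum x y = - ((1 + 2 * y) / (y * (p * q))) * (ulim x y - ((1 + y) + p) / (1 + y))"
    using E by (simp add: c_def p_def q_def)
  also have "\<dots> = - (ulim x y / y) * ((q - p) / (p * q)) + (1 / (y * p) + 1 / ((y + 1) * q))"
    using nz pq unfolding qp by (simp add: divide_simps) (simp add: p_def q_def power2_eq_square algebra_simps)
  also have "(q - p) / (p * q) = 1 / p - 1 / q" using pq by (simp add: divide_simps)
  finally have F: "esum x (y + 1) - esum x y = - (ulim x y / y) * (1 / p - 1 / q) + (1 / (y * p) + 1 / ((y + 1) * q))" .
  show ?thesis
  proof -
    define A B1 B2 v where "A = 1 / p - 1 / q" and "B1 = 1 / (y * p)" and "B2 = 1 / ((y + 1) * q)" and "v = ulim x y / y"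
    have "x ^ 2 / (y * p) = x ^ 2 * B1" "x ^ 2 / ((y + 1) * q) = x ^ 2 * B2" by (simp_all add: B1_def B2_def)
    moreover have "x ^ 2 * (- v * A + (B1 + B2)) = - v * x ^ 2 * A + (x ^ 2 * B1 + x ^ 2 * B2)"
      by (simp add: algebra_simps)
    ultimately show ?thesis
      by (simp only: a_term_def psi_term_def p_def[symmetric] q_def[symmetric] F A_def[symmetric] B1_def[symmetric] B2_def[symmetric] v_def[symmetric])
  qed
qed

lemma sums_alternating_tail:
  fixes a :: "nat \<Rightarrow> real"
  assumes "(\<lambda>k. (- 1) ^ k * a k) sums S"
  shows "(\<lambda>k. (- 1) ^ k * (a k - a (Suc k))) sums (2 * S - a 0)"
proof -
  have "(\<lambda>k. (- 1) ^ Suc k * a (Suc k)) sums (S - a 0)"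
    using assms by (subst sums_Suc_iff) simp
  from sums_add[OF assms this] show ?thesis by (simp add: algebra_simps)
qed

lemma divide_half: "c / (a / 2) = 2 * c * inverse (a :: real)"
  by (cases "a = 0") (simp_all add: field_simps)

lemma summable_a: 
  assumes "nonint y" shows "summable (\<lambda>k. (- 1) ^ k * a_term x (y + real k))"
proof -
  have ev: "eventually (\<lambda>n. norm ((- 1) ^ n * a_term x (y + real n)) \<le> 2 * 1 * inverse (real n ^ 2)) at_top"
  proof -
    have "eventually (\<lambda>n. (y + real n) ^ 2 - x ^ 2 \<ge> real n ^ 2 / 2) at_top"
      by (rule eventually_mono[OF eventually_shifted_square[of y "x ^ 2"]]) (rule conjunct1)
    moreover have "eventually (\<lambda>n. n > 0) (at_top :: nat filter)" by (rule eventually_gt_at_top)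
    ultimately show ?thesis
    proof eventually_elim
      case (elim n)
      then have p: "0 < real n ^ 2 / 2" by simp
      have pos: "(y + real n) ^ 2 - x ^ 2 > 0" using p elim by linarith
      have "norm ((- 1) ^ n * a_term x (y + real n)) = 1 / ((y + real n) ^ 2 - x ^ 2)"
      proof -
        have "norm ((- 1) ^ n * a_term x (y + real n)) = \<bar>a_term x (y + real n)\<bar>"
          by (simp add: abs_mult power_abs)
        also have "\<dots> = a_term x (y + real n)"
          unfolding a_term_def by (intro abs_of_nonneg divide_nonneg_pos pos) simp
        finally show ?thesis by (simp only: a_term_def)
      qed
      also have "\<dots> \<le> 1 / (real n ^ 2 / 2)"
        by (rule divide_left_mono[OF elim(1) _ mult_pos_pos[OF pos p]]) simp
      also have "\<dots> = 2 * 1 * inverse (real n ^ 2)" by (rule divide_half)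
      finally show ?case .
    qed
  qed
  have "summable (\<lambda>n. 2 * 1 * inverse (real n ^ 2))" by (intro summable_mult inverse_power_summable) simp
  then show ?thesis by (rule summable_comparison_test_ev[OF ev])
qed

lemma summable_psi: 
  assumes "nonint y" shows "summable (\<lambda>k. psi_term x (y + real k))"
proof -
  have ev: "eventually (\<lambda>n. norm (psi_term x (y + real n)) \<le> 2 * x ^ 2 * inverse (real n ^ 2)) at_top"
  proof -
    have "eventually (\<lambda>n. (y + real n) * ((y + real n) ^ 2 - x ^ 2) \<ge> real n ^ 2 / 2) at_top"
      by (rule eventually_mono[OF eventually_shifted_square[of y "x ^ 2"]]) (rule conjunct2)
    moreover have "eventually (\<lambda>n. n > 0) (at_top :: nat filter)" by (rule eventually_gt_at_top)
    ultimately show ?thesis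
    proof eventually_elim
      case (elim n)
      then have p: "0 < real n ^ 2 / 2" by simp
      have pos: "(y + real n) * ((y + real n) ^ 2 - x ^ 2) > 0" using p elim by linarith
      have "norm (psi_term x (y + real n)) = x ^ 2 / ((y + real n) * ((y + real n) ^ 2 - x ^ 2))"
        unfolding psi_term_def real_norm_def using pos by (intro abs_of_nonneg divide_nonneg_pos) auto
      also have "\<dots> \<le> x ^ 2 / (real n ^ 2 / 2)"
        by (rule divide_left_mono[OF elim(1) _ mult_pos_pos[OF pos p]]) simp
      also have "\<dots> = 2 * x ^ 2 * inverse (real n ^ 2)" by (rule divide_half)
      finally show ?case .
    qed
  qed
  have "summable (\<lambda>n. 2 * x ^ 2 * inverse (real n ^ 2))" by (intro summable_mult inverse_power_summable) simp
  then show ?thesis by (rule summable_comparison_test_ev[OF ev])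
qed

text \<open>The difference equation is summed along \<open>y, y + 1, ...\<close>; the value 0 at
  infinity fixes the solution. The sign alternates because
  \<open>ulim x (y + real j) / (y + real j)\<close> is \<open>(- 1) ^ j\<close> times its value at
  \<open>j = 0\<close>.\<close>

lemma esum_formula:
  assumes x: "x \<noteq> 0" "\<bar>x\<bar> < 1 / 2" and y: "nonint y" "\<bar>y\<bar> < 1 / 2" and xy: "x ^ 2 \<noteq> y ^ 2"
  shows "x ^ 2 * esum x y = ulim x y / y * x ^ 2 * (2 * (\<Sum>k. (- 1) ^ k * a_term x (y + real k)) - a_term x y)
     - (2 * (\<Sum>k. psi_term x (y + real k)) - psi_term x y)"
proof -
  define v where "v = ulim x y / y"
  have ne: "x ^ 2 \<noteq> (y + real j) ^ 2" for j
  proof (cases j)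
    case (Suc i)
    have "\<bar>x\<bar> < \<bar>y + real j\<bar>" using x y Suc by auto
    then show ?thesis by (metis power2_abs less_irrefl power2_eq_iff_nonneg abs_ge_zero)
  qed (use xy in simp)
  have step: "x ^ 2 * esum x (y + real (Suc j)) - x ^ 2 * esum x (y + real j)
      = - v * x ^ 2 * ((- 1) ^ j * (a_term x (y + real j) - a_term x (y + real (Suc j))))
       + (psi_term x (y + real j) + psi_term x (y + real (Suc j)))" for j
  proof -
    have ny: "nonint (y + real j)" using y nonint_add_nat by blast
    have e: "y + real (Suc j) = y + real j + 1" by simp
    have "ulim x (y + real j) / (y + real j) = (- 1) ^ j * v"
      using nonint_nz(1)[OF y(1), of j] by (simp add: ulim_add_nat[OF y(1)] v_def)
    then show ?thesis
      using esum_shift[OF x(1) ny ne[of j]] ne[of "Suc j"] unfolding e by (simp add: algebra_simps)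
  qed
  have "(\<lambda>j. x ^ 2 * esum x (y + real j)) \<longlonglongrightarrow> x ^ 2 * 0"
    by (intro tendsto_mult tendsto_const esum_tendsto_0 x y)
  then have "(\<lambda>j. x ^ 2 * esum x (y + real (Suc j)) - x ^ 2 * esum x (y + real j)) sums (x ^ 2 * 0 - x ^ 2 * esum x (y + real 0))"
    by (rule telescope_sums)
  moreover have "(\<lambda>j. x ^ 2 * esum x (y + real (Suc j)) - x ^ 2 * esum x (y + real j)) sums
     (- v * x ^ 2 * (2 * (\<Sum>k. (- 1) ^ k * a_term x (y + real k)) - a_term x (y + real 0))
      + ((\<Sum>k. psi_term x (y + real k)) + ((\<Sum>k. psi_term x (y + real k)) - psi_term x (y + real 0))))"
    unfolding step
  proof (intro sums_add sums_mult)
    show "(\<lambda>k. (- 1) ^ k * (a_term x (y + real k) - a_term x (y + real (Suc k)))) sums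
       (2 * (\<Sum>k. (- 1) ^ k * a_term x (y + real k)) - a_term x (y + real 0))"
      by (rule sums_alternating_tail[OF summable_sums[OF summable_a[OF y(1)]]])
    show 1: "(\<lambda>k. psi_term x (y + real k)) sums (\<Sum>k. psi_term x (y + real k))"
      by (rule summable_sums[OF summable_psi[OF y(1)]])
    show "(\<lambda>k. psi_term x (y + real (Suc k))) sums ((\<Sum>k. psi_term x (y + real k)) - psi_term x (y + real 0))"
      using 1 by (subst sums_Suc_iff) simp
  qed
  ultimately have "x ^ 2 * 0 - x ^ 2 * esum x (y + real 0) = - v * x ^ 2 * (2 * (\<Sum>k. (- 1) ^ k * a_term x (y + real k)) - a_term x (y + real 0))
      + ((\<Sum>k. psi_term x (y + real k)) + ((\<Sum>k. psi_term x (y + real k)) - psi_term x (y + real 0)))"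
    by (rule sums_unique2)
  then show ?thesis by (simp add: v_def algebra_simps)
qed

text \<open>The generating function of the odd zeta values, with coefficient
  \<open>zeta (2 * n + 1)\<close> at \<open>z^(2 n)\<close> for \<open>n \<ge> 1\<close>, written
  after summing each geometric series.\<close>

definition zsum :: "real \<Rightarrow> real" where
  "zsum z = (\<Sum>k. z ^ 2 / (real (Suc k) * (real (Suc k) ^ 2 - z ^ 2)))"

lemma summable_zsum: "summable (\<lambda>k. z ^ 2 / (real (Suc k) * (real (Suc k) ^ 2 - z ^ 2)))"
proof -
  have ev: "eventually (\<lambda>n. norm (z ^ 2 / (real (Suc n) * (real (Suc n) ^ 2 - z ^ 2))) \<le> 2 * z ^ 2 * inverse (real n ^ 2)) at_top"
  proof -
    have "eventually (\<lambda>n. real (Suc n) * (real (Suc n) ^ 2 - z ^ 2) \<ge> real n ^ 2 / 2) at_top"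
      by (rule eventually_mono[OF eventually_shifted_square[of 1 "z ^ 2"]]) (simp add: add.commute)
    moreover have "eventually (\<lambda>n. n > 0) (at_top :: nat filter)" by (rule eventually_gt_at_top)
    ultimately show ?thesis
    proof eventually_elim
      case (elim n)
      then have p: "0 < real n ^ 2 / 2" by simp
      have pos: "real (Suc n) * (real (Suc n) ^ 2 - z ^ 2) > 0" using p elim by linarith
      have "norm (z ^ 2 / (real (Suc n) * (real (Suc n) ^ 2 - z ^ 2))) = z ^ 2 / (real (Suc n) * (real (Suc n) ^ 2 - z ^ 2))"
        unfolding real_norm_def using pos by (intro abs_of_nonneg divide_nonneg_pos) auto
      also have "\<dots> \<le> z ^ 2 / (real n ^ 2 / 2)"
        by (rule divide_left_mono[OF elim(1) _ mult_pos_pos[OF pos p]]) simp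
      also have "\<dots> = 2 * z ^ 2 * inverse (real n ^ 2)" by (rule divide_half)
      finally show ?case .
    qed
  qed
  have "summable (\<lambda>n. 2 * z ^ 2 * inverse (real n ^ 2))" by (intro summable_mult inverse_power_summable) simp
  then show ?thesis by (rule summable_comparison_test_ev[OF ev])
qed

lemma nonint_abs: "0 < \<bar>z\<bar> \<Longrightarrow> \<bar>z\<bar> < 1 \<Longrightarrow> nonint z"
  unfolding nonint_def
proof (intro allI notI)
  fix k :: int assume "0 < \<bar>z\<bar>" "\<bar>z\<bar> < 1" "z = of_int k"
  then have "0 < \<bar>k\<bar>" "real_of_int \<bar>k\<bar> < 1" by auto
  then show False by linarith
qed

lemma esum_minus: "esum x (- y) = esum x y"
  by (simp add: esum_def eterm_def uprod_def)

text \<open>\<open>esum\<close> is even and \<open>ulim x y / y\<close> odd in \<open>y\<close>. In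
  the average of the formulas at \<open>y\<close> and \<open>- y\<close> the terms with
  \<open>k = 0\<close> cancel, and partial fractions combine the remaining \<open>psi_term\<close>s
  into values of \<open>zsum\<close>.\<close>

lemma esum_closed_form:
  assumes x: "x \<noteq> 0" "\<bar>x\<bar> < 1 / 2" and y: "y \<noteq> 0" "\<bar>y\<bar> < 1 / 2" and xy: "x ^ 2 \<noteq> y ^ 2"
  shows "x ^ 2 * esum x y + zsum (x + y) + zsum (x - y) - 2 * zsum y
     = ulim x y / y * x ^ 2 * (\<Sum>k. (- 1) ^ Suc k * (a_term x (y + real (Suc k)) - a_term x (- y + real (Suc k))))"
proof -
  have ny: "nonint y" "nonint (- y)" using y by (auto intro!: nonint_abs)
  have f1: "x ^ 2 * esum x y = ulim x y / y * x ^ 2 * (2 * (\<Sum>k. (- 1) ^ k * a_term x (y + real k)) - a_term x y)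
     - (2 * (\<Sum>k. psi_term x (y + real k)) - psi_term x y)"
    by (rule esum_formula) (use assms ny in auto)
  have f2: "x ^ 2 * esum x (- y) = ulim x (- y) / (- y) * x ^ 2 * (2 * (\<Sum>k. (- 1) ^ k * a_term x (- y + real k)) - a_term x (- y))
     - (2 * (\<Sum>k. psi_term x (- y + real k)) - psi_term x (- y))"
    by (rule esum_formula) (use assms ny in auto)
  have u: "ulim x (- y) = ulim x y" by (simp add: ulim_def sinc_def)
  have a0: "a_term x (- y) = a_term x y" "psi_term x (- y) = - psi_term x y"
    by (simp_all add: a_term_def psi_term_def)
  have sa: "(\<Sum>k. (- 1) ^ k * a_term x (y' + real k)) = a_term x y' + (\<Sum>k. (- 1) ^ Suc k * a_term x (y' + real (Suc k)))"
    if "nonint y'" for y'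
    using suminf_split_head[OF summable_a[OF that, of x]] by simp
  have sp: "(\<Sum>k. psi_term x (y' + real k)) = psi_term x y' + (\<Sum>k. psi_term x (y' + real (Suc k)))"
    if "nonint y'" for y'
    using suminf_split_head[OF summable_psi[OF that, of x]] by simp
  have sa': "summable (\<lambda>k. (- 1) ^ Suc k * a_term x (y' + real (Suc k)))" if "nonint y'" for y'
    using summable_a[OF that, of x] by (subst summable_Suc_iff[where f = "\<lambda>k. (- 1) ^ k * a_term x (y' + real k)"])
  have sp': "summable (\<lambda>k. psi_term x (y' + real (Suc k)))" if "nonint y'" for y'
    using summable_psi[OF that, of x] by (subst summable_Suc_iff[where f = "\<lambda>k. psi_term x (y' + real k)"])
  define SA where "SA y' = (\<Sum>k. (- 1) ^ Suc k * a_term x (y' + real (Suc k)))" for y'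
  define SP where "SP y' = (\<Sum>k. psi_term x (y' + real (Suc k)))" for y'
  have g1: "x ^ 2 * esum x y = ulim x y / y * x ^ 2 * (2 * SA y + a_term x y) - (2 * SP y + psi_term x y)"
    unfolding f1 sa[OF ny(1)] sp[OF ny(1)] SA_def SP_def by simp
  have g2: "x ^ 2 * esum x y = - (ulim x y / y * x ^ 2 * (2 * SA (- y) + a_term x y)) - (2 * SP (- y) - psi_term x y)"
    using f2 unfolding esum_minus sa[OF ny(2)] sp[OF ny(2)] SA_def[symmetric] SP_def[symmetric] u a0 by simp
  define v where "v = ulim x y / y * x ^ 2"
  have "2 * (x ^ 2 * esum x y) = 2 * (v * (SA y - SA (- y))) - 2 * (SP y + SP (- y))"
    using arg_cong2[where f = "(+)", OF g1 g2] unfolding v_def[symmetric] by (simp add: algebra_simps)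
  then have g3: "x ^ 2 * esum x y = v * (SA y - SA (- y)) - (SP y + SP (- y))" by (simp only: right_diff_distrib[symmetric] mult_cancel_left) simp
  have SA: "SA y - SA (- y) = (\<Sum>k. (- 1) ^ Suc k * (a_term x (y + real (Suc k)) - a_term x (- y + real (Suc k))))"
    unfolding SA_def using suminf_diff[OF sa'[OF ny(1)] sa'[OF ny(2)]] by (simp only: right_diff_distrib)
  have "SP y + SP (- y) = (\<Sum>k. psi_term x (y + real (Suc k)) + psi_term x (- y + real (Suc k)))"
    unfolding SP_def by (rule suminf_add[OF sp'[OF ny(1)] sp'[OF ny(2)]])
  also have "\<dots> = (\<Sum>k. (x + y) ^ 2 / (real (Suc k) * (real (Suc k) ^ 2 - (x + y) ^ 2))
      + (x - y) ^ 2 / (real (Suc k) * (real (Suc k) ^ 2 - (x - y) ^ 2))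
      - 2 * (y ^ 2 / (real (Suc k) * (real (Suc k) ^ 2 - y ^ 2))))"
  proof (intro suminf_cong)
    fix k
    define m where "m = real (Suc k)"
    have m: "m \<ge> 1" by (simp add: m_def)
    have nz: "m \<noteq> 0" "m + y \<noteq> 0" "m - y \<noteq> 0" "m - x - y \<noteq> 0" "m + x + y \<noteq> 0" "m - x + y \<noteq> 0" "m + x - y \<noteq> 0"
      using m x y by auto
    have e: "(y + m)\<^sup>2 - x\<^sup>2 = (m + x + y) * (m - x + y)" "(- y + m)\<^sup>2 - x\<^sup>2 = (m + x - y) * (m - x - y)"
        "m\<^sup>2 - (x + y)\<^sup>2 = (m - x - y) * (m + x + y)" "m\<^sup>2 - (x - y)\<^sup>2 = (m - x + y) * (m + x - y)"
        "m\<^sup>2 - y\<^sup>2 = (m - y) * (m + y)"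
      by (simp_all add: power2_eq_square algebra_simps)
    have p: "x\<^sup>2 / ((m + y) * ((m + x + y) * (m - x + y))) = (1 / (m - x + y) + 1 / (m + x + y)) / 2 - 1 / (m + y)"
      using nz by (simp add: divide_simps) (simp add: power2_eq_square algebra_simps)
    have p': "x\<^sup>2 / ((m - y) * ((m + x - y) * (m - x - y))) = (1 / (m - x - y) + 1 / (m + x - y)) / 2 - 1 / (m - y)"
      using nz by (simp add: divide_simps) (simp add: power2_eq_square algebra_simps)
    have z1: "(x + y)\<^sup>2 / (m * ((m - x - y) * (m + x + y))) = (1 / (m - x - y) + 1 / (m + x + y)) / 2 - 1 / m"
      using nz by (simp add: divide_simps) (simp add: power2_eq_square algebra_simps)
    have z2: "(x - y)\<^sup>2 / (m * ((m - x + y) * (m + x - y))) = (1 / (m - x + y) + 1 / (m + x - y)) / 2 - 1 / m"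
      using nz by (simp add: divide_simps) (simp add: power2_eq_square algebra_simps)
    have z3: "y\<^sup>2 / (m * ((m - y) * (m + y))) = (1 / (m - y) + 1 / (m + y)) / 2 - 1 / m"
      using nz by (simp add: divide_simps) (simp add: power2_eq_square algebra_simps)
    have ym: "y + m = m + y" "- y + m = m - y" by simp_all
    show "psi_term x (y + real (Suc k)) + psi_term x (- y + real (Suc k)) = (x + y)\<^sup>2 / (real (Suc k) * ((real (Suc k))\<^sup>2 - (x + y)\<^sup>2))
      + (x - y)\<^sup>2 / (real (Suc k) * ((real (Suc k))\<^sup>2 - (x - y)\<^sup>2)) - 2 * (y\<^sup>2 / (real (Suc k) * ((real (Suc k))\<^sup>2 - y\<^sup>2)))"
      unfolding psi_term_def m_def[symmetric] e z1 z2 z3 unfolding ym p p' by (simp add: field_simps)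
  qed
  also have "\<dots> = zsum (x + y) + zsum (x - y) - 2 * zsum y"
    unfolding zsum_def
    by (subst suminf_diff[symmetric] suminf_add[symmetric] suminf_mult[symmetric] | intro summable_zsum summable_mult summable_add)+ simp
  finally have SP: "SP y + SP (- y) = zsum (x + y) + zsum (x - y) - 2 * zsum y" .
  show ?thesis using g3 unfolding SA SP v_def by simp
qed

text \<open>The alternating sum \<open>T\<close> in the closed form satisfies
  \<open>x T x y = y T y x\<close> term by term, and the squared factors turn the prefactors on both
  sides into \<open>x y sinc x sinc y\<close>.\<close>

theorem esum_symmetry:
  assumes x: "x \<noteq> 0" "\<bar>x\<bar> < 1 / 2" and y: "y \<noteq> 0" "\<bar>y\<bar> < 1 / 2" and xy: "x ^ 2 \<noteq> y ^ 2"
  shows "(y * sinc y) ^ 2 * (x ^ 2 * esum x y + zsum (x + y) + zsum (x - y) - 2 * zsum y)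
       = (x * sinc x) ^ 2 * (y ^ 2 * esum y x + zsum (x + y) + zsum (x - y) - 2 * zsum x)"
proof -
  have ny: "nonint y" "nonint x" using x y by (auto intro!: nonint_abs)
  define T where "T x y = (\<Sum>k. (- 1) ^ Suc k * (a_term x (y + real (Suc k)) - a_term x (- y + real (Suc k))))" for x y
  have T: "x * T x y = y * T y x"
  proof -
    have *: "x * ((- 1) ^ Suc k * (a_term x (y + real (Suc k)) - a_term x (- y + real (Suc k))))
      = y * ((- 1) ^ Suc k * (a_term y (x + real (Suc k)) - a_term y (- x + real (Suc k))))" for k
    proof -
      define m where "m = real (Suc k)"
      have m: "m \<ge> 1" by (simp add: m_def)
      have nz: "m - x - y \<noteq> 0" "m + x + y \<noteq> 0" "m - x + y \<noteq> 0" "m + x - y \<noteq> 0"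
        using m x y by auto
      have e: "(y + m)\<^sup>2 - x\<^sup>2 = (m + x + y) * (m - x + y)" "(- y + m)\<^sup>2 - x\<^sup>2 = (m + x - y) * (m - x - y)"
         "(x + m)\<^sup>2 - y\<^sup>2 = (m + x + y) * (m + x - y)" "(- x + m)\<^sup>2 - y\<^sup>2 = (m - x + y) * (m - x - y)"
        by (simp_all add: power2_eq_square algebra_simps)
      have "x * (a_term x (y + m) - a_term x (- y + m)) = y * (a_term y (x + m) - a_term y (- x + m))"
        unfolding a_term_def e using nz by (simp add: divide_simps) (simp add: algebra_simps)
      then show ?thesis unfolding m_def[symmetric] by (metis mult.left_commute)
    qed
    have sm: "summable (\<lambda>k. (- 1) ^ Suc k * (a_term x (y + real (Suc k)) - a_term x (- y + real (Suc k))))" if "nonint y" for x y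
    proof -
      have sa': "summable (\<lambda>k. (- 1) ^ Suc k * a_term x (y' + real (Suc k)))" if "nonint y'" for y'
        using summable_a[OF that, of x] by (subst summable_Suc_iff[where f = "\<lambda>k. (- 1) ^ k * a_term x (y' + real k)"])
      show ?thesis
        using summable_diff[OF sa'[OF that] sa'[OF nonint_minus[OF that]]] by (simp only: right_diff_distrib)
    qed
    have "x * T x y = (\<Sum>k. x * ((- 1) ^ Suc k * (a_term x (y + real (Suc k)) - a_term x (- y + real (Suc k)))))"
      unfolding T_def by (rule suminf_mult[symmetric, OF sm[OF ny(1)]])
    also have "\<dots> = y * T y x"
      unfolding T_def * by (rule suminf_mult[OF sm[OF ny(2)]])
    finally show ?thesis .
  qed
  have z: "zsum (y - x) = zsum (x - y)" "zsum (y + x) = zsum (x + y)"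
    by (simp_all add: zsum_def power2_commute add.commute)
  have L: "x ^ 2 * esum x y + zsum (x + y) + zsum (x - y) - 2 * zsum y = ulim x y / y * x ^ 2 * T x y"
    unfolding T_def by (rule esum_closed_form) (use assms in auto)
  have R: "y ^ 2 * esum y x + zsum (x + y) + zsum (x - y) - 2 * zsum x = ulim y x / x * y ^ 2 * T y x"
    unfolding T_def z[symmetric] by (rule esum_closed_form) (use assms in auto)
  have L': "(y * sinc y) ^ 2 * (ulim x y / y * x ^ 2 * T x y) = x * y * sinc x * sinc y * (x * T x y)"
    using y sinc_nz[OF ny(1)] by (simp add: ulim_def field_simps power2_eq_square)
  have R': "(x * sinc x) ^ 2 * (ulim y x / x * y ^ 2 * T y x) = x * y * sinc x * sinc y * (y * T y x)"
    using x sinc_nz[OF ny(2)] by (simp add: ulim_def field_simps power2_eq_square)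
  show ?thesis unfolding L R L' R' T ..
qed

no_notation Infinite_Set_Sum.abs_summable_on (infix "abs'_summable'_on" 50)

subsection \<open>Double power series\<close>

lemma has_sum_times:
  fixes f :: "'i \<Rightarrow> 'a::{real_normed_field,banach}"
  assumes f: "f abs_summable_on A" "(f has_sum a) A" and g: "g abs_summable_on B" "(g has_sum b) B"
  shows "((\<lambda>(x, y). f x * g y) has_sum a * b) (A \<times> B)" "(\<lambda>(x, y). f x * g y) abs_summable_on (A \<times> B)"
proof -
  show abs: "(\<lambda>(x, y). f x * g y) abs_summable_on (A \<times> B)"
    unfolding Infinite_Sum.abs_summable_on_Sigma_iff
  proof (intro conjI ballI)
    fix x assume "x \<in> A"
    show "(\<lambda>y. case (x, y) of (x, y) \<Rightarrow> f x * g y) abs_summable_on B"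
      using summable_on_cmult_right[OF g(1), of "norm (f x)"] by (simp add: norm_mult)
  next
    have "infsum (\<lambda>y. norm (case (x, y) of (x, y) \<Rightarrow> f x * g y)) B = norm (f x) * infsum (\<lambda>y. norm (g y)) B" for x
      by (simp add: norm_mult infsum_cmult_right')
    then show "(\<lambda>x. infsum (\<lambda>y. norm (case (x, y) of (x, y) \<Rightarrow> f x * g y)) B) abs_summable_on A"
      using summable_on_cmult_left[OF f(1), of "infsum (\<lambda>y. norm (g y)) B"]
      by (simp add: norm_mult infsum_nonneg)
  qed
  show "((\<lambda>(x, y). f x * g y) has_sum a * b) (A \<times> B)"
  proof (rule has_sum_SigmaI)
    show "((\<lambda>y. case (x, y) of (x, y) \<Rightarrow> f x * g y) has_sum f x * b) B" for x
      using has_sum_cmult_right[OF g(2), of "f x"] by simp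
    show "((\<lambda>x. f x * b) has_sum a * b) A" by (rule has_sum_cmult_left[OF f(2)])
    show "(\<lambda>(x, y). f x * g y) summable_on A \<times> B" by (rule abs_summable_summable[OF abs])
  qed
qed

definition dterm :: "(nat \<Rightarrow> nat \<Rightarrow> 'a::{real_normed_field,banach}) \<Rightarrow> 'a \<Rightarrow> 'a \<Rightarrow> nat \<times> nat \<Rightarrow> 'a" where
  "dterm f X Y = (\<lambda>(m, n). f m n * X ^ m * Y ^ n)"

text \<open>Absolute convergence is part of the notion, since the series are multiplied, transposed
  and regrouped along diagonals.\<close>

definition dsum :: "(nat \<Rightarrow> nat \<Rightarrow> 'a::{real_normed_field,banach}) \<Rightarrow> 'a \<Rightarrow> 'a \<Rightarrow> 'a \<Rightarrow> bool" where
  "dsum f X Y v \<longleftrightarrow> dterm f X Y abs_summable_on UNIV \<and> (dterm f X Y has_sum v) UNIV"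

definition dmult :: "(nat \<Rightarrow> nat \<Rightarrow> 'a::comm_ring_1) \<Rightarrow> (nat \<Rightarrow> nat \<Rightarrow> 'a) \<Rightarrow> nat \<Rightarrow> nat \<Rightarrow> 'a" where
  "dmult f g m n = (\<Sum>i\<le>m. \<Sum>j\<le>n. f i j * g (m - i) (n - j))"

lemma dterm_dmult_has_sum:
  fixes f g :: "nat \<Rightarrow> nat \<Rightarrow> 'a::{real_normed_field,banach}"
  assumes "dsum f X Y a" "dsum g X Y b"
  shows "(dterm (dmult f g) X Y has_sum a * b) UNIV"
proof -
  let ?h = "\<lambda>((i, j), (k, l)). dterm f X Y (i, j) * dterm g X Y (k, l)"
  let ?S = "SIGMA (m, n) : UNIV. {..m} \<times> {..n}"
  let ?\<phi> = "\<lambda>((m, n), (i, j)). ((i, j), (m - i, n - j)) :: (nat \<times> nat) \<times> (nat \<times> nat)"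
  have "((\<lambda>(p, q). dterm f X Y p * dterm g X Y q) has_sum a * b) (UNIV \<times> UNIV)"
    using assms unfolding dsum_def by (intro has_sum_times) auto
  then have 1: "(?h has_sum a * b) UNIV" by (simp add: case_prod_unfold)
  have bij: "bij_betw ?\<phi> ?S UNIV"
    by (rule bij_betwI[where g = "\<lambda>((i, j), (k, l)). ((i + k, j + l), (i, j))"]) auto
  have "((\<lambda>p. ?h (?\<phi> p)) has_sum a * b) ?S"
    using 1 by (subst has_sum_reindex_bij_betw[OF bij])
  then have "((\<lambda>mn. \<Sum>ij\<in>{..fst mn} \<times> {..snd mn}. ?h (?\<phi> (mn, ij))) has_sum a * b) UNIV"
    by (rule has_sum_SigmaD) (auto intro!: has_sum_finite simp: case_prod_unfold)
  moreover have "(\<Sum>ij\<in>{..fst mn} \<times> {..snd mn}. ?h (?\<phi> (mn, ij))) = dterm (dmult f g) X Y mn" for mn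
  proof -
    obtain m n where mn: "mn = (m, n)" by (cases mn)
    have "(\<Sum>ij\<in>{..m} \<times> {..n}. ?h (?\<phi> ((m, n), ij))) = (\<Sum>i\<le>m. \<Sum>j\<le>n. dterm f X Y (i, j) * dterm g X Y (m - i, n - j))"
      by (simp add: sum.cartesian_product case_prod_unfold)
    also have "\<dots> = (\<Sum>i\<le>m. \<Sum>j\<le>n. f i j * g (m - i) (n - j) * X ^ m * Y ^ n)"
    proof (intro sum.cong refl)
      fix i j assume "i \<in> {..m}" "j \<in> {..n}"
      then have "X ^ m = X ^ i * X ^ (m - i)" "Y ^ n = Y ^ j * Y ^ (n - j)" by (simp_all flip: power_add)
      then show "dterm f X Y (i, j) * dterm g X Y (m - i, n - j) = f i j * g (m - i) (n - j) * X ^ m * Y ^ n"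
        by (simp add: dterm_def)
    qed
    also have "\<dots> = dterm (dmult f g) X Y mn"
      by (simp add: mn dterm_def dmult_def sum_distrib_right)
    finally show ?thesis by (simp add: mn)
  qed
  ultimately show ?thesis by simp
qed

text \<open>Absolute convergence follows by applying the preceding lemma to the series of norms,
  which dominates the norms of the product coefficients.\<close>

lemma dsum_mult:
  fixes f g :: "nat \<Rightarrow> nat \<Rightarrow> 'a::{real_normed_field,banach}"
  assumes "dsum f X Y a" "dsum g X Y b"
  shows "dsum (dmult f g) X Y (a * b)"
proof -
  have nrm: "dsum (\<lambda>m n. norm (u m n)) (norm X) (norm Y) (infsum (\<lambda>p. norm (dterm u X Y p)) UNIV)"
    if "dsum u X Y c" for u :: "nat \<Rightarrow> nat \<Rightarrow> 'a" and c
  proof -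
    have e: "dterm (\<lambda>m n. norm (u m n)) (norm X) (norm Y) = (\<lambda>p. norm (dterm u X Y p))"
      by (simp add: dterm_def fun_eq_iff norm_mult norm_power)
    have "(\<lambda>p. norm (dterm u X Y p)) summable_on UNIV" using that by (simp add: dsum_def)
    then show ?thesis unfolding dsum_def e by simp
  qed
  have "dterm (dmult (\<lambda>m n. norm (f m n)) (\<lambda>m n. norm (g m n))) (norm X) (norm Y) summable_on UNIV"
    using dterm_dmult_has_sum[OF nrm[OF assms(1)] nrm[OF assms(2)]] by (rule has_sum_imp_summable)
  then have "dterm (dmult f g) X Y abs_summable_on UNIV"
  proof (rule Infinite_Sum.abs_summable_on_comparison_test')
    fix p :: "nat \<times> nat"
    obtain m n where p: "p = (m, n)" by (cases p)
    have "norm (dmult f g m n) \<le> dmult (\<lambda>m n. norm (f m n)) (\<lambda>m n. norm (g m n)) m n"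
      unfolding dmult_def by (intro order_trans[OF norm_sum] sum_mono) (simp add: norm_mult)
    then show "norm (dterm (dmult f g) X Y p) \<le> dterm (dmult (\<lambda>m n. norm (f m n)) (\<lambda>m n. norm (g m n))) (norm X) (norm Y) p"
      unfolding p dterm_def by (simp add: norm_mult norm_power mult_right_mono)
  qed
  then show ?thesis using dterm_dmult_has_sum[OF assms] by (simp add: dsum_def)
qed

lemma dsum_add:
  assumes "dsum f X Y a" "dsum g X Y b"
  shows "dsum (\<lambda>m n. f m n + g m n) X Y (a + b)"
proof -
  have e: "dterm (\<lambda>m n. f m n + g m n) X Y = (\<lambda>p. dterm f X Y p + dterm g X Y p)"
    by (auto simp: dterm_def fun_eq_iff algebra_simps)
  have "(\<lambda>p. dterm f X Y p + dterm g X Y p) abs_summable_on UNIV"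
    by (rule Infinite_Sum.abs_summable_on_comparison_test'[where g = "\<lambda>p. norm (dterm f X Y p) + norm (dterm g X Y p)"])
       (use assms in \<open>auto simp: dsum_def intro!: summable_on_add norm_triangle_ineq\<close>)
  then show ?thesis using assms unfolding dsum_def e by (auto intro!: has_sum_add)
qed

lemma dsum_cmult:
  assumes "dsum f X Y a"
  shows "dsum (\<lambda>m n. c * f m n) X Y (c * a)"
proof -
  have e: "dterm (\<lambda>m n. c * f m n) X Y = (\<lambda>p. c * dterm f X Y p)"
    by (auto simp: dterm_def fun_eq_iff algebra_simps)
  show ?thesis using assms summable_on_cmult_right[of "\<lambda>p. norm (dterm f X Y p)" UNIV "norm c"]
    unfolding dsum_def e by (auto intro!: has_sum_cmult_right simp: norm_mult)
qed

lemma dsum_diff: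
  assumes "dsum f X Y a" "dsum g X Y b"
  shows "dsum (\<lambda>m n. f m n - g m n) X Y (a - b)"
  using dsum_add[OF assms(1) dsum_cmult[OF assms(2), of "- 1"]] by simp

lemma dsum_swap:
  assumes "dsum f X Y a"
  shows "dsum (\<lambda>m n. f n m) Y X a"
proof -
  have e: "dterm (\<lambda>m n. f n m) Y X = (\<lambda>(x, y). dterm f X Y (y, x))"
    by (auto simp: dterm_def fun_eq_iff algebra_simps)
  have "(dterm f X Y has_sum a) (UNIV \<times> UNIV)" using assms by (simp add: dsum_def)
  then have 1: "(dterm (\<lambda>m n. f n m) Y X has_sum a) UNIV"
    unfolding e by (subst (asm) has_sum_swap) simp
  have "((\<lambda>p. norm (dterm f X Y p)) has_sum (infsum (\<lambda>p. norm (dterm f X Y p)) UNIV)) (UNIV \<times> UNIV)"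
    using assms by (simp add: dsum_def)
  then have "((\<lambda>(x, y). norm (dterm f X Y (y, x))) has_sum (infsum (\<lambda>p. norm (dterm f X Y p)) UNIV)) (UNIV \<times> UNIV)"
    by (subst (asm) has_sum_swap)
  then have "(\<lambda>p. norm (dterm (\<lambda>m n. f n m) Y X p)) summable_on UNIV"
    unfolding e by (simp add: case_prod_unfold has_sum_imp_summable)
  then show ?thesis using 1 by (simp add: dsum_def)
qed

lemma dsum_single:
  assumes "(\<lambda>m. norm (f m * X ^ m)) summable_on UNIV" "((\<lambda>m. f m * X ^ m) has_sum a) UNIV"
  shows "dsum (\<lambda>m n. if n = 0 then f m else 0) X Y a"
proof -
  let ?h = "\<lambda>m n. if n = 0 then f m else (0 :: 'a)"
  have inj: "inj (\<lambda>m. (m, 0 :: nat))" by (auto intro: injI)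
  have r: "range (\<lambda>m. (m, 0 :: nat)) = UNIV \<times> {0}" by auto
  have "(dterm ?h X Y has_sum a) (UNIV \<times> {0})"
    unfolding r[symmetric] has_sum_reindex[OF inj] using assms(2) by (simp add: o_def dterm_def)
  then have 1: "(dterm ?h X Y has_sum a) UNIV"
    by (rule has_sum_cong_neutral[THEN iffD1, rotated -1]) (auto simp: dterm_def split: if_splits)
  have "(\<lambda>p. norm (dterm ?h X Y p)) summable_on (UNIV \<times> {0})"
    unfolding r[symmetric] summable_on_reindex[OF inj] using assms(1) by (simp add: o_def dterm_def)
  then have "(\<lambda>p. norm (dterm ?h X Y p)) summable_on UNIV"
    by (rule summable_on_cong_neutral[THEN iffD1, rotated -1]) (auto simp: dterm_def split: if_splits)
  then show ?thesis using 1 by (simp add: dsum_def)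
qed

lemma dsum_abs_boundI:
  fixes f :: "nat \<Rightarrow> nat \<Rightarrow> real"
  assumes "\<And>m n. \<bar>f m n\<bar> \<le> K * a ^ m * a ^ n" "0 \<le> a" "\<bar>a * X\<bar> < 1" "\<bar>a * Y\<bar> < 1"
  shows "dsum f X Y (infsum (dterm f X Y) UNIV)"
proof -
  have geo: "(\<lambda>m. \<bar>c\<bar> ^ m) summable_on UNIV" if "\<bar>c\<bar> < 1" for c :: real
    using that by (intro summable_nonneg_imp_summable_on summable_geometric) auto
  have "(\<lambda>(m, n). \<bar>a * X\<bar> ^ m * \<bar>a * Y\<bar> ^ n) abs_summable_on (UNIV \<times> UNIV)"
    by (rule has_sum_times(2)[OF _ has_sum_infsum _ has_sum_infsum])
       (use geo[of "a * X"] geo[of "a * Y"] assms in simp_all)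
  then have "(\<lambda>(m, n). \<bar>a * X\<bar> ^ m * \<bar>a * Y\<bar> ^ n) summable_on UNIV"
    using abs_summable_summable by fastforce
  from summable_on_cmult_right[OF this, of K]
  have "(\<lambda>p. K * (case p of (m, n) \<Rightarrow> \<bar>a * X\<bar> ^ m * \<bar>a * Y\<bar> ^ n)) summable_on UNIV" .
  then have 1: "dterm f X Y abs_summable_on UNIV"
  proof (rule Infinite_Sum.abs_summable_on_comparison_test')
    fix p :: "nat \<times> nat"
    obtain m n where p: "p = (m, n)" by (cases p)
    have "\<bar>f m n\<bar> * \<bar>X\<bar> ^ m * \<bar>Y\<bar> ^ n \<le> (K * a ^ m * a ^ n) * \<bar>X\<bar> ^ m * \<bar>Y\<bar> ^ n"
      by (intro mult_right_mono assms) auto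
    then show "norm (dterm f X Y p) \<le> K * (case p of (m, n) \<Rightarrow> \<bar>a * X\<bar> ^ m * \<bar>a * Y\<bar> ^ n)"
      using assms(2) by (simp add: p dterm_def abs_mult power_abs power_mult_distrib mult_ac)
  qed
  then show ?thesis unfolding dsum_def using abs_summable_summable by fastforce
qed

text \<open>Once the earlier coefficients vanish, division by \<open>x ^ n\<close> leaves a power
  series that is 0 for small positive \<open>x\<close>; its limit at 0 is the coefficient
  \<open>a n\<close>.\<close>

lemma power_series_zero:
  fixes a :: "nat \<Rightarrow> real"
  assumes "r > 0" "\<And>x. 0 < x \<Longrightarrow> x < r \<Longrightarrow> (\<lambda>n. a n * x ^ n) sums 0"
  shows "a n = 0"
proof (induction n rule: less_induct)
  case (less n)
  define b where "b k = a (k + n)" for k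
  have s: "(\<lambda>k. b k * x ^ k) sums 0" if x: "0 < x" "x < r" for x
  proof -
    have "(\<lambda>k. a (k + n) * x ^ (k + n)) sums (0 - (\<Sum>i<n. a i * x ^ i))"
      by (rule sums_split_initial_segment[OF assms(2)[OF x]])
    moreover have "(\<Sum>i<n. a i * x ^ i) = 0" using less by simp
    ultimately have "(\<lambda>k. a (k + n) * x ^ (k + n) / x ^ n) sums (0 / x ^ n)"
      by (intro sums_divide) simp
    moreover have "a (k + n) * x ^ (k + n) / x ^ n = b k * x ^ k" for k
      using x by (simp add: b_def power_add)
    ultimately show ?thesis by simp
  qed
  define g where "g x = (\<Sum>k. b k * x ^ k)" for x
  have sm: "(\<lambda>k. b k * x ^ k) sums g x" if "norm x < r / 2" for x
    unfolding g_def using sums_summable[OF s[of "r / 2"]] assms(1) that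
    by (intro summable_sums powser_inside[of b "r / 2" x]) auto
  have "(g \<longlongrightarrow> b 0) (at 0)" by (rule powser_limit_0[of "r / 2", OF _ sm]) (use assms(1) in auto)
  then have "(g \<longlongrightarrow> b 0) (at_right 0)" by (rule tendsto_within_subset) simp
  moreover have "(g \<longlongrightarrow> 0) (at_right 0)"
  proof (rule tendsto_eventually)
    have "eventually (\<lambda>x. x \<in> {0<..<r}) (at_right 0)" by (rule eventually_at_right_real[OF assms(1)])
    then show "eventually (\<lambda>x. g x = 0) (at_right 0)"
      by eventually_elim (use s in \<open>auto simp: g_def sums_iff\<close>)
  qed
  ultimately have "b 0 = 0" using tendsto_unique trivial_limit_at_right_real by blast
  then show ?case by (simp add: b_def)
qed

text \<open>For fixed \<open>s\<close> the series in \<open>t\<close> vanishes on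
  \<open>(0, s)\<close>, so each of its coefficients is 0; these are power series in
  \<open>s\<close>. The region leaves out the diagonal, as \<open>esum_symmetry\<close>
  does.\<close>

lemma dsum_zero:
  fixes f :: "nat \<Rightarrow> nat \<Rightarrow> real"
  assumes "r > 0" "\<And>s t. 0 < t \<Longrightarrow> t < s \<Longrightarrow> s < r \<Longrightarrow> dsum f s t 0"
  shows "f m n = 0"
proof -
  have 1: "(\<lambda>m. f m n * s ^ m) sums 0" if s: "0 < s" "s < r" for s n
  proof -
    have sm: "(\<lambda>m. f m n * s ^ m) summable_on UNIV" for n
    proof -
      have "dterm f s (s / 2) summable_on UNIV" using assms(2)[of "s / 2" s] s by (auto simp: dsum_def intro: has_sum_imp_summable)
      then have "dterm f s (s / 2) summable_on ((\<lambda>m. (m, n)) ` UNIV)"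
        by (rule summable_on_subset_banach) auto
      then have "(\<lambda>m. f m n * s ^ m * (s / 2) ^ n) summable_on UNIV"
        by (subst (asm) summable_on_reindex) (auto intro: injI simp: o_def dterm_def)
      from summable_on_cmult_left[OF this, of "1 / (s / 2) ^ n"] show ?thesis using s by simp
    qed
    define a where "a n = infsum (\<lambda>m. f m n * s ^ m) UNIV" for n
    have "a n = 0" for n
    proof (rule power_series_zero[of s])
      fix t :: real assume t: "0 < t" "t < s"
      have "(dterm (\<lambda>m n. f n m) t s has_sum 0) (UNIV \<times> UNIV)"
        using dsum_swap[OF assms(2)[OF t s(2)]] by (simp add: dsum_def)
      then have "((\<lambda>n. a n * t ^ n) has_sum 0) UNIV"
      proof (rule has_sum_SigmaD)
        fix n
        show "((\<lambda>m. dterm (\<lambda>m n. f n m) t s (n, m)) has_sum a n * t ^ n) UNIV"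
          using has_sum_cmult_left[OF has_sum_infsum[OF sm[of n]], of "t ^ n"] by (simp add: a_def dterm_def mult_ac)
      qed
      then show "(\<lambda>n. a n * t ^ n) sums 0" by (rule has_sum_imp_sums)
    qed (use s in auto)
    then show ?thesis using has_sum_imp_sums[OF has_sum_infsum[OF sm[of n]]] by (simp add: a_def)
  qed
  show ?thesis by (rule power_series_zero[OF assms(1), of "\<lambda>m. f m n"]) (use 1 in auto)
qed

subsection \<open>Values of the associator\<close>

text \<open>
  \<open>pcoef w\<close> is the Taylor series of \<open>L w\<close> at \<open>0\<close> when \<open>w\<close> does not begin with \<open>X0\<close>. On reversed
  words the recursion is structural.
\<close>

primrec rcoef :: "word \<Rightarrow> nat \<Rightarrow> real" where
  "rcoef [] m = (if m = 0 then 1 else 0)"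
| "rcoef (i # u) m = (case i of X0 \<Rightarrow> rcoef u m / real m | X1 \<Rightarrow> - (\<Sum>k<m. rcoef u k) / real m)"

definition pcoef :: "word \<Rightarrow> nat \<Rightarrow> real" where "pcoef w = rcoef (rev w)"

lemma pcoef_Nil: "pcoef [] m = (if m = 0 then 1 else 0)"
  and pcoef_X0: "pcoef (w @ [X0]) m = pcoef w m / real m"
  and pcoef_X1: "pcoef (w @ [X1]) m = - (\<Sum>k<m. pcoef w k) / real m"
  by (simp_all add: pcoef_def)

lemma pcoef_0: "w \<noteq> [] \<Longrightarrow> pcoef w 0 = 0"
  by (cases w rule: rev_exhaust) (auto simp: pcoef_def split: letter.split)

lemma pcoef_bound: "\<bar>pcoef w m\<bar> \<le> 1"
proof (induction w arbitrary: m rule: rev_induct)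
  case (snoc i w)
  show ?case
  proof (cases i)
    case X0
    have "\<bar>pcoef w m\<bar> / real m \<le> 1"
    proof (cases "m = 0")
      case False
      then have "1 \<le> real m" by simp
      then show ?thesis using snoc[of m] by (simp add: field_simps)
    qed simp
    then show ?thesis by (simp add: X0 pcoef_X0)
  next
    case X1
    have "\<bar>\<Sum>k<m. pcoef w k\<bar> \<le> (\<Sum>k<m. 1)"
      by (rule order_trans[OF sum_abs]) (intro sum_mono snoc)
    then have "\<bar>\<Sum>k<m. pcoef w k\<bar> / real m \<le> 1" by (cases "m = 0") (simp_all add: field_simps)
    then show ?thesis by (simp add: X1 pcoef_X1)
  qed
qed (simp add: pcoef_Nil)

definition pfps :: "word \<Rightarrow> complex fps" where "pfps w = Abs_fps (\<lambda>m. of_real (pcoef w m))"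

lemma pfps_radius: "fps_conv_radius (pfps w) \<ge> 1"
  unfolding fps_conv_radius_def
proof (rule conv_radius_geI_ex')
  fix r :: real assume r: "0 < r" "ereal r < 1"
  then have r1: "r < 1" by simp
  show "summable (\<lambda>n. fps_nth (pfps w) n * of_real r ^ n)"
  proof (rule summable_comparison_test'[where N = 0])
    show "summable (\<lambda>n. r ^ n)" using r r1 by (intro summable_geometric) simp
    fix n
    have "\<bar>pcoef w n\<bar> * r ^ n \<le> 1 * r ^ n" using r by (intro mult_right_mono pcoef_bound) simp
    then show "norm (fps_nth (pfps w) n * of_real r ^ n) \<le> r ^ n"
      using r by (simp add: pfps_def norm_mult norm_power)
  qed
qed

lemma pfps_X0:
  assumes "w \<noteq> []"
  shows "fps_X * fps_deriv (pfps (w @ [X0])) = pfps w"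
proof (rule fps_ext)
  fix n show "fps_nth (fps_X * fps_deriv (pfps (w @ [X0]))) n = fps_nth (pfps w) n"
    using pcoef_0[OF assms] by (cases n) (simp_all add: pfps_def pcoef_X0 del: of_nat_Suc)
qed

lemma pfps_X1: "fps_X * fps_deriv (pfps (w @ [X1])) - fps_deriv (pfps (w @ [X1])) = pfps w"
proof (rule fps_ext)
  fix n
  have d: "fps_nth (fps_deriv (pfps (w @ [X1]))) n = - (\<Sum>k<Suc n. of_real (pcoef w k))" for n
  proof -
    have "fps_nth (fps_deriv (pfps (w @ [X1]))) n = of_nat (Suc n) * of_real (- (\<Sum>k<Suc n. pcoef w k) / real (Suc n))"
      by (simp only: fps_deriv_nth pfps_def fps_nth_Abs_fps pcoef_X1 Suc_eq_plus1)
    also have "of_nat (Suc n) = complex_of_real (real (Suc n))" by simp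
    also have "complex_of_real (real (Suc n)) * of_real (- (\<Sum>k<Suc n. pcoef w k) / real (Suc n)) = of_real (- (\<Sum>k<Suc n. pcoef w k))"
      unfolding of_real_mult[symmetric] by (simp del: of_nat_Suc)
    finally show ?thesis by simp
  qed
  define D where "D = fps_deriv (pfps (w @ [X1]))"
  have dD: "fps_nth D n = - (\<Sum>k<Suc n. of_real (pcoef w k))" for n unfolding D_def by (rule d)
  have "fps_nth (fps_X * D - D) n = fps_nth (pfps w) n"
    by (cases n) (simp_all add: dD pfps_def)
  then show "fps_nth (fps_X * fps_deriv (pfps (w @ [X1])) - fps_deriv (pfps (w @ [X1]))) n = fps_nth (pfps w) n"
    by (simp only: D_def)
qed

text \<open>A connected part of the slit plane inside the disc of convergence, with 0 on its
  boundary: constants of integration are read off there.\<close>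

definition half_disc :: "complex set" where "half_disc = {z. 0 < Re z} \<inter> ball 0 1"

lemma half_disc: "open half_disc" "connected half_disc" "half_disc \<subseteq> slit_domain" "at 0 within half_disc \<noteq> bot"
proof -
  show "open half_disc" unfolding half_disc_def by (intro open_Int open_Collect_less continuous_intros open_ball)
  have "convex half_disc" unfolding half_disc_def
    using convex_halfspace_Re_gt[of 0] by (intro convex_Int convex_ball) auto
  then show "connected half_disc" by (rule convex_connected)
  show "half_disc \<subseteq> slit_domain"
  proof
    fix z assume z: "z \<in> half_disc"
    then have "0 < Re z" "norm z < 1" by (auto simp: half_disc_def)
    moreover have "Re z \<le> norm z" by (rule complex_Re_le_cmod)
    ultimately show "z \<in> slit_domain" by (simp add: slit_domain_iff)
  qed
  have "0 islimpt half_disc"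
    unfolding islimpt_approachable
  proof (intro allI impI)
    fix e :: real assume "e > 0"
    then show "\<exists>x'\<in>half_disc. x' \<noteq> 0 \<and> dist x' 0 < e"
      by (intro bexI[of _ "of_real (min (e/2) (1/2))"]) (auto simp: half_disc_def min_def)
  qed
  then show "at 0 within half_disc \<noteq> bot" by (simp add: trivial_limit_within)
qed

lemma L_eq_pfps:
  assumes "w \<noteq> [] \<longrightarrow> hd w = X1" "z \<in> half_disc"
  shows "L w z = eval_fps (pfps w) z"
  using assms
proof (induction w arbitrary: z rule: rev_induct)
  case Nil
  have "pfps [] = 1" by (simp add: fps_eq_iff pfps_def pcoef_Nil)
  then show ?case using half_disc(3) Nil.prems by (auto simp: poly_sol_Nil[OF poly_sol_L])
next
  case (snoc i w)
  have hw: "w \<noteq> [] \<longrightarrow> hd w = X1" using snoc.prems(1) by (cases w) auto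
  let ?P = "pfps (w @ [i])"
  have rad: "ereal (norm z) < fps_conv_radius (pfps u)" "ereal (norm z) < fps_conv_radius (fps_deriv (pfps u))"
    if "z \<in> half_disc" for z u
  proof -
    have "ereal (norm z) < 1" using that by (simp add: half_disc_def)
    also note pfps_radius[of u]
    finally show "ereal (norm z) < fps_conv_radius (pfps u)" .
    also note fps_conv_radius_deriv[of "pfps u"]
    finally show "ereal (norm z) < fps_conv_radius (fps_deriv (pfps u))" .
  qed
  have ev: "eval_fps (fps_deriv ?P) z = L w z / (z - pt i)" if z: "z \<in> half_disc" for z
  proof -
    have z01: "z \<noteq> 0" "z \<noteq> 1" using z by (auto simp: half_disc_def)
    have X: "eval_fps (fps_X * fps_deriv ?P) z = z * eval_fps (fps_deriv ?P) z"
      using rad(2)[OF z] by (subst eval_fps_mult) auto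
    show ?thesis
    proof (cases i)
      case X0
      then have "w \<noteq> []" using snoc.prems(1) by auto
      then have "z * eval_fps (fps_deriv ?P) z = eval_fps (pfps w) z"
        using X pfps_X0[of w] X0 by simp
      then show ?thesis using snoc.IH[OF hw z] z01 X0 by (simp add: field_simps)
    next
      case X1
      have "ereal (norm z) < fps_conv_radius (fps_X * fps_deriv ?P)"
        using rad(2)[OF z, of "w @ [i]"] fps_conv_radius_mult[of fps_X "fps_deriv ?P"] by (auto simp: min_def split: if_splits)
      then have "eval_fps (fps_X * fps_deriv ?P - fps_deriv ?P) z = z * eval_fps (fps_deriv ?P) z - eval_fps (fps_deriv ?P) z"
        using rad(2)[OF z, of "w @ [i]"] by (subst eval_fps_diff) (auto simp: X)
      then have "(z - 1) * eval_fps (fps_deriv ?P) z = eval_fps (pfps w) z"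
        using pfps_X1[of w] X1 by (simp add: algebra_simps)
      then show ?thesis using snoc.IH[OF hw z] z01 X1 by (simp add: field_simps)
    qed
  qed
  have "((\<lambda>z. L (w @ [i]) z - eval_fps ?P z) has_field_derivative 0) (at z)" if z: "z \<in> half_disc" for z
  proof -
    have zs: "z \<in> slit_domain" using z half_disc(3) by blast
    show ?thesis
      using DERIV_diff[OF poly_sol_deriv[OF poly_sol_L zs, of w i] has_field_derivative_eval_fps[OF rad(1)[OF z, of "w @ [i]"], where A = UNIV]]
      by (simp add: ev[OF z])
  qed
  then have "(\<lambda>z. L (w @ [i]) z - eval_fps ?P z) constant_on half_disc"
    by (rule has_field_derivative_0_imp_constant_on[OF _ half_disc(2,1)])
  then obtain c where c: "\<And>z. z \<in> half_disc \<Longrightarrow> L (w @ [i]) z - eval_fps ?P z = c"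
    unfolding constant_on_def by blast
  have X1: "X1 \<in> set (w @ [i])" using snoc.prems(1) by (metis hd_in_set snoc_eq_iff_butlast)
  then have np: "\<nexists>n. w @ [i] = replicate n X0" by (metis in_set_replicate letter.distinct(1))
  have 1: "(L (w @ [i]) \<longlongrightarrow> 0) (at 0 within half_disc)"
    using L_tendsto_0[OF np, of 0] half_disc(3) tendsto_within_subset by fastforce
  have "isCont (eval_fps ?P) 0"
    by (rule DERIV_isCont[OF has_field_derivative_eval_fps]) (use pfps_radius[of "w @ [i]"] in \<open>auto simp: zero_ereal_def[symmetric] intro: less_le_trans[of _ 1]\<close>)
  then have "(eval_fps ?P \<longlongrightarrow> eval_fps ?P 0) (at 0 within half_disc)"
    using tendsto_within_subset[OF _ subset_UNIV] by (simp add: isCont_def)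
  moreover have "eval_fps ?P 0 = 0" by (simp add: eval_fps_at_0 pfps_def pcoef_0)
  ultimately have "((\<lambda>z. L (w @ [i]) z - eval_fps ?P z) \<longlongrightarrow> 0 - 0) (at 0 within half_disc)"
    using 1 by (intro tendsto_diff) simp_all
  moreover have "((\<lambda>z. L (w @ [i]) z - eval_fps ?P z) \<longlongrightarrow> c) (at 0 within half_disc)"
    by (rule tendsto_eventually) (auto simp: eventually_at_filter c)
  ultimately have "c = 0" using tendsto_unique[OF half_disc(4)] by fastforce
  then show ?case using c[OF snoc.prems(2)] by simp
qed

text \<open>Both sides are the limit of \<open>L w x\<close> for real \<open>x\<close> tending to 1
  from below; absolute summability dominates the power series uniformly.\<close>

lemma Zser_eq_suminf:
  assumes w: "w \<noteq> []" "hd w = X1" "last w = X0" and sm: "summable (\<lambda>m. \<bar>pcoef w m\<bar>)"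
  shows "Zser w = (\<Sum>m. pcoef w m)"
proof -
  have "((\<lambda>x. \<Sum>m. pcoef w m * x ^ m) \<longlongrightarrow> (\<Sum>m. pcoef w m)) (at_left 1)"
  proof (rule tannerys_theorem[where M = "\<lambda>m. \<bar>pcoef w m\<bar>", THEN conjunct2, THEN conjunct2])
    fix k
    have "((\<lambda>x. pcoef w k * x ^ k) \<longlongrightarrow> pcoef w k * 1 ^ k) (at_left 1)"
      by (intro tendsto_intros)
    then show "((\<lambda>x. pcoef w k * x ^ k) \<longlongrightarrow> pcoef w k) (at_left 1)" by simp
  next
    have "eventually (\<lambda>x::real. x \<in> {0<..<1}) (at_left 1)" by (rule eventually_at_left_real) simp
    then have "eventually (\<lambda>p::nat \<times> real. snd p \<in> {0<..<1}) (at_top \<times>\<^sub>F at_left 1)"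
      by (rule eventually_compose_filterlim[OF _ filterlim_snd])
    then show "\<forall>\<^sub>F (k, x) in sequentially \<times>\<^sub>F at_left 1. norm (pcoef w k * x ^ k) \<le> \<bar>pcoef w k\<bar>"
    proof eventually_elim
      case (elim p)
      then have "\<bar>snd p\<bar> ^ fst p \<le> 1" by (intro power_le_one) auto
      then have "\<bar>pcoef w (fst p)\<bar> * \<bar>snd p\<bar> ^ fst p \<le> \<bar>pcoef w (fst p)\<bar> * 1" by (intro mult_left_mono) auto
      then show ?case by (simp add: case_prod_unfold abs_mult power_abs)
    qed
  qed (use sm in auto)
  moreover have "((\<lambda>x. \<Sum>m. pcoef w m * x ^ m) \<longlongrightarrow> Zser w) (at_left 1)"
  proof -
    have fl: "filterlim complex_of_real (at 1 within slit_domain) (at_left 1)"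
      unfolding filterlim_at
    proof
      show "(complex_of_real \<longlongrightarrow> 1) (at_left 1)" by (auto intro!: tendsto_eq_intros)
      have "eventually (\<lambda>x::real. x \<in> {0<..<1}) (at_left 1)" by (rule eventually_at_left_real) simp
      then show "\<forall>\<^sub>F x in at_left 1. complex_of_real x \<in> slit_domain \<and> complex_of_real x \<noteq> 1"
        by eventually_elim (auto simp: slit_domain_iff)
    qed
    from tendsto_Re[OF filterlim_compose[OF L_tendsto_Zser[OF w(3,1)] fl]]
    have "((\<lambda>x. Re (L w (of_real x))) \<longlongrightarrow> Zser w) (at_left 1)" by simp
    moreover have "eventually (\<lambda>x. Re (L w (of_real x)) = (\<Sum>m. pcoef w m * x ^ m)) (at_left 1)"
    proof -
      have "eventually (\<lambda>x::real. x \<in> {0<..<1}) (at_left 1)" by (rule eventually_at_left_real) simp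
      then show ?thesis
      proof eventually_elim
        case (elim x)
        then have "of_real x \<in> half_disc" by (auto simp: half_disc_def)
        then have "L w (of_real x) = (\<Sum>m. of_real (pcoef w m) * of_real x ^ m)"
          using L_eq_pfps[of w "of_real x"] w by (simp add: eval_fps_def pfps_def)
        also have "\<dots> = (\<Sum>m. of_real (pcoef w m * x ^ m))" by simp
        also have "\<dots> = of_real (\<Sum>m. pcoef w m * x ^ m)"
        proof (rule suminf_of_real[symmetric])
          show "summable (\<lambda>m. pcoef w m * x ^ m)"
          proof (rule summable_comparison_test'[OF sm, of 0])
            fix m
            have "\<bar>x\<bar> ^ m \<le> 1" using elim by (intro power_le_one) auto
            then have "\<bar>pcoef w m\<bar> * \<bar>x\<bar> ^ m \<le> \<bar>pcoef w m\<bar> * 1" by (intro mult_left_mono) auto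
            then show "norm (pcoef w m * x ^ m) \<le> \<bar>pcoef w m\<bar>" by (simp add: abs_mult power_abs)
          qed
        qed
        finally show ?case by simp
      qed
    qed
    ultimately show ?thesis by (rule Lim_transform_eventually)
  qed
  ultimately show ?thesis using tendsto_unique trivial_limit_at_left_real by blast
qed

section \<open>Appending \<open>X1 X0\<close> as an operator on summable sequences\<close>

definition absum :: "(nat \<Rightarrow> real) \<Rightarrow> real \<Rightarrow> bool" where
  "absum g B \<longleftrightarrow> summable (\<lambda>m. \<bar>g m\<bar>) \<and> (\<Sum>m. \<bar>g m\<bar>) \<le> B"

definition top_op :: "(nat \<Rightarrow> real) \<Rightarrow> nat \<Rightarrow> real" where
  "top_op g m = - (\<Sum>k<m. g k) / real m ^ 2"

lemma pcoef_X1X0: "pcoef (w @ [X1, X0]) = top_op (pcoef w)"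
  using pcoef_X0[of "w @ [X1]"] by (simp add: fun_eq_iff pcoef_X1 top_op_def power2_eq_square)

lemma absum_partial:
  assumes "absum g B" "finite A" shows "\<bar>\<Sum>k\<in>A. g k\<bar> \<le> B" "(\<Sum>k\<in>A. \<bar>g k\<bar>) \<le> B"
proof -
  show "(\<Sum>k\<in>A. \<bar>g k\<bar>) \<le> B"
    using sum_le_suminf[of "\<lambda>m. \<bar>g m\<bar>" A] assms by (auto simp: absum_def)
  then show "\<bar>\<Sum>k\<in>A. g k\<bar> \<le> B" using sum_abs[of g A] by linarith
qed

lemma absum_suminf: "absum g B \<Longrightarrow> \<bar>\<Sum>m. g m\<bar> \<le> B"
  unfolding absum_def using summable_rabs[of g] by linarith

lemma absum_summable: "absum g B \<Longrightarrow> summable g"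
  unfolding absum_def using summable_rabs_cancel by blast

lemma absum_nonneg: "absum g B \<Longrightarrow> B \<ge> 0"
  using absum_suminf[of g B] by simp

lemma absum_comparison:
  assumes "absum g B" "\<And>m. \<bar>f m\<bar> \<le> \<bar>g m\<bar>" shows "absum f B"
proof -
  have a: "summable (\<lambda>m. \<bar>g m\<bar>)" "(\<Sum>m. \<bar>g m\<bar>) \<le> B" using assms(1) by (auto simp: absum_def)
  have s: "summable (\<lambda>m. \<bar>f m\<bar>)"
    by (rule summable_comparison_test'[OF a(1), of 0]) (simp only: real_norm_def abs_abs assms(2))
  show ?thesis
    unfolding absum_def using s order_trans[OF suminf_le[OF assms(2) s a(1)] a(2)] by blast
qed

lemma inverse_squares: "summable (\<lambda>m. 1 / real m ^ 2)" "(\<Sum>m. 1 / real m ^ 2) \<le> 3"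
proof -
  have s: "(\<lambda>m. 1 / real (Suc m) ^ 2) sums (pi\<^sup>2 / 6)"
    using inverse_squares_sums by (simp add: add.commute)
  then have s': "(\<lambda>m. 1 / real m ^ 2) sums (pi\<^sup>2 / 6)"
    using sums_Suc_iff[of "\<lambda>m. 1 / real m ^ 2" "pi\<^sup>2 / 6"] by simp
  then show "summable (\<lambda>m. 1 / real m ^ 2)" by (rule sums_summable)
  have "pi ^ 2 \<le> 4 ^ 2" using pi_less_4 pi_gt_zero by (intro power_mono) auto
  then show "(\<Sum>m. 1 / real m ^ 2) \<le> 3" using s' by (simp add: sums_iff)
qed

text \<open>Every partial sum is at most \<open>B\<close>, and the inverse squares sum to at most 3.
  This constant is the source of the radius \<open>1 / 3\<close> below.\<close>

lemma absum_top_op: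
  assumes "absum g B" shows "absum (top_op g) (3 * B)"
proof -
  have b: "\<bar>top_op g m\<bar> \<le> B * (1 / real m ^ 2)" for m
    using absum_partial(1)[OF assms, of "{..<m}"] by (simp add: top_op_def abs_divide divide_right_mono)
  have s: "summable (\<lambda>m. B * (1 / real m ^ 2))" by (intro summable_mult inverse_squares)
  have s': "summable (\<lambda>m. \<bar>top_op g m\<bar>)"
    by (rule summable_comparison_test'[OF s, of 0]) (simp only: real_norm_def abs_abs b)
  have "(\<Sum>m. \<bar>top_op g m\<bar>) \<le> (\<Sum>m. B * (1 / real m ^ 2))" by (rule suminf_le[OF b s' s])
  also have "\<dots> = B * (\<Sum>m. 1 / real m ^ 2)" by (intro suminf_mult inverse_squares)
  also have "\<dots> \<le> B * 3" by (intro mult_left_mono inverse_squares absum_nonneg[OF assms])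
  finally show ?thesis using s' by (simp add: absum_def)
qed

lemma absum_top_op_pow: "absum g B \<Longrightarrow> absum ((top_op ^^ b) g) (3 ^ b * B)"
  by (induction b) (use absum_top_op in \<open>auto simp: mult.assoc\<close>)

text \<open>The recursion for the partial sums up to \<open>N\<close> of the generating function in
  \<open>t\<close> of the iterates of \<open>top_op\<close>. At fixed \<open>N\<close> the sum over
  all iterates obeys a first-order recursion, which replaces the nested sums.\<close>

primrec hrec :: "(nat \<Rightarrow> real) \<Rightarrow> real \<Rightarrow> nat \<Rightarrow> real" where
  "hrec g t 0 = g 0"
| "hrec g t (Suc N) = hrec g t N * (1 - t / real (Suc N) ^ 2) + g (Suc N)"

lemma summable_absum_pow:
  assumes "absum g B" "\<bar>t\<bar> < 1 / 3" "\<And>b. \<bar>A b\<bar> \<le> 3 ^ b * B"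
  shows "summable (\<lambda>b. A b * t ^ b)" "summable (\<lambda>b. B * (3 * \<bar>t\<bar>) ^ b)" "\<bar>A b * t ^ b\<bar> \<le> B * (3 * \<bar>t\<bar>) ^ b"
proof -
  show *: "\<bar>A b * t ^ b\<bar> \<le> B * (3 * \<bar>t\<bar>) ^ b" for b
    using mult_right_mono[OF assms(3)[of b], of "\<bar>t\<bar> ^ b"] by (simp add: abs_mult power_abs power_mult_distrib mult_ac)
  show s: "summable (\<lambda>b. B * (3 * \<bar>t\<bar>) ^ b)" using assms(2) by (intro summable_mult summable_geometric) simp
  show "summable (\<lambda>b. A b * t ^ b)" by (rule summable_comparison_test'[OF s, of 0]) (simp only: real_norm_def *)
qed

lemma hrec_sums:
  assumes g: "absum g B" and t: "\<bar>t\<bar> < 1 / 3"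
  shows "(\<lambda>b. (\<Sum>m\<le>N. (top_op ^^ b) g m) * t ^ b) sums hrec g t N"
proof (induction N)
  case 0
  have "(top_op ^^ b) g 0 = 0" if "b \<noteq> 0" for b using that by (cases b) (simp_all add: top_op_def)
  then have "(\<lambda>b. (top_op ^^ b) g 0 * t ^ b) sums (\<Sum>b\<in>{0}. (top_op ^^ b) g 0 * t ^ b)"
    by (intro sums_finite) auto
  then show ?case by simp
next
  case (Suc N)
  have "(\<lambda>b. - (t / real (Suc N) ^ 2) * ((\<Sum>m\<le>N. (top_op ^^ b) g m) * t ^ b)) sums (- (t / real (Suc N) ^ 2) * hrec g t N)"
    by (rule sums_mult[OF Suc])
  moreover have "- (t / real (Suc N) ^ 2) * ((\<Sum>m\<le>N. (top_op ^^ b) g m) * t ^ b) = (top_op ^^ Suc b) g (Suc N) * t ^ Suc b" for b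
    by (simp add: top_op_def lessThan_Suc_atMost del: of_nat_Suc sum.lessThan_Suc)
  ultimately have "(\<lambda>b. (top_op ^^ Suc b) g (Suc N) * t ^ Suc b) sums (- (t / real (Suc N) ^ 2) * hrec g t N)"
    by (simp only:)
  then have "(\<lambda>b. (top_op ^^ b) g (Suc N) * t ^ b) sums (- (t / real (Suc N) ^ 2) * hrec g t N + g (Suc N))"
    using sums_Suc_iff[of "\<lambda>b. (top_op ^^ b) g (Suc N) * t ^ b"] by simp
  from sums_add[OF Suc this] show ?case by (simp add: algebra_simps del: of_nat_Suc)
qed

text \<open>The limit in \<open>N\<close> may be taken inside the sum over \<open>b\<close>: the l1
  bounds \<open>3 ^ b * B\<close> give the geometric majorant.\<close>

lemma hrec_limit:
  assumes g: "absum g B" and t: "\<bar>t\<bar> < 1 / 3" and lim: "hrec g t \<longlonglongrightarrow> l"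
  shows "(\<lambda>b. (\<Sum>m. (top_op ^^ b) g m) * t ^ b) sums l"
proof -
  have ab: "absum ((top_op ^^ b) g) (3 ^ b * B)" for b by (rule absum_top_op_pow[OF g])
  have "(\<lambda>N. \<Sum>b. (\<Sum>m\<le>N. (top_op ^^ b) g m) * t ^ b) \<longlonglongrightarrow> (\<Sum>b. (\<Sum>m. (top_op ^^ b) g m) * t ^ b)"
  proof (rule tannerys_theorem[where M = "\<lambda>b. B * (3 * \<bar>t\<bar>) ^ b", THEN conjunct2, THEN conjunct2])
    show "(\<lambda>N. (\<Sum>m\<le>N. (top_op ^^ b) g m) * t ^ b) \<longlonglongrightarrow> (\<Sum>m. (top_op ^^ b) g m) * t ^ b" for b
      by (intro tendsto_mult tendsto_const summable_LIMSEQ' absum_summable[OF ab])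
    show "\<forall>\<^sub>F (b, N) in sequentially \<times>\<^sub>F sequentially. norm ((\<Sum>m\<le>N. (top_op ^^ b) g m) * t ^ b) \<le> B * (3 * \<bar>t\<bar>) ^ b"
      using summable_absum_pow(3)[OF g t, of "\<lambda>b. \<Sum>m\<le>_. (top_op ^^ b) g m"] absum_partial(1)[OF ab]
      by (intro always_eventually) auto
    show "summable (\<lambda>b. B * (3 * \<bar>t\<bar>) ^ b)"
      by (rule summable_absum_pow(2)[OF g t, of "\<lambda>_. 0"]) (use absum_nonneg[OF g] in simp)
  qed simp
  moreover have "(\<lambda>N. \<Sum>b. (\<Sum>m\<le>N. (top_op ^^ b) g m) * t ^ b) = hrec g t"
    using hrec_sums[OF g t] by (simp add: sums_iff fun_eq_iff)
  ultimately have "(\<Sum>b. (\<Sum>m. (top_op ^^ b) g m) * t ^ b) = l" using lim LIMSEQ_unique by metis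
  moreover have "summable (\<lambda>b. (\<Sum>m. (top_op ^^ b) g m) * t ^ b)"
    by (rule summable_absum_pow(1)[OF g t]) (rule absum_suminf[OF ab])
  ultimately show ?thesis by (simp add: sums_iff)
qed

lemma wd_Suc: "wd (Suc n) = wd n @ [X1, X0]"
  by (simp add: wd_def wpow_Suc_right)

lemma wbd_Suc: "wbd m (Suc n) = wbd m n @ [X1, X0]"
  by (simp add: wbd_def wpow_Suc_right)

lemma wbd_0: "wbd m 0 = wd m @ [X0]"
  by (simp add: wbd_def wd_def)

lemma pcoef_wd: "pcoef (wd n) = (top_op ^^ n) (pcoef [])"
proof (induction n)
  case 0
  show ?case by (simp add: wd_def)
qed (simp add: wd_Suc pcoef_X1X0)

lemma pcoef_wbd: "pcoef (wbd m n) = (top_op ^^ n) (pcoef (wbd m 0))"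
  by (induction n) (simp_all only: wbd_Suc pcoef_X1X0 funpow.simps o_apply id_apply)

lemma absum_pcoef_Nil: "absum (pcoef []) 1"
proof -
  have "(\<lambda>m. \<bar>pcoef [] m\<bar>) sums 1"
    using sums_single[of 0 "\<lambda>_. 1 :: real"] by (simp add: pcoef_Nil if_distrib[of abs] cong: if_cong)
  then show ?thesis by (simp add: absum_def sums_iff)
qed

lemma absum_pcoef_wd: "absum (pcoef (wd n)) (3 ^ n)"
  using absum_top_op_pow[OF absum_pcoef_Nil, of n] by (simp add: pcoef_wd)

lemma absum_pcoef_wbd: "absum (pcoef (wbd m n)) (3 ^ n * 3 ^ m)"
proof -
  have "absum (pcoef (wbd m 0)) (3 ^ m)"
  proof (rule absum_comparison[OF absum_pcoef_wd])
    fix k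
    show "\<bar>pcoef (wbd m 0) k\<bar> \<le> \<bar>pcoef (wd m) k\<bar>"
    proof (cases "k = 0")
      case False
      then have "1 \<le> real k" by simp
      then have "\<bar>pcoef (wd m) k\<bar> / real k \<le> \<bar>pcoef (wd m) k\<bar> / 1" by (intro divide_left_mono) auto
      then show ?thesis by (simp add: wbd_0 pcoef_X0)
    qed (simp add: wbd_0 pcoef_X0)
  qed
  from absum_top_op_pow[OF this] show ?thesis by (simp only: pcoef_wbd[of m n])
qed

lemma Zser_wd: "Zser (wd n) = (\<Sum>m. (top_op ^^ n) (pcoef []) m)"
proof (cases "n = 0")
  case True
  have "pcoef [] sums 1"
    using sums_single[of 0 "\<lambda>_. 1 :: real"] by (simp add: pcoef_Nil[abs_def] cong: if_cong)
  then show ?thesis using True by (simp add: wd_def sums_iff)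
next
  case False
  have "Zser (wd n) = (\<Sum>m. pcoef (wd n) m)"
    by (rule Zser_eq_suminf) (use False absum_pcoef_wd[of n] in \<open>auto simp: absum_def wd_def\<close>)
  then show ?thesis by (simp only: pcoef_wd)
qed

lemma Zser_wbd: "m \<noteq> 0 \<Longrightarrow> Zser (wbd m n) = (\<Sum>k. pcoef (wbd m n) k)"
proof -
  assume m: "m \<noteq> 0"
  show ?thesis
  proof (rule Zser_eq_suminf)
    show "wbd m n \<noteq> []" by (simp add: wbd_def)
    show "hd (wbd m n) = X1" using m by (intro hd_wbd) simp
    show "last (wbd m n) = X0" by (rule last_wbd)
    show "summable (\<lambda>k. \<bar>pcoef (wbd m n) k\<bar>)" using absum_pcoef_wbd by (simp add: absum_def)
  qed
qed

lemma sine_partial_Suc: "sine_partial (Suc N) t = sine_partial N t * (1 - t / real (Suc N) ^ 2)"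
  by (simp add: sine_partial_def)

lemma sine_partial_0 [simp]: "sine_partial 0 t = 1"
  by (simp add: sine_partial_def)

text \<open>For the empty word the recursion has initial value 1 and no source term, so its solution
  is the partial Euler product.\<close>

lemma hrec_pcoef_Nil: "hrec (pcoef []) t N = sine_partial N t"
  by (induction N) (simp_all add: pcoef_Nil sine_partial_Suc del: of_nat_Suc)

lemma genD_sums:
  assumes "x \<noteq> 0" "x ^ 2 < 1 / 3"
  shows "(\<lambda>n. Zser (wd n) * (x ^ 2) ^ n) sums sinc x"
  unfolding Zser_wd
proof (rule hrec_limit[OF absum_pcoef_Nil])
  show "\<bar>x\<^sup>2\<bar> < 1 / 3" using assms by simp
  show "hrec (pcoef []) (x\<^sup>2) \<longlonglongrightarrow> sinc x"
    using sine_partial_tendsto[OF assms(1)] by (simp add: hrec_pcoef_Nil[abs_def])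
qed

text \<open>Row \<open>a = 0\<close> is set to 0: the words \<open>wbd 0 b\<close> begin with
  \<open>X0\<close>, where \<open>pcoef\<close> does not describe \<open>L\<close>. Their values are
  recovered from the shuffle relation in \<open>Zser_wb\<close>.\<close>

definition rfam :: "nat \<Rightarrow> nat \<Rightarrow> real" where "rfam a = (if a = 0 then (\<lambda>_. 0) else pcoef (wbd a 0))"
text \<open>Closed form of the sum of \<open>rfam a m * s ^ a\<close> over \<open>a\<close>: the
  difference of consecutive Euler partial products, divided by \<open>real m\<close>. At
  \<open>m = 0\<close> it is 0 by the convention for division.\<close>

definition rsum :: "real \<Rightarrow> nat \<Rightarrow> real" where "rsum s m = - (s / real m ^ 3) * sine_partial (m - 1) s"
definition Rr :: "nat \<Rightarrow> nat \<Rightarrow> real" where "Rr m n = (if m = 0 then 0 else Zser (wbd m n))"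

section \<open>Values on words with one factor \<open>X0 X0\<close>\<close>

lemma top_op_pow_zero: "(top_op ^^ b) (\<lambda>_. 0) = (\<lambda>_. 0)"
  by (induction b) (simp_all add: top_op_def[abs_def])

lemma absum_rfam: "absum ((top_op ^^ b) (rfam a)) (3 ^ b * 3 ^ a)"
proof (cases "a = 0")
  case True
  then show ?thesis by (simp add: rfam_def top_op_pow_zero absum_def)
next
  case False
  then show ?thesis using absum_pcoef_wbd[of a b] by (simp only: rfam_def pcoef_wbd[of a b] if_False)
qed

lemma Rr_eq: "Rr a b = (\<Sum>m. (top_op ^^ b) (rfam a) m)"
proof (cases "a = 0")
  case False
  then show ?thesis using Zser_wbd[OF False, of b] by (simp only: Rr_def rfam_def if_False pcoef_wbd[of a b])
qed (simp add: Rr_def rfam_def top_op_pow_zero)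

lemma Rr_bound: "\<bar>Rr m n\<bar> \<le> 1 * 3 ^ m * 3 ^ n"
  using absum_suminf[OF absum_rfam[of n m]] by (simp only: Rr_eq mult.commute[of "3 ^ n"] mult_1)

lemma rfam_sums:
  assumes "\<bar>s\<bar> < 1 / 3"
  shows "(\<lambda>a. rfam a m * s ^ a) sums rsum s m"
proof (cases m)
  case 0
  have "rfam a 0 = 0" for a by (simp add: rfam_def wbd_0 pcoef_X0)
  then show ?thesis by (simp add: 0 rsum_def)
next
  case (Suc N)
  have "(\<lambda>a. (\<Sum>m\<le>Suc N. (top_op ^^ a) (pcoef []) m) * s ^ a - (\<Sum>m\<le>N. (top_op ^^ a) (pcoef []) m) * s ^ a)
      sums (hrec (pcoef []) s (Suc N) - hrec (pcoef []) s N)"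
    by (intro sums_diff hrec_sums[OF absum_pcoef_Nil assms])
  then have "(\<lambda>a. pcoef (wd a) (Suc N) * s ^ a) sums (sine_partial (Suc N) s - sine_partial N s)"
    unfolding hrec_pcoef_Nil pcoef_wd by (simp add: algebra_simps)
  from sums_divide[OF this, of "real (Suc N)"]
  have "(\<lambda>a. pcoef (wbd a 0) (Suc N) * s ^ a) sums ((sine_partial (Suc N) s - sine_partial N s) / real (Suc N))"
    by (simp add: wbd_0 pcoef_X0 del: of_nat_Suc)
  moreover have "pcoef (wbd a 0) (Suc N) = rfam a (Suc N)" for a
    by (simp add: rfam_def wbd_0 pcoef_X0 wd_def pcoef_Nil del: of_nat_Suc)
  moreover have "(sine_partial (Suc N) s - sine_partial N s) / real (Suc N) = rsum s (Suc N)"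
    by (simp add: rsum_def sine_partial_Suc algebra_simps power2_eq_square power3_eq_cube del: of_nat_Suc)
  ultimately show ?thesis by (simp only: Suc)
qed

lemma rfam_pow_sums:
  assumes "\<bar>s\<bar> < 1 / 3"
  shows "(\<lambda>a. (top_op ^^ b) (rfam a) m * s ^ a) sums (top_op ^^ b) (rsum s) m"
proof (induction b arbitrary: m)
  case (Suc b)
  have "(\<lambda>a. (\<Sum>k<m. (top_op ^^ b) (rfam a) k * s ^ a)) sums (\<Sum>k<m. (top_op ^^ b) (rsum s) k)"
    by (intro sums_sum Suc)
  from sums_mult[OF this, of "- 1 / real m ^ 2"]
  have "(\<lambda>a. - 1 / real m ^ 2 * (\<Sum>k<m. (top_op ^^ b) (rfam a) k * s ^ a)) sums (- 1 / real m ^ 2 * (\<Sum>k<m. (top_op ^^ b) (rsum s) k))" .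
  moreover have "- 1 / real m ^ 2 * (\<Sum>k<m. (top_op ^^ b) (rfam a) k * s ^ a) = (top_op ^^ Suc b) (rfam a) m * s ^ a" for a
    by (simp add: top_op_def sum_distrib_right)
  moreover have "- 1 / real m ^ 2 * (\<Sum>k<m. (top_op ^^ b) (rsum s) k) = (top_op ^^ Suc b) (rsum s) m"
    by (simp add: top_op_def)
  ultimately show ?case by (simp only:)
qed (simp add: rfam_sums[OF assms])

lemma absum_rsum:
  assumes "x \<noteq> 0" obtains B where "absum (rsum (x ^ 2)) B"
proof -
  have "Bseq (\<lambda>n. sine_partial n (x ^ 2))"
    using sine_partial_tendsto[OF assms] convergentI convergent_imp_Bseq by blast
  then obtain C where C: "C > 0" "\<And>n. \<bar>sine_partial n (x ^ 2)\<bar> \<le> C" by (auto simp: Bseq_def)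
  have b: "\<bar>rsum (x ^ 2) m\<bar> \<le> x ^ 2 * C * (1 / real m ^ 2)" for m
  proof (cases "m = 0")
    case False
    then have "real m ^ 2 * 1 \<le> real m ^ 2 * real m" by (intro mult_left_mono) auto
    then have "x ^ 2 / real m ^ 3 \<le> x ^ 2 / real m ^ 2"
      using False by (intro divide_left_mono) (auto simp: power2_eq_square power3_eq_cube)
    then have "x ^ 2 / real m ^ 3 * \<bar>sine_partial (m - 1) (x ^ 2)\<bar> \<le> x ^ 2 / real m ^ 2 * C"
      by (intro mult_mono C) auto
    then show ?thesis by (simp add: rsum_def abs_mult)
  qed (simp add: rsum_def)
  have s: "summable (\<lambda>m. x ^ 2 * C * (1 / real m ^ 2))" by (intro summable_mult inverse_squares)
  have "summable (\<lambda>m. \<bar>rsum (x ^ 2) m\<bar>)"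
    by (rule summable_comparison_test'[OF s, of 0]) (simp only: real_norm_def abs_abs b)
  then have "absum (rsum (x ^ 2)) (\<Sum>m. \<bar>rsum (x ^ 2) m\<bar>)" by (simp add: absum_def)
  then show ?thesis using that by blast
qed

text \<open>The sum over Taylor coefficients and the sum over \<open>a\<close> are exchanged; the
  majorant \<open>3 ^ b * (3 * \<bar>x ^ 2\<bar>) ^ a\<close> is independent of the
  truncation.\<close>

lemma Rr_sums:
  assumes x: "x \<noteq> 0" "x ^ 2 < 1 / 3"
  shows "(\<lambda>a. Rr a b * (x ^ 2) ^ a) sums (\<Sum>m. (top_op ^^ b) (rsum (x ^ 2)) m)"
proof -
  let ?s = "x ^ 2"
  have s: "\<bar>?s\<bar> < 1 / 3" using x by simp
  obtain B where B: "absum (rsum ?s) B" using absum_rsum[OF x(1)] .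
  have smM: "summable (\<lambda>a. 3 ^ b * (3 * \<bar>?s\<bar>) ^ a)" using s by (intro summable_mult summable_geometric) simp
  have bd: "\<bar>c * ?s ^ a\<bar> \<le> 3 ^ b * (3 * \<bar>?s\<bar>) ^ a" if "\<bar>c\<bar> \<le> 3 ^ b * 3 ^ a" for c a
    using mult_right_mono[OF that, of "\<bar>?s\<bar> ^ a"] by (simp add: abs_mult power_abs power_mult_distrib mult_ac)
  have "(\<lambda>N. \<Sum>a. (\<Sum>m\<le>N. (top_op ^^ b) (rfam a) m) * ?s ^ a) \<longlonglongrightarrow> (\<Sum>a. Rr a b * ?s ^ a)"
  proof (rule tannerys_theorem[where M = "\<lambda>a. 3 ^ b * (3 * \<bar>?s\<bar>) ^ a", THEN conjunct2, THEN conjunct2])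
    show "(\<lambda>N. (\<Sum>m\<le>N. (top_op ^^ b) (rfam a) m) * ?s ^ a) \<longlonglongrightarrow> Rr a b * ?s ^ a" for a
      unfolding Rr_eq by (intro tendsto_mult tendsto_const summable_LIMSEQ' absum_summable[OF absum_rfam])
    show "\<forall>\<^sub>F (a, N) in sequentially \<times>\<^sub>F sequentially. norm ((\<Sum>m\<le>N. (top_op ^^ b) (rfam a) m) * ?s ^ a) \<le> 3 ^ b * (3 * \<bar>?s\<bar>) ^ a"
    proof (intro always_eventually allI)
      fix p :: "nat \<times> nat"
      obtain a N where p: "p = (a, N)" by (cases p)
      have "\<bar>\<Sum>m\<le>N. (top_op ^^ b) (rfam a) m\<bar> \<le> 3 ^ b * 3 ^ a" by (rule absum_partial(1)[OF absum_rfam]) simp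
      from bd[OF this] show "case p of (a, N) \<Rightarrow> norm ((\<Sum>m\<le>N. (top_op ^^ b) (rfam a) m) * ?s ^ a) \<le> 3 ^ b * (3 * \<bar>?s\<bar>) ^ a"
        by (simp only: p prod.case real_norm_def)
    qed
  qed (use smM in auto)
  moreover have "(\<Sum>a. (\<Sum>m\<le>N. (top_op ^^ b) (rfam a) m) * ?s ^ a) = (\<Sum>m\<le>N. (top_op ^^ b) (rsum ?s) m)" for N
  proof -
    have "(\<lambda>a. \<Sum>m\<le>N. (top_op ^^ b) (rfam a) m * ?s ^ a) sums (\<Sum>m\<le>N. (top_op ^^ b) (rsum ?s) m)"
      by (intro sums_sum rfam_pow_sums s)
    then show ?thesis by (simp only: sum_distrib_right sums_iff)
  qed
  moreover have "(\<lambda>N. \<Sum>m\<le>N. (top_op ^^ b) (rsum ?s) m) \<longlonglongrightarrow> (\<Sum>m. (top_op ^^ b) (rsum ?s) m)"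
    by (intro summable_LIMSEQ' absum_summable[OF absum_top_op_pow[OF B]])
  ultimately have "(\<Sum>a. Rr a b * ?s ^ a) = (\<Sum>m. (top_op ^^ b) (rsum ?s) m)"
    using LIMSEQ_unique by (simp only:)
  moreover have "summable (\<lambda>a. Rr a b * ?s ^ a)"
  proof (rule summable_comparison_test'[OF smM, of 0])
    fix a
    have "\<bar>Rr a b\<bar> \<le> 3 ^ b * 3 ^ a" using Rr_bound[of a b] by (simp add: mult.commute)
    from bd[OF this] show "norm (Rr a b * ?s ^ a) \<le> 3 ^ b * (3 * \<bar>?s\<bar>) ^ a" by (simp only: real_norm_def)
  qed
  ultimately show ?thesis by (simp add: sums_iff)
qed

lemma sine_partial_nz: "nonint y \<Longrightarrow> sine_partial n (y ^ 2) \<noteq> 0"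
proof -
  assume y: "nonint y"
  have "1 - y ^ 2 / real k ^ 2 \<noteq> 0" if "k \<in> {1..n}" for k
    using nonint_nz(3)[OF y, of k] that by (simp add: field_simps)
  then show ?thesis by (simp add: sine_partial_def)
qed

text \<open>Variation of constants: \<open>sine_partial N (y ^ 2)\<close> solves the homogeneous
  recursion, and the source \<open>rsum\<close> at \<open>Suc N\<close> divided by
  \<open>sine_partial (Suc N) (y ^ 2)\<close> is \<open>- (x ^ 2) * eterm x y N\<close>. This is the
  origin of \<open>esum\<close>.\<close>

lemma hrec_rsum:
  assumes y: "nonint y"
  shows "hrec (rsum (x ^ 2)) (y ^ 2) N = sine_partial N (y ^ 2) * (- (x ^ 2) * (\<Sum>n<N. eterm x y n))"
proof (induction N)
  case 0
  then show ?case by (simp add: rsum_def)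
next
  case (Suc N)
  define c where "c = real (Suc N)"
  define P where "P = sine_partial N (y ^ 2)"
  have c: "c > 0" "c ^ 2 - y ^ 2 \<noteq> 0" using nonint_nz(3)[OF y, of "Suc N"] by (simp_all add: c_def del: of_nat_Suc)
  have P: "P \<noteq> 0" using sine_partial_nz[OF y] by (simp add: P_def)
  have "sine_partial (Suc N) (y ^ 2) * (- (x ^ 2) * eterm x y N)
    = P * (1 - y ^ 2 / c ^ 2) * (- (x ^ 2) * (sine_partial N (x ^ 2) / P / (c * (c ^ 2 - y ^ 2))))"
    by (simp only: eterm_def uprod_eq sine_partial_Suc c_def P_def)
  also have "\<dots> = - (x ^ 2 / c ^ 3) * sine_partial N (x ^ 2)"
    using c P by (simp add: divide_simps) (simp add: power2_eq_square power3_eq_cube algebra_simps)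
  also have "\<dots> = rsum (x ^ 2) (Suc N)" by (simp add: rsum_def c_def)
  finally show ?case by (simp add: Suc sine_partial_Suc algebra_simps del: of_nat_Suc)
qed

text \<open>Evaluated as an iterated sum: \<open>Rr_sums\<close> gives the rows over
  \<open>a\<close>, and \<open>hrec_limit\<close> with the solution in \<open>hrec_rsum\<close>
  gives the sum over \<open>b\<close>.\<close>

lemma dsum_Rr:
  assumes x: "x \<noteq> 0" "\<bar>x\<bar> < 1 / 4" and y: "y \<noteq> 0" "\<bar>y\<bar> < 1 / 4"
  shows "dsum Rr (x ^ 2) (y ^ 2) (- (x ^ 2) * sinc y * esum x y)"
proof -
  have sq: "z ^ 2 < 1 / 3" if "\<bar>z\<bar> < 1 / 4" for z :: real
  proof -
    have "\<bar>z\<bar> ^ 2 \<le> (1 / 4) ^ 2" using that by (intro power_mono) auto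
    then show ?thesis by (simp add: power2_eq_square)
  qed
  have ny: "nonint y" using y by (intro nonint_abs) auto
  obtain B where B: "absum (rsum (x ^ 2)) B" using absum_rsum[OF x(1)] .
  have lim: "hrec (rsum (x ^ 2)) (y ^ 2) \<longlonglongrightarrow> sinc y * (- (x ^ 2) * esum x y)"
    unfolding hrec_rsum[OF ny] esum_def
    by (intro tendsto_mult tendsto_const sine_partial_tendsto y summable_LIMSEQ eterm_summable x ny)
  have it: "(\<lambda>b. (\<Sum>m. (top_op ^^ b) (rsum (x ^ 2)) m) * (y ^ 2) ^ b) sums (sinc y * (- (x ^ 2) * esum x y))"
    by (rule hrec_limit[OF B _ lim]) (use sq[OF y(2)] in simp)
  have d: "dsum Rr (x ^ 2) (y ^ 2) (infsum (dterm Rr (x ^ 2) (y ^ 2)) UNIV)"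
    by (rule dsum_abs_boundI[where K = 1 and a = 3]) (use Rr_bound sq[OF x(2)] sq[OF y(2)] in \<open>auto simp: abs_mult\<close>)
  then have "(dterm (\<lambda>m n. Rr n m) (y ^ 2) (x ^ 2) has_sum infsum (dterm Rr (x ^ 2) (y ^ 2)) UNIV) (UNIV \<times> UNIV)"
    using dsum_swap[OF d] by (simp add: dsum_def)
  then have "((\<lambda>b. (\<Sum>m. (top_op ^^ b) (rsum (x ^ 2)) m) * (y ^ 2) ^ b) has_sum infsum (dterm Rr (x ^ 2) (y ^ 2)) UNIV) UNIV"
  proof (rule has_sum_SigmaD)
    fix b
    have "(\<lambda>a. \<bar>Rr a b * (x ^ 2) ^ a\<bar>) summable_on UNIV"
    proof -
      have "dterm (\<lambda>m n. Rr n m) (y ^ 2) (x ^ 2) summable_on UNIV"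
        using dsum_swap[OF d] by (auto simp: dsum_def intro: has_sum_imp_summable)
      then have "dterm (\<lambda>m n. Rr n m) (y ^ 2) (x ^ 2) summable_on (Pair b ` UNIV)"
        by (rule summable_on_subset_banach) auto
      then have "(\<lambda>a. Rr a b * (y ^ 2) ^ b * (x ^ 2) ^ a) summable_on UNIV"
        by (subst (asm) summable_on_reindex) (auto intro: injI simp: o_def dterm_def)
      from summable_on_cmult_left[OF this, of "1 / (y ^ 2) ^ b"] have "(\<lambda>a. Rr a b * (x ^ 2) ^ a) summable_on UNIV"
        using y by (simp add: mult_ac)
      then show ?thesis using summable_on_iff_abs_summable_on_real[of "\<lambda>a. Rr a b * (x ^ 2) ^ a"] by simp
    qed
    then have "summable (\<lambda>a. norm (Rr a b * (x ^ 2) ^ a))"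
      using summable_on_imp_summable by fastforce
    from norm_summable_imp_has_sum[OF this Rr_sums[OF x(1) sq[OF x(2)], of b]]
    have "((\<lambda>a. Rr a b * (x ^ 2) ^ a) has_sum (\<Sum>m. (top_op ^^ b) (rsum (x ^ 2)) m)) UNIV" .
    from has_sum_cmult_left[OF this, of "(y ^ 2) ^ b"]
    show "((\<lambda>a. dterm (\<lambda>m n. Rr n m) (y ^ 2) (x ^ 2) (b, a)) has_sum (\<Sum>m. (top_op ^^ b) (rsum (x ^ 2)) m) * (y ^ 2) ^ b) UNIV"
      by (simp add: dterm_def mult_ac)
  qed
  then have "infsum (dterm Rr (x ^ 2) (y ^ 2)) UNIV = sinc y * (- (x ^ 2) * esum x y)"
    using it has_sum_imp_sums sums_unique2 by blast
  then show ?thesis using d by (simp add: mult_ac)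
qed

subsection \<open>Generating functions of the associator\<close>

lemma insertions_Cons: "insertions f (x # w) = f (X0 # x # w) + insertions (\<lambda>u. f (x # u)) w"
  unfolding insertions_def by (simp add: sum.atMost_Suc_shift del: sum.atMost_Suc)

text \<open>Inserting \<open>X0\<close> just before or just after an \<open>X0\<close> of the word
  gives the same result. So \<open>wbd i (n - i)\<close> arises twice for \<open>i \<ge> 1\<close>,
  and \<open>wbd 0 n\<close> once.\<close>

lemma insertions_wd:
  "insertions f (wd n) = (\<Sum>i\<le>n. f (wbd i (n - i))) + (\<Sum>i<n. f (wbd (Suc i) (n - Suc i)))"
proof (induction n arbitrary: f)
  case 0
  then show ?case by (simp add: insertions_def wd_def wbd_def)
next
  case (Suc n)
  have w: "wd (Suc n) = X1 # X0 # wd n" "X0 # X1 # X0 # wd n = wbd 0 (Suc n)" "X1 # X0 # X0 # wd n = wbd 1 n"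
     "X1 # X0 # wbd i j = wbd (Suc i) j" for i j
    by (simp_all add: wd_def wbd_def wpow_Suc)
  have "insertions f (wd (Suc n)) = f (wbd 0 (Suc n)) + (f (wbd 1 n) + insertions (\<lambda>u. f (X1 # X0 # u)) (wd n))"
    by (simp only: w insertions_Cons)
  also have "insertions (\<lambda>u. f (X1 # X0 # u)) (wd n) = (\<Sum>i\<le>n. f (wbd (Suc i) (n - i))) + (\<Sum>i<n. f (wbd (Suc (Suc i)) (n - Suc i)))"
    by (simp only: Suc.IH w)
  finally show ?case
    by (simp add: sum.atMost_Suc_shift sum.lessThan_Suc_shift del: sum.atMost_Suc sum.lessThan_Suc)
qed

text \<open>The vanishing of the insertions is solved for \<open>wbd 0 n = wb n\<close>, the only
  one of the words that begins with \<open>X0\<close>. For \<open>n = 0\<close> the value is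
  \<open>Ln 1\<close>.\<close>

lemma Zser_wb: "Zser (wb n) = - 2 * (\<Sum>i\<le>n. Rr i (n - i))"
proof (cases "n = 0")
  case True
  have "(L [X0] \<longlongrightarrow> of_real (Zser [X0])) (at 1 within slit_domain)" by (rule L_tendsto_Zser) auto
  moreover have "(L [X0] \<longlongrightarrow> 0) (at 1 within slit_domain)"
  proof -
    have "(Ln \<longlongrightarrow> Ln 1) (at 1 within slit_domain)"
      by (rule tendsto_within_subset[OF _ subset_UNIV]) (use DERIV_isCont[OF has_field_derivative_Ln[of 1]] in \<open>simp add: isCont_def\<close>)
    then have "(Ln \<longlongrightarrow> 0) (at 1 within slit_domain)" by simp
    then show ?thesis by (rule Lim_transform_eventually) (auto simp: eventually_at_filter L_X0)
  qed
  ultimately have "complex_of_real (Zser [X0]) = 0" using tendsto_unique[OF one_islimpt_slit] by blast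
  then show ?thesis using True by (simp add: wb_def Rr_def)
next
  case False
  have "insertions Zser (wd n) = 0"
    by (rule Zser_insertions) (use False in \<open>auto simp: wd_def\<close>)
  moreover have "wbd 0 n = wb n" using wpow_shift[of X0 X1 n] by (simp add: wbd_def wb_def)
  moreover have "(\<Sum>i\<le>n. Zser (wbd i (n - i))) = Zser (wbd 0 n) + (\<Sum>i<n. Zser (wbd (Suc i) (n - Suc i)))"
    by (cases n) (simp_all add: sum.atMost_Suc_shift lessThan_Suc_atMost del: sum.atMost_Suc)
  moreover have "(\<Sum>i\<le>n. Rr i (n - i)) = (\<Sum>i<n. Zser (wbd (Suc i) (n - Suc i)))"
    by (cases n) (simp_all add: sum.atMost_Suc_shift lessThan_Suc_atMost Rr_def del: sum.atMost_Suc)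
  ultimately show ?thesis unfolding insertions_wd by simp
qed

lemma dsum_diagonal:
  fixes f :: "nat \<Rightarrow> nat \<Rightarrow> real"
  assumes "dsum f s s v"
  shows "((\<lambda>n. (\<Sum>i\<le>n. f i (n - i)) * s ^ n) has_sum v) UNIV"
proof -
  let ?\<phi> = "\<lambda>(n, i). (i, n - i) :: nat \<times> nat"
  have bij: "bij_betw ?\<phi> (SIGMA n : UNIV. {..n}) UNIV"
    by (rule bij_betwI[where g = "\<lambda>(i, j). (i + j, i)"]) auto
  have "((\<lambda>p. dterm f s s (?\<phi> p)) has_sum v) (SIGMA n : UNIV. {..n})"
    using assms by (subst has_sum_reindex_bij_betw[OF bij]) (simp add: dsum_def)
  then have "((\<lambda>n. \<Sum>i\<le>n. dterm f s s (?\<phi> (n, i))) has_sum v) UNIV"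
    by (rule has_sum_SigmaD) (auto intro!: has_sum_finite)
  moreover have "(\<Sum>i\<le>n. dterm f s s (?\<phi> (n, i))) = (\<Sum>i\<le>n. f i (n - i)) * s ^ n" for n
    unfolding sum_distrib_right by (intro sum.cong refl) (simp add: dterm_def mult.assoc flip: power_add)
  ultimately show ?thesis by simp
qed

lemma esum_diagonal:
  assumes "nonint x" shows "x ^ 2 * esum x x = zsum x"
proof -
  have "uprod x x n = 1" for n
    unfolding uprod_def
  proof (rule prod.neutral, rule ballI)
    fix k assume "k \<in> {1..n}"
    have "real k ^ 2 - x ^ 2 \<noteq> 0" using nonint_nz(3)[OF assms, of k] by simp
    then show "(real k ^ 2 - x ^ 2) / (real k ^ 2 - x ^ 2) = 1" by simp
  qed
  then have e: "x ^ 2 / (real (Suc n) * (real (Suc n) ^ 2 - x ^ 2)) = x ^ 2 * eterm x x n" for n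
    by (simp add: eterm_def del: of_nat_Suc)
  have "x \<noteq> 0" using nonint_nz'(1)[OF assms] .
  then show ?thesis
    unfolding zsum_def e esum_def using suminf_mult[OF eterm_summable[of x x], of "x ^ 2"] assms by simp
qed

text \<open>By \<open>Zser_wb\<close> this is \<open>- 2\<close> times the diagonal
  \<open>y = x\<close> of the double series, where all \<open>uprod x x n\<close> are 1 and
  \<open>x ^ 2 * esum x x\<close> becomes \<open>zsum x\<close>.\<close>

lemma genB_has_sum:
  assumes x: "x \<noteq> 0" "\<bar>x\<bar> < 1 / 4"
  shows "((\<lambda>n. Zser (wb n) * (x ^ 2) ^ n) has_sum 2 * sinc x * zsum x) UNIV"
proof -
  have nx: "nonint x" using x by (intro nonint_abs) auto
  from has_sum_cmult_right[OF dsum_diagonal[OF dsum_Rr[OF x x]], of "- 2"]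
  have "((\<lambda>n. - 2 * ((\<Sum>i\<le>n. Rr i (n - i)) * (x ^ 2) ^ n)) has_sum - 2 * (- (x ^ 2) * sinc x * esum x x)) UNIV" .
  moreover have "- 2 * (- (x ^ 2) * sinc x * esum x x) = 2 * sinc x * zsum x"
    unfolding esum_diagonal[OF nx, symmetric] by simp
  moreover have "(\<lambda>n. - 2 * ((\<Sum>i\<le>n. Rr i (n - i)) * (x ^ 2) ^ n)) = (\<lambda>n. Zser (wb n) * (x ^ 2) ^ n)"
    unfolding Zser_wb by (simp only: mult.assoc)
  ultimately show ?thesis by (simp only:)
qed

definition zc :: "nat \<Rightarrow> real" where "zc n = (if n = 0 then 0 else zeta (2 * n + 1))"

lemma summable_zeta: "2 \<le> k \<Longrightarrow> summable (\<lambda>n. 1 / real (Suc n) ^ k)"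
proof -
  assume "2 \<le> k"
  then have "summable (\<lambda>n. inverse (real n ^ k))" by (rule inverse_power_summable)
  then have "summable (\<lambda>n. inverse (real (Suc n) ^ k))" by (subst summable_Suc_iff)
  then show ?thesis by (simp only: inverse_eq_divide)
qed

lemma zc_nonneg: "0 \<le> zc n"
proof (cases "n = 0")
  case False
  have "summable (\<lambda>k. 1 / real (Suc k) ^ (2 * n + 1))"
    using False by (intro summable_zeta) simp
  then show ?thesis by (auto simp: zc_def zeta_def intro!: suminf_nonneg)
qed (simp add: zc_def)

text \<open>Geometric expansion of each term in \<open>z ^ 2\<close> over the square of
  \<open>real (Suc k)\<close>; all terms are nonnegative, so the two summations may be
  exchanged.\<close>

lemma zsum_has_sum:
  assumes z: "\<bar>z\<bar> < 1"
  shows "((\<lambda>n. zc n * (z ^ 2) ^ n) has_sum zsum z) UNIV"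
proof -
  let ?g = "\<lambda>(k, n). (z ^ 2) ^ Suc n / real (Suc k) ^ (2 * n + 3)"
  let ?h = "\<lambda>k. z ^ 2 / (real (Suc k) * (real (Suc k) ^ 2 - z ^ 2))"
  have z2: "z ^ 2 < 1" using z by (simp add: abs_square_less_1)
  have inner: "((\<lambda>n. ?g (k, n)) has_sum ?h k) UNIV" for k
  proof -
    define c where "c = real (Suc k)"
    have c: "c \<ge> 1" by (simp add: c_def)
    have c2: "1 \<le> c ^ 2" using c by simp
    have q: "0 \<le> z ^ 2 / c ^ 2" "z ^ 2 / c ^ 2 < 1" using z2 c2 by (auto simp: divide_less_eq)
    have "(\<lambda>n. z ^ 2 / c ^ 3 * (z ^ 2 / c ^ 2) ^ n) sums (z ^ 2 / c ^ 3 * (1 / (1 - z ^ 2 / c ^ 2)))"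
      using q by (intro sums_mult geometric_sums) simp
    moreover have "z ^ 2 / c ^ 3 * (1 / (1 - z ^ 2 / c ^ 2)) = ?h k"
    proof -
      have "c ^ 2 - z ^ 2 > 0" "c > 0" using z2 c2 c by linarith+
      then have "c ^ 2 - z ^ 2 \<noteq> 0" "c \<noteq> 0" by simp_all
      then show ?thesis unfolding c_def[symmetric]
        by (simp add: divide_simps) (simp add: power2_eq_square power3_eq_cube algebra_simps)
    qed
    moreover have "z ^ 2 / c ^ 3 * (z ^ 2 / c ^ 2) ^ n = ?g (k, n)" for n
    proof -
      have "?g (k, n) = (z ^ 2) ^ Suc n / c ^ (2 * n + 3)" by (simp only: c_def prod.case)
      moreover have "z ^ 2 / c ^ 3 * (z ^ 2 / c ^ 2) ^ n = (z ^ 2) ^ Suc n / c ^ (2 * n + 3)"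
      proof -
        have "c ^ (2 * n + 3) = c ^ 3 * (c ^ 2) ^ n" by (simp only: power_mult[symmetric] power_add[symmetric] add.commute)
        then show ?thesis by (simp only: power_divide power_Suc times_divide_times_eq)
      qed
      ultimately show ?thesis by (rule trans[rotated, OF sym])
    qed
    ultimately have "(\<lambda>n. ?g (k, n)) sums ?h k" by (simp only:)
    then show ?thesis by (rule sums_nonneg_imp_has_sum) simp
  qed
  have outer: "(?h has_sum zsum z) UNIV"
  proof (rule sums_nonneg_imp_has_sum)
    show "?h sums zsum z" unfolding zsum_def by (rule summable_sums[OF summable_zsum])
    fix k
    have "1 \<le> real (Suc k) ^ 2" by (rule one_le_power) simp
    then have "0 \<le> real (Suc k) ^ 2 - z ^ 2" using z2 by linarith
    then show "0 \<le> ?h k" by (intro divide_nonneg_nonneg mult_nonneg_nonneg zero_le_power2 of_nat_0_le_iff)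
  qed
  have "?g summable_on (UNIV \<times> UNIV)"
    by (rule summable_on_SigmaI[OF inner has_sum_imp_summable[OF outer]]) auto
  from has_sum_SigmaI[OF inner outer this] have "(?g has_sum zsum z) (UNIV \<times> UNIV)" .
  then have "((\<lambda>(n, k). ?g (k, n)) has_sum zsum z) (UNIV \<times> UNIV)" by (subst (asm) has_sum_swap) simp
  then have "((\<lambda>n. zc (Suc n) * (z ^ 2) ^ Suc n) has_sum zsum z) UNIV"
  proof (rule has_sum_SigmaD)
    fix n :: nat
    have "summable (\<lambda>k. 1 / real (Suc k) ^ (2 * n + 3))"
      by (intro summable_zeta) simp
    then have "(\<lambda>k. 1 / real (Suc k) ^ (2 * n + 3)) sums zeta (2 * n + 3)" unfolding zeta_def by (rule summable_sums)
    from sums_mult[OF this, of "(z ^ 2) ^ Suc n"]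
    have "(\<lambda>k. (z ^ 2) ^ Suc n / real (Suc k) ^ (2 * n + 3)) sums (zc (Suc n) * (z ^ 2) ^ Suc n)"
      by (simp add: zc_def numeral_eq_Suc mult_ac del: of_nat_Suc power_Suc)
    then have "((\<lambda>k. (z ^ 2) ^ Suc n / real (Suc k) ^ (2 * n + 3)) has_sum (zc (Suc n) * (z ^ 2) ^ Suc n)) UNIV"
      by (rule sums_nonneg_imp_has_sum) simp
    then show "((\<lambda>k. case (n, k) of (n, k) \<Rightarrow> ?g (k, n)) has_sum (zc (Suc n) * (z ^ 2) ^ Suc n)) UNIV"
      by (simp only: prod.case)
  qed
  then have "((\<lambda>n. zc n * (z ^ 2) ^ n) has_sum zsum z) (range Suc)"
    by (subst has_sum_reindex) (simp_all add: o_def)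
  then show ?thesis
    by (subst (asm) has_sum_cong_neutral[where T = UNIV and g = "\<lambda>n. zc n * (z ^ 2) ^ n"])
       (auto simp: zc_def image_iff gr0_conv_Suc)
qed

lemma even_binomial_sum:
  fixes x y :: real
  shows "(\<Sum>m\<le>N. real ((2 * N) choose (2 * m)) * (x ^ 2) ^ m * (y ^ 2) ^ (N - m)) = ((x + y) ^ (2 * N) + (x - y) ^ (2 * N)) / 2"
proof -
  have ev: "(\<Sum>k\<le>2 * N. (1 + (- 1) ^ k) * f k) = 2 * (\<Sum>m\<le>N. f (2 * m))" for f :: "nat \<Rightarrow> real"
    by (induction N) (simp_all add: algebra_simps)
  define f where "f k = real ((2 * N) choose k) * x ^ k * y ^ (2 * N - k)" for k
  have "(x + y) ^ (2 * N) = (\<Sum>k\<le>2 * N. f k)" by (simp add: binomial_ring f_def)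
  moreover have "(x - y) ^ (2 * N) = (\<Sum>k\<le>2 * N. (- 1) ^ k * f k)"
  proof -
    have "(x - y) ^ (2 * N) = (- x + y) ^ (2 * N)"
      by (simp add: power_mult) (metis minus_diff_eq power2_minus uminus_add_conv_diff)
    also have "\<dots> = (\<Sum>k\<le>2 * N. real ((2 * N) choose k) * (- x) ^ k * y ^ (2 * N - k))" by (rule binomial_ring)
    also have "\<dots> = (\<Sum>k\<le>2 * N. (- 1) ^ k * f k)"
    proof (rule sum.cong[OF refl])
      fix k
      have "(- x) ^ k = (- 1) ^ k * x ^ k" using power_mult_distrib[of "- 1" x k] by simp
      then show "real ((2 * N) choose k) * (- x) ^ k * y ^ (2 * N - k) = (- 1) ^ k * f k" by (simp add: f_def)
    qed
    finally show ?thesis .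
  qed
  ultimately have "(x + y) ^ (2 * N) + (x - y) ^ (2 * N) = (\<Sum>k\<le>2 * N. (1 + (- 1) ^ k) * f k)"
    by (simp add: sum.distrib[symmetric] algebra_simps)
  also have "\<dots> = 2 * (\<Sum>m\<le>N. f (2 * m))" by (rule ev)
  also have "(\<Sum>m\<le>N. f (2 * m)) = (\<Sum>m\<le>N. real ((2 * N) choose (2 * m)) * (x ^ 2) ^ m * (y ^ 2) ^ (N - m))"
    by (rule sum.cong[OF refl]) (simp add: f_def power_mult diff_mult_distrib2 flip: power_mult)
  finally show ?thesis by simp
qed

text \<open>Along \<open>m + n = N\<close> the even binomial coefficients produce half of
  \<open>(x + y)^(2 N) + (x - y)^(2 N)\<close>; the factor \<open>- 4\<close> therefore becomes
  \<open>- 2\<close>.\<close>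

lemma dsum_Cc:
  assumes xy: "\<bar>x + y\<bar> < 1" "\<bar>x - y\<bar> < 1"
  shows "dsum Cc (x ^ 2) (y ^ 2) (- 2 * (zsum (x + y) + zsum (x - y)))"
proof -
  let ?b = "\<lambda>m n. real ((2 * m + 2 * n) choose (2 * m)) * zc (m + n)"
  let ?\<phi> = "\<lambda>(n, i). (i, n - i) :: nat \<times> nat"
  let ?v = "(zsum (x + y) + zsum (x - y)) / 2"
  have bij: "bij_betw ?\<phi> (SIGMA n : UNIV. {..n}) UNIV"
    by (rule bij_betwI[where g = "\<lambda>(i, j). (i + j, i)"]) auto
  have inn: "((\<lambda>i. dterm ?b (x ^ 2) (y ^ 2) (?\<phi> (n, i))) has_sum (zc n * ((x + y) ^ 2) ^ n + zc n * ((x - y) ^ 2) ^ n) / 2) {..n}" for n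
  proof (rule has_sum_finiteI)
    have "(\<Sum>i\<le>n. dterm ?b (x ^ 2) (y ^ 2) (?\<phi> (n, i))) = (\<Sum>i\<le>n. zc n * (real ((2 * n) choose (2 * i)) * (x ^ 2) ^ i * (y ^ 2) ^ (n - i)))"
    proof (rule sum.cong[OF refl])
      fix i assume "i \<in> {..n}"
      then have e: "2 * i + 2 * (n - i) = 2 * n" "i + (n - i) = n" by auto
      show "dterm ?b (x ^ 2) (y ^ 2) (?\<phi> (n, i)) = zc n * (real ((2 * n) choose (2 * i)) * (x ^ 2) ^ i * (y ^ 2) ^ (n - i))"
        by (simp only: dterm_def prod.case e) (simp only: mult_ac)
    qed
    also have "\<dots> = zc n * (((x + y) ^ (2 * n) + (x - y) ^ (2 * n)) / 2)"
      by (simp only: sum_distrib_left[symmetric] even_binomial_sum)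
    also have "\<dots> = (zc n * ((x + y) ^ 2) ^ n + zc n * ((x - y) ^ 2) ^ n) / 2"
      by (simp only: power_mult distrib_left add_divide_distrib times_divide_eq_right)
    finally show "(zc n * ((x + y) ^ 2) ^ n + zc n * ((x - y) ^ 2) ^ n) / 2 = (\<Sum>i\<le>n. dterm ?b (x ^ 2) (y ^ 2) (?\<phi> (n, i)))" ..
  qed simp
  have out: "((\<lambda>n. (zc n * ((x + y) ^ 2) ^ n + zc n * ((x - y) ^ 2) ^ n) / 2) has_sum ?v) UNIV"
    using has_sum_cmult_left[OF has_sum_add[OF zsum_has_sum[OF xy(1)] zsum_has_sum[OF xy(2)]], of "1 / 2"] by simp
  have nn: "0 \<le> dterm ?b (x ^ 2) (y ^ 2) p" for p
    by (cases p) (simp add: dterm_def zc_nonneg)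
  have "(\<lambda>p. dterm ?b (x ^ 2) (y ^ 2) (?\<phi> p)) summable_on (SIGMA n : UNIV. {..n})"
    by (rule summable_on_SigmaI[OF inn has_sum_imp_summable[OF out]]) (simp only: nn)
  from has_sum_SigmaI[OF inn out this]
  have "(dterm ?b (x ^ 2) (y ^ 2) has_sum ?v) UNIV" by (subst (asm) has_sum_reindex_bij_betw[OF bij])
  then have "dsum ?b (x ^ 2) (y ^ 2) ?v"
    unfolding dsum_def using summable_on_iff_abs_summable_on_real has_sum_imp_summable by blast
  moreover have "- 4 * ?v = - 2 * (zsum (x + y) + zsum (x - y))" by simp
  ultimately have "dsum (\<lambda>m n. - 4 * ?b m n) (x ^ 2) (y ^ 2) (- 2 * (zsum (x + y) + zsum (x - y)))"
    using dsum_cmult[of ?b "x ^ 2" "y ^ 2" ?v "- 4"] by (simp only:)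
  moreover have "(\<lambda>m n. - 4 * ?b m n) = Cc" by (auto simp: fun_eq_iff Cc_def zc_def)
  ultimately show ?thesis by (simp only:)
qed

lemma genD_has_sum:
  assumes x: "x \<noteq> 0" "\<bar>x\<bar> < 1 / 4"
  shows "((\<lambda>n. Zser (wd n) * (x ^ 2) ^ n) has_sum sinc x) UNIV"
proof (rule norm_summable_imp_has_sum)
  have x2: "x ^ 2 < 1 / 3"
  proof -
    have "\<bar>x\<bar> ^ 2 \<le> (1 / 4) ^ 2" using x by (intro power_mono) auto
    then show ?thesis by (simp add: power2_eq_square)
  qed
  then show "(\<lambda>n. Zser (wd n) * (x ^ 2) ^ n) sums sinc x" by (rule genD_sums[OF x(1)])
  have s: "summable (\<lambda>n. (3 * x ^ 2) ^ n)" using x2 by (intro summable_geometric) simp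
  show "summable (\<lambda>n. norm (Zser (wd n) * (x ^ 2) ^ n))"
  proof (rule summable_comparison_test'[OF s, of 0])
    fix n
    have "\<bar>Zser (wd n)\<bar> \<le> 3 ^ n" unfolding Zser_wd pcoef_wd[symmetric] by (rule absum_suminf[OF absum_pcoef_wd])
    then have "\<bar>Zser (wd n)\<bar> * (x ^ 2) ^ n \<le> 3 ^ n * (x ^ 2) ^ n" by (intro mult_right_mono) auto
    then show "norm (norm (Zser (wd n) * (x ^ 2) ^ n)) \<le> (3 * x ^ 2) ^ n" by (simp add: abs_mult power_mult_distrib)
  qed
qed

text \<open>Both series take the value \<open>4 * sinc x * zsum x\<close> at \<open>x ^ 2\<close>.
  The interval up to \<open>1 / 16\<close> corresponds to \<open>x < 1 / 4\<close>.\<close>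

lemma Zser_gen: "2 * genB Zser = - (S0fps * genD Zser)"
proof (rule fps_ext)
  fix n
  define a where "a n = 2 * Zser (wb n) + (\<Sum>i\<le>n. S0c i * Zser (wd (n - i)))" for n
  have "a n = 0"
  proof (rule power_series_zero[where r = "1 / 16"])
    fix s :: real assume s: "0 < s" "s < 1 / 16"
    define x where "x = sqrt s"
    have x2: "x ^ 2 = s" using s by (simp add: x_def)
    have "x < sqrt (1 / 16)" unfolding x_def using s(2) by (rule real_sqrt_less_mono)
    then have x: "x \<noteq> 0" "\<bar>x\<bar> < 1 / 4" using s by (auto simp: x_def real_sqrt_divide)
    have abs: "summable (\<lambda>n. norm (f n))" if "(f has_sum v) UNIV" for f :: "nat \<Rightarrow> real" and v
      using that summable_on_iff_abs_summable_on_real has_sum_imp_summable summable_on_imp_summable by blast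
    have S0: "((\<lambda>n. S0c n * s ^ n) has_sum - 4 * zsum x) UNIV"
    proof -
      have e: "S0c n * s ^ n = - 4 * (zc n * (x ^ 2) ^ n)" for n by (simp add: S0c_def zc_def x2)
      show ?thesis unfolding e by (rule has_sum_cmult_right, rule zsum_has_sum) (use x in simp)
    qed
    have D: "((\<lambda>n. Zser (wd n) * s ^ n) has_sum sinc x) UNIV" using genD_has_sum[OF x] by (simp only: x2)
    have B: "(\<lambda>n. Zser (wb n) * s ^ n) sums (2 * sinc x * zsum x)" using has_sum_imp_sums[OF genB_has_sum[OF x]] by (simp only: x2)
    have "(\<lambda>k. \<Sum>i\<le>k. (S0c i * s ^ i) * (Zser (wd (k - i)) * s ^ (k - i))) sums ((\<Sum>k. S0c k * s ^ k) * (\<Sum>k. Zser (wd k) * s ^ k))"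
      by (rule Cauchy_product_sums[OF abs[OF S0] abs[OF D]])
    moreover have "(\<Sum>k. S0c k * s ^ k) = - 4 * zsum x" "(\<Sum>k. Zser (wd k) * s ^ k) = sinc x"
      using has_sum_imp_sums[OF S0] has_sum_imp_sums[OF D] by (auto dest: sums_unique)
    moreover have "(\<Sum>i\<le>k. (S0c i * s ^ i) * (Zser (wd (k - i)) * s ^ (k - i))) = (\<Sum>i\<le>k. S0c i * Zser (wd (k - i))) * s ^ k" for k
      unfolding sum_distrib_right
    proof (rule sum.cong[OF refl])
      fix i assume "i \<in> {..k}"
      then have "s ^ k = s ^ i * s ^ (k - i)" by (simp flip: power_add)
      then show "(S0c i * s ^ i) * (Zser (wd (k - i)) * s ^ (k - i)) = S0c i * Zser (wd (k - i)) * s ^ k" by simp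
    qed
    ultimately have "(\<lambda>k. (\<Sum>i\<le>k. S0c i * Zser (wd (k - i))) * s ^ k) sums (- 4 * zsum x * sinc x)" by (simp only:)
    from sums_add[OF sums_mult[OF B, of 2] this]
    show "(\<lambda>n. a n * s ^ n) sums 0" by (simp add: a_def algebra_simps)
  qed simp
  moreover have "fps_nth (2 * genB Zser) n = 2 * Zser (wb n)"
    by (simp only: mult_2 fps_add_nth) (simp add: genB_def)
  ultimately show "fps_nth (2 * genB Zser) n = fps_nth (- (S0fps * genD Zser)) n"
    by (simp only: fps_neg_nth) (simp add: a_def genD_def fps_mult_nth atLeast0AtMost)
qed

abbreviation fsum :: "real fps fps \<Rightarrow> real \<Rightarrow> real \<Rightarrow> real \<Rightarrow> bool" where
  "fsum u \<equiv> dsum (\<lambda>m n. fps_nth (fps_nth u m) n)"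

lemma fsum_inner:
  assumes "((\<lambda>n. fps_nth u n * t ^ n) has_sum v) UNIV"
  shows "fsum (inner u) s t v"
proof -
  have "(\<lambda>n. norm (fps_nth u n * t ^ n)) summable_on UNIV"
    using has_sum_imp_summable[OF assms] summable_on_iff_abs_summable_on_real[of "\<lambda>n. fps_nth u n * t ^ n" UNIV]
    by simp
  from dsum_swap[OF dsum_single[OF this assms, of s]]
  have "dsum (\<lambda>m n. if m = 0 then fps_nth u n else 0) s t v" .
  moreover have "(\<lambda>m n. fps_nth (fps_nth (inner u) m) n) = (\<lambda>m n. if m = 0 then fps_nth u n else 0)"
    by (auto simp: fun_eq_iff)
  ultimately show ?thesis by (simp only:)
qed

lemma fsum_mult: "fsum u s t a \<Longrightarrow> fsum v s t b \<Longrightarrow> fsum (u * v) s t (a * b)"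
  using dsum_mult[of "\<lambda>m n. fps_nth (fps_nth u m) n" s t a "\<lambda>m n. fps_nth (fps_nth v m) n" b]
  by (simp only: dmult_def[abs_def] fps_fps_mult_nth)

lemma fsum_add: "fsum u s t a \<Longrightarrow> fsum v s t b \<Longrightarrow> fsum (u + v) s t (a + b)"
  using dsum_add[of "\<lambda>m n. fps_nth (fps_nth u m) n" s t a "\<lambda>m n. fps_nth (fps_nth v m) n" b] by simp

text \<open>The factor \<open>fps_X * genD Zser\<close> contributes \<open>y ^ 2 * sinc y\<close>,
  which makes the value at \<open>(x ^ 2, y ^ 2)\<close> equal to \<open>- 2\<close> times the
  left-hand side of \<open>esum_symmetry\<close>. Equality with the transposed series then follows
  from \<open>dsum_zero\<close>.\<close>

lemma genBD_Zser_symmetric: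
  "fps_nth (fps_nth (inner (fps_X * genD Zser) * (2 * genBD Zser + Cfps * inner (genD Zser))) m) n
   = fps_nth (fps_nth (inner (fps_X * genD Zser) * (2 * genBD Zser + Cfps * inner (genD Zser))) n) m"
proof -
  define W where "W = inner (fps_X * genD Zser) * (2 * genBD Zser + Cfps * inner (genD Zser))"
  have val: "fsum W (x ^ 2) (y ^ 2) (- 2 * ((y * sinc y) ^ 2 * (x ^ 2 * esum x y + zsum (x + y) + zsum (x - y) - 2 * zsum y)))"
    if x: "x \<noteq> 0" "\<bar>x\<bar> < 1 / 4" and y: "y \<noteq> 0" "\<bar>y\<bar> < 1 / 4" for x y
  proof -
    have D: "fsum (inner (genD Zser)) (x ^ 2) (y ^ 2) (sinc y)"
      using genD_has_sum[OF y] by (intro fsum_inner) (simp add: genD_def)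
    have B: "fsum (inner (genB Zser)) (x ^ 2) (y ^ 2) (2 * sinc y * zsum y)"
      using genB_has_sum[OF y] by (intro fsum_inner) (simp add: genB_def)
    have R: "fsum (Abs_fps (\<lambda>m. Abs_fps (Rr m))) (x ^ 2) (y ^ 2) (- (x ^ 2) * sinc y * esum x y)"
      using dsum_Rr[OF x y] by simp
    have C: "fsum Cfps (x ^ 2) (y ^ 2) (- 2 * (zsum (x + y) + zsum (x - y)))"
      using dsum_Cc[of x y] x y by simp
    have X: "fsum (inner fps_X) (x ^ 2) (y ^ 2) (y ^ 2)"
    proof (rule fsum_inner)
      have "((\<lambda>n. fps_nth (fps_X :: real fps) n * (y ^ 2) ^ n) has_sum y ^ 2) {1}"
        by (rule has_sum_finiteI) auto
      then show "((\<lambda>n. fps_nth (fps_X :: real fps) n * (y ^ 2) ^ n) has_sum y ^ 2) UNIV"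
        by (rule has_sum_cong_neutral[THEN iffD1, rotated -1]) (auto split: if_splits)
    qed
    have BD: "genBD Zser = Abs_fps (\<lambda>m. Abs_fps (Rr m)) + inner (genB Zser)"
    proof (rule fps_fps_eqI)
      fix m n
      have "wbd 0 n = wb n" using wpow_shift[of X0 X1 n] by (simp add: wbd_def wb_def)
      then show "fps_nth (fps_nth (genBD Zser) m) n = fps_nth (fps_nth (Abs_fps (\<lambda>m. Abs_fps (Rr m)) + inner (genB Zser)) m) n"
        by (cases m) (simp_all add: genBD_def genB_def Rr_def)
    qed
    have W: "W = (inner fps_X * inner (genD Zser)) * ((genBD Zser + genBD Zser) + Cfps * inner (genD Zser))"
      unfolding W_def inner_mult mult_2 ..
    note BD' = fsum_add[OF R B, folded BD]
    have "fsum W (x ^ 2) (y ^ 2) ((y ^ 2 * sinc y) * (((- (x ^ 2) * sinc y * esum x y + 2 * sinc y * zsum y) + (- (x ^ 2) * sinc y * esum x y + 2 * sinc y * zsum y))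
        + (- 2 * (zsum (x + y) + zsum (x - y))) * sinc y))"
      unfolding W by (rule fsum_mult[OF fsum_mult[OF X D] fsum_add[OF fsum_add[OF BD' BD'] fsum_mult[OF C D]]])
    moreover have "(y ^ 2 * sinc y) * (((- (x ^ 2) * sinc y * esum x y + 2 * sinc y * zsum y) + (- (x ^ 2) * sinc y * esum x y + 2 * sinc y * zsum y))
        + (- 2 * (zsum (x + y) + zsum (x - y))) * sinc y) = - 2 * ((y * sinc y) ^ 2 * (x ^ 2 * esum x y + zsum (x + y) + zsum (x - y) - 2 * zsum y))"
      by (simp add: power_mult_distrib) (simp add: power2_eq_square algebra_simps)
    ultimately show ?thesis by (simp only:)
  qed
  have "fps_nth (fps_nth W m) n - fps_nth (fps_nth W n) m = 0"
  proof (rule dsum_zero[where r = "1 / 16" and f = "\<lambda>m n. fps_nth (fps_nth W m) n - fps_nth (fps_nth W n) m"])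
    fix s t :: real assume st: "0 < t" "t < s" "s < 1 / 16"
    define x y where "x = sqrt s" and "y = sqrt t"
    have x2: "x ^ 2 = s" "y ^ 2 = t" using st by (simp_all add: x_def y_def)
    have "x < sqrt (1 / 16)" "y < sqrt (1 / 16)" unfolding x_def y_def using st by (auto intro!: real_sqrt_less_mono)
    then have x: "x \<noteq> 0" "\<bar>x\<bar> < 1 / 4" and y: "y \<noteq> 0" "\<bar>y\<bar> < 1 / 4"
      using st by (auto simp: x_def y_def real_sqrt_divide)
    have e: "zsum (y + x) = zsum (x + y)" "zsum (y - x) = zsum (x - y)"
      by (simp_all add: zsum_def power2_commute add.commute)
    have "(y * sinc y) ^ 2 * (x ^ 2 * esum x y + zsum (x + y) + zsum (x - y) - 2 * zsum y)
      = (x * sinc x) ^ 2 * (y ^ 2 * esum y x + zsum (x + y) + zsum (x - y) - 2 * zsum x)"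
      by (rule esum_symmetry) (use x y x2 st in auto)
    with dsum_diff[OF val[OF x y] dsum_swap[OF val[OF y x]]]
    show "dsum (\<lambda>m n. fps_nth (fps_nth W m) n - fps_nth (fps_nth W n) m) s t 0"
      by (simp add: e x2)
  qed simp
  then show ?thesis by (simp add: W_def)
qed

section \<open>Commutation with \<open>X1\<close> and conjugation by exponentials\<close>

abbreviation "monodromy_series \<equiv> conv (conv (\<lambda>u. Zser (rev u)) S_series) Zser"

theorem monodromy_commutes:
  assumes "w \<in> B0"
  shows "lsh X1 monodromy_series w = rsh monodromy_series X1 w"
proof -
  have inv: "conv (\<lambda>u. (- 1) ^ length u * Zser (rev u)) Zser v = unit_series v" for v
    using antipode_Zser[of v] by (simp add: antipode_def[abs_def])
  have Xeq: "2 * Xfps = Cfps * (outer S0fps + inner S0fps) - outer S0fps * inner S0fps" 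
  proof -
    have "2 = fps_const (fps_const (2 :: real))" by (simp only: numeral_fps_const)
    then have "2 * fps_const (fps_const (1 / 2 :: real)) = 1" by simp
    then show ?thesis by (simp only: mult.assoc[symmetric] mult_1)
  qed
  note hyps = inv S_series_rev gen_S_series Xeq Zser_gen Zser_Nil
  have "genB monodromy_series = 0" by (rule genB_M[OF hyps])
  then have b: "monodromy_series (wb n) = 0" for n by (simp add: genB_def fps_eq_iff)
  have "genAD monodromy_series = 0" by (rule genAD_M[OF hyps])
  then have ad: "monodromy_series (wad m n) = 0" for m n
    by (metis genAD_def fps_nth_Abs_fps fps_zero_nth)
  show ?thesis
    by (rule palindromic_commutes[OF M_rev[OF hyps] b ad genBD_M_symmetric[OF hyps genBD_Zser_symmetric] assms])
qed

lemma conv3_cong_B0: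
  assumes "w \<in> B0" "\<And>u. u \<in> B0 \<Longrightarrow> T u = T' u"
  shows "conv (conv f T) g w = conv (conv f T') g w"
proof (rule conv_cong)
  fix k
  show "conv f T (take k w) = conv f T' (take k w)"
    by (rule conv_cong) (simp_all add: assms B0_take B0_drop)
qed simp

text \<open>The derivative of \<open>exp (- t i) T exp (t i)\<close> in \<open>t\<close> is the
  conjugate of \<open>T i - i T\<close>. Its coefficient at \<open>w\<close> only involves
  coefficients of \<open>T i - i T\<close> at factors of \<open>w\<close>, and these lie in
  \<open>B0\<close>.\<close>

lemma exp_conjugate:
  fixes T :: "word \<Rightarrow> complex"
  assumes w: "w \<in> B0" and comm: "\<And>w. w \<in> B0 \<Longrightarrow> lsh i T w = rsh T i w"
  shows "conv (conv (expl i (- c)) T) (expl i c) w = T w"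
proof -
  define \<phi> where "\<phi> t = conv (conv (expl i (- t)) T) (expl i t) w" for t
  have d: "(\<phi> has_field_derivative 0) (at t)" for t
  proof -
    let ?e = "expl i (- t)" and ?e' = "expl i t"
    have 1: "((\<lambda>t. expl i (- t) u) has_field_derivative - rsh ?e i u) (at t)" for u
      using DERIV_chain2[where f = "\<lambda>c. expl i c u" and g = "\<lambda>t. - t", OF expl_deriv DERIV_minus[OF DERIV_ident]]
      by simp
    have z: "conv f (\<lambda>_. 0) u = 0" for f and u by (simp add: conv_def)
    have 2: "((\<lambda>t. conv (expl i (- t)) T u) has_field_derivative conv (\<lambda>u. - rsh ?e i u) T u + conv ?e (\<lambda>_. 0) u) (at t)" for u
      by (rule conv_has_field_derivative[where f = "\<lambda>t. expl i (- t)" and g = "\<lambda>_. T"]) (rule 1 DERIV_const)+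
    have neg: "conv (\<lambda>u. - f u) g u = - conv f g u" for f g :: "word \<Rightarrow> complex" and u
      by (simp add: conv_def sum_negf)
    have "(\<phi> has_field_derivative conv (conv (\<lambda>u. - rsh ?e i u) T) ?e' w + conv (conv ?e T) (rsh ?e' i) w) (at t)"
      unfolding \<phi>_def
      by (rule conv_has_field_derivative[where f = "\<lambda>t. conv (expl i (- t)) T" and g = "\<lambda>t. expl i t"])
         (use 2 in \<open>simp only: z add_0_right\<close>, rule expl_deriv)
    moreover have "conv (conv (\<lambda>u. - rsh ?e i u) T) ?e' w = - conv (conv ?e (lsh i T)) ?e' w"
    proof -
      have "conv (\<lambda>u. - rsh ?e i u) T = (\<lambda>u. - conv ?e (lsh i T) u)" by (rule ext) (simp only: neg conv_rsh)
      then show ?thesis by (simp only: neg)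
    qed
    moreover have "conv (conv ?e T) (rsh ?e' i) w = conv (conv ?e (rsh T i)) ?e' w"
    proof -
      have "rsh ?e' i = conv (letter_series i) ?e'" by (simp only: expl_commute[symmetric] lsh_conv_letter)
      then show ?thesis by (simp only: rsh_conv_letter[of T] conv_assoc_fun)
    qed
    moreover have "conv (conv ?e (lsh i T)) ?e' w = conv (conv ?e (rsh T i)) ?e' w"
      by (rule conv3_cong_B0[OF w comm])
    ultimately show ?thesis by (simp only: add.left_inverse)
  qed
  have "\<phi> c = \<phi> 0"
    using has_field_derivative_zero_constant[of UNIV \<phi>] d by (metis UNIV_I convex_UNIV)
  then show ?thesis by (simp add: \<phi>_def)
qed

subsection \<open>The single-valued function\<close>

text \<open>The branch at \<open>cnj z\<close> is encoded as the conjugate of the branch at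
  \<open>z\<close>, which is what following the conjugate path produces.\<close>

definition sesq :: "(word \<Rightarrow> complex \<Rightarrow> complex) \<Rightarrow> word \<Rightarrow> complex \<Rightarrow> complex" where
  "sesq \<Lambda> w z = conv (conv (\<lambda>u. cnj (\<Lambda> (rev u) z)) (\<lambda>u. of_real (S_series u))) (\<lambda>u. \<Lambda> u z) w"

lemma sesq_cong: "(\<And>u. \<Lambda> u z = \<Lambda>' u z) \<Longrightarrow> sesq \<Lambda> w z = sesq \<Lambda>' w z"
  by (simp add: sesq_def)

lemma sesq_change:
  assumes "\<And>u. \<Lambda>' u z = conv c (\<lambda>v. \<Lambda> v z) u"
  shows "sesq \<Lambda>' w z = conv (conv (\<lambda>u. cnj (\<Lambda> (rev u) z))
    (conv (conv (\<lambda>u. cnj (c (rev u))) (\<lambda>u. of_real (S_series u))) c)) (\<lambda>u. \<Lambda> u z) w"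
proof -
  have a: "(\<lambda>u. cnj (\<Lambda>' (rev u) z)) = conv (\<lambda>u. cnj (\<Lambda> (rev u) z)) (\<lambda>u. cnj (c (rev u)))"
    by (rule ext) (simp only: assms cnj_conv conv_rev)
  have b: "(\<lambda>u. \<Lambda>' u z) = conv c (\<lambda>u. \<Lambda> u z)"
    by (rule ext) (rule assms)
  show ?thesis unfolding sesq_def a b by (simp only: conv_assoc_fun)
qed

lemma cnj_expl: "cnj (expl i c u) = expl i (cnj c) u"
  by (simp add: expl_def)

text \<open>The exponent \<open>2 \<pi> \<i>\<close> is purely imaginary, so the conjugated
  exponential is the inverse one, and \<open>S\<close> is conjugated by a series in
  \<open>X0\<close>.\<close>

lemma sesq_Lleft:
  assumes w: "w \<in> B0" and z: "Im z \<noteq> 0"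
  shows "sesq Lleft w z = sesq L w z"
proof (cases "Im z > 0")
  case True
  then show ?thesis by (intro sesq_cong Lleft_upper)
next
  case False
  then have z: "Im z < 0" using z by simp
  define c where "c = 2 * \<i> * complex_of_real pi"
  have cc: "cnj c = - c" by (simp add: c_def)
  have "sesq Lleft w z = conv (conv (\<lambda>u. cnj (L (rev u) z))
    (conv (conv (\<lambda>u. cnj (expl X0 c (rev u))) (\<lambda>u. of_real (S_series u))) (expl X0 c))) (\<lambda>u. L u z) w"
    by (rule sesq_change) (simp only: Lleft_lower[OF z] c_def)
  also have "(\<lambda>u. cnj (expl X0 c (rev u))) = expl X0 (- c)"
    by (rule ext) (simp only: cnj_expl expl_rev cc)
  also have "conv (conv (\<lambda>u. cnj (L (rev u) z)) (conv (conv (expl X0 (- c)) (\<lambda>u. of_real (S_series u))) (expl X0 c))) (\<lambda>u. L u z) w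
     = sesq L w z"
    unfolding sesq_def
  proof (rule conv3_cong_B0[OF w exp_conjugate])
    fix w assume "w \<in> B0"
    then show "lsh X0 (\<lambda>u. complex_of_real (S_series u)) w = rsh (\<lambda>u. of_real (S_series u)) X0 w"
      using S_series_commutes[of w] by (auto simp: lsh_def rsh_def)
  qed
  finally show ?thesis .
qed

text \<open>Both sides are rewritten in the solution normalised at 1. There \<open>S\<close> is
  replaced by \<open>Z~ S Z\<close>, and crossing the cut conjugates this series by an exponential
  of \<open>X1\<close>.\<close>

lemma sesq_Lright:
  assumes w: "w \<in> B0" and z: "Im z \<noteq> 0"
  shows "sesq Lright w z = sesq L w z"
proof (cases "Im z > 0")
  case True
  then show ?thesis by (intro sesq_cong Lright_upper)
next
  case False
  then have z: "Im z < 0" using z by simp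
  have slit: "z \<in> slit_domain" using z by (simp add: slit_domain_iff)
  define c where "c = - (2 * \<i> * complex_of_real pi)"
  define \<Lambda> where "\<Lambda> v z = L (map swap v) (1 - z)" for v z
  define Zc where "Zc = (\<lambda>u. complex_of_real (Zser u))"
  define Sc where "Sc = (\<lambda>u. complex_of_real (S_series u))"
  let ?Zr = "\<lambda>u. cnj (Zc (rev u))"
  have cc: "cnj c = - c" by (simp add: c_def)
  have M: "conv (conv ?Zr Sc) Zc = (\<lambda>u. of_real (monodromy_series u))"
  proof
    fix u
    have "(\<lambda>u. cnj (Zc (rev u))) = (\<lambda>u. of_real (Zser (rev u)))" by (simp add: Zc_def)
    moreover have "conv (\<lambda>u. of_real (Zser (rev u))) Sc = (\<lambda>u. complex_of_real (conv (\<lambda>u. Zser (rev u)) S_series u))"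
      by (rule ext) (simp only: Sc_def conv_of_real)
    ultimately show "conv (conv ?Zr Sc) Zc u = of_real (monodromy_series u)"
      by (simp only: Zc_def conv_of_real)
  qed
  have 1: "sesq L w z = conv (conv (\<lambda>u. cnj (\<Lambda> (rev u) z)) (conv (conv ?Zr Sc) Zc)) (\<lambda>u. \<Lambda> u z) w"
    unfolding Sc_def by (rule sesq_change) (simp only: Zc_def \<Lambda>_def L_Zser[OF slit])
  have 2: "sesq Lright w z = conv (conv (\<lambda>u. cnj (\<Lambda> (rev u) z))
     (conv (conv (\<lambda>u. cnj (conv Zc (expl X1 c) (rev u))) Sc) (conv Zc (expl X1 c)))) (\<lambda>u. \<Lambda> u z) w"
    unfolding Sc_def by (rule sesq_change) (simp only: Zc_def \<Lambda>_def Lright_lower[OF z] c_def conv_assoc)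
  have 3: "(\<lambda>u. cnj (conv Zc (expl X1 c) (rev u))) = conv (expl X1 (- c)) ?Zr"
    by (rule ext) (simp only: cnj_conv conv_rev cnj_expl expl_rev cc)
  have 4: "conv (conv (conv (expl X1 (- c)) ?Zr) Sc) (conv Zc (expl X1 c))
      = conv (conv (expl X1 (- c)) (conv (conv ?Zr Sc) Zc)) (expl X1 c)"
    by (simp only: conv_assoc_fun)
  show ?thesis
    unfolding 1 2 3 4 M
  proof (rule conv3_cong_B0[OF w exp_conjugate])
    fix w assume "w \<in> B0"
    then show "lsh X1 (\<lambda>u. complex_of_real (monodromy_series u)) w = rsh (\<lambda>u. of_real (monodromy_series u)) X1 w"
      using monodromy_commutes[of w] by (auto simp: lsh_def rsh_def split: if_splits)
  qed
qed

text \<open>Any two of the three planes meet only off the real axis, where \<open>sesq_Lleft\<close>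
  and \<open>sesq_Lright\<close> show that the choices agree on \<open>B0\<close>.\<close>

definition Gfun :: "word \<Rightarrow> complex \<Rightarrow> complex" where
  "Gfun w z = (if z \<in> slit_domain then sesq L w z else if z \<in> left_plane then sesq Lleft w z else sesq Lright w z)"

section \<open>Local solutions compatible with the glued function\<close>

definition good_sol :: "complex set \<Rightarrow> (word \<Rightarrow> complex \<Rightarrow> complex) \<Rightarrow> bool" where
  "good_sol U \<Lambda> \<longleftrightarrow> open U \<and> poly_sol U \<Lambda> \<and> (\<forall>w\<in>B0. \<forall>z\<in>U. sesq \<Lambda> w z = Gfun w z)"

lemma good_sol_L: "good_sol slit_domain L"
  by (simp add: good_sol_def open_slit_domain poly_sol_L Gfun_def)

lemma good_sol_Lleft: "good_sol left_plane Lleft"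
  unfolding good_sol_def Gfun_def
  using open_left_plane poly_sol_Lleft sesq_Lleft by (auto simp: slit_domain_iff left_plane_def)

lemma good_sol_Lright: "good_sol right_plane Lright"
  unfolding good_sol_def Gfun_def
  using open_right_plane poly_sol_Lright sesq_Lleft sesq_Lright
  by (auto simp: slit_domain_iff left_plane_def right_plane_def)

lemma good_sol_ex: "z \<in> - {0, 1} \<Longrightarrow> \<exists>U \<Lambda>. z \<in> U \<and> good_sol U \<Lambda>"
  using planes_cover[of z] good_sol_L good_sol_Lleft good_sol_Lright by auto

lemma good_sol_subset: "good_sol U \<Lambda> \<Longrightarrow> open V \<Longrightarrow> V \<subseteq> U \<Longrightarrow> good_sol V \<Lambda>"
  unfolding good_sol_def using poly_sol_subset by blast

text \<open>On the overlap \<open>\<Lambda> = c \<Lambda>'\<close>. Both solutions give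
  \<open>Gfun\<close> at a common point \<open>a\<close>; cancelling the values of
  \<open>\<Lambda>'\<close> at \<open>a\<close> on both sides shows that \<open>c~ S c\<close>
  equals \<open>S\<close> on \<open>B0\<close>. Hence \<open>c \<Lambda>'\<close> stays compatible
  on all of \<open>V\<close>.\<close>

lemma good_extend:
  assumes \<Lambda>: "good_sol U \<Lambda>" and \<Lambda>': "good_sol V \<Lambda>'" and UV: "connected (U \<inter> V)" "U \<inter> V \<noteq> {}"
  obtains \<Lambda>'' where "good_sol V \<Lambda>''" "\<And>w z. z \<in> U \<inter> V \<Longrightarrow> \<Lambda>'' w z = \<Lambda> w z"
proof -
  have o: "open U" "open V" and p: "poly_sol U \<Lambda>" "poly_sol V \<Lambda>'" using \<Lambda> \<Lambda>' by (auto simp: good_sol_def)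
  obtain c where c: "c [] = 1" "\<And>w z. z \<in> U \<inter> V \<Longrightarrow> \<Lambda> w z = conv c (\<lambda>v. \<Lambda>' v z) w"
    by (rule poly_sol_unique[OF poly_sol_subset[OF p(2) Int_lower2] poly_sol_subset[OF p(1) Int_lower1] open_Int[OF o] UV]) blast
  define \<Lambda>'' where "\<Lambda>'' w z = conv c (\<lambda>v. \<Lambda>' v z) w" for w z
  define Sc where "Sc = (\<lambda>u. complex_of_real (S_series u))"
  define T where "T = conv (conv (\<lambda>u. cnj (c (rev u))) Sc) c"
  have sesq: "sesq \<Lambda>'' w z = conv (conv (\<lambda>u. cnj (\<Lambda>' (rev u) z)) T) (\<lambda>u. \<Lambda>' u z) w" for w z
    unfolding T_def Sc_def by (rule sesq_change) (rule \<Lambda>''_def)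
  obtain a where a: "a \<in> U" "a \<in> V" using UV by blast
  have N: "\<Lambda>' [] a = 1" by (rule poly_sol_Nil[OF p(2) a(2)])
  have T: "T w = Sc w" if w: "w \<in> B0" for w
  proof (rule conv_left_cancel[where f = "\<lambda>u. cnj (\<Lambda>' (rev u) a)"])
    fix k
    show "conv (\<lambda>u. cnj (\<Lambda>' (rev u) a)) T (drop k w) = conv (\<lambda>u. cnj (\<Lambda>' (rev u) a)) Sc (drop k w)"
    proof (rule conv_right_cancel[where g = "\<lambda>u. \<Lambda>' u a"])
      fix l
      have B: "take l (drop k w) \<in> B0" using w by (intro B0_take B0_drop)
      have "sesq \<Lambda>'' (take l (drop k w)) a = sesq \<Lambda> (take l (drop k w)) a"
        by (rule sesq_cong) (use c(2) a in \<open>simp add: \<Lambda>''_def\<close>)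
      also have "\<dots> = Gfun (take l (drop k w)) a" using \<Lambda> B a by (simp add: good_sol_def)
      also have "\<dots> = sesq \<Lambda>' (take l (drop k w)) a" using \<Lambda>' B a by (simp add: good_sol_def)
      finally show "conv (conv (\<lambda>u. cnj (\<Lambda>' (rev u) a)) T) (\<lambda>u. \<Lambda>' u a) (take l (drop k w))
          = conv (conv (\<lambda>u. cnj (\<Lambda>' (rev u) a)) Sc) (\<lambda>u. \<Lambda>' u a) (take l (drop k w))"
        unfolding sesq by (simp only: sesq_def Sc_def)
    qed (rule N)
  qed (simp add: N)
  have "good_sol V \<Lambda>''"
    unfolding good_sol_def
  proof (intro conjI ballI)
    show "poly_sol V \<Lambda>''" unfolding \<Lambda>''_def[abs_def] by (rule poly_sol_conv[where c = c, OF p(2) o(2) c(1)])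
    fix w z assume wz: "w \<in> B0" "z \<in> V"
    have "sesq \<Lambda>'' w z = conv (conv (\<lambda>u. cnj (\<Lambda>' (rev u) z)) Sc) (\<lambda>u. \<Lambda>' u z) w"
      unfolding sesq by (rule conv3_cong_B0[OF wz(1) T])
    also have "\<dots> = Gfun w z" using \<Lambda>' wz by (simp add: good_sol_def sesq_def Sc_def)
    finally show "sesq \<Lambda>'' w z = Gfun w z" .
  qed (rule o(2))
  then show ?thesis using that c(2) by (simp add: \<Lambda>''_def)
qed

subsection \<open>Continuation along paths\<close>

text \<open>A chain of discs of radius \<open>e\<close> around \<open>\<gamma> (k / n)\<close>. The
  radius is bounded by a Lebesgue number for the sets carrying compatible solutions, and by
  \<open>e1\<close>, so that the chain can start with \<open>L\<close> itself.\<close>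

lemma good_continuation:
  assumes "admissible_path \<gamma>"
  obtains \<Lambda> e where "e > 0" "good_sol (ball (pathfinish \<gamma>) e) \<Lambda>" "\<And>u. continues_to \<gamma> (L u) (\<Lambda> u)"
proof -
  have \<gamma>: "path \<gamma>" "path_image \<gamma> \<subseteq> - {0, 1}" "\<gamma> 0 \<in> slit_domain"
    using assms by (auto simp: admissible_path_def pathstart_def)
  have "path_image \<gamma> \<subseteq> \<Union> {U. \<exists>\<Lambda>. good_sol U \<Lambda>}" using \<gamma>(2) good_sol_ex by blast
  moreover have "open U" if "U \<in> {U. \<exists>\<Lambda>. good_sol U \<Lambda>}" for U using that by (auto simp: good_sol_def)
  ultimately obtain e0 where e0: "0 < e0" "\<And>x. x \<in> path_image \<gamma> \<Longrightarrow> \<exists>U\<in>{U. \<exists>\<Lambda>. good_sol U \<Lambda>}. ball x e0 \<subseteq> U"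
    using Heine_Borel_lemma[OF compact_path_image[OF \<gamma>(1)]] by metis
  obtain e1 where e1: "0 < e1" "ball (\<gamma> 0) e1 \<subseteq> slit_domain"
    using open_slit_domain \<gamma>(3) open_contains_ball by blast
  define e where "e = min e0 e1"
  have e: "e > 0" using e0(1) e1(1) by (simp add: e_def)
  have "uniformly_continuous_on {0..1} \<gamma>"
    using \<gamma>(1) by (intro compact_uniformly_continuous) (auto simp: path_def)
  then obtain d where d: "d > 0" "\<And>s t. s \<in> {0..1} \<Longrightarrow> t \<in> {0..1} \<Longrightarrow> dist t s < d \<Longrightarrow> dist (\<gamma> t) (\<gamma> s) < e"
    unfolding uniformly_continuous_on_def using e by meson
  obtain N where "1 / real (Suc N) < d" using nat_approx_posE[OF d(1)] .
  then obtain n :: nat where n: "n > 0" "1 / real n < d" by blast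
  define c where "c k = \<gamma> (real k / real n)" for k :: nat
  have step: "\<gamma> s \<in> ball (c k) e" if "s \<in> {0..1}" "k \<le> n" "\<bar>s - real k / real n\<bar> \<le> 1 / real n" for s k
    using d(2)[of s "real k / real n"] that n unfolding c_def
    by (simp add: dist_real_def abs_minus_commute)
  have loc: "\<exists>\<Lambda>. good_sol (ball (c k) e) \<Lambda>" if k: "k \<le> n" for k
  proof -
    have "c k \<in> path_image \<gamma>" using k n by (auto simp: c_def path_image_def)
    then obtain U \<Lambda> where "good_sol U \<Lambda>" "ball (c k) e0 \<subseteq> U" using e0(2) by blast
    moreover have "ball (c k) e \<subseteq> ball (c k) e0" by (rule subset_ball) (simp add: e_def)
    ultimately have "good_sol (ball (c k) e) \<Lambda>" by - (rule good_sol_subset[of U \<Lambda>], auto)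
    then show ?thesis by blast
  qed
  \<comment> \<open>The guards \<open>k \<le> n\<close> here and \<open>k < n\<close> in
    \<open>Q\<close> make the conditions satisfiable at every natural number, as dependent choice
    requires.\<close>
  define P where "P k \<Lambda> \<longleftrightarrow> (k \<le> n \<longrightarrow> good_sol (ball (c k) e) \<Lambda>) \<and> (k = 0 \<longrightarrow> \<Lambda> = L)" for k \<Lambda>
  define Q where "Q k \<Lambda> \<Lambda>' \<longleftrightarrow> (k < n \<longrightarrow> (\<forall>w. \<forall>z\<in>ball (c k) e \<inter> ball (c (Suc k)) e. \<Lambda>' w z = \<Lambda> w z))"
    for k and \<Lambda> \<Lambda>' :: "word \<Rightarrow> complex \<Rightarrow> complex"
  have "\<exists>\<Lambda>. \<forall>k. P k (\<Lambda> k) \<and> Q k (\<Lambda> k) (\<Lambda> (Suc k))"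
  proof (rule dependent_nat_choice)
    have "good_sol (ball (c 0) e) L"
      by (rule good_sol_subset[OF good_sol_L]) (use e1(2) in \<open>auto simp: c_def e_def\<close>)
    then show "\<exists>\<Lambda>. P 0 \<Lambda>" by (auto simp: P_def)
    fix \<Lambda> k assume \<Lambda>: "P k \<Lambda>"
    show "\<exists>\<Lambda>'. P (Suc k) \<Lambda>' \<and> Q k \<Lambda> \<Lambda>'"
    proof (cases "k < n")
      case True
      then have g: "good_sol (ball (c k) e) \<Lambda>" using \<Lambda> by (simp add: P_def)
      obtain \<Lambda>' where g': "good_sol (ball (c (Suc k)) e) \<Lambda>'" using loc[of "Suc k"] True by auto
      have "real (Suc k) / real n - real k / real n = 1 / real n" by (simp add: diff_divide_distrib[symmetric])
      then have "c (Suc k) \<in> ball (c k) e"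
        unfolding c_def[of "Suc k"] using True n by (intro step) auto
      then have ne: "ball (c k) e \<inter> ball (c (Suc k)) e \<noteq> {}" using e by (metis IntI centre_in_ball empty_iff)
      obtain \<Lambda>'' where "good_sol (ball (c (Suc k)) e) \<Lambda>''" "\<And>w z. z \<in> ball (c k) e \<inter> ball (c (Suc k)) e \<Longrightarrow> \<Lambda>'' w z = \<Lambda> w z"
        by (rule good_extend[OF g g' convex_connected[OF convex_Int[OF convex_ball convex_ball]] ne]) blast
      then show ?thesis by (auto simp: P_def Q_def)
    qed (auto simp: P_def Q_def)
  qed
  then obtain \<Lambda> where P: "\<And>k. P k (\<Lambda> k)" and Q: "\<And>k. Q k (\<Lambda> k) (\<Lambda> (Suc k))" by blast
  \<comment> \<open>Index of the disc in use at time \<open>t\<close>; it jumps at the multiples of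
    \<open>1 / n\<close>, and \<open>Q\<close> matches the germs there.\<close>
  define j where "j t = nat \<lfloor>t * real n\<rfloor>" for t
  have j: "j t \<le> n" "real (j t) \<le> t * real n" "t * real n < real (j t) + 1" if "t \<in> {0..1}" for t
  proof -
    have 0: "0 \<le> t * real n" "t * real n \<le> real n" using that by (auto simp: mult_left_le_one_le)
    then have r: "real (j t) = of_int \<lfloor>t * real n\<rfloor>" by (simp add: j_def)
    show "real (j t) \<le> t * real n" "t * real n < real (j t) + 1" unfolding r by linarith+
    then show "j t \<le> n" using 0(2) by linarith
  qed
  have near: "\<gamma> s \<in> ball (c k) e" if "s \<in> {0..1}" "k \<le> n" "real k - 1 \<le> s * real n" "s * real n \<le> real k + 1" for s k
  proof (rule step[OF that(1,2)])
    have "\<bar>s * real n - real k\<bar> \<le> 1" using that by linarith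
    moreover have "s - real k / real n = (s * real n - real k) / real n" using n by (simp add: field_simps)
    ultimately show "\<bar>s - real k / real n\<bar> \<le> 1 / real n" using n by (simp add: abs_divide divide_right_mono)
  qed
  have "continues_to \<gamma> (L u) (\<Lambda> n u)" for u
    unfolding continues_to_def
  proof (intro exI[of _ "\<lambda>t. \<Lambda> (j t) u"] conjI ballI)
    fix t :: real assume t: "t \<in> {0..1}"
    have g: "good_sol (ball (c (j t)) e) (\<Lambda> (j t))" using P[of "j t"] j(1)[OF t] by (simp add: P_def)
    have "\<gamma> t \<in> ball (c (j t)) e" using j[OF t] t by (intro near) linarith+
    moreover have "\<Lambda> (j t) u holomorphic_on ball (c (j t)) e"
      using g by (intro poly_sol_holomorphic) (auto simp: good_sol_def)
    ultimately show "\<Lambda> (j t) u analytic_on {\<gamma> t}" unfolding analytic_at by blast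
    \<comment> \<open>The time until the next jump. Within this distance of \<open>t\<close> the
      index equals \<open>j t\<close> or, for earlier times, is one less.\<close>
    define \<delta> where "\<delta> = (real (j t) + 1 - t * real n) / real n"
    have "\<delta> > 0" using j(3)[OF t] n by (simp add: \<delta>_def)
    then have "\<forall>\<^sub>F s in at t within {0..1}. dist s t < \<delta>" by (rule eventually_at_ball'[THEN eventually_mono]) (auto simp: dist_commute)
    moreover have "\<forall>\<^sub>F s in at t within {0..1}. s \<in> {0..1}" by (auto simp: eventually_at_filter)
    ultimately show "\<forall>\<^sub>F s in at t within {0..1}. \<forall>\<^sub>F z in nhds (\<gamma> s). \<Lambda> (j s) u z = \<Lambda> (j t) u z"
    proof eventually_elim
      fix s :: real assume s: "dist s t < \<delta>" "s \<in> {0..1}"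
      have "\<bar>s - t\<bar> * real n < \<delta> * real n" using s n by (simp add: dist_real_def)
      then have "\<bar>s * real n - t * real n\<bar> < real (j t) + 1 - t * real n"
        using n by (simp add: \<delta>_def abs_mult left_diff_distrib[symmetric])
      then have b: "real (j s) < real (j t) + 1" "real (j t) < real (j s) + 2"
        using j[OF s(2)] j[OF t] by linarith+
      then have "j s = j t \<or> Suc (j s) = j t" by linarith
      then show "\<forall>\<^sub>F z in nhds (\<gamma> s). \<Lambda> (j s) u z = \<Lambda> (j t) u z"
      proof
        assume k: "Suc (j s) = j t"
        have lt: "j s < n" using k j(1)[OF t] by linarith
        have "\<gamma> s \<in> ball (c (j s)) e" using j[OF s(2)] s(2) by (intro near) linarith+
        moreover have "\<gamma> s \<in> ball (c (Suc (j s))) e" using j[OF s(2)] s(2) lt by (intro near) auto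
        ultimately have "\<forall>\<^sub>F z in nhds (\<gamma> s). z \<in> ball (c (j s)) e \<inter> ball (c (Suc (j s))) e"
          by (intro eventually_nhds_in_open) auto
        then show ?thesis
        proof (rule eventually_mono)
          fix z assume "z \<in> ball (c (j s)) e \<inter> ball (c (Suc (j s))) e"
          then show "\<Lambda> (j s) u z = \<Lambda> (j t) u z" using Q[of "j s"] lt by (simp add: Q_def k)
        qed
      qed simp
    qed
  next
    have "\<Lambda> (j 0) = L" using P[of 0] by (simp add: P_def j_def)
    then show "\<forall>\<^sub>F z in nhds (pathstart \<gamma>). \<Lambda> (j 0) u z = L u z" by simp
    show "\<forall>\<^sub>F z in nhds (pathfinish \<gamma>). \<Lambda> (j 1) u z = \<Lambda> n u z" by (simp add: j_def)
  qed
  moreover have "c n = pathfinish \<gamma>" using n by (simp add: c_def pathfinish_def)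
  ultimately show ?thesis using that[of e "\<Lambda> n"] P[of n] e by (simp add: P_def)
qed

text \<open>Agreement of the two germs is locally constant in time: near \<open>t\<close> both are
  germs of fixed holomorphic functions on one disc, where the identity theorem applies.
  Connectedness of the interval finishes.\<close>

lemma continues_to_unique:
  assumes \<gamma>: "path \<gamma>" and "continues_to \<gamma> f g" "continues_to \<gamma> f g'"
  shows "\<forall>\<^sub>F z in nhds (pathfinish \<gamma>). g z = g' z"
proof -
  obtain h where h: "\<And>t. t \<in> {0..1} \<Longrightarrow> h t analytic_on {\<gamma> t}"
      "\<And>t. t \<in> {0..1} \<Longrightarrow> \<forall>\<^sub>F s in at t within {0..1}. \<forall>\<^sub>F z in nhds (\<gamma> s). h s z = h t z"
      "\<forall>\<^sub>F z in nhds (pathstart \<gamma>). h 0 z = f z" "\<forall>\<^sub>F z in nhds (pathfinish \<gamma>). h 1 z = g z"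
    using assms(2) unfolding continues_to_def by blast
  obtain k where k: "\<And>t. t \<in> {0..1} \<Longrightarrow> k t analytic_on {\<gamma> t}"
      "\<And>t. t \<in> {0..1} \<Longrightarrow> \<forall>\<^sub>F s in at t within {0..1}. \<forall>\<^sub>F z in nhds (\<gamma> s). k s z = k t z"
      "\<forall>\<^sub>F z in nhds (pathstart \<gamma>). k 0 z = f z" "\<forall>\<^sub>F z in nhds (pathfinish \<gamma>). k 1 z = g' z"
    using assms(3) unfolding continues_to_def by blast
  define P where "P t \<longleftrightarrow> (\<forall>\<^sub>F z in nhds (\<gamma> t). h t z = k t z)" for t
  have "P 1"
  proof (rule connected_induction_simple[where S = "{0..1}" and a = 0])
    show "P 0" unfolding P_def using h(3) k(3) unfolding pathstart_def by eventually_elim simp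
    fix t :: real assume t: "t \<in> {0..1}"
    obtain r1 where r1: "r1 > 0" "h t holomorphic_on ball (\<gamma> t) r1" using h(1)[OF t] unfolding analytic_at_ball by blast
    obtain r2 where r2: "r2 > 0" "k t holomorphic_on ball (\<gamma> t) r2" using k(1)[OF t] unfolding analytic_at_ball by blast
    define D where "D = ball (\<gamma> t) (min r1 r2)"
    have D: "open D" "connected D" "\<gamma> t \<in> D" "h t holomorphic_on D" "k t holomorphic_on D"
      using r1 r2 by (auto simp: D_def intro: holomorphic_on_subset)
    have "(\<gamma> \<longlongrightarrow> \<gamma> t) (at t within {0..1})"
      using \<gamma> t by (auto simp: path_def continuous_on_def)
    then have "\<forall>\<^sub>F s in at t within {0..1}. \<gamma> s \<in> D" using D(1,3) topological_tendstoD by blast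
    with h(2)[OF t] k(2)[OF t]
    have "\<forall>\<^sub>F s in at t within {0..1}. (\<forall>\<^sub>F z in nhds (\<gamma> s). h s z = h t z) \<and> (\<forall>\<^sub>F z in nhds (\<gamma> s). k s z = k t z) \<and> \<gamma> s \<in> D"
      by eventually_elim blast
    then obtain T where T: "open T" "t \<in> T" "\<And>s. s \<in> T \<Longrightarrow> s \<noteq> t \<Longrightarrow> s \<in> {0..1} \<Longrightarrow>
        (\<forall>\<^sub>F z in nhds (\<gamma> s). h s z = h t z) \<and> (\<forall>\<^sub>F z in nhds (\<gamma> s). k s z = k t z) \<and> \<gamma> s \<in> D"
      unfolding eventually_at_topological by blast
    have all: "(\<forall>\<^sub>F z in nhds (\<gamma> s). h s z = h t z)" "(\<forall>\<^sub>F z in nhds (\<gamma> s). k s z = k t z)" "\<gamma> s \<in> D"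
      if "s \<in> T \<inter> {0..1}" for s
      using T(3)[of s] that D(3) by (cases "s = t"; auto)+
    have iff: "P s \<longleftrightarrow> (\<forall>z\<in>D. h t z = k t z)" if s: "s \<in> T \<inter> {0..1}" for s
    proof
      assume "P s"
      with all(1,2)[OF s] have "\<forall>\<^sub>F z in nhds (\<gamma> s). h t z = k t z" unfolding P_def by eventually_elim simp
      then obtain V where V: "open V" "\<gamma> s \<in> V" "\<And>z. z \<in> V \<Longrightarrow> h t z = k t z" unfolding eventually_nhds by blast
      show "\<forall>z\<in>D. h t z = k t z"
        using analytic_continuation_open[of "V \<inter> D" D "h t" "k t"] D V all(3)[OF s] by blast
    next
      assume "\<forall>z\<in>D. h t z = k t z"
      then have "\<forall>\<^sub>F z in nhds (\<gamma> s). h t z = k t z" using eventually_nhds_in_open[OF D(1) all(3)[OF s]] by (auto elim: eventually_mono)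
      with all(1,2)[OF s] show "P s" unfolding P_def by eventually_elim simp
    qed
    show "\<exists>T. openin (top_of_set {0..1}) T \<and> t \<in> T \<and> (\<forall>x\<in>T. \<forall>y\<in>T. P x \<longrightarrow> P y)"
    proof (intro exI conjI ballI impI)
      show "openin (top_of_set {0..1}) (T \<inter> {0..1})" using T(1) by (metis Int_commute openin_open_Int)
      show "t \<in> T \<inter> {0..1}" using T(2) t by simp
    qed (use iff in blast)
  qed auto
  with h(4) k(4) show ?thesis unfolding P_def pathfinish_def by eventually_elim simp
qed

lemma eventually_nhds_cnj: "eventually P (nhds p) \<Longrightarrow> eventually (\<lambda>z. P (cnj z)) (nhds (cnj p))"
proof -
  assume P: "eventually P (nhds p)"
  have "filterlim cnj (nhds (cnj (cnj p))) (nhds (cnj p))" by (intro tendsto_cnj filterlim_ident)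
  then show ?thesis using P by (simp add: filterlim_iff)
qed

lemma continues_to_cnj:
  assumes "continues_to \<gamma> f g"
  shows "continues_to (cnj \<circ> \<gamma>) (\<lambda>z. cnj (f (cnj z))) (\<lambda>z. cnj (g (cnj z)))"
proof -
  obtain h where h: "\<And>t. t \<in> {0..1} \<Longrightarrow> h t analytic_on {\<gamma> t}"
      "\<And>t. t \<in> {0..1} \<Longrightarrow> \<forall>\<^sub>F s in at t within {0..1}. \<forall>\<^sub>F z in nhds (\<gamma> s). h s z = h t z"
      "\<forall>\<^sub>F z in nhds (pathstart \<gamma>). h 0 z = f z" "\<forall>\<^sub>F z in nhds (pathfinish \<gamma>). h 1 z = g z"
    using assms unfolding continues_to_def by blast
  show ?thesis
    unfolding continues_to_def
  proof (intro exI[of _ "\<lambda>t z. cnj (h t (cnj z))"] conjI ballI)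
    fix t :: real assume t: "t \<in> {0..1}"
    obtain r where r: "r > 0" "h t holomorphic_on ball (\<gamma> t) r" using h(1)[OF t] unfolding analytic_at_ball by blast
    have d: "dist (cnj a) (cnj b) = dist a b" for a b
      by (metis complex_cnj_diff complex_mod_cnj dist_norm)
    have "cnj ` ball (cnj (\<gamma> t)) r = ball (\<gamma> t) r"
    proof safe
      fix z assume "z \<in> ball (\<gamma> t) r"
      then show "z \<in> cnj ` ball (cnj (\<gamma> t)) r" by (intro image_eqI[of _ _ "cnj z"]) (simp_all add: d)
    next
      fix z assume "z \<in> ball (cnj (\<gamma> t)) r"
      then show "cnj z \<in> ball (\<gamma> t) r" using d[of "cnj (\<gamma> t)" z] by simp
    qed
    then have "cnj \<circ> h t \<circ> cnj holomorphic_on ball (cnj (\<gamma> t)) r"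
      using r(2) by (intro holomorphic_on_compose_cnj_cnj) simp_all
    then show "(\<lambda>z. cnj (h t (cnj z))) analytic_on {(cnj \<circ> \<gamma>) t}"
      unfolding analytic_at_ball using r(1) by (auto simp: o_def)
    show "\<forall>\<^sub>F s in at t within {0..1}. \<forall>\<^sub>F z in nhds ((cnj \<circ> \<gamma>) s). cnj (h s (cnj z)) = cnj (h t (cnj z))"
      using h(2)[OF t] by (rule eventually_mono) (use eventually_nhds_cnj in \<open>auto simp: o_def\<close>)
  next
    show "\<forall>\<^sub>F z in nhds (pathstart (cnj \<circ> \<gamma>)). cnj (h 0 (cnj z)) = cnj (f (cnj z))"
      using eventually_nhds_cnj[OF h(3)] by (simp add: pathstart_def)
    show "\<forall>\<^sub>F z in nhds (pathfinish (cnj \<circ> \<gamma>)). cnj (h 1 (cnj z)) = cnj (g (cnj z))"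
      using eventually_nhds_cnj[OF h(4)] by (simp add: pathfinish_def)
  qed
qed

lemma continues_to_cong_start:
  assumes "continues_to \<gamma> f g" "\<forall>\<^sub>F z in nhds (pathstart \<gamma>). f z = f' z"
  shows "continues_to \<gamma> f' g"
proof -
  obtain h where h: "\<forall>t\<in>{0..1}. h t analytic_on {\<gamma> t} \<and>
        (\<forall>\<^sub>F s in at t within {0..1}. \<forall>\<^sub>F z in nhds (\<gamma> s). h s z = h t z)"
      "\<forall>\<^sub>F z in nhds (pathstart \<gamma>). h 0 z = f z" "\<forall>\<^sub>F z in nhds (pathfinish \<gamma>). h 1 z = g z"
    using assms(1) unfolding continues_to_def by blast
  have "\<forall>\<^sub>F z in nhds (pathstart \<gamma>). h 0 z = f' z" using h(2) assms(2) by eventually_elim simp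
  then show ?thesis unfolding continues_to_def using h by blast
qed

lemma F_comb_sesq: "F_comb w (\<lambda>u z. cnj (\<Lambda> u (cnj z))) \<Lambda> z = sesq \<Lambda> w z"
  using sum_triple_splits[of "\<lambda>u. cnj (\<Lambda> (rev u) z)" "\<lambda>u. complex_of_real (S_series u)" "\<lambda>u. \<Lambda> u z" w]
  by (simp add: F_comb_def sesq_def)

lemma F_comb_L: "z \<in> slit_domain \<Longrightarrow> F_comb w L L z = sesq L w z"
  using F_comb_sesq[of w L z] by (simp add: F_comb_def L_cnj)

lemma branches_ex:
  assumes \<gamma>: "admissible_path \<gamma>"
  obtains A B where "branches_along \<gamma> A B"
    "\<And>w. w \<in> B0 \<Longrightarrow> \<forall>\<^sub>F z in nhds (pathfinish \<gamma>). F_comb w A B z = Gfun w z"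
proof -
  obtain \<Lambda> e where e: "e > 0" "good_sol (ball (pathfinish \<gamma>) e) \<Lambda>" "\<And>u. continues_to \<gamma> (L u) (\<Lambda> u)"
    by (rule good_continuation[OF \<gamma>]) blast
  define A where "A = (\<lambda>u z. cnj (\<Lambda> u (cnj z)))"
  have "pathstart (cnj \<circ> \<gamma>) \<in> slit_domain" using \<gamma> by (simp add: admissible_path_def pathstart_def)
  then have s: "\<forall>\<^sub>F z in nhds (pathstart (cnj \<circ> \<gamma>)). z \<in> slit_domain"
    by (intro eventually_nhds_in_open open_slit_domain)
  have "continues_to (cnj \<circ> \<gamma>) (L u) (A u)" for u
    unfolding A_def
    by (rule continues_to_cong_start[OF continues_to_cnj[OF e(3)] eventually_mono[OF s]]) (simp add: L_cnj)
  then have "branches_along \<gamma> A \<Lambda>" using e(3) by (simp add: branches_along_def)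
  moreover have "\<forall>\<^sub>F z in nhds (pathfinish \<gamma>). F_comb w A \<Lambda> z = Gfun w z" if "w \<in> B0" for w
  proof -
    have "\<forall>\<^sub>F z in nhds (pathfinish \<gamma>). z \<in> ball (pathfinish \<gamma>) e"
      using e(1) by (intro eventually_nhds_in_open) auto
    then show ?thesis
      by (rule eventually_mono) (use e(2) that in \<open>simp add: A_def F_comb_sesq good_sol_def del: mem_ball\<close>)
  qed
  ultimately show ?thesis using that by blast
qed

text \<open>All branches along the path have the same germs at its end, so the branches built in
  \<open>branches_ex\<close> determine the value. This makes the description in
  \<open>sv_fun\<close> unique.\<close>

lemma branches_F_comb:
  assumes \<gamma>: "admissible_path \<gamma>" and br: "branches_along \<gamma> A B" and w: "w \<in> B0"
  shows "F_comb w A B (pathfinish \<gamma>) = Gfun w (pathfinish \<gamma>)"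
proof -
  obtain A' B' where br': "branches_along \<gamma> A' B'"
    and ev: "\<And>w. w \<in> B0 \<Longrightarrow> \<forall>\<^sub>F z in nhds (pathfinish \<gamma>). F_comb w A' B' z = Gfun w z"
    by (rule branches_ex[OF \<gamma>]) blast
  have p: "path \<gamma>" using \<gamma> by (simp add: admissible_path_def)
  then have p': "path (cnj \<circ> \<gamma>)" unfolding path_def o_def by (intro continuous_intros)
  have "A u (pathfinish (cnj \<circ> \<gamma>)) = A' u (pathfinish (cnj \<circ> \<gamma>))" for u
    by (rule eventually_nhds_x_imp_x[OF continues_to_unique[OF p']]) (use br br' in \<open>auto simp: branches_along_def\<close>)
  then have A: "A u (cnj (pathfinish \<gamma>)) = A' u (cnj (pathfinish \<gamma>))" for u by (simp add: pathfinish_def)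
  have B: "B u (pathfinish \<gamma>) = B' u (pathfinish \<gamma>)" for u
    by (rule eventually_nhds_x_imp_x[OF continues_to_unique[OF p]]) (use br br' in \<open>auto simp: branches_along_def\<close>)
  have "F_comb w A B (pathfinish \<gamma>) = F_comb w A' B' (pathfinish \<gamma>)" by (simp add: F_comb_def A B)
  also have "\<dots> = Gfun w (pathfinish \<gamma>)" by (rule eventually_nhds_x_imp_x[OF ev[OF w]])
  finally show ?thesis .
qed

theorem single_valued_F:
  assumes w: "w \<in> B0"
  shows "single_valued (F_comb w)"
  unfolding single_valued_def
proof (intro allI impI, elim conjE)
  fix \<gamma> assume \<gamma>: "admissible_path \<gamma>" and loop: "pathfinish \<gamma> = pathstart \<gamma>"
  obtain A B where AB: "branches_along \<gamma> A B"
    and ev: "\<And>w. w \<in> B0 \<Longrightarrow> \<forall>\<^sub>F z in nhds (pathfinish \<gamma>). F_comb w A B z = Gfun w z"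
    by (rule branches_ex[OF \<gamma>]) blast
  have "\<forall>\<^sub>F z in nhds (pathstart \<gamma>). z \<in> slit_domain"
    using \<gamma> by (intro eventually_nhds_in_open open_slit_domain) (simp add: admissible_path_def)
  with ev[OF w, unfolded loop] have "\<forall>\<^sub>F z in nhds (pathstart \<gamma>). F_comb w A B z = F_comb w L L z"
    by eventually_elim (simp add: F_comb_L Gfun_def)
  then show "\<exists>A B. branches_along \<gamma> A B \<and> (\<forall>\<^sub>F z in nhds (pathstart \<gamma>). F_comb w A B z = F_comb w L L z)"
    using AB by blast
qed

lemma F_eq_Gfun:
  assumes w: "w \<in> B0" and z: "z \<in> - {0, 1}"
  shows "F w z = Gfun w z"
  unfolding F_def sv_fun_def
proof (rule the_equality)
  have "path_connected (- {0, 1 :: complex})" by (rule path_connected_complement_countable) auto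
  moreover have half: "1 / 2 \<in> slit_domain" by (simp add: slit_domain_iff)
  ultimately obtain \<gamma> where \<gamma>: "path \<gamma>" "path_image \<gamma> \<subseteq> - {0, 1}" "pathstart \<gamma> = 1 / 2" "pathfinish \<gamma> = z"
    using z unfolding path_connected_def by (metis ComplI divide_eq_0_iff divide_eq_1_iff insertE one_eq_numeral_iff singletonD numeral_neq_zero zero_neq_one semiring_norm(85))
  then have adm: "admissible_path \<gamma>" using half by (simp only: admissible_path_def)
  obtain A B where AB: "branches_along \<gamma> A B" by (rule branches_ex[OF adm]) blast
  show "\<exists>\<gamma> A B. admissible_path \<gamma> \<and> pathfinish \<gamma> = z \<and> branches_along \<gamma> A B \<and> Gfun w z = F_comb w A B z"
    using branches_F_comb[OF adm AB w] adm AB \<gamma>(4) by metis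
next
  fix v assume "\<exists>\<gamma> A B. admissible_path \<gamma> \<and> pathfinish \<gamma> = z \<and> branches_along \<gamma> A B \<and> v = F_comb w A B z"
  then show "v = Gfun w z" using branches_F_comb w by blast
qed

subsection \<open>Real analyticity\<close>

text \<open>Stated with \<open>dsum\<close>, so that absolute convergence is available and products
  reduce to Cauchy products.\<close>

definition real_analytic_at :: "(complex \<Rightarrow> complex) \<Rightarrow> complex \<Rightarrow> bool" where
  "real_analytic_at f p \<longleftrightarrow> (\<exists>a r. r > 0 \<and> (\<forall>z\<in>ball p r. dsum a (of_real (Re (z - p))) (of_real (Im (z - p))) (f z)))"

lemma real_analytic_onI:
  assumes "\<And>p. p \<in> U \<Longrightarrow> real_analytic_at f p"
  shows "real_analytic_on f U"
  unfolding real_analytic_on_def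
proof
  fix p assume "p \<in> U"
  then obtain a r where ar: "r > 0" "\<And>z. z \<in> ball p r \<Longrightarrow> dsum a (of_real (Re (z - p))) (of_real (Im (z - p))) (f z)"
    using assms unfolding real_analytic_at_def by blast
  show "\<exists>a r. r > 0 \<and> (\<forall>z\<in>ball p r. ((\<lambda>(m, n). a m n * of_real (Re (z - p)) ^ m * of_real (Im (z - p)) ^ n) has_sum f z) UNIV)"
    using ar by (intro exI[of _ a] exI[of _ r] conjI ballI) (auto simp only: dsum_def dterm_def)
qed

lemma real_analytic_at_binop:
  assumes "real_analytic_at f p" "real_analytic_at g p"
    and "\<And>a b X Y u v. dsum a X Y u \<Longrightarrow> dsum b X Y v \<Longrightarrow> dsum (q a b) X Y (h u v)"
  shows "real_analytic_at (\<lambda>z. h (f z) (g z)) p"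
proof -
  obtain a r where a: "r > 0" "\<And>z. z \<in> ball p r \<Longrightarrow> dsum a (of_real (Re (z - p))) (of_real (Im (z - p))) (f z)"
    using assms(1) unfolding real_analytic_at_def by blast
  obtain b s where b: "s > 0" "\<And>z. z \<in> ball p s \<Longrightarrow> dsum b (of_real (Re (z - p))) (of_real (Im (z - p))) (g z)"
    using assms(2) unfolding real_analytic_at_def by blast
  show ?thesis
    unfolding real_analytic_at_def
  proof (intro exI conjI ballI)
    show "min r s > 0" using a(1) b(1) by simp
    fix z assume "z \<in> ball p (min r s)"
    then have "z \<in> ball p r" "z \<in> ball p s" by simp_all
    then show "dsum (q a b) (of_real (Re (z - p))) (of_real (Im (z - p))) (h (f z) (g z))"
      by (intro assms(3) a(2) b(2))
  qed
qed

lemma real_analytic_at_add: "real_analytic_at f p \<Longrightarrow> real_analytic_at g p \<Longrightarrow> real_analytic_at (\<lambda>z. f z + g z) p"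
  by (rule real_analytic_at_binop[where h = "(+)" and q = "\<lambda>a b m n. a m n + b m n"]) (simp_all only: dsum_add)

lemma real_analytic_at_mult: "real_analytic_at f p \<Longrightarrow> real_analytic_at g p \<Longrightarrow> real_analytic_at (\<lambda>z. f z * g z) p"
  by (rule real_analytic_at_binop[where h = "(*)" and q = dmult]) (simp_all only: dsum_mult)

lemma real_analytic_at_cnj:
  assumes "real_analytic_at f p" shows "real_analytic_at (\<lambda>z. cnj (f z)) p"
proof -
  have d: "dsum (\<lambda>m n. cnj (a m n)) (of_real x) (of_real y) (cnj v)" if "dsum a (of_real x) (of_real y) v" for a x y v
  proof -
    have e: "dterm (\<lambda>m n. cnj (a m n)) (of_real x) (of_real y) = (\<lambda>p. cnj (dterm a (of_real x) (of_real y) p))"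
      by (auto simp: dterm_def fun_eq_iff)
    show ?thesis using that unfolding dsum_def e by (simp add: has_sum_cnj_iff)
  qed
  show ?thesis using assms d unfolding real_analytic_at_def by meson
qed

lemma real_analytic_at_const: "real_analytic_at (\<lambda>z. c) p"
proof -
  have "dsum (\<lambda>m n. if n = 0 then (if m = 0 then c else 0) else 0) X Y c" for X Y :: complex
  proof (rule dsum_single)
    have "((\<lambda>m. (if m = 0 then c else 0) * X ^ m) has_sum c) {0}" by (rule has_sum_finiteI) auto
    then show "((\<lambda>m. (if m = 0 then c else 0) * X ^ m) has_sum c) UNIV"
      by (rule has_sum_cong_neutral[THEN iffD1, rotated -1]) auto
    have "(\<lambda>m. norm ((if m = 0 then c else 0) * X ^ m)) summable_on {0}" by simp
    then show "(\<lambda>m. norm ((if m = 0 then c else 0) * X ^ m)) summable_on UNIV"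
      by (rule summable_on_cong_neutral[THEN iffD1, rotated -1]) auto
  qed
  then show ?thesis unfolding real_analytic_at_def by (meson zero_less_one)
qed

lemma real_analytic_at_sum:
  assumes "\<And>i. i \<in> I \<Longrightarrow> real_analytic_at (f i) p"
  shows "real_analytic_at (\<lambda>z. \<Sum>i\<in>I. f i z) p"
proof (cases "finite I")
  case True
  then show ?thesis
    using assms by (induction I rule: finite_induct) (simp_all add: real_analytic_at_const real_analytic_at_add)
qed (simp add: real_analytic_at_const)

lemma real_analytic_at_cong:
  assumes "real_analytic_at f p" "open U" "p \<in> U" "\<And>z. z \<in> U \<Longrightarrow> g z = f z"
  shows "real_analytic_at g p"
proof -
  obtain a r where a: "r > 0" "\<And>z. z \<in> ball p r \<Longrightarrow> dsum a (of_real (Re (z - p))) (of_real (Im (z - p))) (f z)"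
    using assms(1) unfolding real_analytic_at_def by blast
  obtain s where s: "s > 0" "ball p s \<subseteq> U" using assms(2,3) open_contains_ball by blast
  show ?thesis
    unfolding real_analytic_at_def
  proof (intro exI conjI ballI)
    show "min r s > 0" using a(1) s(1) by simp
    fix z assume "z \<in> ball p (min r s)"
    then have "z \<in> ball p r" "z \<in> U" using s(2) by auto
    then show "dsum a (of_real (Re (z - p))) (of_real (Im (z - p))) (g z)" using a(2) assms(4) by simp
  qed
qed

text \<open>The power series of a holomorphic function at \<open>p\<close> is expanded binomially in \<open>z - p = x + \<i> y\<close>.\<close>

lemma real_analytic_at_holomorphic:
  assumes f: "f holomorphic_on U" "open U" "p \<in> U"
  shows "real_analytic_at f p"
proof -
  obtain r where r: "r > 0" "ball p r \<subseteq> U" using f open_contains_ball by blast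
  define c where "c n = (deriv ^^ n) f p / fact n" for n
  have ser: "(\<lambda>n. c n * (z - p) ^ n) sums f z" if "z \<in> ball p r" for z
    unfolding c_def by (rule holomorphic_power_series[OF holomorphic_on_subset[OF f(1) r(2)] that])
  define a where "a m n = c (m + n) * of_nat ((m + n) choose m) * \<i> ^ n" for m n
  let ?\<phi> = "\<lambda>(n, i). (i, n - i) :: nat \<times> nat"
  have bij: "bij_betw ?\<phi> (SIGMA n : UNIV. {..n}) UNIV"
    by (rule bij_betwI[where g = "\<lambda>(i, j). (i + j, i)"]) auto
  \<comment> \<open>Radius \<open>r / 2\<close>, because the binomial terms are summed absolutely
    and \<open>\<bar>x\<bar> + \<bar>y\<bar>\<close> may reach twice a bound for
    \<open>norm (z - p)\<close> but must stay below \<open>r\<close>.\<close>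
  have "dsum a (of_real (Re (z - p))) (of_real (Im (z - p))) (f z)" if z: "z \<in> ball p (r / 2)" for z
  proof -
    define x y where "x = Re (z - p)" and "y = Im (z - p)"
    define q where "q = \<bar>x\<bar> + \<bar>y\<bar>"
    have xy: "of_real x + \<i> * of_real y = z - p" by (simp add: x_def y_def complex_eq_iff)
    have "\<bar>x\<bar> \<le> norm (z - p)" "\<bar>y\<bar> \<le> norm (z - p)" unfolding x_def y_def by (rule abs_Re_le_cmod abs_Im_le_cmod)+
    moreover have "norm (z - p) < r / 2" using z by (simp add: dist_norm norm_minus_commute)
    ultimately have q: "0 \<le> q" "q < r" by (simp_all add: q_def)
    define q' where "q' = (q + r) / 2"
    have q': "q < q'" "0 < q'" "q' < r" using q r(1) by (simp_all add: q'_def)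
    have "summable (\<lambda>n. c n * (p + of_real q' - p) ^ n)"
      by (rule sums_summable[OF ser]) (use q' in \<open>simp add: dist_norm\<close>)
    then have "summable (\<lambda>n. c n * of_real q' ^ n)" by simp
    then have "summable (\<lambda>n. norm (c n * of_real q ^ n))"
      by (rule powser_insidea) (use q q' in simp)
    then have S: "summable (\<lambda>n. norm (c n) * q ^ n)" using q by (simp add: norm_mult norm_power)
    have S': "(\<lambda>n. norm (c n) * q ^ n) summable_on UNIV"
      by (rule summable_nonneg_imp_summable_on[OF S]) (use q in simp)
    let ?t = "dterm a (of_real x) (of_real y)"
    have inn: "((\<lambda>i. norm (?t (?\<phi> (n, i)))) has_sum norm (c n) * q ^ n) {..n}" for n
    proof (rule has_sum_finiteI)
      have "norm (?t (?\<phi> (n, i))) = norm (c n) * (of_nat (n choose i) * \<bar>x\<bar> ^ i * \<bar>y\<bar> ^ (n - i))" if "i \<in> {..n}" for i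
        using that by (simp add: dterm_def a_def norm_mult norm_power)
      then show "norm (c n) * q ^ n = (\<Sum>i\<le>n. norm (?t (?\<phi> (n, i))))"
        unfolding q_def binomial_ring sum_distrib_left by (intro sum.cong) auto
    qed simp
    have "(\<lambda>u. norm (?t (?\<phi> u))) summable_on (SIGMA n : UNIV. {..n})"
      by (rule summable_on_SigmaI[OF inn S']) simp
    then have abs: "(\<lambda>u. norm (?t u)) summable_on UNIV"
      by (subst (asm) summable_on_reindex_bij_betw[OF bij, of "\<lambda>u. norm (?t u)"])
    have sum: "(?t has_sum infsum ?t UNIV) UNIV" by (rule has_sum_infsum[OF abs_summable_summable[OF abs]])
    then have "((\<lambda>u. ?t (?\<phi> u)) has_sum infsum ?t UNIV) (SIGMA n : UNIV. {..n})"
      by (subst has_sum_reindex_bij_betw[OF bij])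
    then have "((\<lambda>n. c n * (z - p) ^ n) has_sum infsum ?t UNIV) UNIV"
    proof (rule has_sum_SigmaD)
      fix n :: nat
      show "((\<lambda>i. ?t (?\<phi> (n, i))) has_sum c n * (z - p) ^ n) {..n}"
      proof (rule has_sum_finiteI)
        have "?t (?\<phi> (n, i)) = c n * (of_nat (n choose i) * of_real x ^ i * (\<i> * of_real y) ^ (n - i))" if "i \<in> {..n}" for i
          using that by (simp add: dterm_def a_def power_mult_distrib)
        then show "c n * (z - p) ^ n = (\<Sum>i\<le>n. ?t (?\<phi> (n, i)))"
          unfolding xy[symmetric] binomial_ring sum_distrib_left by (intro sum.cong) auto
      qed simp
    qed
    then have "(\<lambda>n. c n * (z - p) ^ n) sums infsum ?t UNIV" by (rule has_sum_imp_sums)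
    moreover have "(\<lambda>n. c n * (z - p) ^ n) sums f z" by (rule ser) (use z r(1) in simp)
    ultimately have "infsum ?t UNIV = f z" by (rule sums_unique2)
    with abs show ?thesis unfolding dsum_def x_def[symmetric] y_def[symmetric]
      using sum by simp
  qed
  then show ?thesis unfolding real_analytic_at_def using r(1) by (intro exI[of _ a] exI[of _ "r / 2"]) simp
qed

lemma F_local:
  assumes "z \<in> - {0, 1}"
  obtains U \<Lambda> where "open U" "z \<in> U" "U \<subseteq> - {0, 1}" "poly_sol U \<Lambda>" "\<And>w z. w \<in> B0 \<Longrightarrow> z \<in> U \<Longrightarrow> F w z = sesq \<Lambda> w z"
proof -
  obtain V \<Lambda> where V: "z \<in> V" "good_sol V \<Lambda>" using good_sol_ex[OF assms] by blast
  have "open (- {0, 1 :: complex})" by (intro open_Compl finite_imp_closed) simp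
  then have o: "open (V \<inter> - {0, 1})" using V(2) by (auto simp: good_sol_def)
  have g: "good_sol (V \<inter> - {0, 1}) \<Lambda>" by (rule good_sol_subset[OF V(2) o]) simp
  show ?thesis
  proof (rule that[of "V \<inter> - {0, 1}" \<Lambda>])
    show "poly_sol (V \<inter> - {0, 1}) \<Lambda>" using g by (simp add: good_sol_def)
    fix w z assume "w \<in> B0" "z \<in> V \<inter> - {0, 1}"
    then show "F w z = sesq \<Lambda> w z" using g F_eq_Gfun[of w z] by (simp add: good_sol_def)
  qed (use o V assms in auto)
qed

theorem real_analytic_F:
  assumes w: "w \<in> B0"
  shows "real_analytic_on (F w) (- {0, 1})"
proof (rule real_analytic_onI)
  fix p :: complex assume p: "p \<in> - {0, 1}"
  obtain U \<Lambda> where U: "open U" "p \<in> U" "poly_sol U \<Lambda>" "\<And>w z. w \<in> B0 \<Longrightarrow> z \<in> U \<Longrightarrow> F w z = sesq \<Lambda> w z"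
    by (rule F_local[OF p]) blast
  have h: "real_analytic_at (\<Lambda> u) p" for u
    by (rule real_analytic_at_holomorphic[OF poly_sol_holomorphic[OF U(3,1)] U(1,2)])
  have "real_analytic_at (sesq \<Lambda> w) p"
    unfolding sesq_def[abs_def] conv_def
    by (intro real_analytic_at_sum real_analytic_at_mult real_analytic_at_cnj real_analytic_at_const h)
  then show "real_analytic_at (F w) p" by (rule real_analytic_at_cong[OF _ U(1,2)]) (rule U(4)[OF w])
qed

subsection \<open>Wirtinger derivatives\<close>

text \<open>Records the coefficients of \<open>dz\<close> and of its conjugate in the total
  derivative; holomorphic functions and their conjugates each have only one of them.\<close>

definition has_wirtinger :: "(complex \<Rightarrow> complex) \<Rightarrow> complex \<Rightarrow> complex \<Rightarrow> complex \<Rightarrow> bool" where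
  "has_wirtinger f a b z \<longleftrightarrow> (f has_derivative (\<lambda>h. a * h + b * cnj h)) (at z)"

lemma has_wirtinger_imp: 
  assumes "has_wirtinger f a b z" shows "wirtinger_dz f z = a" "wirtinger_dzbar f z = b"
proof -
  have "frechet_derivative f (at z) = (\<lambda>h. a * h + b * cnj h)"
    using assms unfolding has_wirtinger_def by (rule frechet_derivative_at[symmetric])
  then show "wirtinger_dz f z = a" "wirtinger_dzbar f z = b"
    by (simp_all add: wirtinger_dz_def wirtinger_dzbar_def algebra_simps)
qed

lemma has_wirtinger_add:
  assumes "has_wirtinger f a b z" "has_wirtinger g c d z"
  shows "has_wirtinger (\<lambda>z. f z + g z) (a + c) (b + d) z"
proof -
  have e: "(\<lambda>h. (a + c) * h + (b + d) * cnj h) = (\<lambda>h. (a * h + b * cnj h) + (c * h + d * cnj h))"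
    by (simp add: fun_eq_iff algebra_simps)
  show ?thesis using assms unfolding has_wirtinger_def e by (rule has_derivative_add)
qed

lemma has_wirtinger_mult:
  assumes "has_wirtinger f a b z" "has_wirtinger g c d z"
  shows "has_wirtinger (\<lambda>z. f z * g z) (a * g z + f z * c) (b * g z + f z * d) z"
proof -
  have e: "(\<lambda>h. (a * g z + f z * c) * h + (b * g z + f z * d) * cnj h) = (\<lambda>h. f z * (c * h + d * cnj h) + (a * h + b * cnj h) * g z)"
    by (simp add: fun_eq_iff algebra_simps)
  show ?thesis using assms unfolding has_wirtinger_def e by (rule has_derivative_mult)
qed

lemma has_wirtinger_const: "has_wirtinger (\<lambda>z. c) 0 0 z"
  by (simp add: has_wirtinger_def)

lemma has_wirtinger_sum:
  assumes "finite I" "\<And>i. i \<in> I \<Longrightarrow> has_wirtinger (f i) (a i) (b i) z"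
  shows "has_wirtinger (\<lambda>z. \<Sum>i\<in>I. f i z) (\<Sum>i\<in>I. a i) (\<Sum>i\<in>I. b i) z"
  using assms by (induction I rule: finite_induct) (simp_all add: has_wirtinger_const has_wirtinger_add)

lemma has_wirtinger_holomorphic: "(f has_field_derivative d) (at z) \<Longrightarrow> has_wirtinger f d 0 z"
  by (simp add: has_wirtinger_def has_field_derivative_def)

lemma has_wirtinger_cnj:
  assumes "(f has_field_derivative d) (at z)" shows "has_wirtinger (\<lambda>z. cnj (f z)) 0 (cnj d) z"
proof -
  have "((\<lambda>z. cnj (f z)) has_derivative (\<lambda>h. cnj (d * h))) (at z)"
    using assms unfolding has_field_derivative_def by (rule has_derivative_cnj)
  then show ?thesis by (simp add: has_wirtinger_def)
qed

lemma has_wirtinger_cong: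
  assumes "has_wirtinger f a b z" "open U" "z \<in> U" "\<And>z. z \<in> U \<Longrightarrow> f z = g z"
  shows "has_wirtinger g a b z"
  using assms has_derivative_transform_within_open[of f _ z UNIV U g] unfolding has_wirtinger_def by blast

lemma has_wirtinger_conv:
  assumes "\<And>u. has_wirtinger (\<lambda>z. f z u) (fa u) (fb u) z" "\<And>u. has_wirtinger (\<lambda>z. g z u) (ga u) (gb u) z"
  shows "has_wirtinger (\<lambda>z. conv (f z) (g z) w) (conv fa (g z) w + conv (f z) ga w) (conv fb (g z) w + conv (f z) gb w) z"
  unfolding conv_def sum.distrib[symmetric]
  by (intro has_wirtinger_sum has_wirtinger_mult assms) simp

text \<open>The factor in \<open>z\<close> loses its last letter under differentiation; in the
  conjugated factor the reversal makes this the first letter of \<open>u1\<close>. Factorisations in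
  which the outer word concerned is empty contribute 0, so the letter comes off the whole
  word.\<close>

lemma sesq_has_wirtinger:
  assumes \<Lambda>: "poly_sol U \<Lambda>" and U: "open U" and z: "z \<in> U"
  obtains a b where "\<And>w. has_wirtinger (sesq \<Lambda> w) (a w) (b w) z"
    "\<And>w j. a (w @ [j]) = sesq \<Lambda> w z / (z - pt j)" "\<And>w i. b (i # w) = sesq \<Lambda> w z / (cnj z - pt i)"
proof -
  define f where "f z u = cnj (\<Lambda> (rev u) z)" for z u
  define g where "g z u = \<Lambda> u z" for z u
  define Sc where "Sc u = complex_of_real (S_series u)" for u
  define fb where "fb u = (if u = [] then 0 else f z (tl u) / (cnj z - pt (hd u)))" for u
  define ga where "ga u = (if u = [] then 0 else g z (butlast u) / (z - pt (last u)))" for u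
  have cpt: "cnj (pt i) = pt i" for i by (cases i) simp_all
  have DN: "(\<Lambda> [] has_field_derivative 0) (at z)"
    by (rule has_field_derivative_transform_within_open[OF DERIV_const[of 1] U z]) (simp add: poly_sol_Nil[OF \<Lambda>])
  have f: "has_wirtinger (\<lambda>z. f z u) 0 (fb u) z" for u
  proof (cases u)
    case Nil
    then show ?thesis using has_wirtinger_cnj[OF DN] by (simp add: f_def fb_def)
  next
    case (Cons i v)
    show ?thesis using has_wirtinger_cnj[OF poly_sol_deriv[OF \<Lambda> z, of "rev v" i]] by (simp add: Cons f_def fb_def cpt)
  qed
  have g: "has_wirtinger (\<lambda>z. g z u) (ga u) 0 z" for u
  proof (cases u rule: rev_exhaust)
    case Nil
    then show ?thesis using has_wirtinger_holomorphic[OF DN] by (simp add: g_def ga_def)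
  next
    case (snoc v j)
    show ?thesis using has_wirtinger_holomorphic[OF poly_sol_deriv[OF \<Lambda> z, of v j]] by (simp add: snoc g_def ga_def)
  qed
  have z1: "conv (\<lambda>_. 0) h w = 0" "conv h (\<lambda>_. 0) w = 0" for h :: "word \<Rightarrow> complex" and w by (simp_all add: conv_def)
  have fS: "has_wirtinger (\<lambda>z. conv (f z) Sc u) 0 (conv fb Sc u) z" for u
    using has_wirtinger_conv[where f = f and g = "\<lambda>_. Sc", OF f has_wirtinger_const, of u] by (simp only: z1 add_0_right)
  show ?thesis
  proof (rule that[of "\<lambda>w. conv (conv (f z) Sc) ga w" "\<lambda>w. conv (conv fb Sc) (g z) w"])
    fix w
    have "has_wirtinger (\<lambda>z. conv (conv (f z) Sc) (g z) w) (conv (conv (f z) Sc) ga w) (conv (conv fb Sc) (g z) w) z"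
      using has_wirtinger_conv[where f = "\<lambda>z. conv (f z) Sc" and g = g, OF fS g, of w] by (simp only: z1 add_0_left add_0_right)
    moreover have "sesq \<Lambda> w = (\<lambda>z. conv (conv (f z) Sc) (g z) w)"
      by (simp add: fun_eq_iff sesq_def f_def[abs_def] g_def[abs_def] Sc_def[abs_def])
    ultimately show "has_wirtinger (sesq \<Lambda> w) (conv (conv (f z) Sc) ga w) (conv (conv fb Sc) (g z) w) z" by (simp only:)
  next
    fix w j
    have "(\<lambda>v. ga (v @ [j])) = (\<lambda>v. 1 / (z - pt j) * g z v)" by (simp add: ga_def fun_eq_iff)
    then have "conv (conv (f z) Sc) ga (w @ [j]) = 1 / (z - pt j) * conv (conv (f z) Sc) (g z) w"
      by (simp only: conv_snoc conv_scale_right) (simp add: ga_def)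
    then show "conv (conv (f z) Sc) ga (w @ [j]) = sesq \<Lambda> w z / (z - pt j)"
      by (simp add: sesq_def f_def[abs_def] g_def[abs_def] Sc_def[abs_def])
  next
    fix w i
    have N: "fb [] = 0" by (simp add: fb_def)
    have "(\<lambda>u. fb (i # u)) = (\<lambda>u. 1 / (cnj z - pt i) * f z u)" by (simp add: fb_def fun_eq_iff)
    then have "(\<lambda>u. conv fb Sc (i # u)) = (\<lambda>u. 1 / (cnj z - pt i) * conv (f z) Sc u)"
      by (simp only: conv_Cons conv_scale_left N mult_zero_left add_0_left)
    then have "conv (conv fb Sc) (g z) (i # w) = 1 / (cnj z - pt i) * conv (conv (f z) Sc) (g z) w"
      by (simp only: conv_Cons[of "conv fb Sc"] conv_scale_left) (simp add: N)
    then show "conv (conv fb Sc) (g z) (i # w) = sesq \<Lambda> w z / (cnj z - pt i)"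
      by (simp add: sesq_def f_def[abs_def] g_def[abs_def] Sc_def[abs_def])
  qed
qed

lemma F_has_wirtinger:
  assumes z: "z \<in> - {0, 1}"
  obtains a b where "\<And>w. w \<in> B0 \<Longrightarrow> has_wirtinger (F w) (a w) (b w) z"
    "\<And>w j. w @ [j] \<in> B0 \<Longrightarrow> a (w @ [j]) = F w z / (z - pt j)"
    "\<And>w i. i # w \<in> B0 \<Longrightarrow> b (i # w) = F w z / (cnj z - pt i)"
proof -
  obtain U \<Lambda> where U: "open U" "z \<in> U" "poly_sol U \<Lambda>" "\<And>w z. w \<in> B0 \<Longrightarrow> z \<in> U \<Longrightarrow> F w z = sesq \<Lambda> w z"
    by (rule F_local[OF z]) blast
  obtain a b where ab: "\<And>w. has_wirtinger (sesq \<Lambda> w) (a w) (b w) z"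
    "\<And>w j. a (w @ [j]) = sesq \<Lambda> w z / (z - pt j)" "\<And>w i. b (i # w) = sesq \<Lambda> w z / (cnj z - pt i)"
    by (rule sesq_has_wirtinger[OF U(3,1,2)]) blast
  show ?thesis
  proof (rule that[of a b])
    fix w assume "w \<in> B0"
    then show "has_wirtinger (F w) (a w) (b w) z"
      by (intro has_wirtinger_cong[OF ab(1) U(1,2)]) (simp add: U(4))
  next
    fix w j assume "w @ [j] \<in> B0"
    then have "w \<in> B0" using B0_factor[of "[]" w "[j]"] by simp
    then show "a (w @ [j]) = F w z / (z - pt j)" by (simp add: ab(2) U(4)[OF _ U(2)])
  next
    fix w i assume "i # w \<in> B0"
    then have "w \<in> B0" using B0_factor[of "[i]" w "[]"] by simp
    then show "b (i # w) = F w z / (cnj z - pt i)" by (simp add: ab(3) U(4)[OF _ U(2)])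
  qed
qed

text \<open>The factor from the first differentiation is the conjugate of a holomorphic function and
  so acts as a constant under \<open>wirtinger_dz\<close>.\<close>

theorem wirtinger_F:
  assumes w: "[i] @ w @ [j] \<in> B0" and z: "z \<in> - {0, 1}"
  shows "wirtinger_dz (wirtinger_dzbar (F ([i] @ w @ [j]))) z = F w z / ((cnj z - pt i) * (z - pt j))"
proof -
  have w': "w @ [j] \<in> B0" using w B0_factor[of "[i]" "w @ [j]" "[]"] by simp
  have bar: "wirtinger_dzbar (F ([i] @ w @ [j])) z = F (w @ [j]) z * cnj (1 / (z - pt i))" if z: "z \<in> - {0, 1}" for z
  proof -
    obtain a b where "\<And>w. w \<in> B0 \<Longrightarrow> has_wirtinger (F w) (a w) (b w) z"
       "\<And>w i. i # w \<in> B0 \<Longrightarrow> b (i # w) = F w z / (cnj z - pt i)"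
      by (rule F_has_wirtinger[OF z]) blast
    then have "wirtinger_dzbar (F ([i] @ w @ [j])) z = F (w @ [j]) z / (cnj z - pt i)"
      using has_wirtinger_imp(2) w by fastforce
    also have "\<dots> = F (w @ [j]) z * cnj (1 / (z - pt i))" by (cases i) simp_all
    finally show ?thesis .
  qed
  have o: "open (- {0, 1 :: complex})" by (intro open_Compl finite_imp_closed) simp
  obtain a b where ab: "\<And>w. w \<in> B0 \<Longrightarrow> has_wirtinger (F w) (a w) (b w) z"
       "\<And>w j. w @ [j] \<in> B0 \<Longrightarrow> a (w @ [j]) = F w z / (z - pt j)"
    by (rule F_has_wirtinger[OF z]) blast
  have "z - pt i \<noteq> 0" using z by (cases i) auto
  then have "((\<lambda>z. 1 / (z - pt i)) has_field_derivative - 1 / (z - pt i) ^ 2) (at z)"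
    by (auto intro!: derivative_eq_intros simp: power2_eq_square)
  from has_wirtinger_mult[OF ab(1)[OF w'] has_wirtinger_cnj[OF this]]
  have "has_wirtinger (wirtinger_dzbar (F ([i] @ w @ [j]))) (a (w @ [j]) * cnj (1 / (z - pt i)) + F (w @ [j]) z * 0)
    (b (w @ [j]) * cnj (1 / (z - pt i)) + F (w @ [j]) z * cnj (- 1 / (z - pt i) ^ 2)) z"
    by (rule has_wirtinger_cong[OF _ o z]) (rule bar[symmetric])
  then have "wirtinger_dz (wirtinger_dzbar (F ([i] @ w @ [j]))) z = a (w @ [j]) * cnj (1 / (z - pt i))"
    by (simp add: has_wirtinger_imp(1))
  also have "\<dots> = F w z / ((cnj z - pt i) * (z - pt j))"
    using ab(2)[OF w'] by (cases i) simp_all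
  finally show ?thesis .
qed

lemma continuous_F:
  assumes w: "w \<in> B0" and z: "z \<in> - {0, 1}" shows "isCont (F w) z"
proof -
  obtain a b where "\<And>w. w \<in> B0 \<Longrightarrow> has_wirtinger (F w) (a w) (b w) z"
    by (rule F_has_wirtinger[OF z]) blast
  then show ?thesis using w unfolding has_wirtinger_def by (meson has_derivative_continuous)
qed

lemma F_slit: "w \<in> B0 \<Longrightarrow> z \<in> slit_domain \<Longrightarrow> F w z = sesq L w z"
proof -
  assume w: "w \<in> B0" and z: "z \<in> slit_domain"
  then have "z \<in> - {0, 1}" by (auto simp: slit_domain_iff)
  from F_eq_Gfun[OF w this] show ?thesis using z by (simp add: Gfun_def)
qed

text \<open>On the slit plane this is \<open>L_cnj\<close> together with the reversal symmetry of
  \<open>S\<close>. Points of the cuts are limits of points above them, and \<open>F\<close> is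
  continuous on both sides of the identity.\<close>

theorem F_rev:
  assumes w: "w \<in> B0" and z: "z \<in> - {0, 1}"
  shows "F w z = F (rev w) (cnj z)"
proof -
  have slit: "F w z = F (rev w) (cnj z)" if z: "z \<in> slit_domain" for z
  proof -
    have "sesq L (rev w) (cnj z) = conv (\<lambda>u. cnj (L (rev u) z))
        (\<lambda>u. conv (\<lambda>u. L (rev u) z) (\<lambda>u. of_real (S_series u)) (rev u)) w"
      unfolding sesq_def conv_rev[of _ _ w] by (simp add: L_cnj[OF z])
    also have "(\<lambda>u. conv (\<lambda>u. L (rev u) z) (\<lambda>u. complex_of_real (S_series u)) (rev u))
        = conv (\<lambda>u. of_real (S_series u)) (\<lambda>u. L u z)"
      by (rule ext) (simp add: conv_rev S_series_rev)
    finally show ?thesis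
      using z w by (simp add: F_slit B0_rev) (simp add: sesq_def conv_assoc)
  qed
  show ?thesis
  proof (cases "z \<in> slit_domain")
    case False
    then have Im: "Im z = 0" by (simp add: slit_domain_iff)
    define x where "x n = z + of_real (inverse (real (Suc n))) * \<i>" for n
    have "x \<longlonglongrightarrow> z + of_real 0 * \<i>" unfolding x_def by (intro tendsto_intros LIMSEQ_inverse_real_of_nat)
    then have x: "x \<longlonglongrightarrow> z" by simp
    have "F w (x n) = F (rev w) (cnj (x n))" for n
      by (rule slit) (simp add: slit_domain_iff x_def Im)
    moreover have "(\<lambda>n. F w (x n)) \<longlonglongrightarrow> F w z"
      by (rule isCont_tendsto_compose[OF continuous_F[OF w z] x])
    moreover have "(\<lambda>n. F (rev w) (cnj (x n))) \<longlonglongrightarrow> F (rev w) (cnj z)"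
      by (rule isCont_tendsto_compose[OF continuous_F[OF B0_rev[OF w]] tendsto_cnj[OF x]]) (use z in \<open>auto simp: complex_eq_iff\<close>)
    ultimately show ?thesis using LIMSEQ_unique by (simp only:)
  qed (rule slit)
qed

theorem theorem1p4:
  fixes w :: word
  assumes "w \<in> B0"
  shows "single_valued (F_comb w) \<and>
         real_analytic_on (F w) (- {0, 1}) \<and>
         (\<forall>z \<in> slit_domain. F w z = F_comb w L L z) \<and>
         (\<forall>z \<in> - {0, 1}. F w z = F (rev w) (cnj z)) \<and>
         (\<forall>i j. [i] @ w @ [j] \<in> B0 \<longrightarrow>
            (\<forall>z \<in> - {0, 1}.
               wirtinger_dz (wirtinger_dzbar (F ([i] @ w @ [j]))) z
                 = F w z / ((cnj z - pt i) * (z - pt j))))"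
proof (intro conjI ballI allI impI)
  show "single_valued (F_comb w)" by (rule single_valued_F[OF assms])
  show "real_analytic_on (F w) (- {0, 1})" by (rule real_analytic_F[OF assms])
  show "F w z = F_comb w L L z" if "z \<in> slit_domain" for z
    using that assms by (simp only: F_slit F_comb_L)
  show "F w z = F (rev w) (cnj z)" if "z \<in> - {0, 1}" for z
    by (rule F_rev[OF assms that])
  show "wirtinger_dz (wirtinger_dzbar (F ([i] @ w @ [j]))) z = F w z / ((cnj z - pt i) * (z - pt j))"
    if "[i] @ w @ [j] \<in> B0" "z \<in> - {0, 1}" for i j z
    by (rule wirtinger_F[OF that])
qed

end
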